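(* Let $(M^n,g)$ be a complete non-compact gradient Kähler-Ricci soliton of complex dimension $n$, with associated constant $\rho$. Suppose that one of the following holds: (a) the soliton is steady ($\rho=0$), the Ricci curvature of $g$ is positive, and the scalar curvature of $g$ attains its maximum at some point of $M$; or (b) the soliton is expanding ($\rho>0$) and the Ricci curvature of $g$ is non-negative. Then $M$ is biholomorphic to $\mathbb{C}^n$.
   Context: A Kähler manifold $(M,g)$ with Kähler metric $g_{i\bar j}(x)$ is a Kähler-Ricci soliton if there is a family of biholomorphisms $\phi_t: M\to M$, $0\le t<\infty$, given by (the flow of) a holomorphic vector field $V$ on $M$, such that $g_{i\bar j}(x,t)=\phi_t^*(g_{i\bar j}(x))$ solves the Kähler-Ricci flow $$\frac{\partial}{\partial t} g_{i\bar j} = -R_{i\bar j} - 2\rho\, g_{i\bar j},\qquad g_{i\bar j}(x,0)=g_{i\bar j}(x),$$ for $0\le t<\infty$, where $R_{i\bar j}$ is the Ricci tensor of the metric at time $t$ and $\rho$ is a real constant. The soliton is of steady type if $\rho=0$ and of expanding type if $\rho>0$. It is a gradient Kähler-Ricci soliton if, in addition, the vector field $V$ is given (up to sign and a normalization constant) by the gradient of a real-valued function $f$ on $M$; in this case $f$, suitably normalized, satisfies $$f_{i\bar j}=R_{i\bar j}+2\rho\, g_{i\bar j},\qquad f_{ij}=0,$$ where $f_{i\bar j}$ and $f_{ij}$ denote the components of the second covariant derivative (Hessian) of $f$ with respect to $g$ in local holomorphic coordinates, and $R_{i\bar j}$ is the Ricci tensor of $g$. Manifolds are connected. *)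

theory Defs
  imports "HOL-Analysis.Analysis"
begin

section \<open>Several complex variables in coordinates\<close>

text \<open>Only used on open sets \<open>S\<close>.\<close>

definition holomorphic_vec_on ::
    "(complex^'n \<Rightarrow> complex^'m) \<Rightarrow> (complex^'n) set \<Rightarrow> bool" where
  "holomorphic_vec_on F S \<longleftrightarrow>
     (\<forall>x\<in>S. \<exists>D. (F has_derivative D) (at x) \<and> (\<forall>a v. D (a *s v) = a *s D v))"

primrec Ck_on :: "nat \<Rightarrow> ('a::real_normed_vector \<Rightarrow> 'b::real_normed_vector) \<Rightarrow> 'a set \<Rightarrow> bool" where
  "Ck_on 0 f S \<longleftrightarrow> continuous_on S f"
| "Ck_on (Suc k) f S \<longleftrightarrow>
     (\<forall>x\<in>S. f differentiable (at x)) \<and> (\<forall>v. Ck_on k (\<lambda>x. frechet_derivative f (at x) v) S)"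

definition smooth_on :: "('a::real_normed_vector \<Rightarrow> 'b::real_normed_vector) \<Rightarrow> 'a set \<Rightarrow> bool" where
  "smooth_on f S \<longleftrightarrow> (\<forall>k. Ck_on k f S)"

text \<open>The Wirtinger operators \<open>\<partial>/\<partial>z\<^sup>i = (\<partial>/\<partial>x\<^sup>i - \<i> \<partial>/\<partial>y\<^sup>i)/2\<close> and its conjugate;
  \<open>\<partial>/\<partial>x\<^sup>i\<close> and \<open>\<partial>/\<partial>y\<^sup>i\<close> are the derivatives in the directions \<open>axis i 1\<close> and \<open>axis i \<i>\<close>.\<close>

definition dz :: "'n \<Rightarrow> (complex^'n \<Rightarrow> complex) \<Rightarrow> complex^'n \<Rightarrow> complex" where
  "dz i u x = (frechet_derivative u (at x) (axis i 1)
                 - \<i> * frechet_derivative u (at x) (axis i \<i>)) / 2"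

definition dzbar :: "'n \<Rightarrow> (complex^'n \<Rightarrow> complex) \<Rightarrow> complex^'n \<Rightarrow> complex" where
  "dzbar i u x = (frechet_derivative u (at x) (axis i 1)
                    + \<i> * frechet_derivative u (at x) (axis i \<i>)) / 2"


section \<open>Hermitian forms and curvature in coordinates\<close>

text \<open>A matrix \<open>H\<close> with \<open>H $ i $ j\<close> the component with indices \<open>i\<close>, \<open>j\<close>-bar.\<close>

definition herm_form :: "complex^'n^'n \<Rightarrow> complex^'n \<Rightarrow> complex" where
  "herm_form H v = (\<Sum>i\<in>UNIV. \<Sum>j\<in>UNIV. H $ i $ j * v $ i * cnj (v $ j))"

definition hermitian :: "complex^'n^'n \<Rightarrow> bool" where
  "hermitian H \<longleftrightarrow> (\<forall>i j. H $ j $ i = cnj (H $ i $ j))"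

definition herm_pos :: "complex^'n^'n \<Rightarrow> bool" where
  "herm_pos H \<longleftrightarrow> hermitian H \<and> (\<forall>v. v \<noteq> 0 \<longrightarrow> 0 < Re (herm_form H v))"

definition herm_nonneg :: "complex^'n^'n \<Rightarrow> bool" where
  "herm_nonneg H \<longleftrightarrow> hermitian H \<and> (\<forall>v. 0 \<le> Re (herm_form H v))"

text \<open>\<open>g_up G k l\<close> is the component of the inverse metric with indices \<open>k\<close>, \<open>l\<close>-bar. The index
  order is transposed so that contracting both \<open>l\<close>-bar indices of \<open>G $ i $ l\<close> and \<open>g_up G k l\<close>
  gives the identity.\<close>

definition g_up :: "complex^'n^'n \<Rightarrow> 'n \<Rightarrow> 'n \<Rightarrow> complex" where
  "g_up G k l = matrix_inv G $ l $ k"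

text \<open>Below, \<open>G\<close> maps coordinates to the component matrix of a Kaehler metric. The component of the
  curvature tensor with indices \<open>i\<close>, \<open>j\<close>-bar, \<open>k\<close>, \<open>l\<close>-bar, with the sign for which complex
  projective space has positive Ricci curvature.\<close>

definition curvature ::
    "(complex^'n \<Rightarrow> complex^'n^'n) \<Rightarrow> complex^'n \<Rightarrow> 'n \<Rightarrow> 'n \<Rightarrow> 'n \<Rightarrow> 'n \<Rightarrow> complex" where
  "curvature G x i j k l =
     - dz k (dzbar l (\<lambda>y. G y $ i $ j)) x
     + (\<Sum>p\<in>UNIV. \<Sum>q\<in>UNIV.
          g_up (G x) p q * dz k (\<lambda>y. G y $ i $ q) x * dzbar l (\<lambda>y. G y $ p $ j) x)"

definition ricci :: "(complex^'n \<Rightarrow> complex^'n^'n) \<Rightarrow> complex^'n \<Rightarrow> complex^'n^'n" where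
  "ricci G x = (\<chi> i j. \<Sum>k\<in>UNIV. \<Sum>l\<in>UNIV. g_up (G x) k l * curvature G x i j k l)"

definition scalar_curv :: "(complex^'n \<Rightarrow> complex^'n^'n) \<Rightarrow> complex^'n \<Rightarrow> real" where
  "scalar_curv G x = Re (\<Sum>i\<in>UNIV. \<Sum>j\<in>UNIV. g_up (G x) i j * ricci G x $ i $ j)"


section \<open>Complex manifolds\<close>

text \<open>A chart is its domain together with the coordinate map; values of the coordinate map
  outside the domain are irrelevant. The complex dimension is \<open>CARD('n)\<close>.\<close>

type_synonym ('a, 'n) chart = "'a set \<times> ('a \<Rightarrow> complex^'n)"

abbreviation cdom :: "('a, 'n) chart \<Rightarrow> 'a set" where
  "cdom c \<equiv> fst c"

abbreviation coord :: "('a, 'n) chart \<Rightarrow> 'a \<Rightarrow> complex^'n" where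
  "coord c \<equiv> snd c"

definition coord_range :: "('a, 'n) chart \<Rightarrow> (complex^'n) set" where
  "coord_range c = coord c ` cdom c"

definition coord_inv :: "('a, 'n) chart \<Rightarrow> complex^'n \<Rightarrow> 'a" where
  "coord_inv c = inv_into (cdom c) (coord c)"

text \<open>The expression of a map \<open>F\<close> in the charts \<open>c\<close> and \<open>c'\<close>; with \<open>F = id\<close> this is the transition
  map. It is meaningful at coordinates of points \<open>p \<in> cdom c\<close> with \<open>F p \<in> cdom c'\<close>.\<close>

definition local_expr ::
    "('a, 'n) chart \<Rightarrow> ('b, 'm) chart \<Rightarrow> ('a \<Rightarrow> 'b) \<Rightarrow> complex^'n \<Rightarrow> complex^'m" where
  "local_expr c c' F = coord c' \<circ> F \<circ> coord_inv c"

text \<open>An atlas need not be maximal.\<close>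

definition complex_manifold :: "'a topology \<Rightarrow> ('a, 'n::finite) chart set \<Rightarrow> bool" where
  "complex_manifold X A \<longleftrightarrow>
     Hausdorff_space X \<and> second_countable X \<and> connected_space X \<and>
     (\<Union>c\<in>A. cdom c) = topspace X \<and>
     (\<forall>c\<in>A. openin X (cdom c) \<and> open (coord_range c) \<and>
        homeomorphic_map (subtopology X (cdom c)) (top_of_set (coord_range c)) (coord c)) \<and>
     (\<forall>c\<in>A. \<forall>c'\<in>A. holomorphic_vec_on (local_expr c c' id) (coord c ` (cdom c \<inter> cdom c')))"

definition holomorphic_map ::
    "'a topology \<Rightarrow> ('a, 'n::finite) chart set \<Rightarrow> 'b topology \<Rightarrow> ('b, 'm::finite) chart set
       \<Rightarrow> ('a \<Rightarrow> 'b) \<Rightarrow> bool" where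
  "holomorphic_map X A Y B F \<longleftrightarrow>
     continuous_map X Y F \<and>
     (\<forall>c\<in>A. \<forall>c'\<in>B. holomorphic_vec_on (local_expr c c' F) (coord c ` {p\<in>cdom c. F p \<in> cdom c'}))"

definition biholomorphism ::
    "'a topology \<Rightarrow> ('a, 'n::finite) chart set \<Rightarrow> 'b topology \<Rightarrow> ('b, 'm::finite) chart set
       \<Rightarrow> ('a \<Rightarrow> 'b) \<Rightarrow> bool" where
  "biholomorphism X A Y B F \<longleftrightarrow>
     holomorphic_map X A Y B F \<and>
     (\<exists>G. holomorphic_map Y B X A G \<and>
          (\<forall>p\<in>topspace X. G (F p) = p) \<and> (\<forall>q\<in>topspace Y. F (G q) = q))"

definition std_atlas :: "(complex^'n, 'n) chart set" where
  "std_atlas = {(UNIV, id)}"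


section \<open>Kaehler metrics\<close>

text \<open>A metric is given by its component matrices: \<open>g c x $ i $ j\<close> is the component with indices
  \<open>i\<close>, \<open>j\<close>-bar in the chart \<open>c\<close> at the point with coordinates \<open>x\<close>.\<close>

type_synonym ('a, 'n) herm_tensor = "('a, 'n) chart \<Rightarrow> complex^'n \<Rightarrow> complex^'n^'n"

text \<open>\<open>h\<close> is the pullback of \<open>g\<close> under the holomorphic self-map \<open>F\<close>. For \<open>F = id\<close> and \<open>h = g\<close> this
  is the transformation law of a tensor of type (1,1).\<close>

definition is_pullback ::
    "('a, 'n::finite) chart set \<Rightarrow> ('a \<Rightarrow> 'a) \<Rightarrow> ('a, 'n) herm_tensor \<Rightarrow> ('a, 'n) herm_tensor \<Rightarrow> bool"
  where
  "is_pullback A F g h \<longleftrightarrow>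
     (\<forall>c\<in>A. \<forall>c'\<in>A. \<forall>p\<in>cdom c. F p \<in> cdom c' \<longrightarrow>
        (\<forall>i j. h c (coord c p) $ i $ j =
           (\<Sum>k\<in>UNIV. \<Sum>l\<in>UNIV.
              dz i (\<lambda>y. local_expr c c' F y $ k) (coord c p) *
              g c' (coord c' (F p)) $ k $ l *
              cnj (dz j (\<lambda>y. local_expr c c' F y $ l) (coord c p)))))"

text \<open>The last clause says that the fundamental form is closed.\<close>

definition kaehler_metric :: "('a, 'n::finite) chart set \<Rightarrow> ('a, 'n) herm_tensor \<Rightarrow> bool" where
  "kaehler_metric A g \<longleftrightarrow>
     is_pullback A id g g \<and>
     (\<forall>c\<in>A. smooth_on (g c) (coord_range c) \<and>
        (\<forall>x\<in>coord_range c. herm_pos (g c x) \<and>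
           (\<forall>i j k. dz k (\<lambda>y. g c y $ i $ j) x = dz i (\<lambda>y. g c y $ k $ j) x)))"

text \<open>\<open>\<gamma>\<close>, restricted to the unit interval, is a piecewise \<open>C\<^sup>1\<close> curve (in the sense of
  \<^const>\<open>piecewise_C1_differentiable_on\<close>) of length \<open>L\<close>. The underlying Riemannian metric is the
  real part of the Hermitian form, possibly up to a constant factor, which does not affect
  completeness.\<close>

definition has_length ::
    "'a topology \<Rightarrow> ('a, 'n::finite) chart set \<Rightarrow> ('a, 'n) herm_tensor \<Rightarrow> (real \<Rightarrow> 'a) \<Rightarrow> real \<Rightarrow> bool"
  where
  "has_length X A g \<gamma> L \<longleftrightarrow>
     pathin X \<gamma> \<and>
     (\<exists>S s. finite S \<and>
        (\<forall>c\<in>A. let T = {t\<in>{0<..<1}. \<gamma> t \<in> cdom c} - S in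
           (coord c \<circ> \<gamma>) C1_differentiable_on T \<and>
           (\<forall>t\<in>T. s t = sqrt (Re (herm_form (g c (coord c (\<gamma> t)))
                                     (vector_derivative (coord c \<circ> \<gamma>) (at t)))))) \<and>
        (s has_integral L) {0..1})"

definition riem_dist ::
    "'a topology \<Rightarrow> ('a, 'n::finite) chart set \<Rightarrow> ('a, 'n) herm_tensor \<Rightarrow> 'a \<Rightarrow> 'a \<Rightarrow> real" where
  "riem_dist X A g p q =
     (if p \<in> topspace X \<and> q \<in> topspace X
      then Inf {L. \<exists>\<gamma>. has_length X A g \<gamma> L \<and> \<gamma> 0 = p \<and> \<gamma> 1 = q} else 0)"

definition complete_metric ::
    "'a topology \<Rightarrow> ('a, 'n::finite) chart set \<Rightarrow> ('a, 'n) herm_tensor \<Rightarrow> bool" where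
  "complete_metric X A g \<longleftrightarrow> Metric_space.mcomplete (topspace X) (riem_dist X A g)"

definition positive_ricci :: "('a, 'n::finite) chart set \<Rightarrow> ('a, 'n) herm_tensor \<Rightarrow> bool" where
  "positive_ricci A g \<longleftrightarrow> (\<forall>c\<in>A. \<forall>x\<in>coord_range c. herm_pos (ricci (g c) x))"

definition nonneg_ricci :: "('a, 'n::finite) chart set \<Rightarrow> ('a, 'n) herm_tensor \<Rightarrow> bool" where
  "nonneg_ricci A g \<longleftrightarrow> (\<forall>c\<in>A. \<forall>x\<in>coord_range c. herm_nonneg (ricci (g c) x))"

definition scalar_curv_attains_max :: "('a, 'n::finite) chart set \<Rightarrow> ('a, 'n) herm_tensor \<Rightarrow> bool"
  where
  "scalar_curv_attains_max A g \<longleftrightarrow>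
     (\<exists>c\<in>A. \<exists>x\<in>coord_range c. \<forall>c'\<in>A. \<forall>y\<in>coord_range c'.
        scalar_curv (g c') y \<le> scalar_curv (g c) x)"


section \<open>Kaehler-Ricci solitons\<close>

text \<open>\<open>V c x $ i\<close> is the \<open>i\<close>-th component of the vector field of type (1,0) in the chart \<open>c\<close>.\<close>

type_synonym ('a, 'n) vfield = "('a, 'n) chart \<Rightarrow> complex^'n \<Rightarrow> complex^'n"

definition holomorphic_vfield :: "('a, 'n::finite) chart set \<Rightarrow> ('a, 'n) vfield \<Rightarrow> bool" where
  "holomorphic_vfield A V \<longleftrightarrow>
     (\<forall>c\<in>A. holomorphic_vec_on (V c) (coord_range c)) \<and>
     (\<forall>c\<in>A. \<forall>c'\<in>A. \<forall>p\<in>cdom c \<inter> cdom c'. \<forall>k.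
        V c' (coord c' p) $ k =
          (\<Sum>i\<in>UNIV. dz i (\<lambda>y. local_expr c c' id y $ k) (coord c p) * V c (coord c p) $ i))"

text \<open>The flow for times \<open>t \<ge> 0\<close>: in coordinates the integral curves satisfy \<open>dz\<^sup>i/dt = V\<^sup>i\<close>, i.e.
  they are the integral curves of the real vector field \<open>V\<close> plus its conjugate.\<close>

definition is_flow ::
    "'a topology \<Rightarrow> ('a, 'n::finite) chart set \<Rightarrow> ('a, 'n) vfield \<Rightarrow> (real \<Rightarrow> 'a \<Rightarrow> 'a) \<Rightarrow> bool" where
  "is_flow X A V \<phi> \<longleftrightarrow>
     (\<forall>p\<in>topspace X.
        \<phi> 0 p = p \<and>
        continuous_map (top_of_set {0..}) X (\<lambda>t. \<phi> t p) \<and>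
        (\<forall>t\<ge>0. \<forall>c\<in>A. \<phi> t p \<in> cdom c \<longrightarrow>
           ((\<lambda>s. coord c (\<phi> s p)) has_vector_derivative V c (coord c (\<phi> t p))) (at t within {0..})))"

definition kr_flow ::
    "('a, 'n::finite) chart set \<Rightarrow> real \<Rightarrow> (real \<Rightarrow> ('a, 'n) herm_tensor) \<Rightarrow> bool" where
  "kr_flow A \<rho> gt \<longleftrightarrow>
     (\<forall>t\<ge>0. \<forall>c\<in>A. \<forall>x\<in>coord_range c.
        ((\<lambda>s. gt s c x) has_vector_derivative (- ricci (gt t c) x - (2 * \<rho>) *\<^sub>R gt t c x))
          (at t within {0..}))"

definition kr_soliton_field ::
    "'a topology \<Rightarrow> ('a, 'n::finite) chart set \<Rightarrow> ('a, 'n) herm_tensor \<Rightarrow> real \<Rightarrow> ('a, 'n) vfield \<Rightarrow> bool"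
  where
  "kr_soliton_field X A g \<rho> V \<longleftrightarrow>
     holomorphic_vfield A V \<and>
     (\<exists>\<phi> gt. is_flow X A V \<phi> \<and>
        (\<forall>t\<ge>0. biholomorphism X A X A (\<phi> t) \<and> is_pullback A (\<phi> t) g (gt t)) \<and>
        (\<forall>c\<in>A. \<forall>x\<in>coord_range c. gt 0 c x = g c x) \<and>
        kr_flow A \<rho> gt)"

text \<open>\<open>V\<close> is a non-zero real multiple of the gradient of the smooth real function \<open>f\<close>; the components
  of the gradient are obtained from the \<open>z\<close>-bar derivatives of \<open>f\<close> by raising the index.\<close>

definition is_gradient_of ::
    "('a, 'n::finite) chart set \<Rightarrow> ('a, 'n) herm_tensor \<Rightarrow> ('a, 'n) vfield \<Rightarrow> ('a \<Rightarrow> real) \<Rightarrow> bool" where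
  "is_gradient_of A g V f \<longleftrightarrow>
     (\<forall>c\<in>A. smooth_on (f \<circ> coord_inv c) (coord_range c)) \<and>
     (\<exists>a::real. a \<noteq> 0 \<and>
        (\<forall>c\<in>A. \<forall>x\<in>coord_range c. \<forall>i.
           V c x $ i = complex_of_real a *
             (\<Sum>j\<in>UNIV. g_up (g c x) i j * dzbar j (\<lambda>y. complex_of_real (f (coord_inv c y))) x)))"

text \<open>The equations \<open>f\<^sub>i\<^sub>j = 0\<close> (holomorphy of \<open>V\<close>) and, for suitably normalized \<open>f\<close>, equality of the
  mixed Hessian of \<open>f\<close> with \<open>Ric + 2 \<rho> g\<close> (the flow equation at time 0) are consequences.\<close>

definition gradient_kr_soliton ::
    "'a topology \<Rightarrow> ('a, 'n::finite) chart set \<Rightarrow> ('a, 'n) herm_tensor \<Rightarrow> real \<Rightarrow> bool" where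
  "gradient_kr_soliton X A g \<rho> \<longleftrightarrow>
     (\<exists>V f. kr_soliton_field X A g \<rho> V \<and> is_gradient_of A g V f)"

end

theory Submission
  imports Defs "HOL-Complex_Analysis.Cauchy_Integral_Formula" "HOL-Real_Asymp.Real_Asymp"
begin

text \<open>The flow \<open>\<phi>\<close> of \<open>V\<close> contracts the metric, because \<open>d/dt \<phi>\<^sub>t\<^sup>*g = - Ric - 2 \<rho> g \<le> 0\<close>. In the expanding case
  it is a strict contraction of the complete distance, so it has a fixed point; in the steady case a
  maximum of the scalar curvature is a zero of \<open>V\<close>. At a fixed point \<open>p\<close> we have \<open>Ric + 2 \<rho> g > 0\<close>, so \<open>p\<close>
  is attracting, and completeness is not needed to see that its basin is all of \<open>M\<close>: the basin is open
  and, as \<open>\<phi>\<^sub>t\<close> does not increase lengths, also closed. Near \<open>p\<close> the flow is holomorphically conjugate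
  to a linear contraction: lowering the index of \<open>V\<close> with the metric shows that \<open>V\<close> is, to every finite
  order at \<open>p\<close>, linear in Bochner coordinates, so no resonances obstruct the limit \<open>N\<^sup>m P \<phi>\<^sub>T\<^sup>m\<close>,
  where \<open>N\<close> inverts the linear part and \<open>P\<close> is such a coordinate map of high order. Extending the
  conjugacy along the flow gives a biholomorphism of \<open>M\<close> onto \<open>\<complex>\<^sup>n\<close>.\<close>

section \<open>Holomorphic functions of several variables\<close>

text \<open>A holomorphic contraction need not be linearizable: for eigenvalues related by
  \<lambda>1 = \<lambda>2^2 the iterates N^m P \<psi>^m can diverge if P conjugates \<psi> to its
  linear part only to first order. When \<psi> halves distances to p and \<kappa> bounds N, they
  converge once the conjugation error is O(|z - p|^n) with \<kappa> <= 2^(n-1). As \<kappa> depends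
  on the time T, maps P of every finite order must be available and P is chosen after T. The
  gradient equation supplies them because only derivatives in the z-directions at p are compared.
  There the conjugate of V, and the conjugate of its Jacobian minus the value at p, are
  antiholomorphic functions vanishing at p and leave no trace. Polynomial primitives of Taylor
  polynomials of the metric serve as P, so no power series has to converge. The flow is given for t
  >= 0 only; backward motion uses the inverses contained in \<open>biholomorphism\<close>.\<close>

abbreviation FD :: "('a::real_normed_vector \<Rightarrow> 'b::real_normed_vector) \<Rightarrow> 'a \<Rightarrow> 'a \<Rightarrow> 'b" where
  "FD f x \<equiv> frechet_derivative f (at x)"

lemma norm_smult_vec: "norm (a *s (v::complex^'n)) = norm a * norm v"
  by (simp add: norm_vec_def L2_set_def norm_mult power_mult_distrib flip: sum_distrib_left)
     (simp add: real_sqrt_mult)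

lemma bounded_bilinear_smult: "bounded_bilinear (\<lambda>(a::complex) (v::complex^'n). a *s v)"
  by (rule bounded_bilinear.intro)
     (auto simp: vec_eq_iff algebra_simps norm_smult_vec intro!: exI[of _ 1])

lemma scaleR_smult: "r *\<^sub>R (v::complex^'n) = complex_of_real r *s v"
  unfolding vec_eq_iff by (simp, simp add: scaleR_conv_of_real)

lemma has_derivative_imp_differentiable: "(f has_derivative D) (at x) \<Longrightarrow> f differentiable (at x)"
  by (auto simp: differentiable_def)

lemma FD_eqI: "(f has_derivative D) (at x) \<Longrightarrow> FD f x = D"
  using frechet_derivative_at by metis

lemma FD_works: "f differentiable (at x) \<Longrightarrow> (f has_derivative FD f x) (at x)"
  using frechet_derivative_works by blast

text \<open>\<open>frechet_derivative\<close> chooses from the set of derivatives, so functions with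
  the same set get the same value, even where that set is empty.\<close>

lemma FD_cong:
  assumes "open S" "x \<in> S" "\<And>y. y \<in> S \<Longrightarrow> f y = h y"
  shows "FD f x = FD h x"
proof -
  have "(f has_derivative D) (at x) \<longleftrightarrow> (h has_derivative D) (at x)" for D
    using has_derivative_transform_within_open[of f D x UNIV S h]
      has_derivative_transform_within_open[of h D x UNIV S f] assms by force
  then show ?thesis
    unfolding frechet_derivative_def by simp
qed

lemma differentiable_cong_open:
  assumes "open S" "x \<in> S" "\<And>y. y \<in> S \<Longrightarrow> f y = h y"
  shows "f differentiable (at x) \<longleftrightarrow> h differentiable (at x)"
  using has_derivative_transform_within_open[of f _ x UNIV S h]
    has_derivative_transform_within_open[of h _ x UNIV S f] assms
  unfolding differentiable_def by force

text \<open>Scalar components of \<open>holomorphic_vec_on\<close>, with the derivative named as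
  \<open>FD\<close> so that it can be differentiated again. Complex linearity of \<open>FD\<close>
  is the Cauchy-Riemann system.\<close>

definition holo_on :: "(complex^'n \<Rightarrow> complex) \<Rightarrow> (complex^'n) set \<Rightarrow> bool" where
  "holo_on f S \<longleftrightarrow>
     (\<forall>x\<in>S. f differentiable (at x) \<and> (\<forall>a v. FD f x (a *s v) = a * FD f x v))"

lemma holo_onI:
  assumes "\<And>x. x \<in> S \<Longrightarrow> \<exists>D. (f has_derivative D) (at x) \<and> (\<forall>a v. D (a *s v) = a * D v)"
  shows "holo_on f S"
  unfolding holo_on_def using assms FD_eqI has_derivative_imp_differentiable by metis

lemma holo_on_has_derivative: "holo_on f S \<Longrightarrow> x \<in> S \<Longrightarrow> (f has_derivative FD f x) (at x)"
  by (simp add: holo_on_def FD_works)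

lemma holo_on_FD_smult: "holo_on f S \<Longrightarrow> x \<in> S \<Longrightarrow> FD f x (a *s v) = a * FD f x v"
  by (simp add: holo_on_def)

lemma holo_on_subset: "holo_on f S \<Longrightarrow> T \<subseteq> S \<Longrightarrow> holo_on f T"
  by (auto simp: holo_on_def)

lemma holo_on_cong:
  assumes "open S" "\<And>y. y \<in> S \<Longrightarrow> f y = h y" "holo_on f S"
  shows "holo_on h S"
  unfolding holo_on_def
proof (intro ballI conjI allI)
  fix x a v assume x: "x \<in> S"
  show "h differentiable (at x)"
    using differentiable_cong_open[of S x f h] assms x by (simp add: holo_on_def)
  show "FD h x (a *s v) = a * FD h x v"
    using FD_cong[of S x f h] assms(1,2) x holo_on_FD_smult[OF assms(3) x] by simp
qed

lemma holo_on_const: "holo_on (\<lambda>_. k) S"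
  by (rule holo_onI) (rule exI[of _ "\<lambda>_. 0"], auto intro: derivative_eq_intros)

lemma holo_on_nth: "holo_on (\<lambda>x. x $ i) S"
  by (rule holo_onI) (rule exI[of _ "\<lambda>x. x $ i"],
      auto intro!: bounded_linear_imp_has_derivative bounded_linear_vec_nth)

lemma holo_on_add: 
  assumes "holo_on f S" "holo_on h S" shows "holo_on (\<lambda>x. f x + h x) S"
  using has_derivative_add[OF holo_on_has_derivative[OF assms(1)] holo_on_has_derivative[OF assms(2)]]
  by (intro holo_onI) (force simp: holo_on_FD_smult[OF assms(1)] holo_on_FD_smult[OF assms(2)] algebra_simps)

lemma holo_on_diff: 
  assumes "holo_on f S" "holo_on h S" shows "holo_on (\<lambda>x. f x - h x) S"
  using has_derivative_diff[OF holo_on_has_derivative[OF assms(1)] holo_on_has_derivative[OF assms(2)]]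
  by (intro holo_onI) (force simp: holo_on_FD_smult[OF assms(1)] holo_on_FD_smult[OF assms(2)] algebra_simps)

lemma holo_on_mult: 
  assumes "holo_on f S" "holo_on h S" shows "holo_on (\<lambda>x. f x * h x) S"
  using has_derivative_mult[OF holo_on_has_derivative[OF assms(1)] holo_on_has_derivative[OF assms(2)]]
  by (intro holo_onI) (force simp: holo_on_FD_smult[OF assms(1)] holo_on_FD_smult[OF assms(2)] algebra_simps)

lemma holo_on_sum: 
  assumes "\<And>i. i \<in> I \<Longrightarrow> holo_on (f i) S" shows "holo_on (\<lambda>x. \<Sum>i\<in>I. f i x) S"
  using assms by (induction I rule: infinite_finite_induct) (auto intro: holo_on_const holo_on_add)

lemma holo_on_continuous: "holo_on f S \<Longrightarrow> continuous_on S f"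
  by (meson continuous_at_imp_continuous_on differentiable_imp_continuous_within holo_on_def)

section \<open>Cauchy's estimate and its consequences\<close>

lemma holo_on_slice:
  assumes "holo_on f S" "z + \<zeta> *s v \<in> S"
  shows "((\<lambda>\<zeta>. f (z + \<zeta> *s v)) has_field_derivative FD f (z + \<zeta> *s v) v) (at \<zeta>)"
proof -
  have 1: "((\<lambda>\<zeta>. z + \<zeta> *s v) has_derivative (\<lambda>\<zeta>. \<zeta> *s v)) (at \<zeta>)"
    using bounded_bilinear.bounded_linear_left[OF bounded_bilinear_smult, of v]
    by (auto intro!: derivative_eq_intros bounded_linear_imp_has_derivative)
  have "((\<lambda>\<zeta>. f (z + \<zeta> *s v)) has_derivative (\<lambda>\<eta>. FD f (z + \<zeta> *s v) (\<eta> *s v))) (at \<zeta>)"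
    using has_derivative_compose[OF 1 holo_on_has_derivative[OF assms]] .
  then show ?thesis
    unfolding has_field_derivative_def using holo_on_FD_smult[OF assms]
    by (simp add: mult.commute[of _ "FD f (z + \<zeta> *s v) v"])
qed

text \<open>The one-variable Cauchy inequality for the slice \<zeta> -> f (z + \<zeta> v) on the
  disc of radius r / norm v, which the slice carries into \<open>cball z r\<close>.\<close>

lemma holo_on_Cauchy_bound:
  assumes "holo_on f S" "cball z r \<subseteq> S" "r > 0" "\<And>w. w \<in> cball z r \<Longrightarrow> norm (f w) \<le> M"
  shows "norm (FD f z v) \<le> M / r * norm v"
proof (cases "v = 0")
  case True
  moreover have "z \<in> S" using assms(2,3) by (meson centre_in_cball less_imp_le subsetD)
  ultimately show ?thesis
    using linear_0[OF has_derivative_linear[OF holo_on_has_derivative[OF assms(1)]]] by simp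
next
  case False
  define R where "R = r / norm v"
  have R: "R > 0" using False assms by (simp add: R_def)
  have in_cb: "z + \<zeta> *s v \<in> cball z r" if "norm \<zeta> \<le> R" for \<zeta>
  proof -
    have "norm \<zeta> * norm v \<le> r" using that False by (simp add: R_def field_simps)
    then show ?thesis by (simp add: dist_norm norm_smult_vec)
  qed
  let ?f = "\<lambda>\<zeta>. f (z + \<zeta> *s v)"
  have der: "(?f has_field_derivative FD f (z + \<zeta> *s v) v) (at \<zeta>)" if "norm \<zeta> \<le> R" for \<zeta>
    using holo_on_slice[OF assms(1)] in_cb[OF that] assms(2) by blast
  have "norm ((deriv ^^ 1) ?f 0) \<le> fact 1 * M / R ^ 1"
  proof (rule Cauchy_inequality)
    show "?f holomorphic_on ball 0 R"
    proof (rule holomorphic_onI)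
      fix x :: complex assume "x \<in> ball 0 R"
      then have "norm x \<le> R" by simp
      from has_field_derivative_at_within[OF der[OF this]]
      show "?f field_differentiable at x within ball 0 R"
        unfolding field_differentiable_def by blast
    qed
    show "continuous_on (cball 0 R) ?f"
    proof (intro continuous_at_imp_continuous_on ballI)
      fix x :: complex assume "x \<in> cball 0 R"
      then show "isCont ?f x" by (intro DERIV_isCont[OF der]) simp
    qed
    show "norm (?f x) \<le> M" if "norm (0 - x) = R" for x
      using in_cb[of x] that assms(4) by simp
  qed fact
  moreover have "deriv ?f 0 = FD f z v"
    using der[of 0] R DERIV_imp_deriv by force
  ultimately show ?thesis by (simp add: R_def)
qed

lemma holo_on_FD_diff:
  assumes "holo_on f S" "holo_on h S" "x \<in> S"
  shows "FD (\<lambda>x. f x - h x) x v = FD f x v - FD h x v"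
  using FD_eqI[OF has_derivative_diff[OF holo_on_has_derivative[OF assms(1,3)] holo_on_has_derivative[OF assms(2,3)]]]
  by simp

text \<open>Weierstrass' theorem. Cauchy's estimate for the differences f n - f m makes the
  derivatives uniformly Cauchy near x, so they converge to a derivative of the limit; complex
  linearity passes to the limit pointwise.\<close>

lemma holo_on_uniform_limit:
  assumes "open S" and holo: "\<And>n. holo_on (f n) S" and lim: "uniform_limit S f l sequentially"
  shows "holo_on l S" "\<And>x v. x \<in> S \<Longrightarrow> (\<lambda>n. FD (f n) x v) \<longlonglongrightarrow> FD l x v"
proof -
  have *: "\<exists>D. (l has_derivative D) (at x) \<and> (\<forall>a v. D (a *s v) = a * D v)
       \<and> (\<forall>v. (\<lambda>n. FD (f n) x v) \<longlonglongrightarrow> D v)" if x: "x \<in> S" for x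
  proof -
    obtain e where e: "e > 0" "cball x e \<subseteq> S"
      using \<open>open S\<close> x open_contains_cball by blast
    \<comment> \<open>Half the radius, so that the closed r-ball about any point of
      \<open>ball x r\<close> stays in S and Cauchy's estimate applies there.\<close>
    define r where "r = e / 2"
    have r: "r > 0" using e by (simp add: r_def)
    have sub: "cball y r \<subseteq> S" if "y \<in> ball x r" for y
    proof
      fix w assume "w \<in> cball y r"
      then have "dist x w \<le> e"
        using dist_triangle[of x w y] that by (simp add: r_def)
      then show "w \<in> S" using e by auto
    qed
    have est: "\<exists>N. \<forall>m\<ge>N. \<forall>n\<ge>N. \<forall>y\<in>ball x r. \<forall>h. norm (FD (f n) y h - FD (f m) y h) \<le> E * norm h"
      if "E > 0" for E
    proof -
      have "E * r / 2 > 0" using that r by simp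
      then obtain N where N: "\<And>n w. n \<ge> N \<Longrightarrow> w \<in> S \<Longrightarrow> dist (f n w) (l w) < E * r / 2"
        using lim unfolding uniform_limit_iff eventually_sequentially by meson
      have "norm (FD (f n) y h - FD (f m) y h) \<le> E * norm h"
        if "m \<ge> N" "n \<ge> N" "y \<in> ball x r" for m n y h
      proof -
        have y: "y \<in> S" using sub[OF that(3)] r by auto
        have "norm (FD (\<lambda>w. f n w - f m w) y h) \<le> E * r / r * norm h"
        proof (rule holo_on_Cauchy_bound[OF holo_on_diff[OF holo holo] sub[OF that(3)] r])
          fix w assume "w \<in> cball y r"
          then have "w \<in> S" using sub that by blast
          have "norm (f n w - f m w) \<le> dist (f n w) (l w) + dist (f m w) (l w)"
            by (metis dist_norm dist_commute dist_triangle)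
          then show "norm (f n w - f m w) \<le> E * r"
            using N[OF that(1) \<open>w \<in> S\<close>] N[OF that(2) \<open>w \<in> S\<close>] by simp
        qed
        then show ?thesis
          using r holo_on_FD_diff[OF holo holo y] by simp
      qed
      then show ?thesis by blast
    qed
    define D where "D = (\<lambda>y h. lim (\<lambda>n. FD (f n) y h))"
    have D: "(\<lambda>n. FD (f n) y h) \<longlonglongrightarrow> D y h" if "y \<in> ball x r" for y h
    proof -
      have "Cauchy (\<lambda>n. FD (f n) y h)"
      proof (rule metric_CauchyI)
        fix E :: real assume "E > 0"
        \<comment> \<open>Adding 1 covers h = 0 and keeps the product with norm h strictly below
          E.\<close>
        define E' where "E' = E / (norm h + 1)"
        have "E' > 0" using \<open>E > 0\<close> by (simp add: add_nonneg_pos E'_def)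
        from est[OF this] obtain N where N: "\<forall>m\<ge>N. \<forall>n\<ge>N. norm (FD (f n) y h - FD (f m) y h) \<le> E' * norm h"
          using \<open>y \<in> ball x r\<close> by meson
        have "E' * norm h < E" unfolding E'_def
          using \<open>E > 0\<close> norm_ge_zero[of h] by (simp add: divide_less_eq add_nonneg_pos)
        then show "\<exists>M. \<forall>m\<ge>M. \<forall>n\<ge>M. dist (FD (f m) y h) (FD (f n) y h) < E"
          using N unfolding dist_norm by (meson le_less_trans)
      qed
      then show ?thesis
        unfolding D_def by (simp add: Cauchy_convergent_iff convergent_LIMSEQ_iff)
    qed
    have nle: "\<forall>\<^sub>F n in sequentially. \<forall>y\<in>ball x r. \<forall>h. norm (FD (f n) y h - D y h) \<le> E * norm h"
      if "E > 0" for E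
    proof -
      obtain N where N: "\<forall>m\<ge>N. \<forall>n\<ge>N. \<forall>y\<in>ball x r. \<forall>h. norm (FD (f n) y h - FD (f m) y h) \<le> E * norm h"
        using est[OF \<open>E > 0\<close>] by blast
      have "norm (FD (f n) y h - D y h) \<le> E * norm h" if "n \<ge> N" "y \<in> ball x r" for n y h
      proof (rule tendsto_upperbound)
        show "(\<lambda>m. norm (FD (f n) y h - FD (f m) y h)) \<longlonglongrightarrow> norm (FD (f n) y h - D y h)"
          by (intro tendsto_intros D that)
        show "\<forall>\<^sub>F m in sequentially. norm (FD (f n) y h - FD (f m) y h) \<le> E * norm h"
          using N that unfolding eventually_sequentially by blast
      qed auto
      then show ?thesis unfolding eventually_sequentially by blast
    qed
    have xb: "x \<in> ball x r" using r by simp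
    have "\<exists>g. \<forall>y\<in>ball x r. (\<lambda>n. f n y) \<longlonglongrightarrow> g y \<and> (g has_derivative D y) (at y within ball x r)"
    proof (rule has_derivative_sequence[where f = f and f' = "\<lambda>n. FD (f n)" and g' = D and l = "l x" and ?x0.0 = x])
      show "(\<lambda>n. f n x) \<longlonglongrightarrow> l x"
        using tendsto_uniform_limitI[OF lim x] .
      show "(f n has_derivative FD (f n) y) (at y within ball x r)" if "y \<in> ball x r" for n y
        using holo_on_has_derivative[OF holo[of n]] sub[OF that] r has_derivative_at_withinI
        by (meson centre_in_cball less_eq_real_def subsetD)
    qed (use nle xb in auto)
    then obtain g where g: "\<And>y. y \<in> ball x r \<Longrightarrow> (\<lambda>n. f n y) \<longlonglongrightarrow> g y"
      "\<And>y. y \<in> ball x r \<Longrightarrow> (g has_derivative D y) (at y within ball x r)" by blast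
    have "g y = l y" if "y \<in> ball x r" for y
      using g(1)[OF that] tendsto_uniform_limitI[OF lim] sub[OF that] r LIMSEQ_unique
      by (meson centre_in_cball less_eq_real_def subsetD)
    moreover have "(g has_derivative D x) (at x)"
      using g(2)[OF xb] at_within_open[OF xb] by simp
    ultimately have "(l has_derivative D x) (at x)"
      using has_derivative_transform_within_open[of g "D x" x UNIV "ball x r" l] xb by auto
    moreover have "D x (a *s v) = a * D x v" for a v
    proof (rule LIMSEQ_unique[OF D[OF xb]])
      show "(\<lambda>n. FD (f n) x (a *s v)) \<longlonglongrightarrow> a * D x v"
        using holo_on_FD_smult[OF holo x] tendsto_mult_left[OF D[OF xb]] by simp
    qed
    ultimately show ?thesis using D[OF xb] by blast
  qed
  show "holo_on l S"
  proof (rule holo_onI)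
    fix x assume "x \<in> S"
    from *[OF this] show "\<exists>D. (l has_derivative D) (at x) \<and> (\<forall>a v. D (a *s v) = a * D v)"
      by meson
  qed
  show "(\<lambda>n. FD (f n) x v) \<longlonglongrightarrow> FD l x v" if "x \<in> S" for x v
  proof -
    obtain D where D: "(l has_derivative D) (at x)" "(\<lambda>n. FD (f n) x v) \<longlonglongrightarrow> D v"
      using *[OF \<open>x \<in> S\<close>] by meson
    then show ?thesis using FD_eqI[OF D(1)] by simp
  qed
qed

lemma holo_on_shift:
  assumes "holo_on f S" 
  shows "holo_on (\<lambda>w. f (w + h)) {w. w + h \<in> S}" "w + h \<in> S \<Longrightarrow> FD (\<lambda>w. f (w + h)) w = FD f (w + h)"
proof -
  have *: "((\<lambda>w. f (w + h)) has_derivative FD f (w + h)) (at w)" if "w + h \<in> S" for w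
  proof -
    have 1: "((\<lambda>w. w + h) has_derivative (\<lambda>v. v)) (at w)"
      by (auto intro!: derivative_eq_intros)
    show ?thesis
      using has_derivative_compose[OF 1 holo_on_has_derivative[OF assms that]] by simp
  qed
  show "holo_on (\<lambda>w. f (w + h)) {w. w + h \<in> S}"
    using * holo_on_FD_smult[OF assms] by (intro holo_onI) blast
  show "FD (\<lambda>w. f (w + h)) w = FD f (w + h)" if "w + h \<in> S"
    using FD_eqI[OF *[OF that]] .
qed

text \<open>Cauchy's estimate applied to w -> f (w + h) - f w: uniform continuity of f on a compact
  ball makes this difference small, hence also its derivative at z.\<close>

lemma holo_on_continuous_FD:
  assumes "open S" "holo_on f S"
  shows "continuous_on S (\<lambda>z. FD f z v)"
proof (rule continuous_at_imp_continuous_on, rule ballI)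
  fix z assume z: "z \<in> S"
  obtain e where e: "e > 0" "cball z e \<subseteq> S"
    using \<open>open S\<close> z open_contains_cball by blast
  define r where "r = e / 2"
  have r: "r > 0" "r < e" using e by (auto simp: r_def)
  have "uniformly_continuous_on (cball z e) f"
    using compact_uniformly_continuous[OF continuous_on_subset[OF holo_on_continuous[OF assms(2)] e(2)]] by simp
  note unif = this[unfolded uniformly_continuous_on_def, rule_format]
  show "isCont (\<lambda>z. FD f z v) z"
    unfolding continuous_at_eps_delta
  proof (intro allI impI)
    fix E :: real assume "E > 0"
    define E' where "E' = E * r / (norm v + 1)"
    have v1: "norm v + 1 > 0" by (simp add: add_nonneg_pos)
    have "E' > 0" using \<open>E > 0\<close> r v1 by (simp add: E'_def)
    from unif[OF this] obtain d where d: "d > 0"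
      "\<And>x x'. x \<in> cball z e \<Longrightarrow> x' \<in> cball z e \<Longrightarrow> dist x' x < d \<Longrightarrow> dist (f x') (f x) < E'" by metis
    have "norm (FD f z' v - FD f z v) < E" if "norm (z' - z) < min d r" for z'
    proof -
      define h where "h = z' - z"
      have h: "norm h < d" "norm h < r" "z' = z + h" using that by (auto simp: h_def)
      have in_cb: "w + h \<in> cball z e" "w \<in> cball z e" if "w \<in> cball z r" for w
      proof -
        have "dist z (w + h) \<le> dist z w + norm h"
          using norm_triangle_ineq4[of "z - w" h] by (simp add: dist_norm algebra_simps)
        then show "w + h \<in> cball z e" "w \<in> cball z e"
          using that h r by (auto simp: r_def)
      qed
      let ?S = "S \<inter> {w. w + h \<in> S}"
      have hs: "holo_on (\<lambda>w. f (w + h)) ?S" "holo_on f ?S"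
        using holo_on_subset[OF holo_on_shift(1)[OF assms(2)] inf_le2] holo_on_subset[OF assms(2) inf_le1] .
      have "cball z r \<subseteq> ?S" using in_cb e by auto
      then have "norm (FD (\<lambda>w. f (w + h) - f w) z v) \<le> E' / r * norm v"
      proof (rule holo_on_Cauchy_bound[OF holo_on_diff[OF hs] _ r(1)])
        fix w assume w: "w \<in> cball z r"
        have "dist (w + h) w < d" using h(1) by (simp add: dist_norm)
        from d(2)[OF in_cb(2)[OF w] in_cb(1)[OF w] this]
        show "norm (f (w + h) - f w) \<le> E'" by (simp add: dist_norm)
      qed
      also have "E' / r * norm v = E * (norm v / (norm v + 1))" using r by (simp add: E'_def)
      also have "\<dots> < E" using \<open>E > 0\<close> v1 by (simp add: pos_divide_less_eq del: times_divide_eq_right)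
      finally show ?thesis
        using holo_on_FD_diff[OF hs] holo_on_shift(2)[OF assms(2), of z h] z h in_cb(1)[of z] r e
        by (simp add: subset_iff)
    qed
    then show "\<exists>d>0. \<forall>z'. dist z' z < d \<longrightarrow> dist (FD f z' v) (FD f z v) < E"
      using d(1) r by (intro exI[of _ "min d r"]) (auto simp: dist_norm)
  qed
qed

text \<open>The difference quotients \<open>q n\<close> are holomorphic and converge uniformly near
  z to the directional derivative, by its continuity just proved; Weierstrass' theorem makes that
  derivative holomorphic. Iteration gives smoothness.\<close>

lemma holo_on_FD:
  assumes "open S" "holo_on f S"
  shows "holo_on (\<lambda>z. FD f z v) S"
proof (rule holo_onI)
  fix z assume z: "z \<in> S"
  obtain e where e: "e > 0" "cball z e \<subseteq> S"
    using \<open>open S\<close> z open_contains_cball by blast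
  define r where "r = e / 2"
  have r: "r > 0" "r < e" using e by (auto simp: r_def)
  \<comment> \<open>The factor r / (norm v + 1) keeps every step
    \<open>\<delta> n *\<^sub>R v\<close> shorter than r, so the quotients are defined on all of
    \<open>ball z r\<close>.\<close>
  define \<delta> where "\<delta> = (\<lambda>n. r / (norm v + 1) * inverse (real (Suc n)))"
  have v1: "norm v + 1 > 0" by (simp add: add_nonneg_pos)
  have \<delta>0: "\<delta> n > 0" for n using r v1 by (simp add: \<delta>_def)
  have \<delta>v: "\<delta> n * norm v < r" for n
  proof -
    have "inverse (real (Suc n)) \<le> 1" by (simp add: field_simps)
    then have "\<delta> n \<le> r / (norm v + 1)"
      unfolding \<delta>_def using r v1 by (intro mult_left_le) auto
    then have "\<delta> n * norm v \<le> r / (norm v + 1) * norm v"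
      by (rule mult_right_mono) simp
    also have "\<dots> < r" using r v1 by (simp add: field_simps)
    finally show ?thesis .
  qed
  have \<delta>lim: "\<delta> \<longlonglongrightarrow> 0"
    unfolding \<delta>_def by (rule tendsto_mult_right_zero[OF LIMSEQ_inverse_real_of_nat])
  define q where "q = (\<lambda>n w. (f (w + \<delta> n *\<^sub>R v) - f w) / complex_of_real (\<delta> n))"
  have in_cb: "w + s *\<^sub>R v \<in> cball z e" if "w \<in> ball z r" "0 \<le> s" "s \<le> \<delta> n" for w n s
  proof -
    have "dist z (w + s *\<^sub>R v) \<le> dist z w + norm (s *\<^sub>R v)"
      using norm_triangle_ineq4[of "z - w" "s *\<^sub>R v"] by (simp add: dist_norm algebra_simps)
    moreover have "norm (s *\<^sub>R v) \<le> \<delta> n * norm v"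
      using that by (simp add: mult_right_mono)
    ultimately show ?thesis using that \<delta>v[of n] by (simp add: r_def)
  qed
  have qholo: "holo_on (q n) (ball z r)" for n
  proof -
    let ?S = "S \<inter> {w. w + \<delta> n *\<^sub>R v \<in> S}"
    have "holo_on (\<lambda>w. f (w + \<delta> n *\<^sub>R v)) ?S" "holo_on f ?S"
      using holo_on_subset[OF holo_on_shift(1)[OF assms(2)] inf_le2] holo_on_subset[OF assms(2) inf_le1] .
    then have "holo_on (\<lambda>w. (1 / complex_of_real (\<delta> n)) * (f (w + \<delta> n *\<^sub>R v) - f w)) ?S"
      by (intro holo_on_mult holo_on_const holo_on_diff)
    moreover have "ball z r \<subseteq> ?S"
      using in_cb[of _ "\<delta> n" n] \<delta>0[of n] e(2) r(2) by (auto simp: subset_iff)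
    ultimately have "holo_on (\<lambda>w. (1 / complex_of_real (\<delta> n)) * (f (w + \<delta> n *\<^sub>R v) - f w)) (ball z r)"
      using holo_on_subset by blast
    then show ?thesis
      unfolding q_def by simp
  qed
  have "uniform_limit (ball z r) q (\<lambda>w. FD f w v) sequentially"
    unfolding uniform_limit_iff
  proof (intro allI impI)
    fix E :: real assume E: "E > 0"
    have "uniformly_continuous_on (cball z e) (\<lambda>w. FD f w v)"
      using compact_uniformly_continuous[OF continuous_on_subset[OF holo_on_continuous_FD[OF assms] e(2)]] by simp
    then obtain d where d: "d > 0"
      "\<And>x x'. x \<in> cball z e \<Longrightarrow> x' \<in> cball z e \<Longrightarrow> dist x' x < d \<Longrightarrow> dist (FD f x' v) (FD f x v) < E / 2"
      unfolding uniformly_continuous_on_def using half_gt_zero[OF E] by metis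
    have "(\<lambda>n. \<delta> n * norm v) \<longlonglongrightarrow> 0" using tendsto_mult_left_zero[OF \<delta>lim] .
    then have "\<forall>\<^sub>F n in sequentially. \<delta> n * norm v < d"
      using d(1) order_tendstoD(2) by blast
    then show "\<forall>\<^sub>F n in sequentially. \<forall>w\<in>ball z r. dist (q n w) (FD f w v) < E"
    proof eventually_elim
      case (elim n)
      show ?case
      proof
        fix w assume w: "w \<in> ball z r"
        define k where "k = (\<lambda>s. f (w + s *\<^sub>R v) - s *\<^sub>R FD f w v)"
        have der: "(k has_derivative (\<lambda>t. t *\<^sub>R (FD f (w + s *\<^sub>R v) v - FD f w v))) (at s)"
          if "s \<in> {0..\<delta> n}" for s
        proof -
          have inS: "w + s *\<^sub>R v \<in> S" using in_cb[OF w, of s n] that e by auto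
          have 1: "((\<lambda>s. w + s *\<^sub>R v) has_derivative (\<lambda>t. t *\<^sub>R v)) (at s)"
            by (auto intro!: derivative_eq_intros)
          have "((\<lambda>s. f (w + s *\<^sub>R v)) has_derivative (\<lambda>t. FD f (w + s *\<^sub>R v) (t *\<^sub>R v))) (at s)"
            using has_derivative_compose[OF 1 holo_on_has_derivative[OF assms(2) inS]] .
          moreover have "FD f (w + s *\<^sub>R v) (t *\<^sub>R v) = t *\<^sub>R FD f (w + s *\<^sub>R v) v" for t
            using holo_on_FD_smult[OF assms(2) inS] by (simp add: scaleR_smult scaleR_conv_of_real)
          ultimately have "((\<lambda>s. f (w + s *\<^sub>R v)) has_derivative (\<lambda>t. t *\<^sub>R FD f (w + s *\<^sub>R v) v)) (at s)"
            by simp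
          from has_derivative_diff[OF this bounded_linear_imp_has_derivative[OF bounded_linear_scaleR_left]]
          show ?thesis
            unfolding k_def by (simp add: scaleR_diff_right)
        qed
        have "norm (k (\<delta> n) - k 0) \<le> E / 2 * norm (\<delta> n - 0)"
        proof (rule differentiable_bound[of "{0..\<delta> n}" k "\<lambda>s t. t *\<^sub>R (FD f (w + s *\<^sub>R v) v - FD f w v)"])
          show "onorm (\<lambda>t. t *\<^sub>R (FD f (w + s *\<^sub>R v) v - FD f w v)) \<le> E / 2" if "s \<in> {0..\<delta> n}" for s
          proof (rule onorm_le)
            fix t :: real
            have "s * norm v \<le> \<delta> n * norm v" using that by (intro mult_right_mono) auto
            then have "dist (FD f (w + s *\<^sub>R v) v) (FD f w v) < E / 2"
              using in_cb[OF w, of s n] in_cb[OF w, of 0 n] that elim d(2) \<delta>0[of n] by (simp add: dist_norm)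
            then have "norm (FD f (w + s *\<^sub>R v) v - FD f w v) \<le> E / 2" by (simp add: dist_norm)
            from mult_left_mono[OF this abs_ge_zero[of t]]
            show "norm (t *\<^sub>R (FD f (w + s *\<^sub>R v) v - FD f w v)) \<le> E / 2 * norm t"
              by (simp add: mult.commute)
          qed
          show "(k has_derivative (\<lambda>t. t *\<^sub>R (FD f (w + s *\<^sub>R v) v - FD f w v))) (at s within {0..\<delta> n})"
            if "s \<in> {0..\<delta> n}" for s
            using has_derivative_at_withinI[OF der[OF that]] .
        qed (use \<delta>0[of n] in auto)
        then have "norm (f (w + \<delta> n *\<^sub>R v) - f w - \<delta> n *\<^sub>R FD f w v) \<le> E / 2 * \<delta> n"
          using \<delta>0[of n] by (simp add: k_def algebra_simps)
        moreover have "f (w + \<delta> n *\<^sub>R v) - f w - \<delta> n *\<^sub>R FD f w v = complex_of_real (\<delta> n) * (q n w - FD f w v)"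
          using \<delta>0[of n] by (simp add: q_def scaleR_conv_of_real field_simps)
        ultimately have "norm (q n w - FD f w v) \<le> E / 2"
          using \<delta>0[of n] by (simp add: norm_mult mult.commute)
        then show "dist (q n w) (FD f w v) < E" using E by (simp add: dist_norm)
      qed
    qed
  qed
  from holo_on_uniform_limit(1)[OF open_ball qholo this] 
  show "\<exists>D. ((\<lambda>z. FD f z v) has_derivative D) (at z) \<and> (\<forall>a v. D (a *s v) = a * D v)"
    using holo_on_has_derivative holo_on_FD_smult r(1) by (metis centre_in_ball)
qed


section \<open>Wirtinger derivatives and holomorphic maps\<close>

lemma axis_decomp: "(v::complex^'n) = (\<Sum>i\<in>UNIV. Re (v $ i) *\<^sub>R axis i 1 + Im (v $ i) *\<^sub>R axis i \<i>)"
proof (subst vec_eq_iff, rule allI)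
  fix k
  have "(\<Sum>i\<in>UNIV. Re (v $ i) *\<^sub>R axis i 1 + Im (v $ i) *\<^sub>R axis i \<i>) $ k
      = (\<Sum>i\<in>UNIV. if i = k then v $ k else 0)"
    unfolding sum_component
    by (rule sum.cong) (auto simp: axis_def complex_eq_iff)
  then show "v $ k = (\<Sum>i\<in>UNIV. Re (v $ i) *\<^sub>R axis i 1 + Im (v $ i) *\<^sub>R axis i \<i>) $ k"
    by simp
qed

text \<open>A real-linear map splits into a complex-linear and an antilinear part; \<open>dz\<close>
  and \<open>dzbar\<close> are their coefficients.\<close>

lemma FD_dz:
  assumes "u differentiable (at x)"
  shows "FD u x v = (\<Sum>i\<in>UNIV. v $ i * dz i u x + cnj (v $ i) * dzbar i u x)"
proof -
  have lin: "linear (FD u x)"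
    using has_derivative_linear[OF FD_works[OF assms]] .
  have "FD u x v = FD u x (\<Sum>i\<in>UNIV. Re (v $ i) *\<^sub>R axis i 1 + Im (v $ i) *\<^sub>R axis i \<i>)"
    using axis_decomp[of v] by simp
  also have "\<dots> = (\<Sum>i\<in>UNIV. Re (v $ i) *\<^sub>R FD u x (axis i 1) + Im (v $ i) *\<^sub>R FD u x (axis i \<i>))"
    by (simp add: linear_sum[OF lin] linear_add[OF lin] linear_scale[OF lin])
  also have "\<dots> = (\<Sum>i\<in>UNIV. v $ i * dz i u x + cnj (v $ i) * dzbar i u x)"
    by (rule sum.cong) (auto simp: dz_def dzbar_def complex_eq_iff field_simps)
  finally show ?thesis .
qed

lemma holo_on_axis: "holo_on u S \<Longrightarrow> x \<in> S \<Longrightarrow> FD u x (axis i a) = a * FD u x (axis i 1)"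
  using holo_on_FD_smult[of u S x a "axis i 1"]
  by (simp add: vec_eq_iff axis_def if_distrib vector_scalar_mult_def cong: if_cong)

lemma holo_on_dz: "holo_on u S \<Longrightarrow> x \<in> S \<Longrightarrow> dz i u x = FD u x (axis i 1)"
  using holo_on_axis[of u S x i \<i>] by (simp add: dz_def)

lemma holo_on_dzbar: "holo_on u S \<Longrightarrow> x \<in> S \<Longrightarrow> dzbar i u x = 0"
  using holo_on_axis[of u S x i \<i>] by (simp add: dzbar_def)

lemma holo_on_FD_dz:
  assumes "holo_on u S" "x \<in> S"
  shows "FD u x v = (\<Sum>i\<in>UNIV. v $ i * dz i u x)"
  using FD_dz[of u x v] assms holo_on_dzbar[OF assms] by (simp add: holo_on_def)

lemma holo_on_dz_holo: "open S \<Longrightarrow> holo_on u S \<Longrightarrow> holo_on (dz i u) S"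
  by (rule holo_on_cong[OF _ _ holo_on_FD[of S u "axis i 1"]]) (auto simp: holo_on_dz)

lemma has_derivative_vec:
  fixes F :: "'a::real_normed_vector \<Rightarrow> 'b::euclidean_space^'m"
  assumes "\<And>k. ((\<lambda>x. F x $ k) has_derivative (\<lambda>h. D h $ k)) (at x within S)"
  shows "(F has_derivative D) (at x within S)"
proof (subst has_derivative_componentwise_within, rule ballI)
  fix i :: "'b^'m" assume "i \<in> Basis"
  then obtain k b where i: "i = axis k b" by (auto simp: Basis_vec_def)
  have "((\<lambda>x. F x $ k \<bullet> b) has_derivative (\<lambda>h. D h $ k \<bullet> b)) (at x within S)"
    using assms[of k] by (auto intro!: derivative_eq_intros)
  then show "((\<lambda>x. F x \<bullet> i) has_derivative (\<lambda>h. D h \<bullet> i)) (at x within S)"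
    by (simp add: i inner_axis)
qed

lemma has_derivative_vec_nth:
  "(F has_derivative D) F' \<Longrightarrow> ((\<lambda>x. F x $ k) has_derivative (\<lambda>h. D h $ k)) F'"
  using bounded_linear.has_derivative[OF bounded_linear_vec_nth] by blast

lemma holomorphic_vec_on_iff:
  "holomorphic_vec_on F S \<longleftrightarrow> (\<forall>k. holo_on (\<lambda>x. F x $ k) S)"
proof
  assume F: "holomorphic_vec_on F S"
  show "\<forall>k. holo_on (\<lambda>x. F x $ k) S"
  proof (intro allI holo_onI)
    fix k x assume "x \<in> S"
    then obtain D where D: "(F has_derivative D) (at x)" "\<forall>a v. D (a *s v) = a *s D v"
      using F by (auto simp: holomorphic_vec_on_def)
    show "\<exists>D. ((\<lambda>x. F x $ k) has_derivative D) (at x) \<and> (\<forall>a v. D (a *s v) = a * D v)"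
      using has_derivative_vec_nth[OF D(1), of k] D(2) by (intro exI[of _ "\<lambda>h. D h $ k"]) simp
  qed
next
  assume h: "\<forall>k. holo_on (\<lambda>x. F x $ k) S"
  show "holomorphic_vec_on F S"
    unfolding holomorphic_vec_on_def
  proof
    fix x assume x: "x \<in> S"
    let ?D = "\<lambda>v. \<chi> k. FD (\<lambda>x. F x $ k) x v"
    have "(F has_derivative ?D) (at x)"
      by (rule has_derivative_vec) (use h x holo_on_has_derivative in force)
    moreover have "?D (a *s v) = a *s ?D v" for a v
      using holo_on_FD_smult[OF h[rule_format] x] by (auto simp: vec_eq_iff)
    ultimately show "\<exists>D. (F has_derivative D) (at x) \<and> (\<forall>a v. D (a *s v) = a *s D v)" by blast
  qed
qed

lemma holomorphic_vec_on_nth: "holomorphic_vec_on F S \<Longrightarrow> holo_on (\<lambda>x. F x $ k) S"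
  by (simp add: holomorphic_vec_on_iff)

lemma holomorphic_vec_on_has_derivative:
  assumes "holomorphic_vec_on F S" "x \<in> S"
  shows "(F has_derivative (\<lambda>v. \<chi> k. \<Sum>i\<in>UNIV. v $ i * dz i (\<lambda>x. F x $ k) x)) (at x)"
proof (rule has_derivative_vec)
  fix k
  have holo: "holo_on (\<lambda>x. F x $ k) S" using holomorphic_vec_on_nth[OF assms(1)] .
  have "FD (\<lambda>x. F x $ k) x = (\<lambda>v. \<Sum>i\<in>UNIV. v $ i * dz i (\<lambda>x. F x $ k) x)"
    using holo_on_FD_dz[OF holo assms(2)] by (rule ext)
  then show "((\<lambda>x. F x $ k) has_derivative (\<lambda>v. (\<chi> k. \<Sum>i\<in>UNIV. v $ i * dz i (\<lambda>x. F x $ k) x) $ k)) (at x)"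
    using holo_on_has_derivative[OF holo assms(2)] by simp
qed

lemma holomorphic_vec_on_subset: "holomorphic_vec_on F S \<Longrightarrow> T \<subseteq> S \<Longrightarrow> holomorphic_vec_on F T"
  by (auto simp: holomorphic_vec_on_def)

lemma holomorphic_vec_on_continuous: "holomorphic_vec_on F S \<Longrightarrow> continuous_on S F"
  by (meson continuous_at_imp_continuous_on has_derivative_continuous holomorphic_vec_on_def)

lemma holo_on_compose:
  assumes u: "holo_on u T" and F: "holomorphic_vec_on F S" and FS: "F ` S \<subseteq> T"
  shows "holo_on (\<lambda>x. u (F x)) S"
    and "x \<in> S \<Longrightarrow> dz i (\<lambda>x. u (F x)) x = (\<Sum>k\<in>UNIV. dz k u (F x) * dz i (\<lambda>x. F x $ k) x)"
proof -
  let ?J = "\<lambda>x v. \<chi> k. \<Sum>i\<in>UNIV. v $ i * dz i (\<lambda>x. F x $ k) x"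
  have der: "((\<lambda>x. u (F x)) has_derivative (\<lambda>v. FD u (F x) (?J x v))) (at x)" if "x \<in> S" for x
    using has_derivative_compose[OF holomorphic_vec_on_has_derivative[OF F that] holo_on_has_derivative[OF u]]
      FS that by blast
  have J: "?J x (a *s v) = a *s ?J x v" for x a v
    by (simp add: vec_eq_iff sum_distrib_left mult.assoc)
  show holo: "holo_on (\<lambda>x. u (F x)) S"
  proof (rule holo_onI)
    fix x assume x: "x \<in> S"
    show "\<exists>D. ((\<lambda>x. u (F x)) has_derivative D) (at x) \<and> (\<forall>a v. D (a *s v) = a * D v)"
      using der[OF x] J holo_on_FD_smult[OF u] FS x by (intro exI[of _ "\<lambda>v. FD u (F x) (?J x v)"]) auto
  qed
  assume x: "x \<in> S"
  have "dz i (\<lambda>x. u (F x)) x = FD u (F x) (?J x (axis i 1))"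
    using holo_on_dz[OF holo x] FD_eqI[OF der[OF x]] by simp
  also have "\<dots> = (\<Sum>k\<in>UNIV. dz i (\<lambda>x. F x $ k) x * dz k u (F x))"
    using FS x by (subst holo_on_FD_dz[OF u]) (auto simp: axis_def if_distrib[of "\<lambda>z. z * _"] cong: if_cong)
  finally show "dz i (\<lambda>x. u (F x)) x = (\<Sum>k\<in>UNIV. dz k u (F x) * dz i (\<lambda>x. F x $ k) x)"
    by (simp add: mult.commute)
qed

lemma holomorphic_vec_on_compose:
  assumes "holomorphic_vec_on G T" "holomorphic_vec_on F S" "F ` S \<subseteq> T"
  shows "holomorphic_vec_on (\<lambda>x. G (F x)) S"
  unfolding holomorphic_vec_on_iff
  using holo_on_compose(1)[OF holomorphic_vec_on_nth[OF assms(1)] assms(2,3)] by blast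

lemma holomorphic_vec_on_cong:
  assumes "open S" "\<And>y. y \<in> S \<Longrightarrow> F y = H y" "holomorphic_vec_on F S"
  shows "holomorphic_vec_on H S"
  unfolding holomorphic_vec_on_iff
proof
  fix k
  show "holo_on (\<lambda>x. H x $ k) S"
    by (rule holo_on_cong[OF assms(1) _ holomorphic_vec_on_nth[OF assms(3), of k]]) (simp add: assms(2))
qed

lemma holomorphic_vec_on_id: "holomorphic_vec_on (\<lambda>x. x) S"
  unfolding holomorphic_vec_on_iff using holo_on_nth by blast

lemma holomorphic_vec_on_local:
  assumes "\<And>x. x \<in> S \<Longrightarrow> \<exists>T. x \<in> T \<and> holomorphic_vec_on F T"
  shows "holomorphic_vec_on F S"
  using assms unfolding holomorphic_vec_on_def by meson

section \<open>Smooth functions\<close>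

lemma Ck_on_cong:
  assumes "open S" "\<And>y. y \<in> S \<Longrightarrow> f y = h y" "Ck_on k f S"
  shows "Ck_on k h S"
  using assms(2,3)
proof (induction k arbitrary: f h)
  case 0
  then show ?case using continuous_on_cong[of S S f h] by simp
next
  case (Suc k)
  have d: "h differentiable (at x)" if "x \<in> S" for x
    using differentiable_cong_open[of S x f h] Suc.prems that assms(1) by simp
  have "Ck_on k (\<lambda>x. FD h x v) S" for v
  proof (rule Suc.IH)
    show "FD f y v = FD h y v" if "y \<in> S" for y
      using FD_cong[of S y f h] Suc.prems that assms(1) by simp
    show "Ck_on k (\<lambda>x. FD f x v) S" using Suc.prems by simp
  qed
  then show ?case using d by simp
qed

lemma Ck_on_Suc_D: "Ck_on (Suc k) f S \<Longrightarrow> Ck_on k f S"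
proof (induction k arbitrary: f)
  case 0
  then show ?case
    by (auto intro!: continuous_at_imp_continuous_on differentiable_imp_continuous_within)
next
  case (Suc k)
  then show ?case by (metis Ck_on.simps(2))
qed

lemma Ck_on_linear:
  assumes "open S" "bounded_linear L" "Ck_on k f S"
  shows "Ck_on k (\<lambda>x. L (f x)) S"
  using assms(3)
proof (induction k arbitrary: f)
  case 0
  then show ?case using bounded_linear.continuous_on[OF assms(2)] by simp
next
  case (Suc k)
  have der: "((\<lambda>x. L (f x)) has_derivative (\<lambda>v. L (FD f x v))) (at x)" if "x \<in> S" for x
    using Suc.prems that by (intro bounded_linear.has_derivative[OF assms(2)] FD_works) simp
  have "Ck_on k (\<lambda>x. FD (\<lambda>x. L (f x)) x v) S" for v
  proof (rule Ck_on_cong[OF assms(1)])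
    show "Ck_on k (\<lambda>x. L (FD f x v)) S" using Suc by simp
  qed (simp add: FD_eqI[OF der])
  then show ?case using differentiableI[OF der] by auto
qed

lemma Ck_on_add:
  assumes "open S" "Ck_on k f S" "Ck_on k h S"
  shows "Ck_on k (\<lambda>x. f x + h x) S"
  using assms(2,3)
proof (induction k arbitrary: f h)
  case 0
  then show ?case by (simp add: continuous_on_add)
next
  case (Suc k)
  have der: "((\<lambda>x. f x + h x) has_derivative (\<lambda>v. FD f x v + FD h x v)) (at x)" if "x \<in> S" for x
    using Suc.prems that by (intro has_derivative_add FD_works) auto
  have "Ck_on k (\<lambda>x. FD (\<lambda>x. f x + h x) x v) S" for v
  proof (rule Ck_on_cong[OF assms(1)])
    show "Ck_on k (\<lambda>x. FD f x v + FD h x v) S" using Suc by simp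
  qed (simp add: FD_eqI[OF der])
  then show ?case using differentiableI[OF der] by auto
qed

lemma Ck_on_bilinear:
  assumes "open S" "bounded_bilinear B" "Ck_on k f S" "Ck_on k h S"
  shows "Ck_on k (\<lambda>x. B (f x) (h x)) S"
  using assms(3,4)
proof (induction k arbitrary: f h)
  case 0
  then show ?case by (simp add: bounded_bilinear.continuous_on[OF assms(2)])
next
  case (Suc k)
  have der: "((\<lambda>x. B (f x) (h x)) has_derivative (\<lambda>v. B (f x) (FD h x v) + B (FD f x v) (h x))) (at x)"
    if "x \<in> S" for x
    using Suc.prems that by (intro bounded_bilinear.FDERIV[OF assms(2)] FD_works) auto
  have "Ck_on k (\<lambda>x. FD (\<lambda>x. B (f x) (h x)) x v) S" for v
  proof (rule Ck_on_cong[OF assms(1)])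
    have "Ck_on k f S" "Ck_on k h S" using Suc.prems Ck_on_Suc_D by blast+
    then show "Ck_on k (\<lambda>x. B (f x) (FD h x v) + B (FD f x v) (h x)) S"
      using Suc by (intro Ck_on_add[OF assms(1)]) auto
  qed (simp add: FD_eqI[OF der])
  then show ?case using differentiableI[OF der] by auto
qed

lemma FD_const: "FD (\<lambda>_. c) x = (\<lambda>_. 0)"
  by (rule FD_eqI) (rule has_derivative_const)

lemma Ck_on_const: "Ck_on k (\<lambda>_. c) S"
  by (induction k arbitrary: c) (auto simp: FD_const)

lemma Ck_on_holo: "open S \<Longrightarrow> holo_on u S \<Longrightarrow> Ck_on k u S"
proof (induction k arbitrary: u)
  case 0
  then show ?case by (simp add: holo_on_continuous)
next
  case (Suc k)
  then show ?case using holo_on_FD[OF Suc.prems] by (simp add: holo_on_def)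
qed

lemma smooth_on_differentiable: "smooth_on f S \<Longrightarrow> x \<in> S \<Longrightarrow> f differentiable (at x)"
  unfolding smooth_on_def by (metis Ck_on.simps(2))

lemma smooth_on_FD: "smooth_on f S \<Longrightarrow> smooth_on (\<lambda>x. FD f x v) S"
  unfolding smooth_on_def by (metis Ck_on.simps(2))

lemma smooth_on_continuous: "smooth_on f S \<Longrightarrow> continuous_on S f"
  unfolding smooth_on_def by (metis Ck_on.simps(1))

lemma smooth_on_linear: "open S \<Longrightarrow> bounded_linear L \<Longrightarrow> smooth_on f S \<Longrightarrow> smooth_on (\<lambda>x. L (f x)) S"
  unfolding smooth_on_def using Ck_on_linear by blast

lemma smooth_on_add: "open S \<Longrightarrow> smooth_on f S \<Longrightarrow> smooth_on h S \<Longrightarrow> smooth_on (\<lambda>x. f x + h x) S"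
  unfolding smooth_on_def using Ck_on_add by blast

lemma smooth_on_const: "smooth_on (\<lambda>_. c) S"
  unfolding smooth_on_def using Ck_on_const by blast

lemma smooth_on_mult:
  fixes f h :: "'a::real_normed_vector \<Rightarrow> 'b::real_normed_algebra"
  shows "open S \<Longrightarrow> smooth_on f S \<Longrightarrow> smooth_on h S \<Longrightarrow> smooth_on (\<lambda>x. f x * h x) S"
  unfolding smooth_on_def using Ck_on_bilinear[OF _ bounded_bilinear_mult] by blast

lemma smooth_on_cmult:
  fixes f :: "'a::real_normed_vector \<Rightarrow> 'b::real_normed_algebra"
  shows "open S \<Longrightarrow> smooth_on f S \<Longrightarrow> smooth_on (\<lambda>x. c * f x) S"
  by (rule smooth_on_linear[OF _ bounded_linear_mult_right])

lemma smooth_on_minus: "open S \<Longrightarrow> smooth_on f S \<Longrightarrow> smooth_on (\<lambda>x. - f x) S"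
  by (rule smooth_on_linear[OF _ bounded_linear_minus[OF bounded_linear_ident]])

lemma smooth_on_diff: "open S \<Longrightarrow> smooth_on f S \<Longrightarrow> smooth_on h S \<Longrightarrow> smooth_on (\<lambda>x. f x - h x) S"
  using smooth_on_add[of S f "\<lambda>x. - h x"] smooth_on_minus[of S h] by simp

lemma smooth_on_sum:
  assumes "open S" "\<And>i. i \<in> I \<Longrightarrow> smooth_on (f i) S"
  shows "smooth_on (\<lambda>x. \<Sum>i\<in>I. f i x) S"
  using assms(2)
  by (induction I rule: infinite_finite_induct) (auto intro: smooth_on_const smooth_on_add[OF assms(1)])

lemma smooth_on_cnj: "open S \<Longrightarrow> smooth_on f S \<Longrightarrow> smooth_on (\<lambda>x. cnj (f x)) S"
  by (rule smooth_on_linear[OF _ bounded_linear_cnj])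

lemma smooth_on_holo: "open S \<Longrightarrow> holo_on u S \<Longrightarrow> smooth_on u S"
  unfolding smooth_on_def using Ck_on_holo by blast

lemma smooth_on_dz: "open S \<Longrightarrow> smooth_on f S \<Longrightarrow> smooth_on (dz i f) S"
  and smooth_on_dzbar: "open S \<Longrightarrow> smooth_on f S \<Longrightarrow> smooth_on (dzbar i f) S"
proof -
  assume *: "open S" "smooth_on f S"
  have "smooth_on (\<lambda>x. (1/2) * (FD f x (axis i 1) + (-\<i>) * FD f x (axis i \<i>))) S"
    "smooth_on (\<lambda>x. (1/2) * (FD f x (axis i 1) + \<i> * FD f x (axis i \<i>))) S"
    by (intro smooth_on_cmult smooth_on_add smooth_on_FD *)+
  then show "smooth_on (dz i f) S" "smooth_on (dzbar i f) S"
    by (simp_all add: dz_def[abs_def] dzbar_def[abs_def])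
qed


section \<open>Symmetry of second derivatives\<close>

lemma linear_approx_bound:
  fixes h :: "real \<Rightarrow> 'b::real_normed_vector"
  assumes "0 \<le> d" "\<And>s. s \<in> {0..d} \<Longrightarrow> (h has_vector_derivative h' s) (at s within {0..d})"
    and "\<And>s. s \<in> {0..d} \<Longrightarrow> norm (h' s - c) \<le> e"
  shows "norm (h d - h 0 - d *\<^sub>R c) \<le> e * d"
proof -
  let ?k = "\<lambda>s. h s - s *\<^sub>R c"
  have "norm (?k d - ?k 0) \<le> e * norm (d - 0)"
  proof (rule differentiable_bound[of "{0..d}" ?k "\<lambda>s t. t *\<^sub>R (h' s - c)"])
    show "(?k has_derivative (\<lambda>t. t *\<^sub>R (h' s - c))) (at s within {0..d})" if "s \<in> {0..d}" for s
      using assms(2)[OF that] unfolding has_vector_derivative_def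
      by (auto intro!: derivative_eq_intros simp: algebra_simps)
    show "onorm (\<lambda>t. t *\<^sub>R (h' s - c)) \<le> e" if "s \<in> {0..d}" for s
    proof (rule onorm_le)
      fix t :: real
      show "norm (t *\<^sub>R (h' s - c)) \<le> e * norm t"
        using mult_left_mono[OF assms(3)[OF that] abs_ge_zero[of t]] by (simp add: mult.commute)
    qed
  qed (use assms(1) in auto)
  then show ?thesis using assms(1) by (simp add: algebra_simps)
qed

lemma FD_line:
  assumes "f differentiable (at (x + s *\<^sub>R v))"
  shows "((\<lambda>s. f (x + s *\<^sub>R v)) has_vector_derivative FD f (x + s *\<^sub>R v) v) (at s within T)"
proof -
  have 1: "((\<lambda>s. x + s *\<^sub>R v) has_derivative (\<lambda>t. t *\<^sub>R v)) (at s)"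
    by (auto intro!: derivative_eq_intros)
  have 2: "((\<lambda>s. f (x + s *\<^sub>R v)) has_derivative (\<lambda>t. FD f (x + s *\<^sub>R v) (t *\<^sub>R v))) (at s)"
    using has_derivative_compose[OF 1 FD_works[OF assms]] .
  have "linear (FD f (x + s *\<^sub>R v))"
    using has_derivative_linear[OF FD_works[OF assms]] .
  then have "((\<lambda>s. f (x + s *\<^sub>R v)) has_vector_derivative FD f (x + s *\<^sub>R v) v) (at s)"
    using 2 by (simp add: has_vector_derivative_def linear_scale)
  then show ?thesis by (rule has_vector_derivative_at_within)
qed

text \<open>Two mean value estimates: along w for the derivative in direction v, then along v for f
  itself. The second difference is symmetric in v and w, which is what \<open>FD_commute\<close>
  exploits.\<close>

lemma second_difference_bound:
  fixes f :: "'a::real_normed_vector \<Rightarrow> 'b::real_normed_vector"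
  assumes "open S" and f: "smooth_on f S" and "x \<in> S" "e > 0"
  shows "\<exists>d>0. \<forall>t. 0 < t \<and> t < d \<longrightarrow>
     norm (f (x + t *\<^sub>R v + t *\<^sub>R w) - f (x + t *\<^sub>R v) - f (x + t *\<^sub>R w) + f x
       - (t * t) *\<^sub>R FD (\<lambda>y. FD f y v) x w) \<le> e * (t * t)"
proof -
  define k where "k = (\<lambda>y. FD f y v)"
  have k: "smooth_on k S" unfolding k_def by (rule smooth_on_FD[OF f])
  have "continuous_on S (\<lambda>y. FD k y w)" using smooth_on_continuous[OF smooth_on_FD[OF k]] .
  then have "isCont (\<lambda>y. FD k y w) x"
    using assms(1,3) by (simp add: continuous_on_eq_continuous_at)
  then obtain d1 where d1: "d1 > 0" "\<And>y. dist y x < d1 \<Longrightarrow> dist (FD k y w) (FD k x w) < e"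
    using \<open>e > 0\<close> unfolding continuous_at_eps_delta by meson
  obtain d2 where d2: "d2 > 0" "ball x d2 \<subseteq> S" using assms(1,3) open_contains_ball by blast
  \<comment> \<open>With this d all points x + s v + r w with s, r at most t < d stay within min d1
    d2 of x.\<close>
  define d where "d = min d1 d2 / (norm v + norm w + 1)"
  have pos: "norm v + norm w + 1 > 0" by (simp add: add_nonneg_pos)
  have d: "d > 0" using d1 d2 pos by (simp add: d_def)
  have near: "dist (x + s *\<^sub>R v + r *\<^sub>R w) x < min d1 d2" if "0 \<le> s" "s \<le> t" "0 \<le> r" "r \<le> t" "t < d" for s r t
  proof -
    have "norm (s *\<^sub>R v + r *\<^sub>R w) \<le> s * norm v + r * norm w"
      using norm_triangle_ineq[of "s *\<^sub>R v" "r *\<^sub>R w"] that by simp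
    also have "\<dots> \<le> t * norm v + t * norm w"
      using that by (intro add_mono mult_right_mono) auto
    also have "\<dots> \<le> t * (norm v + norm w + 1)" using that by (simp add: algebra_simps)
    also have "\<dots> < min d1 d2" using that(5) pos by (simp add: d_def pos_less_divide_eq)
    finally show ?thesis by (simp add: dist_norm add.assoc)
  qed
  have "norm (f (x + t *\<^sub>R v + t *\<^sub>R w) - f (x + t *\<^sub>R v) - f (x + t *\<^sub>R w) + f x
       - (t * t) *\<^sub>R FD k x w) \<le> e * (t * t)" if t: "0 < t" "t < d" for t
  proof -
    have inS: "x + s *\<^sub>R v + r *\<^sub>R w \<in> S" if "0 \<le> s" "s \<le> t" "0 \<le> r" "r \<le> t" for s r
      using near[OF that \<open>t < d\<close>] d2(2) by (auto simp: dist_commute)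
    have kd: "norm (k (x + s *\<^sub>R v + t *\<^sub>R w) - k (x + s *\<^sub>R v) - t *\<^sub>R FD k x w) \<le> e * t"
      if s: "s \<in> {0..t}" for s
    proof -
      have "norm (k (x + s *\<^sub>R v + t *\<^sub>R w) - k (x + s *\<^sub>R v + 0 *\<^sub>R w) - t *\<^sub>R FD k x w) \<le> e * t"
      proof (rule linear_approx_bound[of t "\<lambda>r. k (x + s *\<^sub>R v + r *\<^sub>R w)"])
        fix r assume r: "r \<in> {0..t}"
        show "((\<lambda>r. k (x + s *\<^sub>R v + r *\<^sub>R w)) has_vector_derivative FD k (x + s *\<^sub>R v + r *\<^sub>R w) w) (at r within {0..t})"
          by (rule FD_line, rule smooth_on_differentiable[OF k], rule inS) (use s r in auto)
        show "norm (FD k (x + s *\<^sub>R v + r *\<^sub>R w) w - FD k x w) \<le> e"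
          using d1(2)[of "x + s *\<^sub>R v + r *\<^sub>R w"] near[of s t r] s r t by (simp add: dist_norm)
      qed (use t in auto)
      then show ?thesis by simp
    qed
    let ?h = "\<lambda>s. f (x + t *\<^sub>R w + s *\<^sub>R v) - f (x + s *\<^sub>R v)"
    have "norm (?h t - ?h 0 - t *\<^sub>R (t *\<^sub>R FD k x w)) \<le> (e * t) * t"
    proof (rule linear_approx_bound)
      fix s assume s: "s \<in> {0..t}"
      have i1: "x + t *\<^sub>R w + s *\<^sub>R v \<in> S" "x + s *\<^sub>R v \<in> S"
        using inS[of s t] inS[of s 0] s t by (auto simp: algebra_simps)
      show "(?h has_vector_derivative (k (x + t *\<^sub>R w + s *\<^sub>R v) - k (x + s *\<^sub>R v))) (at s within {0..t})"
        unfolding k_def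
        by (intro has_vector_derivative_diff FD_line smooth_on_differentiable[OF f] i1)
      show "norm (k (x + t *\<^sub>R w + s *\<^sub>R v) - k (x + s *\<^sub>R v) - t *\<^sub>R FD k x w) \<le> e * t"
        using kd[OF s] by (simp add: algebra_simps)
    qed (use t in auto)
    then show ?thesis by (simp add: algebra_simps)
  qed
  then show ?thesis using d unfolding k_def by blast
qed

lemma FD_commute:
  fixes f :: "'a::real_normed_vector \<Rightarrow> 'b::real_normed_vector"
  assumes "open S" "smooth_on f S" "x \<in> S"
  shows "FD (\<lambda>y. FD f y v) x w = FD (\<lambda>y. FD f y w) x v"
proof (rule ccontr)
  let ?a = "FD (\<lambda>y. FD f y v) x w" and ?b = "FD (\<lambda>y. FD f y w) x v"
  assume "?a \<noteq> ?b"
  \<comment> \<open>The two approximation errors add up to 2 e (t * t), less than the gap 3 e (t *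
    t).\<close>
  define e where "e = norm (?a - ?b) / 3"
  have e: "e > 0" using \<open>?a \<noteq> ?b\<close> by (simp add: e_def)
  let ?D = "\<lambda>t. f (x + t *\<^sub>R v + t *\<^sub>R w) - f (x + t *\<^sub>R v) - f (x + t *\<^sub>R w) + f x"
  obtain d1 where d1: "d1 > 0" "\<And>t. 0 < t \<Longrightarrow> t < d1 \<Longrightarrow> norm (?D t - (t * t) *\<^sub>R ?a) \<le> e * (t * t)"
    using second_difference_bound[OF assms e, of v w] by blast
  obtain d2 where d2: "d2 > 0" "\<And>t. 0 < t \<Longrightarrow> t < d2 \<Longrightarrow>
      norm (f (x + t *\<^sub>R w + t *\<^sub>R v) - f (x + t *\<^sub>R w) - f (x + t *\<^sub>R v) + f x - (t * t) *\<^sub>R ?b) \<le> e * (t * t)"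
    using second_difference_bound[OF assms e, of w v] by blast
  define t where "t = min d1 d2 / 2"
  have t: "0 < t" "t < d1" "t < d2" using d1(1) d2(1) by (auto simp: t_def)
  have 2: "norm (?D t - (t * t) *\<^sub>R ?b) \<le> e * (t * t)"
    using d2(2)[OF t(1,3)] by (simp add: algebra_simps)
  have "(t * t) *\<^sub>R (?a - ?b) = (?D t - (t * t) *\<^sub>R ?b) - (?D t - (t * t) *\<^sub>R ?a)"
    by (simp add: algebra_simps)
  then have "norm ((t * t) *\<^sub>R (?a - ?b)) \<le> e * (t * t) + e * (t * t)"
    using norm_triangle_ineq4[of "?D t - (t * t) *\<^sub>R ?b" "?D t - (t * t) *\<^sub>R ?a"] 2 d1(2)[OF t(1,2)] by simp
  moreover have "e * (t * t) + e * (t * t) = (t * t) * (2 * e)" by algebra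
  ultimately have "(t * t) * norm (?a - ?b) \<le> (t * t) * (2 * e)" by simp
  then have "norm (?a - ?b) \<le> 2 * e" using t by (simp only: mult_le_cancel_left_pos mult_pos_pos)
  then show False using e unfolding e_def by simp
qed

lemma FD_add': "f differentiable (at x) \<Longrightarrow> h differentiable (at x) \<Longrightarrow> FD (\<lambda>x. f x + h x) x v = FD f x v + FD h x v"
  using FD_eqI[OF has_derivative_add[OF FD_works FD_works], of f x h] by simp

lemma FD_cmult:
  fixes f :: "'a::real_normed_vector \<Rightarrow> 'b::real_normed_algebra"
  shows "f differentiable (at x) \<Longrightarrow> FD (\<lambda>x. c * f x) x v = c * FD f x v"
  using FD_eqI[OF bounded_linear.has_derivative[OF bounded_linear_mult_right FD_works], of f x c] by simp

lemma
  assumes S: "open S" and f: "smooth_on f S" and x: "x \<in> S"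
  shows dz_commute: "dz i (dz j f) x = dz j (dz i f) x"
    and dz_dzbar_commute: "dz i (dzbar j f) x = dzbar j (dz i f) x"
proof -
  have d: "(\<lambda>x. FD f x v) differentiable (at x)" for v
    using smooth_on_differentiable[OF smooth_on_FD[OF f] x] .
  have 1: "FD (dz j f) x v = (FD (\<lambda>y. FD f y (axis j 1)) x v - \<i> * FD (\<lambda>y. FD f y (axis j \<i>)) x v) / 2" for j v
  proof -
    have "dz j f = (\<lambda>y. (1/2) * FD f y (axis j 1) + (- \<i> / 2) * FD f y (axis j \<i>))"
      by (auto simp: dz_def fun_eq_iff field_simps)
    then show ?thesis
      by (simp only: FD_add'[OF differentiable_mult[OF differentiable_const d] differentiable_mult[OF differentiable_const d]] FD_cmult[OF d])
         (simp add: field_simps)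
  qed
  have 2: "FD (dzbar j f) x v = (FD (\<lambda>y. FD f y (axis j 1)) x v + \<i> * FD (\<lambda>y. FD f y (axis j \<i>)) x v) / 2" for j v
  proof -
    have "dzbar j f = (\<lambda>y. (1/2) * FD f y (axis j 1) + (\<i> / 2) * FD f y (axis j \<i>))"
      by (auto simp: dzbar_def fun_eq_iff field_simps)
    then show ?thesis
      by (simp only: FD_add'[OF differentiable_mult[OF differentiable_const d] differentiable_mult[OF differentiable_const d]] FD_cmult[OF d])
         (simp add: field_simps)
  qed
  note c = FD_commute[OF S f x]
  show "dz i (dz j f) x = dz j (dz i f) x"
    unfolding dz_def[of _ "dz _ _"] 1 by (simp add: c[of "axis i _" "axis j _"] field_simps)
  show "dz i (dzbar j f) x = dzbar j (dz i f) x"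
    unfolding dz_def[of _ "dzbar _ _"] dzbar_def[of _ "dz _ _"] 1 2
    by (simp add: c[of "axis i _" "axis j _"] field_simps)
qed

lemma dz_cong: "open S \<Longrightarrow> x \<in> S \<Longrightarrow> (\<And>y. y \<in> S \<Longrightarrow> f y = h y) \<Longrightarrow> dz i f x = dz i h x"
  unfolding dz_def using FD_cong[of S x f h] by simp

lemma dzbar_cong: "open S \<Longrightarrow> x \<in> S \<Longrightarrow> (\<And>y. y \<in> S \<Longrightarrow> f y = h y) \<Longrightarrow> dzbar i f x = dzbar i h x"
  unfolding dzbar_def using FD_cong[of S x f h] by simp

lemma
  assumes f: "f differentiable (at x)" and h: "h differentiable (at x)"
  shows dz_add: "dz i (\<lambda>x. f x + h x) x = dz i f x + dz i h x"
    and dzbar_add: "dzbar i (\<lambda>x. f x + h x) x = dzbar i f x + dzbar i h x"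
    and dz_diff: "dz i (\<lambda>x. f x - h x) x = dz i f x - dz i h x"
    and dz_mult: "dz i (\<lambda>x. f x * h x) x = f x * dz i h x + dz i f x * h x"
    and dzbar_mult: "dzbar i (\<lambda>x. f x * h x) x = f x * dzbar i h x + dzbar i f x * h x"
  unfolding dz_def dzbar_def 
    FD_eqI[OF has_derivative_add[OF FD_works[OF f] FD_works[OF h]]]
    FD_eqI[OF has_derivative_diff[OF FD_works[OF f] FD_works[OF h]]]
    FD_eqI[OF has_derivative_mult[OF FD_works[OF f] FD_works[OF h]]]
  by (simp_all add: field_simps)

lemma
  assumes f: "f differentiable (at x)"
  shows dz_cmult: "dz i (\<lambda>x. c * f x) x = c * dz i f x"
    and dzbar_cmult: "dzbar i (\<lambda>x. c * f x) x = c * dzbar i f x"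
    and dz_cnj: "dz i (\<lambda>x. cnj (f x)) x = cnj (dzbar i f x)"
    and dzbar_cnj: "dzbar i (\<lambda>x. cnj (f x)) x = cnj (dz i f x)"
  unfolding dz_def dzbar_def FD_cmult[OF f]
    FD_eqI[OF bounded_linear.has_derivative[OF bounded_linear_cnj FD_works[OF f]]]
  by (simp_all add: field_simps)

lemma dz_const: "dz i (\<lambda>_. c) x = 0" and dzbar_const: "dzbar i (\<lambda>_. c) x = 0"
  by (simp_all add: dz_def dzbar_def FD_const)

lemma
  assumes "\<And>k. k \<in> I \<Longrightarrow> f k differentiable (at x)"
  shows dz_sum: "dz i (\<lambda>x. \<Sum>k\<in>I. f k x) x = (\<Sum>k\<in>I. dz i (f k) x)"
    and dzbar_sum: "dzbar i (\<lambda>x. \<Sum>k\<in>I. f k x) x = (\<Sum>k\<in>I. dzbar i (f k) x)"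
proof -
  have "FD (\<lambda>x. \<Sum>k\<in>I. f k x) x = (\<lambda>v. \<Sum>k\<in>I. FD (f k) x v)"
    by (rule FD_eqI, rule has_derivative_sum, rule FD_works, rule assms)
  then show "dz i (\<lambda>x. \<Sum>k\<in>I. f k x) x = (\<Sum>k\<in>I. dz i (f k) x)"
    "dzbar i (\<lambda>x. \<Sum>k\<in>I. f k x) x = (\<Sum>k\<in>I. dzbar i (f k) x)"
    by (simp_all add: dz_def dzbar_def sum_distrib_left flip: sum_divide_distrib sum_subtractf sum.distrib)
qed

lemma dz_nth: "dz i (\<lambda>x. x $ k) x = (if i = k then 1 else 0)"
  using holo_on_dz[OF holo_on_nth, of x UNIV i k]
    FD_eqI[OF bounded_linear_imp_has_derivative[OF bounded_linear_vec_nth], of k x]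
  by (simp add: axis_def)

section \<open>The complex Jacobian\<close>

definition cjac :: "(complex^'n \<Rightarrow> complex^'m) \<Rightarrow> complex^'n \<Rightarrow> complex^'n \<Rightarrow> complex^'m" where
  "cjac F x v = (\<chi> k. \<Sum>i\<in>UNIV. v $ i * dz i (\<lambda>x. F x $ k) x)"

lemma cjac_nth: "cjac F x v $ k = (\<Sum>i\<in>UNIV. v $ i * dz i (\<lambda>x. F x $ k) x)"
  by (simp add: cjac_def)

text \<open>\<open>cjac\<close> is built from \<open>dz\<close> alone and is complex linear for
  every F; holomorphy is what makes it the whole derivative.\<close>

lemma cjac_derivative:
  "holomorphic_vec_on F S \<Longrightarrow> x \<in> S \<Longrightarrow> (F has_derivative cjac F x) (at x)"
  using holomorphic_vec_on_has_derivative unfolding cjac_def[abs_def] .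

lemma cjac_smult: "cjac F x (a *s v) = a *s cjac F x v"
  by (simp add: vec_eq_iff cjac_def sum_distrib_left mult.assoc)

lemma cjac_compose:
  assumes "holomorphic_vec_on G T" "holomorphic_vec_on F S" "F ` S \<subseteq> T" "x \<in> S"
  shows "cjac (\<lambda>x. G (F x)) x v = cjac G (F x) (cjac F x v)"
proof -
  have "((\<lambda>x. G (F x)) has_derivative (\<lambda>v. cjac G (F x) (cjac F x v))) (at x)"
    using has_derivative_compose[OF cjac_derivative[OF assms(2,4)] cjac_derivative[OF assms(1)]] assms by blast
  moreover have "((\<lambda>x. G (F x)) has_derivative cjac (\<lambda>x. G (F x)) x) (at x)"
    using cjac_derivative[OF holomorphic_vec_on_compose[OF assms(1-3)] assms(4)] .
  ultimately show ?thesis using has_derivative_unique by metis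
qed

lemma cjac_cong:
  assumes "open S" "x \<in> S" "\<And>y. y \<in> S \<Longrightarrow> F y = H y"
  shows "cjac F x = cjac H x"
proof -
  have "dz i (\<lambda>x. F x $ k) x = dz i (\<lambda>x. H x $ k) x" for i k
    by (rule dz_cong[OF assms(1,2)]) (simp add: assms(3))
  then show ?thesis by (simp add: cjac_def fun_eq_iff)
qed

lemma cjac_id: "cjac (\<lambda>x. x) x v = v"
  by (simp add: cjac_def vec_eq_iff dz_nth if_distrib cong: if_cong)

lemma cjac_bound:
  fixes F :: "complex^'n \<Rightarrow> complex^'m"
  shows "norm (cjac F x v) \<le> (\<Sum>k\<in>UNIV. \<Sum>i\<in>UNIV. norm (dz i (\<lambda>x. F x $ k) x)) * norm v"
proof -
  have "norm (cjac F x v) \<le> (\<Sum>k\<in>UNIV. norm (cjac F x v $ k))"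
    unfolding norm_vec_def by (rule L2_set_le_sum) simp
  also have "\<dots> \<le> (\<Sum>k\<in>UNIV. \<Sum>i\<in>UNIV. norm (dz i (\<lambda>x. F x $ k) x) * norm v)"
  proof (rule sum_mono)
    fix k
    have "norm (cjac F x v $ k) \<le> (\<Sum>i\<in>UNIV. norm (v $ i * dz i (\<lambda>x. F x $ k) x))"
      unfolding cjac_nth by (rule norm_sum)
    also have "\<dots> \<le> (\<Sum>i\<in>UNIV. norm (dz i (\<lambda>x. F x $ k) x) * norm v)"
    proof (rule sum_mono)
      fix i
      show "norm (v $ i * dz i (\<lambda>x. F x $ k) x) \<le> norm (dz i (\<lambda>x. F x $ k) x) * norm v"
        using mult_right_mono[OF Finite_Cartesian_Product.norm_nth_le[of v i] norm_ge_zero[of "dz i (\<lambda>x. F x $ k) x"]]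
        by (simp add: norm_mult mult.commute)
    qed
    finally show "norm (cjac F x v $ k) \<le> (\<Sum>i\<in>UNIV. norm (dz i (\<lambda>x. F x $ k) x) * norm v)" .
  qed
  finally show ?thesis by (simp add: sum_distrib_right)
qed

lemma continuous_on_dz: "open S \<Longrightarrow> holomorphic_vec_on F S \<Longrightarrow> continuous_on S (dz i (\<lambda>x. F x $ k))"
  using holo_on_continuous[OF holo_on_dz_holo[OF _ holomorphic_vec_on_nth]] .

lemma cjac_bounded_on_compact:
  fixes F :: "complex^'n \<Rightarrow> complex^'m"
  assumes "open S" "holomorphic_vec_on F S" "compact C" "C \<subseteq> S"
  obtains K where "K > 0" "\<And>x v. x \<in> C \<Longrightarrow> norm (cjac F x v) \<le> K * norm v"
proof -
  let ?b = "\<lambda>x. \<Sum>k\<in>UNIV. \<Sum>i\<in>UNIV. norm (dz i (\<lambda>x. F x $ k) x)"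
  have "continuous_on C ?b"
    by (intro continuous_intros continuous_on_subset[OF continuous_on_dz[OF assms(1,2)] assms(4)])
  then have "bounded (?b ` C)"
    using compact_continuous_image[OF _ assms(3)] compact_imp_bounded by blast
  then obtain K where K: "K > 0" "\<And>x. x \<in> C \<Longrightarrow> norm (?b x) \<le> K"
    unfolding bounded_pos by blast
  have "norm (cjac F x v) \<le> K * norm v" if "x \<in> C" for x v
  proof -
    have "?b x \<le> K" using K(2)[OF that] by (simp add: abs_le_iff)
    then show ?thesis using cjac_bound[of F x v] mult_right_mono[OF _ norm_ge_zero[of v]] by (meson order_trans)
  qed
  then show ?thesis using K(1) that by blast
qed

lemma holomorphic_vec_on_Lipschitz:
  fixes F :: "complex^'n \<Rightarrow> complex^'m"
  assumes "open S" "holomorphic_vec_on F S" "cball x r \<subseteq> S"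
  obtains K where "K > 0" "\<And>y z. y \<in> cball x r \<Longrightarrow> z \<in> cball x r \<Longrightarrow> norm (F y - F z) \<le> K * norm (y - z)"
proof -
  obtain K where K: "K > 0" "\<And>y v. y \<in> cball x r \<Longrightarrow> norm (cjac F y v) \<le> K * norm v"
    using cjac_bounded_on_compact[OF assms(1,2) compact_cball assms(3)] by blast
  have "norm (F y - F z) \<le> K * norm (y - z)" if "y \<in> cball x r" "z \<in> cball x r" for y z
  proof (rule differentiable_bound[of "cball x r" F "cjac F"])
    show "(F has_derivative cjac F w) (at w within cball x r)" if "w \<in> cball x r" for w
      using has_derivative_at_withinI[OF cjac_derivative[OF assms(2)]] that assms(3) by blast
    show "onorm (cjac F w) \<le> K" if "w \<in> cball x r" for w
      using onorm_le[OF K(2)[OF that]] .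
  qed (use that in auto)
  then show ?thesis using K(1) that by blast
qed

text \<open>The square of the norm is differentiable also at zeros of f. Since 2 n (K n + e) <= (2 K
  + 1) n^2 + e^2 for n = norm (f t), the function \<open>w\<close> below has non-positive
  derivative. The error term e serves to compare an orbit with its linearization.\<close>

lemma Gronwall_sq:
  fixes f :: "real \<Rightarrow> 'a::real_inner"
  assumes der: "\<And>t. t \<in> {0..T} \<Longrightarrow> (f has_vector_derivative f' t) (at t within {0..T})"
    and bound: "\<And>t. t \<in> {0..T} \<Longrightarrow> norm (f' t) \<le> K * norm (f t) + e"
    and "t \<in> {0..T}" "K \<ge> 0" 
  shows "(norm (f t))\<^sup>2 \<le> exp ((2 * K + 1) * t) * ((norm (f 0))\<^sup>2 + e\<^sup>2 * t)"
proof -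
  define L where "L = 2 * K + 1"
  have L: "L > 0" using assms(4) by (simp add: L_def)
  define w where "w = (\<lambda>t. exp (- L * t) * (f t \<bullet> f t) - e\<^sup>2 * t)"
  have cont: "continuous_on {0..T} f"
    using der has_vector_derivative_continuous continuous_on_eq_continuous_within by blast
  have "w t \<le> w 0"
  proof (rule DERIV_nonpos_imp_decreasing_open[where f = w and a = 0 and b = t])
    show "0 \<le> t" using assms(3) by simp
    show "continuous_on {0..t} w"
      unfolding w_def by (intro continuous_intros continuous_on_subset[OF cont]) (use assms(3) in auto)
    fix s assume s: "0 < s" "s < t"
    then have sT: "s \<in> {0<..<T}" "s \<in> {0..T}" using assms(3) by auto
    have d: "(f has_derivative (\<lambda>h. h *\<^sub>R f' s)) (at s)"
      using der[OF sT(2)] at_within_interior[of s "{0..T}"] sT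
      by (simp add: has_vector_derivative_def)
    have dw: "(w has_real_derivative (exp (- L * s) * (2 * (f s \<bullet> f' s)) - L * exp (- L * s) * (f s \<bullet> f s) - e\<^sup>2)) (at s)"
      unfolding w_def has_field_derivative_def
      by (rule derivative_eq_intros d refl | simp add: fun_eq_iff)+ (simp add: inner_commute algebra_simps)
    have "2 * (f s \<bullet> f' s) \<le> 2 * (norm (f s) * norm (f' s))"
      using norm_cauchy_schwarz[of "f s" "f' s"] by simp
    also have "\<dots> \<le> 2 * (norm (f s) * (K * norm (f s) + e))"
      using bound[OF sT(2)] by (intro mult_left_mono) auto
    also have "\<dots> \<le> L * (f s \<bullet> f s) + e\<^sup>2"
      using sum_squares_bound[of "norm (f s)" e] by (simp add: L_def algebra_simps power2_eq_square flip: power2_norm_eq_inner)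
    finally have "exp (- L * s) * (2 * (f s \<bullet> f' s)) \<le> exp (- L * s) * (L * (f s \<bullet> f s) + e\<^sup>2)"
      by (intro mult_left_mono) auto
    moreover have "exp (- L * s) * e\<^sup>2 \<le> 1 * e\<^sup>2"
      using L s by (intro mult_right_mono) auto
    ultimately show "\<exists>y. (w has_real_derivative y) (at s) \<and> y \<le> 0"
      using dw by (intro exI conjI) (auto simp: algebra_simps)
  qed
  then have "exp (- L * t) * (norm (f t))\<^sup>2 \<le> (norm (f 0))\<^sup>2 + e\<^sup>2 * t"
    by (simp add: w_def power2_norm_eq_inner)
  then have "inverse (exp (L * t)) * (norm (f t))\<^sup>2 \<le> (norm (f 0))\<^sup>2 + e\<^sup>2 * t"
    by (simp add: exp_minus)
  then show ?thesis unfolding L_def by (simp add: field_simps)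
qed

section \<open>Charts\<close>

locale cmanifold =
  fixes X :: "'a topology" and A :: "('a, 'n::finite) chart set"
  assumes mfd: "complex_manifold X A"
begin

lemma Hausdorff: "Hausdorff_space X" using mfd by (simp add: complex_manifold_def)

lemma cover: "p \<in> topspace X \<Longrightarrow> \<exists>c\<in>A. p \<in> cdom c"
  using mfd by (auto simp: complex_manifold_def)

lemma cdom_open: "c \<in> A \<Longrightarrow> openin X (cdom c)"
  using mfd by (simp add: complex_manifold_def)

lemma cdom_subset: "c \<in> A \<Longrightarrow> cdom c \<subseteq> topspace X"
  using cdom_open openin_subset by blast

lemma range_open: "c \<in> A \<Longrightarrow> open (coord_range c)"
  using mfd by (simp add: complex_manifold_def)

lemma coord_homeo:
  assumes "c \<in> A"
  shows "homeomorphic_maps (subtopology X (cdom c)) (top_of_set (coord_range c)) (coord c) (coord_inv c)"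
proof -
  have h: "homeomorphic_map (subtopology X (cdom c)) (top_of_set (coord_range c)) (coord c)"
    using mfd assms by (simp add: complex_manifold_def)
  have top: "topspace (subtopology X (cdom c)) = cdom c"
    using cdom_subset[OF assms] by auto
  obtain k where k: "homeomorphic_maps (subtopology X (cdom c)) (top_of_set (coord_range c)) (coord c) k"
    using h unfolding homeomorphic_map_maps by blast
  have inj: "inj_on (coord c) (cdom c)"
    using homeomorphic_imp_injective_map[OF h] top by simp
  have "k y = coord_inv c y" if "y \<in> coord_range c" for y
  proof -
    have "y = coord c (k y)" "k y \<in> cdom c"
      using k that top unfolding homeomorphic_maps_def continuous_map_def by auto
    then show ?thesis using inv_into_f_f[OF inj] unfolding coord_inv_def by metis
  qed
  then show ?thesis using homeomorphic_maps_eq[OF k] by auto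
qed

lemma coord_inv_coord: "c \<in> A \<Longrightarrow> p \<in> cdom c \<Longrightarrow> coord_inv c (coord c p) = p"
  using coord_homeo[of c] cdom_subset[of c] by (auto simp: homeomorphic_maps_def)

lemma coord_coord_inv: "c \<in> A \<Longrightarrow> x \<in> coord_range c \<Longrightarrow> coord c (coord_inv c x) = x"
  using coord_homeo[of c] by (auto simp: homeomorphic_maps_def)

lemma coord_in_range: "p \<in> cdom c \<Longrightarrow> coord c p \<in> coord_range c"
  by (auto simp: coord_range_def)

lemma coord_inv_in_cdom: "x \<in> coord_range c \<Longrightarrow> coord_inv c x \<in> cdom c"
  by (auto simp: coord_range_def coord_inv_def intro: inv_into_into)

lemma coord_continuous: "c \<in> A \<Longrightarrow> continuous_map (subtopology X (cdom c)) euclidean (coord c)"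
  using coord_homeo[of c] continuous_map_into_fulltopology by (auto simp: homeomorphic_maps_def)

lemma coord_inv_continuous: "c \<in> A \<Longrightarrow> continuous_map (top_of_set (coord_range c)) X (coord_inv c)"
  using coord_homeo[of c] continuous_map_into_fulltopology by (auto simp: homeomorphic_maps_def)

lemma coord_preimage_open:
  assumes "c \<in> A" "open U"
  shows "openin X {p \<in> cdom c. coord c p \<in> U}"
proof -
  have "openin (subtopology X (cdom c)) {p \<in> topspace (subtopology X (cdom c)). coord c p \<in> U}"
    using coord_continuous[OF assms(1)] assms(2) by (auto simp: continuous_map_def)
  then have *: "openin X {p \<in> topspace (subtopology X (cdom c)). coord c p \<in> U}"
    using openin_trans_full cdom_open[OF assms(1)] by blast
  have "topspace (subtopology X (cdom c)) = cdom c"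
    using cdom_subset[OF assms(1)] by auto
  then show ?thesis using * by (simp only:)
qed

lemma coord_image_open:
  assumes "c \<in> A" "openin X W"
  shows "open (coord c ` (cdom c \<inter> W))"
proof -
  have "coord c ` (cdom c \<inter> W) = {x \<in> coord_range c. coord_inv c x \<in> W}"
  proof (intro equalityI subsetI)
    fix x assume "x \<in> coord c ` (cdom c \<inter> W)"
    then obtain p where "p \<in> cdom c" "p \<in> W" "x = coord c p" by blast
    then show "x \<in> {x \<in> coord_range c. coord_inv c x \<in> W}"
      using coord_inv_coord[OF assms(1), of p] coord_in_range[of p c] by simp
  next
    fix x assume "x \<in> {x \<in> coord_range c. coord_inv c x \<in> W}"
    then have "coord_inv c x \<in> cdom c \<inter> W" "x = coord c (coord_inv c x)"
      using coord_coord_inv[OF assms(1), of x] coord_inv_in_cdom[of x c] by simp_all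
    then show "x \<in> coord c ` (cdom c \<inter> W)" by (metis imageI)
  qed
  moreover have "openin (top_of_set (coord_range c)) {x \<in> coord_range c. coord_inv c x \<in> W}"
    using coord_inv_continuous[OF assms(1)] assms(2) by (auto simp: continuous_map_def)
  ultimately show ?thesis
    using openin_open_trans range_open[OF assms(1)] by metis
qed

text \<open>Compact sets are closed in a Hausdorff space, even though the chart domain itself need
  not be closed. This prevents a curve from leaving the chart while its coordinates stay in a
  compact set.\<close>

lemma coord_compact_closed:
  assumes "c \<in> A" "compact C" "C \<subseteq> coord_range c"
  shows "closedin X {p \<in> cdom c. coord c p \<in> C}"
proof -
  have "compactin (top_of_set (coord_range c)) C"
    using assms by (simp add: compactin_subtopology)
  then have "compactin X (coord_inv c ` C)"
    using image_compactin coord_inv_continuous[OF assms(1)] by blast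
  moreover have "coord_inv c ` C = {p \<in> cdom c. coord c p \<in> C}"
  proof (intro equalityI subsetI)
    fix p assume "p \<in> coord_inv c ` C"
    then obtain x where "x \<in> C" "p = coord_inv c x" by blast
    then show "p \<in> {p \<in> cdom c. coord c p \<in> C}"
      using subsetD[OF assms(3)] coord_coord_inv[OF assms(1), of x] coord_inv_in_cdom[of x c] by simp
  next
    fix p assume "p \<in> {p \<in> cdom c. coord c p \<in> C}"
    then have "p = coord_inv c (coord c p)" "coord c p \<in> C"
      using coord_inv_coord[OF assms(1), of p] by simp_all
    then show "p \<in> coord_inv c ` C" by (metis imageI)
  qed
  ultimately show ?thesis using compactin_imp_closedin[OF Hausdorff] by simp
qed

lemma curve_preimage_open:
  assumes "continuous_map (top_of_set I) X \<gamma>" "openin X W"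
  shows "openin (top_of_set I) {t \<in> I. \<gamma> t \<in> W}"
  using assms by (auto simp: continuous_map_def)

lemma curve_preimage_closed:
  assumes "continuous_map (top_of_set I) X \<gamma>" "closedin X W"
  shows "closedin (top_of_set I) {t \<in> I. \<gamma> t \<in> W}"
  using closedin_continuous_map_preimage[OF assms] by simp

lemma curve_coord_continuous:
  assumes "continuous_map (top_of_set I) X \<gamma>" "c \<in> A"
  shows "continuous_on {t \<in> I. \<gamma> t \<in> cdom c} (\<lambda>t. coord c (\<gamma> t))"
proof -
  let ?J = "{t \<in> I. \<gamma> t \<in> cdom c}"
  have "continuous_map (top_of_set ?J) (subtopology X (cdom c)) \<gamma>"
    unfolding continuous_map_in_subtopology
    using continuous_map_from_subtopology_mono[OF assms(1), of ?J] by auto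
  then have "continuous_map (top_of_set ?J) euclidean (coord c \<circ> \<gamma>)"
    using continuous_map_compose coord_continuous[OF assms(2)] by blast
  then show ?thesis by (simp add: o_def)
qed

text \<open>The times outside the open ball form a compact set, and \<tau> is its least element.
  Before \<tau> the curve is in the closed ball, which is closed in X by
  \<open>coord_compact_closed\<close>, so at \<tau> the curve is still in the chart and lies on the
  sphere.\<close>

lemma first_exit:
  fixes T :: real
  assumes "c \<in> A" "cball z R \<subseteq> coord_range c" "continuous_map (top_of_set {0..T}) X \<gamma>"
    and "0 \<le> T" "\<gamma> 0 \<in> cdom c" "dist z (coord c (\<gamma> 0)) < R"
    and "\<exists>t\<in>{0..T}. \<not> (\<gamma> t \<in> cdom c \<and> dist z (coord c (\<gamma> t)) < R)"
  obtains \<tau> where "0 < \<tau>" "\<tau> \<le> T" "\<gamma> \<tau> \<in> cdom c" "dist z (coord c (\<gamma> \<tau>)) = R"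
    "\<And>t. 0 \<le> t \<Longrightarrow> t < \<tau> \<Longrightarrow> \<gamma> t \<in> cdom c \<and> dist z (coord c (\<gamma> t)) < R"
proof -
  let ?N = "{p \<in> cdom c. coord c p \<in> ball z R}"
  define K where "K = {0..T} - {t \<in> {0..T}. \<gamma> t \<in> ?N}"
  have "closedin (top_of_set {0..T}) K"
    unfolding K_def
    using curve_preimage_open[OF assms(3) coord_preimage_open[OF assms(1) open_ball]] 
    by (intro closedin_diff) auto
  then have "closed K" using closedin_closed_trans closed_atLeastAtMost by blast
  then have "compact ({0..T} \<inter> K)" by (rule compact_Int_closed[OF compact_Icc])
  moreover have "{0..T} \<inter> K = K" by (auto simp: K_def)
  ultimately have "compact K" by simp
  moreover have "K \<noteq> {}" using assms(7) by (auto simp: K_def)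
  ultimately have "\<exists>\<tau>\<in>K. \<forall>t\<in>K. \<tau> \<le> t" by (rule compact_attains_inf)
  then obtain \<tau> where \<tau>: "\<tau> \<in> K" "\<And>t. t \<in> K \<Longrightarrow> \<tau> \<le> t" by blast
  have "0 \<notin> K" using assms(4-6) by (auto simp: K_def)
  then have \<tau>0: "0 < \<tau>" "\<tau> \<le> T" using \<tau>(1) by (auto simp: K_def order_less_le)
  have before: "\<gamma> t \<in> ?N" if "0 \<le> t" "t < \<tau>" for t
    using \<tau>(2)[of t] that \<tau>0 by (auto simp: K_def)
  let ?C = "{p \<in> cdom c. coord c p \<in> cball z R}"
  have "closedin (top_of_set {0..T}) {t \<in> {0..T}. \<gamma> t \<in> ?C}"
    by (rule curve_preimage_closed[OF assms(3) coord_compact_closed[OF assms(1) compact_cball assms(2)]])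
  then have cl: "closed {t \<in> {0..T}. \<gamma> t \<in> ?C}"
    using closedin_closed_trans closed_atLeastAtMost by blast
  have "{0..<\<tau>} \<subseteq> {t \<in> {0..T}. \<gamma> t \<in> ?C}" using before \<tau>0 by force
  then have "closure {0..<\<tau>} \<subseteq> {t \<in> {0..T}. \<gamma> t \<in> ?C}" using closure_minimal[OF _ cl] by blast
  moreover have "\<tau> \<in> closure {0..<\<tau>}" using \<tau>0 by (simp add: closure_atLeastLessThan)
  ultimately have "\<gamma> \<tau> \<in> ?C" by blast
  moreover have "\<gamma> \<tau> \<notin> ?N" using \<tau>(1) by (auto simp: K_def)
  ultimately show ?thesis using that[of \<tau>] \<tau>0 before by auto
qed

lemma holomorphic_map_local_expr:
  assumes "holomorphic_map X A X A F" "c \<in> A" "c' \<in> A"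
  shows "open (coord c ` {p \<in> cdom c. F p \<in> cdom c'})"
    and "holomorphic_vec_on (local_expr c c' F) (coord c ` {p \<in> cdom c. F p \<in> cdom c'})"
proof -
  have "openin X {p \<in> topspace X. F p \<in> cdom c'}"
    using assms(1) cdom_open[OF assms(3)] by (auto simp: holomorphic_map_def continuous_map_def)
  from coord_image_open[OF assms(2) this]
  show "open (coord c ` {p \<in> cdom c. F p \<in> cdom c'})"
    using cdom_subset[OF assms(2)] by (simp add: Int_def subset_iff cong: conj_cong)
  show "holomorphic_vec_on (local_expr c c' F) (coord c ` {p \<in> cdom c. F p \<in> cdom c'})"
    using assms by (auto simp: holomorphic_map_def)
qed

lemma local_expr_coord: "c \<in> A \<Longrightarrow> p \<in> cdom c \<Longrightarrow> local_expr c c' F (coord c p) = coord c' (F p)"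
  by (simp add: local_expr_def coord_inv_coord)

lemma holomorphic_map_id: "holomorphic_map X A X A id"
  using mfd by (auto simp: holomorphic_map_def complex_manifold_def Int_def)

section \<open>Integral curves and their uniqueness\<close>

definition flow_line :: "('a, 'n) vfield \<Rightarrow> (real \<Rightarrow> 'a) \<Rightarrow> bool" where
  "flow_line V \<gamma> \<longleftrightarrow> continuous_map (top_of_set {0..}) X \<gamma> \<and>
     (\<forall>t\<ge>0. \<forall>c\<in>A. \<gamma> t \<in> cdom c \<longrightarrow>
       ((\<lambda>s. coord c (\<gamma> s)) has_vector_derivative V c (coord c (\<gamma> t))) (at t within {0..}))"

lemma flow_line_shift:
  assumes "flow_line V \<gamma>" "s \<ge> 0"
  shows "flow_line V (\<lambda>t. \<gamma> (t + s))"
  unfolding flow_line_def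
proof (intro conjI allI impI ballI)
  have "continuous_map (top_of_set {0..}) (top_of_set {0..}) (\<lambda>t. t + s)"
    using assms(2) by (auto simp: continuous_map_in_subtopology intro!: continuous_intros)
  from continuous_map_compose[OF this, of X \<gamma>] show "continuous_map (top_of_set {0..}) X (\<lambda>t. \<gamma> (t + s))"
    using assms(1) by (simp add: flow_line_def o_def)
  fix t c assume t: "0 \<le> t" and c: "c \<in> A" and in_c: "\<gamma> (t + s) \<in> cdom c"
  have 1: "((\<lambda>s. coord c (\<gamma> s)) has_vector_derivative V c (coord c (\<gamma> (t + s)))) (at (t + s) within {0..})"
    using assms t c in_c by (auto simp: flow_line_def)
  have "(\<lambda>a. a + s) ` {0..} \<subseteq> {0..}" using assms(2) by auto
  from has_vector_derivative_within_subset[OF 1 this]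
  have "(((\<lambda>s. coord c (\<gamma> s)) \<circ> (\<lambda>t. t + s)) has_vector_derivative 1 *\<^sub>R V c (coord c (\<gamma> (t + s)))) (at t within {0..})"
    by (intro vector_diff_chain_within) (auto intro!: derivative_eq_intros)
  then show "((\<lambda>t. coord c (\<gamma> (t + s))) has_vector_derivative V c (coord c (\<gamma> (t + s)))) (at t within {0..})"
    by (simp add: o_def)
qed

lemma flow_line_near:
  assumes "flow_line V \<gamma>" "c \<in> A" "t \<ge> 0" "\<gamma> t \<in> cdom c" "open U" "coord c (\<gamma> t) \<in> U"
  obtains d where "d > 0" "\<And>s. 0 \<le> s \<Longrightarrow> \<bar>s - t\<bar> \<le> d \<Longrightarrow> \<gamma> s \<in> cdom c \<and> coord c (\<gamma> s) \<in> U"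
proof -
  have "openin (top_of_set {0..}) {t \<in> {0..}. \<gamma> t \<in> {p \<in> cdom c. coord c p \<in> U}}"
    using assms(1) by (intro curve_preimage_open coord_preimage_open[OF assms(2,5)]) (simp add: flow_line_def)
  then obtain e where e: "e > 0"
    "\<And>s. s \<in> {0..} \<Longrightarrow> dist s t < e \<Longrightarrow> s \<in> {t \<in> {0..}. \<gamma> t \<in> {p \<in> cdom c. coord c p \<in> U}}"
    unfolding openin_euclidean_subtopology_iff using assms(3,4,6) by blast
  show ?thesis
    using e by (intro that[of "e / 2"]) (auto simp: dist_real_def)
qed

text \<open>At the infimum \<open>t0\<close> of the times of disagreement the curves still agree, X
  being Hausdorff. In a chart around that point V is Lipschitz on a ball, and
  \<open>Gronwall_sq\<close> with zero initial difference forces agreement for a further time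
  d.\<close>

lemma flow_line_unique:
  assumes V: "\<And>c. c \<in> A \<Longrightarrow> holomorphic_vec_on (V c) (coord_range c)"
    and \<gamma>: "flow_line V \<gamma>" and \<eta>: "flow_line V \<eta>" and "\<gamma> 0 = \<eta> 0" "t \<ge> 0"
  shows "\<gamma> t = \<eta> t"
proof (rule ccontr)
  assume neq: "\<gamma> t \<noteq> \<eta> t"
  define B where "B = {s. 0 \<le> s \<and> \<gamma> s \<noteq> \<eta> s}"
  have "closedin (top_of_set {0..}) {s \<in> topspace (top_of_set {0..}). \<gamma> s = \<eta> s}"
    using \<gamma> \<eta> Hausdorff by (intro closedin_continuous_maps_eq) (auto simp: flow_line_def)
  then have cl: "closed {s. 0 \<le> s \<and> \<gamma> s = \<eta> s}"
    using closedin_closed_trans[of "{0..}"] by (auto simp: closed_atLeast)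
  have B: "t \<in> B" "bdd_below B" using neq assms(5) by (auto simp: B_def intro!: bdd_belowI[of _ 0])
  define t0 where "t0 = Inf B"
  have "B \<noteq> {}" using B(1) by blast
  then have t0: "t0 \<ge> 0" unfolding t0_def by (rule cInf_greatest) (simp add: B_def)
  have before: "\<gamma> s = \<eta> s" if "0 \<le> s" "s < t0" for s
  proof (rule ccontr)
    assume "\<gamma> s \<noteq> \<eta> s"
    then have "s \<in> B" using that by (simp add: B_def)
    from cInf_lower[OF this B(2)] show False using that by (simp add: t0_def)
  qed
  have eq0: "\<gamma> t0 = \<eta> t0"
  proof (cases "t0 = 0")
    case False
    have "closure {0..<t0} \<subseteq> {s. 0 \<le> s \<and> \<gamma> s = \<eta> s}"
      using before by (intro closure_minimal cl) auto
    moreover have "t0 \<in> closure {0..<t0}" using False t0 by (simp add: closure_atLeastLessThan)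
    ultimately show ?thesis by blast
  qed (use assms(4) in simp)
  have "\<gamma> t0 \<in> topspace X"
    using \<gamma> t0 by (auto simp: flow_line_def continuous_map_def)
  then obtain c where c: "c \<in> A" "\<gamma> t0 \<in> cdom c" using cover by blast
  define x where "x = coord c (\<gamma> t0)"
  obtain r where r: "r > 0" "cball x r \<subseteq> coord_range c"
    using range_open[OF c(1)] coord_in_range[OF c(2)] open_contains_cball x_def by blast
  obtain d1 where d1: "d1 > 0" "\<And>s. 0 \<le> s \<Longrightarrow> \<bar>s - t0\<bar> \<le> d1 \<Longrightarrow> \<gamma> s \<in> cdom c \<and> coord c (\<gamma> s) \<in> ball x r"
    using flow_line_near[OF \<gamma> c(1) t0 c(2) open_ball[of x r]] r x_def by auto
  obtain d2 where d2: "d2 > 0" "\<And>s. 0 \<le> s \<Longrightarrow> \<bar>s - t0\<bar> \<le> d2 \<Longrightarrow> \<eta> s \<in> cdom c \<and> coord c (\<eta> s) \<in> ball x r"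
    using flow_line_near[OF \<eta> c(1) t0, of "ball x r"] c(2) r x_def eq0 by auto
  define d where "d = min d1 d2"
  have d: "d > 0" using d1 d2 by (simp add: d_def)
  obtain K where K: "K > 0" "\<And>y z. y \<in> cball x r \<Longrightarrow> z \<in> cball x r \<Longrightarrow> norm (V c y - V c z) \<le> K * norm (y - z)"
    using holomorphic_vec_on_Lipschitz[OF range_open[OF c(1)] V[OF c(1)] r(2)] by blast
  define u where "u = (\<lambda>s. coord c (\<gamma> (s + t0)) - coord c (\<eta> (s + t0)))"
  have same: "\<gamma> (s + t0) = \<eta> (s + t0)" if s: "s \<in> {0..d}" for s
  proof -
    have in1: "\<gamma> (s + t0) \<in> cdom c" "coord c (\<gamma> (s + t0)) \<in> ball x r"
      and in2: "\<eta> (s + t0) \<in> cdom c" "coord c (\<eta> (s + t0)) \<in> ball x r" if "s \<in> {0..d}" for s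
      using d1(2)[of "s + t0"] d2(2)[of "s + t0"] that t0 by (auto simp: d_def)
    have "(norm (u s))\<^sup>2 \<le> exp ((2 * K + 1) * s) * ((norm (u 0))\<^sup>2 + 0\<^sup>2 * s)"
    proof (rule Gronwall_sq[where T = d and f' = "\<lambda>s. V c (coord c (\<gamma> (s + t0))) - V c (coord c (\<eta> (s + t0)))"])
      fix s assume s: "s \<in> {0..d}"
      note f1 = flow_line_shift[OF \<gamma> t0] and f2 = flow_line_shift[OF \<eta> t0]
      have "(u has_vector_derivative V c (coord c (\<gamma> (s + t0))) - V c (coord c (\<eta> (s + t0)))) (at s within {0..})"
        unfolding u_def using f1 f2 s in1[OF s] in2[OF s] c(1)
        by (intro has_vector_derivative_diff) (auto simp: flow_line_def)
      then show "(u has_vector_derivative V c (coord c (\<gamma> (s + t0))) - V c (coord c (\<eta> (s + t0)))) (at s within {0..d})"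
        by (rule has_vector_derivative_within_subset) auto
      show "norm (V c (coord c (\<gamma> (s + t0))) - V c (coord c (\<eta> (s + t0)))) \<le> K * norm (u s) + 0"
        using K(2) in1[OF s] in2[OF s] by (simp add: u_def less_imp_le)
    qed (use s K in auto)
    moreover have "u 0 = 0" by (simp add: u_def eq0)
    ultimately have "(norm (u s))\<^sup>2 \<le> 0" by simp
    then have "u s = 0" by simp
    then have "coord c (\<gamma> (s + t0)) = coord c (\<eta> (s + t0))" by (simp add: u_def)
    from arg_cong[OF this, of "coord_inv c"] show ?thesis
      by (simp only: coord_inv_coord[OF c(1) in1(1)[OF s]] coord_inv_coord[OF c(1) in2(1)[OF s]])
  qed
  have "t0 + d \<le> Inf B"
  proof (rule cInf_greatest)
    fix s assume s: "s \<in> B"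
    show "t0 + d \<le> s"
    proof (rule ccontr)
      assume "\<not> t0 + d \<le> s"
      moreover have "0 \<le> s" using s by (simp add: B_def)
      ultimately have "\<gamma> s = \<eta> s"
        using before[of s] same[of "s - t0"] by (cases "s < t0") simp_all
      then show False using s by (simp add: B_def)
    qed
  qed fact
  then show False using d by (simp add: t0_def)
qed

end

section \<open>Holomorphic jets\<close>

text \<open>Vanishing at a of all iterated \<open>dz\<close> derivatives of order less than N. The
  conjugate directions are not tested, so vanishing jets bound the growth of holomorphic functions
  only.\<close>

primrec jetz :: "nat \<Rightarrow> complex^'n \<Rightarrow> (complex^'n \<Rightarrow> complex) \<Rightarrow> bool" where
  "jetz 0 a u \<longleftrightarrow> True"
| "jetz (Suc N) a u \<longleftrightarrow> u a = 0 \<and> (\<forall>l. jetz N a (dz l u))"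

text \<open>Words in place of multi-indices: the recursion differentiates in the order of the
  letters, and independence of that order is the separate statement \<open>symc_jd\<close>.\<close>

primrec jd :: "complex^'n \<Rightarrow> 'n list \<Rightarrow> (complex^'n \<Rightarrow> complex) \<Rightarrow> complex" where
  "jd a [] u = u a"
| "jd a (l # w) u = jd a w (dz l u)"

text \<open>A sum over all words of length k, so each monomial occurs once for every ordering of its
  letters. This is why \<open>taypoly\<close> divides by \<open>fact k\<close> instead of
  multi-index factorials.\<close>

primrec tay :: "complex^'n \<Rightarrow> nat \<Rightarrow> ('n list \<Rightarrow> complex) \<Rightarrow> complex^'n \<Rightarrow> complex" where
  "tay a 0 c z = c []"
| "tay a (Suc k) c z = (\<Sum>i\<in>UNIV. (z $ i - a $ i) * tay a k (\<lambda>w. c (i # w)) z)"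

definition taypoly :: "complex^'n \<Rightarrow> nat \<Rightarrow> ('n list \<Rightarrow> complex) \<Rightarrow> complex^'n \<Rightarrow> complex" where
  "taypoly a N c z = (\<Sum>k\<le>N. (1 / fact k) * tay a k c z)"

text \<open>Swaps of adjacent letters generate all permutations of a word.\<close>

definition symc :: "('n list \<Rightarrow> complex) \<Rightarrow> bool" where
  "symc c \<longleftrightarrow> (\<forall>p i l w. c (p @ i # l # w) = c (p @ l # i # w))"

lemma symc_Cons: "symc c \<Longrightarrow> symc (\<lambda>w. c (i # w))"
  unfolding symc_def
proof (intro allI)
  fix p k l w
  assume "\<forall>p i l w. c (p @ i # l # w) = c (p @ l # i # w)"
  from this[rule_format, of "i # p" k l w] show "c (i # p @ k # l # w) = c (i # p @ l # k # w)" by simp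
qed

lemma jetz_cong:
  assumes "open S" "a \<in> S" "\<And>y. y \<in> S \<Longrightarrow> u y = v y" "jetz N a u"
  shows "jetz N a v"
  using assms(3,4)
proof (induction N arbitrary: u v)
  case (Suc N)
  have "jetz N a (dz l v)" for l
  proof (rule Suc.IH)
    show "dz l u y = dz l v y" if "y \<in> S" for y
      by (rule dz_cong[OF assms(1) that]) (rule Suc.prems(1))
    show "jetz N a (dz l u)" using Suc.prems by simp
  qed
  moreover have "v a = 0" using Suc.prems assms(2) by simp
  ultimately show ?case by simp
qed simp

lemma jetz_zero: "jetz N (a::complex^'n) (\<lambda>_. 0)"
proof (induction N)
  case (Suc N)
  have "dz l (\<lambda>_::complex^'n. 0) = (\<lambda>_. 0)" for l by (rule ext) (rule dz_const)
  then show ?case using Suc by simp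
qed simp

lemma jetz_Suc_D: "jetz (Suc N) a u \<Longrightarrow> jetz N a u"
proof (induction N arbitrary: u)
  case (Suc N)
  have "u a = 0" "\<And>l. jetz (Suc N) a (dz l u)" using Suc.prems by auto
  then show ?case using Suc.IH by (simp del: jetz.simps(2) add: jetz.simps(2)[of N])
qed simp

lemma jetz_mono:
  assumes "jetz N a u" "M \<le> N" shows "jetz M a u"
proof -
  have "jetz (M + k) a u \<Longrightarrow> jetz M a u" for k
    by (induction k) (auto dest: jetz_Suc_D simp del: jetz.simps)
  moreover have "N = M + (N - M)" using assms(2) by simp
  ultimately show ?thesis using assms(1) by metis
qed

lemma jetz_add:
  assumes S: "open S" "a \<in> S" and "smooth_on u S" "smooth_on v S" "jetz N a u" "jetz N a v"
  shows "jetz N a (\<lambda>x. u x + v x)"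
  using assms(3-)
proof (induction N arbitrary: u v)
  case (Suc N)
  have "jetz N a (dz l (\<lambda>x. u x + v x))" for l
  proof (rule jetz_cong[OF S])
    show "jetz N a (\<lambda>x. dz l u x + dz l v x)"
      by (rule Suc.IH) (use Suc.prems smooth_on_dz[OF S(1)] in auto)
    show "dz l u y + dz l v y = dz l (\<lambda>x. u x + v x) y" if "y \<in> S" for y
      using dz_add[OF smooth_on_differentiable[OF Suc.prems(1) that] smooth_on_differentiable[OF Suc.prems(2) that]]
      by simp
  qed
  then show ?case using Suc.prems by simp
qed simp

lemma jetz_mult:
  assumes S: "open S" "a \<in> S" and "smooth_on u S" "smooth_on v S" "jetz N a u"
  shows "jetz N a (\<lambda>x. v x * u x)"
  using assms(3-)
proof (induction N arbitrary: u v)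
  case (Suc N)
  have "jetz N a (dz l (\<lambda>x. v x * u x))" for l
  proof (rule jetz_cong[OF S])
    have "jetz N a (\<lambda>x. v x * dz l u x)"
      by (rule Suc.IH) (use Suc.prems smooth_on_dz[OF S(1)] in auto)
    moreover have "jetz N a (\<lambda>x. dz l v x * u x)"
      by (rule Suc.IH) (use Suc.prems smooth_on_dz[OF S(1)] jetz_Suc_D[OF Suc.prems(3)] in auto)
    ultimately show "jetz N a (\<lambda>x. v x * dz l u x + dz l v x * u x)"
      using Suc.prems smooth_on_dz[OF S(1)] by (intro jetz_add[OF S] smooth_on_mult[OF S(1)]) auto
    show "v y * dz l u y + dz l v y * u y = dz l (\<lambda>x. v x * u x) y" if "y \<in> S" for y
      using dz_mult[OF smooth_on_differentiable[OF Suc.prems(2) that] smooth_on_differentiable[OF Suc.prems(1) that]]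
      by simp
  qed
  then show ?case using Suc.prems by simp
qed simp

lemma jetz_cmult:
  assumes S: "open S" "a \<in> S" and "smooth_on u S" "jetz N a u"
  shows "jetz N a (\<lambda>x. k * u x)"
  using jetz_mult[OF S assms(3) smooth_on_const assms(4), of k] .

lemma jetz_sum:
  assumes S: "open S" "a \<in> S" and "\<And>i. i \<in> I \<Longrightarrow> smooth_on (u i) S" "\<And>i. i \<in> I \<Longrightarrow> jetz N a (u i)"
  shows "jetz N a (\<lambda>x. \<Sum>i\<in>I. u i x)"
  using assms(3-)
proof (induction I rule: infinite_finite_induct)
  case (insert i I)
  have "jetz N a (\<lambda>x. u i x + (\<Sum>i\<in>I. u i x))"
    using insert by (intro jetz_add[OF S] smooth_on_sum[OF S(1)]) auto
  then show ?case using insert by simp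
qed (simp_all add: jetz_zero)

text \<open>All first \<open>dz\<close> derivatives of q vanish near a, so only the value at a could
  contribute. Applied to conjugates of holomorphic functions, this discards the conjugate terms in
  the gradient equation.\<close>

lemma jetz_antiholo:
  assumes S: "open S" "a \<in> S" and "q a = 0" "\<And>x l. x \<in> S \<Longrightarrow> dz l q x = 0"
  shows "jetz N a q"
proof (cases N)
  case (Suc M)
  have "jetz M a (dz l q)" for l
    by (rule jetz_cong[OF S _ jetz_zero]) (simp add: assms(4))
  then show ?thesis using Suc assms(3) by simp
qed simp

text \<open>For holomorphic u the jet does control the size: by induction the derivative is O(norm
  (w - a)^N), and integrating it from a gains one power.\<close>

lemma jetz_holo_bound:
  fixes u :: "complex^'n \<Rightarrow> complex"
  assumes S: "open S" "a \<in> S" and "holo_on u S" "jetz N a u"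
  shows "\<exists>C r. C \<ge> 0 \<and> r > 0 \<and> cball a r \<subseteq> S \<and> (\<forall>w\<in>cball a r. norm (u w) \<le> C * norm (w - a) ^ N)"
  using assms(3-)
proof (induction N arbitrary: u)
  case 0
  obtain r where r: "r > 0" "cball a r \<subseteq> S" using S open_contains_cball by blast
  have "bounded (u ` cball a r)"
    by (rule compact_imp_bounded, rule compact_continuous_image)
       (use continuous_on_subset[OF holo_on_continuous[OF 0(1)] r(2)] in auto)
  then obtain C where "C > 0" "\<And>w. w \<in> cball a r \<Longrightarrow> norm (u w) \<le> C"
    unfolding bounded_pos by blast
  then show ?case using r by (intro exI[of _ C] exI[of _ r]) auto
next
  case (Suc N)
  have "\<exists>C r. C \<ge> 0 \<and> r > 0 \<and> cball a r \<subseteq> S \<and> (\<forall>w\<in>cball a r. norm (dz l u w) \<le> C * norm (w - a) ^ N)" for l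
    by (rule Suc.IH[OF holo_on_dz_holo[OF S(1) Suc.prems(1)]]) (use Suc.prems(2) in simp)
  then obtain C r where Cr: "\<And>l. C l \<ge> 0" "\<And>l. r l > (0::real)" "\<And>l. cball a (r l) \<subseteq> S"
    "\<And>l w. w \<in> cball a (r l) \<Longrightarrow> norm (dz l u w) \<le> C l * norm (w - a) ^ N"
    by metis
  define R where "R = Min (range r)"
  have R: "R > 0" "\<And>l. R \<le> r l" using Cr(2) by (auto simp: R_def)
  then have RS: "cball a R \<subseteq> S" using Cr(3) by (meson order_trans subset_cball)
  define K where "K = (\<Sum>l\<in>UNIV. C l)"
  have K: "K \<ge> 0" using Cr(1) by (simp add: K_def sum_nonneg)
  have FDb: "norm (FD u y v) \<le> K * norm (y - a) ^ N * norm v" if y: "y \<in> cball a R" for y v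
  proof -
    have "norm (FD u y v) \<le> (\<Sum>l\<in>UNIV. norm (v $ l * dz l u y))"
      using y RS by (subst holo_on_FD_dz[OF Suc.prems(1)]) (auto intro: norm_sum)
    also have "\<dots> \<le> (\<Sum>l\<in>UNIV. norm v * (C l * norm (y - a) ^ N))"
    proof (rule sum_mono)
      fix l
      have "y \<in> cball a (r l)" using y R(2)[of l] by auto
      then show "norm (v $ l * dz l u y) \<le> norm v * (C l * norm (y - a) ^ N)"
        unfolding norm_mult by (intro mult_mono Finite_Cartesian_Product.norm_nth_le Cr(4)) auto
    qed
    also have "\<dots> = K * norm (y - a) ^ N * norm v"
      by (simp add: K_def sum_distrib_left sum_distrib_right mult_ac)
    finally show ?thesis .
  qed
  have "norm (u w) \<le> K * norm (w - a) ^ Suc N" if w: "w \<in> cball a R" for w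
  proof -
    let ?d = "norm (w - a)"
    \<comment> \<open>The mean value inequality is applied on the ball reaching exactly to w, where
      the derivative is at most K * ?d ^ N.\<close>
    have sub: "cball a ?d \<subseteq> cball a R" using w by (auto simp: dist_norm norm_minus_commute)
    have "norm (u w - u a) \<le> (K * ?d ^ N) * norm (w - a)"
    proof (rule differentiable_bound[of "cball a ?d" u "FD u"])
      show "(u has_derivative FD u y) (at y within cball a ?d)" if "y \<in> cball a ?d" for y
        using has_derivative_at_withinI[OF holo_on_has_derivative[OF Suc.prems(1)]] sub RS that by blast
      show "onorm (FD u y) \<le> K * ?d ^ N" if y: "y \<in> cball a ?d" for y
      proof (rule onorm_le)
        fix v :: "complex^'n"
        have yR: "y \<in> cball a R" using sub y by blast
        have "norm (y - a) ^ N \<le> ?d ^ N"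
          using y by (intro power_mono) (auto simp: dist_norm norm_minus_commute)
        then have "K * norm (y - a) ^ N * norm v \<le> K * ?d ^ N * norm v"
          using K by (intro mult_right_mono mult_left_mono) auto
        then show "norm (FD u y v) \<le> K * ?d ^ N * norm v" using FDb[OF yR, of v] by linarith
      qed
    qed (auto simp: dist_norm norm_minus_commute)
    then show ?thesis using Suc.prems(2) by (simp add: mult_ac)
  qed
  then show ?case using K R(1) RS by blast
qed

section \<open>Holomorphic Taylor polynomials\<close>

lemma jd_cong:
  assumes "open S" "a \<in> S" "\<And>y. y \<in> S \<Longrightarrow> u y = v y"
  shows "jd a w u = jd a w v"
  using assms(3)
proof (induction w arbitrary: u v)
  case Nil
  then show ?case using assms(2) by simp
next
  case (Cons l w)
  have "dz l u y = dz l v y" if "y \<in> S" for y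
    by (rule dz_cong[OF assms(1) that]) (rule Cons.prems)
  then show ?case using Cons.IH[of "dz l u" "dz l v"] by simp
qed

lemma symc_jd:
  assumes S: "open S" "a \<in> S" and "smooth_on u S"
  shows "symc (\<lambda>w. jd a w u)"
proof -
  have "jd a (p @ i # l # w) u = jd a (p @ l # i # w) u" for p i l w
    using assms(3)
  proof (induction p arbitrary: u)
    case Nil
    have "jd a w (dz l (dz i u)) = jd a w (dz i (dz l u))"
      by (rule jd_cong[OF S]) (rule dz_commute[OF S(1) Nil])
    then show ?case by simp
  next
    case (Cons k p)
    then show ?case using smooth_on_dz[OF S(1)] by simp
  qed
  then show ?thesis by (simp add: symc_def)
qed

lemma holo_on_tay: "holo_on (tay a k c) S"
proof (induction k arbitrary: c)
  case 0
  then show ?case by (simp add: holo_on_const)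
next
  case (Suc k)
  show ?case
    by (simp add: tay.simps(2)[abs_def]) 
       (intro holo_on_sum holo_on_mult holo_on_diff holo_on_nth holo_on_const Suc)
qed

lemma holo_on_taypoly: "holo_on (taypoly a N c) S"
  unfolding taypoly_def[abs_def] by (intro holo_on_sum holo_on_mult holo_on_const holo_on_tay)

lemma holo_on_differentiable: "holo_on u S \<Longrightarrow> x \<in> S \<Longrightarrow> u differentiable (at x)"
  by (simp add: holo_on_def)

text \<open>The letter removed by \<open>dz l\<close> can stand in any of the k + 1 positions, and
  symmetry makes all contributions equal. The recursion exposes the first letter only, so the
  induction step swaps the first two.\<close>

lemma dz_tay:
  fixes a :: "complex^'n"
  assumes "symc c"
  shows "dz l (tay a (Suc k) c) z = of_nat (Suc k) * tay a k (\<lambda>w. c (l # w)) z"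
  using assms
proof (induction k arbitrary: c)
  case 0
  have d: "(\<lambda>z::complex^'n. z $ i - a $ i) differentiable (at z)" for i
    using holo_on_differentiable[OF holo_on_diff[OF holo_on_nth holo_on_const], of z UNIV] by simp
  have d1: "dz l (\<lambda>z. z $ i - a $ i) z = (if l = i then 1 else 0)" for i
    using dz_diff[of "\<lambda>z. z $ i" z "\<lambda>_. a $ i" l] holo_on_differentiable[OF holo_on_nth, of z UNIV i]
    by (simp add: dz_nth dz_const)
  have "dz l (\<lambda>z. \<Sum>i\<in>UNIV. (z $ i - a $ i) * c [i]) z = (\<Sum>i\<in>UNIV. dz l (\<lambda>z. (z $ i - a $ i) * c [i]) z)"
    by (rule dz_sum) (intro differentiable_mult d differentiable_const)
  also have "\<dots> = (\<Sum>i\<in>UNIV. if l = i then c [i] else 0)"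
    by (rule sum.cong) (simp_all add: dz_mult[OF d differentiable_const] dz_const d1)
  finally show ?case by (simp add: tay.simps(2)[abs_def])
next
  case (Suc k)
  have d: "(\<lambda>z::complex^'n. z $ i - a $ i) differentiable (at z)" for i
    using holo_on_differentiable[OF holo_on_diff[OF holo_on_nth holo_on_const], of z UNIV] by simp
  have dt: "tay a (Suc k) c' differentiable (at z)" for c' :: "'n list \<Rightarrow> complex"
    using holo_on_differentiable[OF holo_on_tay, of z UNIV] by simp
  have d1: "dz l (\<lambda>z. z $ i - a $ i) z = (if l = i then 1 else 0)" for i
    using dz_diff[of "\<lambda>z. z $ i" z "\<lambda>_. a $ i" l] holo_on_differentiable[OF holo_on_nth, of z UNIV i]
    by (simp add: dz_nth dz_const)
  let ?t = "\<lambda>i. tay a (Suc k) (\<lambda>w. c (i # w))"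
  have sw: "tay a k (\<lambda>w. c (i # l # w)) z = tay a k (\<lambda>w. c (l # i # w)) z" for i
    using Suc.prems unfolding symc_def by (metis append_Nil)
  have "dz l (tay a (Suc (Suc k)) c) z = dz l (\<lambda>z. \<Sum>i\<in>UNIV. (z $ i - a $ i) * ?t i z) z"
    by (simp only: tay.simps(2)[of a "Suc k", abs_def])
  also have "\<dots> = (\<Sum>i\<in>UNIV. dz l (\<lambda>z. (z $ i - a $ i) * ?t i z) z)"
    by (rule dz_sum) (intro differentiable_mult d dt)
  also have "\<dots> = (\<Sum>i\<in>UNIV. (z $ i - a $ i) * (of_nat (Suc k) * tay a k (\<lambda>w. c (l # i # w)) z) + (if l = i then ?t i z else 0))"
    by (rule sum.cong)
       (simp_all only: dz_mult[OF d dt] d1 Suc.IH[OF symc_Cons[OF Suc.prems]] sw, simp_all)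
  also have "\<dots> = of_nat (Suc k) * ?t l z + ?t l z"
    unfolding sum.distrib by (simp add: sum_distrib_left mult_ac del: of_nat_Suc)
  also have "\<dots> = of_nat (Suc (Suc k)) * ?t l z" by (simp add: algebra_simps)
  finally show ?case .
qed

lemma dz_taypoly:
  fixes a :: "complex^'n"
  assumes "symc c"
  shows "dz l (taypoly a (Suc N) c) z = taypoly a N (\<lambda>w. c (l # w)) z"
proof -
  have dt: "tay a k c' differentiable (at z)" for k and c' :: "'n list \<Rightarrow> complex"
    using holo_on_differentiable[OF holo_on_tay, of z UNIV] by simp
  have "dz l (taypoly a (Suc N) c) z = (\<Sum>k\<le>Suc N. dz l (\<lambda>z. (1 / fact k) * tay a k c z) z)"
    unfolding taypoly_def[abs_def] by (rule dz_sum) (intro differentiable_mult differentiable_const dt)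
  also have "\<dots> = (\<Sum>k\<le>Suc N. (1 / fact k) * dz l (tay a k c) z)"
    by (rule sum.cong[OF refl]) (rule dz_cmult[OF dt])
  also have "\<dots> = (\<Sum>k\<le>N. (1 / fact (Suc k)) * dz l (tay a (Suc k) c) z)"
    by (subst sum.atMost_Suc_shift) (simp add: dz_const[of l "c []" z, abs_def] tay.simps(1)[abs_def] dz_const)
  also have "\<dots> = taypoly a N (\<lambda>w. c (l # w)) z"
    unfolding taypoly_def
    by (rule sum.cong[OF refl]) (simp add: dz_tay[OF assms] del: tay.simps of_nat_Suc)
  finally show ?thesis .
qed

lemma taypoly_center: "taypoly a N c a = c []"
proof -
  have "taypoly a N c a = (\<Sum>k\<le>N. if k = 0 then c [] else 0)"
    unfolding taypoly_def
  proof (rule sum.cong[OF refl])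
    fix k show "(1 / fact k) * tay a k c a = (if k = 0 then c [] else 0)"
      by (cases k) simp_all
  qed
  then show ?thesis by simp
qed

lemma jetz_taypoly:
  assumes S: "open S" "a \<in> S" and "smooth_on u S"
  shows "jetz (Suc N) a (\<lambda>x. taypoly a N (\<lambda>w. jd a w u) x - u x)"
  using assms(3)
proof (induction N arbitrary: u)
  case 0
  then show ?case by (simp add: taypoly_center)
next
  case (Suc N)
  have "jetz (Suc N) a (dz l (\<lambda>x. taypoly a (Suc N) (\<lambda>w. jd a w u) x - u x))" for l
  proof (rule jetz_cong[OF S _ Suc.IH[OF smooth_on_dz[OF S(1) Suc.prems], of l]])
    fix y assume y: "y \<in> S"
    have "dz l (\<lambda>x. taypoly a (Suc N) (\<lambda>w. jd a w u) x - u x) y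
      = dz l (taypoly a (Suc N) (\<lambda>w. jd a w u)) y - dz l u y"
      by (rule dz_diff[OF holo_on_differentiable[OF holo_on_taypoly y] smooth_on_differentiable[OF Suc.prems y]])
    also have "\<dots> = taypoly a N (\<lambda>w. jd a w (dz l u)) y - dz l u y"
      by (simp add: dz_taypoly[OF symc_jd[OF S Suc.prems]])
    finally show "taypoly a N (\<lambda>w. jd a w (dz l u)) y - dz l u y
      = dz l (\<lambda>x. taypoly a (Suc N) (\<lambda>w. jd a w u) x - u x) y" by simp
  qed
  then show ?case by (simp add: taypoly_center del: jetz.simps(2) add: jetz.simps(2)[of "Suc N"])
qed

text \<open>A Poincare lemma for jets: the coefficient of i # w is prescribed as the w-th derivative
  of G i. Closedness is the symmetry in the first two letters; symmetry further on is that of the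
  derivatives of each G i. Thus a polynomial primitive exists to any finite order, also when G is
  not holomorphic.\<close>

lemma jet_primitive:
  assumes S: "open S" "a \<in> S" and G: "\<And>i. smooth_on (G i) S"
    and closed: "\<And>i l x. x \<in> S \<Longrightarrow> dz l (G i) x = dz i (G l) x"
  shows "\<exists>P. holo_on P UNIV \<and> P a = 0 \<and> (\<forall>i. jetz (Suc N) a (\<lambda>x. dz i P x - G i x))"
proof -
  \<comment> \<open>The value 0 at the empty word normalizes P a = 0.\<close>
  define c where "c = (\<lambda>w. case w of [] \<Rightarrow> 0 | i # w \<Rightarrow> jd a w (G i))"
  have "symc c"
    unfolding symc_def
  proof (intro allI)
    fix p i l w
    show "c (p @ i # l # w) = c (p @ l # i # w)"
    proof (cases p)
      case Nil
      have "jd a w (dz l (G i)) = jd a w (dz i (G l))"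
        by (rule jd_cong[OF S]) (rule closed)
      then show ?thesis using Nil by (simp add: c_def)
    next
      case (Cons k p')
      then show ?thesis using symc_jd[OF S G[of k]] by (simp add: c_def symc_def)
    qed
  qed
  note d = dz_taypoly[OF this, of _ a N]
  have "(\<lambda>x. dz i (taypoly a (Suc N) c) x - G i x) = (\<lambda>x. taypoly a N (\<lambda>w. jd a w (G i)) x - G i x)" for i
    by (rule ext) (simp only: d, simp add: c_def)
  then show ?thesis
    using jetz_taypoly[OF S G] holo_on_taypoly taypoly_center[of a "Suc N" c]
    by (intro exI[of _ "taypoly a (Suc N) c"]) (simp add: c_def)
qed

text \<open>This is where the gradient structure enters: in Bochner-type coordinates \<open>P\<close> the field \<open>V\<close> has
  no resonant terms.\<close>

lemma gradient_field_jets: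
  fixes G :: "complex^'n \<Rightarrow> complex^'n^'n" and V :: "complex^'n \<Rightarrow> complex^'n"
  assumes S: "open S" "a \<in> S" and G: "\<And>i j. smooth_on (\<lambda>x. G x $ i $ j) S"
    and herm: "\<And>x. x \<in> S \<Longrightarrow> hermitian (G x)"
    and closed: "\<And>i j k x. x \<in> S \<Longrightarrow> dz k (\<lambda>y. G y $ i $ j) x = dz i (\<lambda>y. G y $ k $ j) x"
    and u: "smooth_on u S" and real: "\<And>x. cnj (u x) = u x"
    and V: "holomorphic_vec_on V S" "V a = 0"
    and grad: "\<And>x j. x \<in> S \<Longrightarrow> (\<Sum>i\<in>UNIV. V x $ i * G x $ i $ j) = complex_of_real t * dzbar j u x"
  shows "\<exists>P :: 'n \<Rightarrow> complex^'n \<Rightarrow> complex. (\<forall>j. holo_on (P j) UNIV \<and> P j a = 0 \<and> (\<forall>i. dz i (P j) a = G a $ i $ j) \<and>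
     jetz (Suc N) a (\<lambda>x. (\<Sum>i\<in>UNIV. V x $ i * dz i (P j) x) - (\<Sum>k\<in>UNIV. cnj (dz j (\<lambda>y. V y $ k) a) * P k x)))"
proof -
  have "\<exists>P. holo_on P UNIV \<and> P a = 0 \<and> (\<forall>i. jetz (Suc N) a (\<lambda>x. dz i P x - G x $ i $ j))" for j
    by (rule jet_primitive[OF S]) (use G closed in auto)
  then have "\<forall>j. \<exists>P. holo_on P UNIV \<and> P a = 0 \<and> (\<forall>i. jetz (Suc N) a (\<lambda>x. dz i P x - G x $ i $ j))" by (rule allI)
  from choice[OF this] obtain P where P_all: "\<forall>j. holo_on (P j) UNIV \<and> P j a = 0 \<and>
    (\<forall>i. jetz (Suc N) a (\<lambda>x. dz i (P j) x - G x $ i $ j))" by (rule exE)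
  then have P: "\<And>j. holo_on (P j) UNIV" "\<And>j. P j a = 0"
    "\<And>i j. jetz (Suc N) a (\<lambda>x. dz i (P j) x - G x $ i $ j)" by (auto simp del: jetz.simps)
  \<comment> \<open>Error of replacing the metric by the derivatives of P. Its holomorphic jets at a
    vanish, so it drops out below.\<close>
  define e where "e = (\<lambda>i j x. dz i (P j) x - G x $ i $ j)"
  have PS: "holo_on (P j) S" for j using P(1) holo_on_subset by blast
  have Vh: "holo_on (\<lambda>x. V x $ i) S" for i using holomorphic_vec_on_nth[OF V(1)] .
  note Vs = smooth_on_holo[OF S(1) Vh]
  have es: "smooth_on (e i j) S" for i j
    unfolding e_def by (intro smooth_on_diff[OF S(1)] smooth_on_dz[OF S(1)] G smooth_on_holo[OF S(1)] PS)
  have ej: "jetz (Suc N) a (e i j)" for i j using P(3) by (simp only: e_def)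
  define B where "B = (\<lambda>j k. cnj (dz j (\<lambda>y. V y $ k) a))"
  define h where "h = (\<lambda>j x. (\<Sum>i\<in>UNIV. V x $ i * dz i (P j) x) - (\<Sum>k\<in>UNIV. B j k * P k x))"
  have "jetz (Suc N) a (h j)" for j
  proof -
    define w where "w = (\<lambda>x. \<Sum>i\<in>UNIV. V x $ i * e i j x)"
    have ws: "smooth_on w S" unfolding w_def by (intro smooth_on_sum[OF S(1)] smooth_on_mult[OF S(1)] Vs es)
    have wj: "jetz (Suc N) a w"
      unfolding w_def by (intro jetz_sum[OF S] jetz_mult[OF S] smooth_on_mult[OF S(1)] Vs es ej)
    have hS: "h j x = complex_of_real t * dzbar j u x + w x - (\<Sum>k\<in>UNIV. B j k * P k x)" if "x \<in> S" for x
      using grad[OF that, of j] by (simp add: h_def w_def e_def algebra_simps sum_subtractf)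
    have us: "smooth_on (\<lambda>x. complex_of_real t * dzbar j u x) S"
      by (intro smooth_on_cmult[OF S(1)] smooth_on_dzbar[OF S(1)] u)
    have Bs: "smooth_on (\<lambda>x. \<Sum>k\<in>UNIV. B j k * P k x) S"
      by (intro smooth_on_sum[OF S(1)] smooth_on_cmult[OF S(1)] smooth_on_holo[OF S(1)] PS)
    have "jetz N a (dz l (h j))" for l
    proof -
      \<comment> \<open>Deviation of the conjugate Jacobian of V from its value at a:
        antiholomorphic and zero at a, hence without holomorphic jet.\<close>
      define q where "q = (\<lambda>k x. cnj (dz j (\<lambda>y. V y $ k) x) - B j k)"
      have Vdh: "holo_on (dz j (\<lambda>y. V y $ k)) S" for k by (rule holo_on_dz_holo[OF S(1) Vh])
      have qs: "smooth_on (q k) S" for k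
        unfolding q_def
        by (intro smooth_on_diff[OF S(1)] smooth_on_const smooth_on_cnj[OF S(1)] smooth_on_holo[OF S(1)] Vdh)
      have qj: "jetz N a (q k)" for k
      proof (rule jetz_antiholo[OF S])
        show "q k a = 0" by (simp add: q_def B_def)
        fix x l assume x: "x \<in> S"
        note d = holo_on_differentiable[OF Vdh x, of k]
        have "dz l (q k) x = dz l (\<lambda>x. cnj (dz j (\<lambda>y. V y $ k) x)) x - dz l (\<lambda>_. B j k) x"
          unfolding q_def
          by (rule dz_diff[OF smooth_on_differentiable[OF smooth_on_cnj[OF S(1) smooth_on_holo[OF S(1) Vdh]] x]
                differentiable_const])
        then show "dz l (q k) x = 0"
          by (simp add: dz_cnj[OF d] dz_const holo_on_dzbar[OF Vdh x])
      qed
      have Vcs: "smooth_on (\<lambda>x. cnj (V x $ k)) S" for k by (intro smooth_on_cnj[OF S(1)] Vs)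
      have Vcj: "jetz N a (\<lambda>x. cnj (V x $ k))" for k
      proof (rule jetz_antiholo[OF S])
        show "cnj (V a $ k) = 0" using V(2) by simp
        fix x l assume x: "x \<in> S"
        show "dz l (\<lambda>x. cnj (V x $ k)) x = 0"
          by (simp add: dz_cnj[OF holo_on_differentiable[OF Vh x]] holo_on_dzbar[OF Vh x])
      qed
      \<comment> \<open>The l-th derivative of h j, regrouped into terms with vanishing N-jet. The
        first two sums arise by exchanging \<open>dz l\<close> with \<open>dzbar j\<close> on u and
        then using the conjugate gradient equation.\<close>
      define T where "T = (\<lambda>x. (\<Sum>k\<in>UNIV. G x $ l $ k * q k x) + (\<Sum>k\<in>UNIV. dzbar j (\<lambda>y. G y $ l $ k) x * cnj (V x $ k))
           + dz l w x + (\<Sum>k\<in>UNIV. - B j k * e l k x))"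
      have "jetz N a T"
        unfolding T_def
        by (intro jetz_add[OF S] jetz_sum[OF S] jetz_mult[OF S] jetz_cmult[OF S] smooth_on_add[OF S(1)] smooth_on_sum[OF S(1)]
            smooth_on_mult[OF S(1)] smooth_on_cmult[OF S(1)] smooth_on_dz[OF S(1)] smooth_on_dzbar[OF S(1)] G qs qj Vcs Vcj es
            jetz_Suc_D[OF ej] ws) (use wj in simp)
      moreover have "T x = dz l (h j) x" if x: "x \<in> S" for x
      proof -
        note ud = smooth_on_differentiable[OF smooth_on_dzbar[OF S(1) u, of j] x]
        have "dz l (h j) x = dz l (\<lambda>x. complex_of_real t * dzbar j u x + w x - (\<Sum>k\<in>UNIV. B j k * P k x)) x"
          by (rule dz_cong[OF S(1) x]) (rule hS)
        also have "\<dots> = dz l (\<lambda>x. complex_of_real t * dzbar j u x + w x) x - dz l (\<lambda>x. \<Sum>k\<in>UNIV. B j k * P k x) x"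
          by (rule dz_diff; rule smooth_on_differentiable[OF _ x]; intro smooth_on_add[OF S(1)] us ws Bs)
        also have "dz l (\<lambda>x. complex_of_real t * dzbar j u x + w x) x = dz l (\<lambda>x. complex_of_real t * dzbar j u x) x + dz l w x"
          by (rule dz_add; rule smooth_on_differentiable[OF _ x]; intro us ws)
        also have "dz l (\<lambda>x. complex_of_real t * dzbar j u x) x = complex_of_real t * dzbar j (dz l u) x"
          using dz_cmult[OF ud, of l] dz_dzbar_commute[OF S(1) u x, of l j] by simp
        also have "dz l (\<lambda>x. \<Sum>k\<in>UNIV. B j k * P k x) x = (\<Sum>k\<in>UNIV. B j k * (e l k x + G x $ l $ k))"
        proof -
          have "dz l (\<lambda>x. \<Sum>k\<in>UNIV. B j k * P k x) x = (\<Sum>k\<in>UNIV. dz l (\<lambda>x. B j k * P k x) x)"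
            by (rule dz_sum) (intro differentiable_mult differentiable_const holo_on_differentiable[OF PS x])
          then show ?thesis by (simp add: dz_cmult[OF holo_on_differentiable[OF PS x]] e_def)
        qed
        also have "complex_of_real t * dzbar j (dz l u) x
            = (\<Sum>k\<in>UNIV. cnj (V x $ k) * dzbar j (\<lambda>y. G y $ l $ k) x + cnj (dz j (\<lambda>y. V y $ k) x) * G x $ l $ k)"
        proof -
          \<comment> \<open>The conjugate of the lowered gradient equation, using that u is real and
            G Hermitian. It expresses second derivatives of u through the conjugate of V, to which
            holomorphic jets are blind.\<close>
          have eq: "complex_of_real t * dz l u y = (\<Sum>k\<in>UNIV. cnj (V y $ k) * G y $ l $ k)" if y: "y \<in> S" for y
          proof -
            have "dz l u y = dz l (\<lambda>x. cnj (u x)) y" by (simp add: real)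
            also have "\<dots> = cnj (dzbar l u y)" by (rule dz_cnj[OF smooth_on_differentiable[OF u y]])
            finally have "complex_of_real t * dz l u y = cnj (complex_of_real t * dzbar l u y)" by simp
            also have "\<dots> = (\<Sum>k\<in>UNIV. cnj (V y $ k) * cnj (G y $ k $ l))"
              by (simp only: grad[OF y, of l, symmetric] cnj_sum complex_cnj_mult)
            also have "\<dots> = (\<Sum>k\<in>UNIV. cnj (V y $ k) * G y $ l $ k)"
              using herm[OF y] unfolding hermitian_def by (metis (no_types, lifting))
            finally show ?thesis .
          qed
          have d1: "(\<lambda>y. cnj (V y $ k)) differentiable (at x)" "(\<lambda>y. G y $ l $ k) differentiable (at x)" for k
            using smooth_on_differentiable[OF Vcs x] smooth_on_differentiable[OF G x] by auto
          have "complex_of_real t * dzbar j (dz l u) x = dzbar j (\<lambda>y. complex_of_real t * dz l u y) x"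
            by (rule dzbar_cmult[symmetric, OF smooth_on_differentiable[OF smooth_on_dz[OF S(1) u] x]])
          also have "\<dots> = dzbar j (\<lambda>y. \<Sum>k\<in>UNIV. cnj (V y $ k) * G y $ l $ k) x"
            by (rule dzbar_cong[OF S(1) x]) (rule eq)
          also have "\<dots> = (\<Sum>k\<in>UNIV. dzbar j (\<lambda>y. cnj (V y $ k) * G y $ l $ k) x)"
            by (rule dzbar_sum) (intro differentiable_mult d1)
          finally show ?thesis
            by (simp add: dzbar_mult[OF d1] dzbar_cnj[OF holo_on_differentiable[OF Vh x]])
        qed
        finally show ?thesis
          by (simp add: T_def q_def right_diff_distrib distrib_left sum.distrib sum_subtractf sum_negf mult.commute)
      qed
      ultimately show ?thesis using jetz_cong[OF S] by blast
    qed
    moreover have "h j a = 0" using P(2) V(2) by (simp add: h_def)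
    ultimately show ?thesis by simp
  qed
  moreover have "dz i (P j) a = G a $ i $ j" for i j using P(3)[of i j] by simp
  ultimately show ?thesis
    using P(1,2) unfolding h_def B_def by blast
qed

section \<open>Linearization at an attracting fixed point\<close>

lemma holomorphic_vec_on_uniform_limit:
  fixes f :: "nat \<Rightarrow> complex^'n \<Rightarrow> complex^'m"
  assumes "open S" and holo: "\<And>n. holomorphic_vec_on (f n) S" and lim: "uniform_limit S f l sequentially"
  shows "holomorphic_vec_on l S"
    and "\<And>x v. x \<in> S \<Longrightarrow> (\<lambda>n. cjac (f n) x v) \<longlonglongrightarrow> cjac l x v"
proof -
  have lk: "uniform_limit S (\<lambda>n x. f n x $ k) (\<lambda>x. l x $ k) sequentially" for k
    by (rule bounded_linear.uniform_limit[OF bounded_linear_vec_nth lim])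
  have hk: "holo_on (\<lambda>x. f n x $ k) S" for n k by (rule holomorphic_vec_on_nth[OF holo])
  have lh: "holo_on (\<lambda>x. l x $ k) S" for k
    by (rule holo_on_uniform_limit(1)[OF assms(1) hk lk])
  then show "holomorphic_vec_on l S" by (simp add: holomorphic_vec_on_iff)
  show "(\<lambda>n. cjac (f n) x v) \<longlonglongrightarrow> cjac l x v" if x: "x \<in> S" for x v
  proof (rule vec_tendstoI)
    fix k
    have "(\<lambda>n. FD (\<lambda>x. f n x $ k) x v) \<longlonglongrightarrow> FD (\<lambda>x. l x $ k) x v"
      by (rule holo_on_uniform_limit(2)[OF assms(1) hk lk x])
    then show "(\<lambda>n. cjac (f n) x v $ k) \<longlonglongrightarrow> cjac l x v $ k"
      by (simp add: cjac_nth holo_on_FD_dz[OF hk x] holo_on_FD_dz[OF lh x])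
  qed
qed

lemma holomorphic_vec_on_linear:
  assumes "linear L" "\<And>a v. L (a *s v) = a *s L v"
  shows "holomorphic_vec_on (L :: complex^'n \<Rightarrow> complex^'m) S"
  unfolding holomorphic_vec_on_def
  using linear_imp_has_derivative[OF assms(1)] assms(2) by blast

lemma cjac_linear:
  assumes "linear L" "\<And>a v. L (a *s v) = a *s L v"
  shows "cjac (L :: complex^'n \<Rightarrow> complex^'m) x = L"
  using has_derivative_unique[OF cjac_derivative[OF holomorphic_vec_on_linear[OF assms], of x UNIV]
      linear_imp_has_derivative[OF assms(1)]] by simp

lemma linear_cjac: "linear (cjac F x)"
  by (rule linearI)
     (simp_all add: vec_eq_iff cjac_nth algebra_simps sum.distrib scaleR_sum_right)

lemma linear_inj_inv:
  fixes L :: "complex^'n \<Rightarrow> complex^'n"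
  assumes "linear L" "inj L"
  shows "\<exists>N. linear N \<and> (\<forall>v. N (L v) = v) \<and> (\<forall>v. L (N v) = v)"
proof -
  obtain N where N: "linear N" "N \<circ> L = id" using linear_injective_left_inverse[OF assms] by blast
  moreover have "surj L" using linear_inj_imp_surj[OF assms] .
  ultimately have "N (L v) = v" "L (N v) = v" for v
    by (simp_all add: o_def id_def fun_eq_iff surj_def) metis
  then show ?thesis using N(1) by blast
qed

text \<open>The real inverse function theorem gives a differentiable inverse. Its derivative inverts
  a complex linear map and is therefore complex linear, so the inverse is holomorphic.\<close>

lemma holomorphic_local_inverse:
  fixes F :: "complex^'n \<Rightarrow> complex^'n"
  assumes S: "open S" "a \<in> S" and F: "holomorphic_vec_on F S" and inj: "inj (cjac F a)"
  obtains U G where "open U" "a \<in> U" "U \<subseteq> S" "open (F ` U)" "inj_on F U" "holomorphic_vec_on G (F ` U)"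
    "\<And>x. x \<in> U \<Longrightarrow> G (F x) = x"
proof -
  obtain N where N: "linear N" "\<And>v. N (cjac F a v) = v" "\<And>v. cjac F a (N v) = v"
    using linear_inj_inv[OF linear_cjac inj] by blast
  \<comment> \<open>The inverse function theorem asks for the derivative as a continuous family of
    bounded linear operators.\<close>
  define F' where "F' = (\<lambda>x. Blinfun (cjac F x))"
  have F'[simp]: "blinfun_apply (F' x) = cjac F x" for x
    unfolding F'_def by (rule bounded_linear_Blinfun_apply) (simp add: linear_conv_bounded_linear[symmetric] linear_cjac)
  have N'[simp]: "blinfun_apply (Blinfun N) = N"
    by (rule bounded_linear_Blinfun_apply) (simp add: linear_conv_bounded_linear[symmetric] N)
  have cont: "continuous_on S F'"
  proof (rule continuous_on_blinfun_componentwise)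
    fix i :: "complex^'n"
    have "continuous_on S (\<lambda>x. cjac F x i)"
      unfolding cjac_def by (intro continuous_on_vec_lambda continuous_intros continuous_on_dz[OF S(1) F])
    then show "continuous_on S (\<lambda>x. blinfun_apply (F' x) i)" by simp
  qed
  have inv0: "Blinfun N o\<^sub>L F' a = id_blinfun"
    by (rule blinfun_eqI) (simp add: N)
  have der: "(F has_derivative blinfun_apply (F' x)) (at x)" if "x \<in> S" for x
    using cjac_derivative[OF F that] by simp
  obtain U V g g' where U0: "open U" "U \<subseteq> S" "a \<in> U" "open V" "F a \<in> V" "homeomorphism U V F g"
    and g: "\<And>y. y \<in> V \<Longrightarrow> (g has_derivative g' y) (at y)" "\<And>y. y \<in> V \<Longrightarrow> g' y = inv (blinfun_apply (F' (g y)))"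
      "\<And>y. y \<in> V \<Longrightarrow> bij (blinfun_apply (F' (g y)))"
    by (rule inverse_function_theorem[OF S(1) der cont S(2) inv0], assumption, rule that)
  note U = U0(1-4,6)
  have FU: "F ` U = V" using U(5) by (simp add: homeomorphism_def)
  have gF: "g (F x) = x" if "x \<in> U" for x using U(5) that by (simp add: homeomorphism_def)
  have "holomorphic_vec_on g V"
    unfolding holomorphic_vec_on_def
  proof
    fix y assume y: "y \<in> V"
    let ?L = "cjac F (g y)"
    have b: "bij ?L" using g(3)[OF y] by simp
    have "inv ?L (k *s v) = k *s inv ?L v" for k v
    proof -
      have "?L (k *s inv ?L v) = k *s v" using b by (simp add: cjac_smult bij_is_surj surj_f_inv_f)
      then show ?thesis using inv_f_f[OF bij_is_inj[OF b]] by metis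
    qed
    then show "\<exists>D. (g has_derivative D) (at y) \<and> (\<forall>k v. D (k *s v) = k *s D v)"
      using g(1)[OF y] g(2)[OF y] by auto
  qed
  moreover have "inj_on F U" using gF by (metis inj_onI)
  ultimately show ?thesis using that[of U g] U FU gF by auto
qed

lemma linear_funpow: "linear (N :: 'a::real_vector \<Rightarrow> 'a) \<Longrightarrow> linear (N ^^ m)"
  by (induction m) (auto simp: linear_id linear_compose)

text \<open>F is the limit of \<open>f m\<close>, that is N^m P \<psi>^m. Consecutive terms differ
  by N^(m+1) applied to the conjugation error at \<psi>^m z, a vector of norm at most \<kappa>^(m+1)
  C (r / 2^m)^n; the bound \<kappa> <= 2^n / 2 makes this decay like 2^(-m). The limit conjugates
  \<psi> to M because f m (\<psi> z) = M (f (m + 1) z).\<close>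

lemma linearize_attracting:
  fixes \<psi> P M N :: "complex^'n \<Rightarrow> complex^'n"
  assumes r: "r > 0" and \<psi>: "holomorphic_vec_on \<psi> (ball a r)" "\<psi> a = a"
    and contr: "\<And>z. z \<in> ball a r \<Longrightarrow> norm (\<psi> z - a) \<le> norm (z - a) / 2"
    and P: "holomorphic_vec_on P (ball a r)" "P a = 0" "inj (cjac P a)"
    and N: "linear N" "\<And>k v. N (k *s v) = k *s N v" "\<And>v. N (M v) = v" "\<And>v. M (N v) = v"
    and M: "linear M" "\<And>k v. M (k *s v) = k *s M v"
    and \<kappa>: "\<And>v. norm (N v) \<le> \<kappa> * norm v" "\<kappa> \<ge> 0" "\<kappa> \<le> 2 ^ n / 2"
    and approx: "\<And>z. z \<in> ball a r \<Longrightarrow> norm (P (\<psi> z) - M (P z)) \<le> C * norm (z - a) ^ n" "C \<ge> 0"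
    and conj: "\<And>v. M (cjac P a v) = cjac P a (cjac \<psi> a v)"
  shows "\<exists>F. holomorphic_vec_on F (ball a r) \<and> F a = 0 \<and> inj (cjac F a) \<and>
     (\<forall>z\<in>ball a r. F (\<psi> z) = M (F z))"
proof -
  have \<psi>b: "\<psi> z \<in> ball a r" if "z \<in> ball a r" for z
    using contr[OF that] that r norm_ge_zero[of "z - a"] by (simp add: dist_norm norm_minus_commute)
  have it: "(\<psi> ^^ m) z \<in> ball a r" "norm ((\<psi> ^^ m) z - a) \<le> r / 2 ^ m" if z: "z \<in> ball a r" for z m
  proof (induction m)
    case 0
    show "(\<psi> ^^ 0) z \<in> ball a r" using z by simp
    show "norm ((\<psi> ^^ 0) z - a) \<le> r / 2 ^ 0" using z by (simp add: dist_norm norm_minus_commute)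
  next
    case (Suc m)
    show "(\<psi> ^^ Suc m) z \<in> ball a r" using \<psi>b[OF Suc(1)] by simp
    show "norm ((\<psi> ^^ Suc m) z - a) \<le> r / 2 ^ Suc m" using contr[OF Suc(1)] Suc(2) by simp
  qed
  have \<psi>h: "holomorphic_vec_on (\<psi> ^^ m) (ball a r)" for m
  proof (induction m)
    case 0
    then show ?case using holomorphic_vec_on_id by (simp add: id_def)
  next
    case (Suc m)
    have "(\<psi> ^^ m) ` ball a r \<subseteq> ball a r" using it(1) by blast
    from holomorphic_vec_on_compose[OF \<psi>(1) Suc this] show ?case by (simp add: o_def)
  qed
  have Nb: "norm ((N ^^ m) v) \<le> \<kappa> ^ m * norm v" for m v
  proof (induction m)
    case (Suc m)
    have "norm ((N ^^ Suc m) v) \<le> \<kappa> * norm ((N ^^ m) v)" using \<kappa>(1) by simp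
    also have "\<dots> \<le> \<kappa> * (\<kappa> ^ m * norm v)" using \<kappa>(2) Suc by (rule mult_left_mono[rotated])
    finally show ?case by (simp add: mult.assoc)
  qed simp
  have Nlin: "linear (N ^^ m)" for m by (rule linear_funpow[OF N(1)])
  have Nsm: "(N ^^ m) (k *s v) = k *s (N ^^ m) v" for m k v by (induction m) (simp_all add: N(2))
  have NM: "(N ^^ Suc m) (M v) = (N ^^ m) v" for m v
    by (simp add: funpow_Suc_right N(3) del: funpow.simps)
  define f where "f = (\<lambda>m z. (N ^^ m) (P ((\<psi> ^^ m) z)))"
  have fh: "holomorphic_vec_on (f m) (ball a r)" for m
  proof -
    have "(\<psi> ^^ m) ` ball a r \<subseteq> ball a r" using it(1) by blast
    from holomorphic_vec_on_compose[OF P(1) \<psi>h this]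
    show ?thesis unfolding f_def
      using holomorphic_vec_on_compose[OF holomorphic_vec_on_linear[OF Nlin Nsm, where S = UNIV]] by blast
  qed
  define K where "K = \<kappa> * C * r ^ n"
  have step: "norm (f (Suc m) z - f m z) \<le> K * (1/2) ^ m" if z: "z \<in> ball a r" for m z
  proof -
    let ?w = "(\<psi> ^^ m) z"
    have "f (Suc m) z - f m z = (N ^^ Suc m) (P (\<psi> ?w)) - (N ^^ Suc m) (M (P ?w))"
      unfolding f_def NM by simp
    also have "\<dots> = (N ^^ Suc m) (P (\<psi> ?w) - M (P ?w))"
      using linear_diff[OF Nlin[of "Suc m"]] by simp
    finally have "norm (f (Suc m) z - f m z) \<le> \<kappa> ^ Suc m * norm (P (\<psi> ?w) - M (P ?w))"
      using Nb[of "Suc m"] by simp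
    also have "\<dots> \<le> \<kappa> ^ Suc m * (C * (r / 2 ^ m) ^ n)"
    proof (rule mult_left_mono)
      have "norm (?w - a) ^ n \<le> (r / 2 ^ m) ^ n" by (rule power_mono[OF it(2)[OF z] norm_ge_zero])
      then have "C * norm (?w - a) ^ n \<le> C * (r / 2 ^ m) ^ n" by (rule mult_left_mono[OF _ approx(2)])
      then show "norm (P (\<psi> ?w) - M (P ?w)) \<le> C * (r / 2 ^ m) ^ n"
        using approx(1)[OF it(1)[OF z, of m]] by linarith
    qed (use \<kappa>(2) in simp)
    also have "\<dots> = K * (\<kappa> / 2 ^ n) ^ m"
      by (simp add: K_def power_divide power_mult[symmetric] mult.commute)
    also have "\<dots> \<le> K * (1/2) ^ m"
    proof (rule mult_left_mono)
      have "\<kappa> / 2 ^ n \<le> 1 / 2" using \<kappa>(3) by (simp add: field_simps)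
      then show "(\<kappa> / 2 ^ n) ^ m \<le> (1/2) ^ m" using \<kappa>(2) by (intro power_mono) auto
      show "K \<ge> 0" using \<kappa>(2) approx(2) r by (simp add: K_def)
    qed
    finally show ?thesis .
  qed
  have "uniform_limit (ball a r) (\<lambda>m z. \<Sum>i<m. f (Suc i) z - f i z) (\<lambda>z. \<Sum>i. f (Suc i) z - f i z) sequentially"
    by (rule Weierstrass_m_test[OF step]) (auto intro: summable_mult summable_geometric)
  moreover have "uniform_limit (ball a r) (\<lambda>_::nat. f 0) (f 0) sequentially" by (rule uniform_limit_const)
  ultimately have "uniform_limit (ball a r) (\<lambda>m z. (\<Sum>i<m. f (Suc i) z - f i z) + f 0 z) (\<lambda>z. (\<Sum>i. f (Suc i) z - f i z) + f 0 z) sequentially"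
    by (rule uniform_limit_add)
  moreover have "(\<Sum>i<m. f (Suc i) z - f i z) + f 0 z = f m z" for m z
    using sum_lessThan_telescope[of "\<lambda>i. f i z" m] by simp
  ultimately have lim: "uniform_limit (ball a r) f (\<lambda>z. (\<Sum>i. f (Suc i) z - f i z) + f 0 z) sequentially"
    by simp
  define F where "F = (\<lambda>z. (\<Sum>i. f (Suc i) z - f i z) + f 0 z)"
  note lim = lim[folded F_def]
  have Flim: "(\<lambda>m. f m z) \<longlonglongrightarrow> F z" if "z \<in> ball a r" for z
    by (rule tendsto_uniform_limitI[OF lim that])
  have ab: "a \<in> ball a r" using r by simp
  have Fh: "holomorphic_vec_on F (ball a r)"
    by (rule holomorphic_vec_on_uniform_limit(1)[OF open_ball fh lim])
  have \<psi>a: "(\<psi> ^^ m) a = a" for m by (induction m) (simp_all add: \<psi>(2))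
  have "f m a = 0" for m
    using linear_0[OF Nlin] by (simp add: f_def \<psi>a P(2))
  then have "(\<lambda>m. f m a) \<longlonglongrightarrow> 0" by simp
  then have Fa: "F a = 0" by (rule LIMSEQ_unique[OF Flim[OF ab]])
  \<comment> \<open>All f m have the same derivative at a, because the linear part of P conjugates
    that of \<psi> to M exactly; so the derivative of the limit is injective like that of P.\<close>
  have cj: "cjac (f m) a v = cjac P a v" for m v
  proof (induction m arbitrary: v)
    case 0
    then show ?case by (simp add: f_def)
  next
    case (Suc m)
    have e: "f (Suc m) z = N (f m (\<psi> z))" for z
      by (simp add: f_def funpow_swap1)
    have "cjac (f (Suc m)) a v = cjac (\<lambda>z. N (f m (\<psi> z))) a v"
      by (simp add: e[abs_def])
    also have "\<dots> = cjac N (f m (\<psi> a)) (cjac (\<lambda>z. f m (\<psi> z)) a v)"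
      by (rule cjac_compose[OF holomorphic_vec_on_linear[OF N(1,2), where S = UNIV] holomorphic_vec_on_compose[OF fh \<psi>(1)]])
         (use ab \<psi>b in auto)
    also have "\<dots> = N (cjac (f m) (\<psi> a) (cjac \<psi> a v))"
    proof -
      have "\<psi> ` ball a r \<subseteq> ball a r" using \<psi>b by blast
      from cjac_compose[OF fh \<psi>(1) this ab, of m v] show ?thesis by (simp only: cjac_linear[OF N(1,2)])
    qed
    also have "\<dots> = N (M (cjac P a v))" by (simp only: \<psi>(2) Suc conj)
    also have "\<dots> = cjac P a v" by (rule N(3))
    finally show ?case .
  qed
  have "cjac F a v = cjac P a v" for v
    using holomorphic_vec_on_uniform_limit(2)[OF open_ball fh lim ab, of v] by (simp add: cj LIMSEQ_const_iff)
  then have "inj (cjac F a)" using P(3) by (simp add: inj_def)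
  moreover have "F (\<psi> z) = M (F z)" if z: "z \<in> ball a r" for z
  proof (rule LIMSEQ_unique[OF Flim[OF \<psi>b[OF z]]])
    have e: "f m (\<psi> z) = M (f (Suc m) z)" for m
    proof -
      have "(\<psi> ^^ Suc m) z = (\<psi> ^^ m) (\<psi> z)" by (simp only: funpow_Suc_right o_apply)
      then show ?thesis unfolding f_def by (simp add: N(4) del: funpow.simps(2)) (simp add: N(4))
    qed
    have "(\<lambda>m. M (f (Suc m) z)) \<longlonglongrightarrow> M (F z)"
      by (intro bounded_linear.tendsto[OF linear_conv_bounded_linear[THEN iffD1, OF M(1)]]
            LIMSEQ_Suc[OF Flim[OF z]])
    then show "(\<lambda>m. f m (\<psi> z)) \<longlonglongrightarrow> M (F z)" by (simp add: e)
  qed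
  ultimately show ?thesis using Fh Fa by blast
qed

section \<open>Hermitian forms\<close>

abbreviation Qf :: "complex^'n^'n \<Rightarrow> complex^'n \<Rightarrow> real" where
  "Qf H v \<equiv> Re (herm_form H v)"

lemma herm_form_linear: "linear (\<lambda>H. herm_form H v)"
  by (rule linearI)
     (simp_all add: herm_form_def distrib_right sum.distrib scaleR_sum_right)

lemma Qf_linear: "bounded_linear (\<lambda>H. Qf H v)"
  using bounded_linear_compose[OF bounded_linear_Re linear_conv_bounded_linear[THEN iffD1, OF herm_form_linear]] .

lemma herm_form_smult: "herm_form H (k *s v) = (k * cnj k) * herm_form H v"
  by (simp add: herm_form_def sum_distrib_left mult_ac)

lemma Qf_scaleR: "Qf H (r *\<^sub>R v) = r\<^sup>2 * Qf H v"
proof -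
  have "herm_form H (r *\<^sub>R v) = complex_of_real (r\<^sup>2) * herm_form H v"
    by (simp add: scaleR_smult herm_form_smult power2_eq_square)
  then show ?thesis by (simp del: of_real_power)
qed

lemma Qf_zero: "Qf H 0 = 0"
  by (simp add: herm_form_def)

lemma continuous_on_Qf:
  assumes "continuous_on C G" "continuous_on C w"
  shows "continuous_on C (\<lambda>y. Qf (G y) (w y))"
  unfolding herm_form_def
  by (intro continuous_intros continuous_on_component assms)

text \<open>Extremes over the compact set of pairs of a point and a unit vector, extended to all v
  by homogeneity of degree 2.\<close>

lemma Qf_bounds_on_compact:
  fixes G :: "'a::metric_space \<Rightarrow> complex^'n^'n"
  assumes "compact C" "continuous_on C G" "\<And>y v. y \<in> C \<Longrightarrow> v \<noteq> 0 \<Longrightarrow> 0 < Qf (G y) v"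
  obtains m K where "m > 0" "K > 0" "\<And>y v. y \<in> C \<Longrightarrow> m * (norm v)\<^sup>2 \<le> Qf (G y) v"
    "\<And>y v. y \<in> C \<Longrightarrow> Qf (G y) v \<le> K * (norm v)\<^sup>2"
proof (cases "C = {}")
  case True
  then show ?thesis using that[of 1 1] by simp
next
  case False
  define E where "E = C \<times> sphere (0::complex^'n) 1"
  let ?q = "\<lambda>p. Qf (G (fst p)) (snd p)"
  have cE: "compact E" unfolding E_def by (intro compact_Times assms(1) compact_sphere)
  have "axis undefined 1 \<in> sphere (0::complex^'n) 1" by (simp add: norm_axis_1)
  then have E0: "E \<noteq> {}" using False by (auto simp: E_def)
  have cont: "continuous_on E ?q"
    by (intro continuous_on_Qf continuous_on_compose2[OF assms(2)] continuous_on_fst continuous_on_snd continuous_on_id)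
       (auto simp: E_def)
  obtain p where p: "p \<in> E" "\<And>q. q \<in> E \<Longrightarrow> ?q p \<le> ?q q"
    using continuous_attains_inf[OF cE E0 cont] by blast
  obtain p' where p': "p' \<in> E" "\<And>q. q \<in> E \<Longrightarrow> ?q q \<le> ?q p'"
    using continuous_attains_sup[OF cE E0 cont] by blast
  have "fst p \<in> C" "snd p \<noteq> 0" using p(1) by (auto simp: E_def)
  then have pos: "0 < ?q p" by (rule assms(3))
  have *: "?q p * (norm v)\<^sup>2 \<le> Qf (G y) v" "Qf (G y) v \<le> ?q p' * (norm v)\<^sup>2" if y: "y \<in> C" for y v
  proof -
    have "?q p * (norm v)\<^sup>2 \<le> Qf (G y) v \<and> Qf (G y) v \<le> ?q p' * (norm v)\<^sup>2"
    proof (cases "v = 0")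
      case False
      define w where "w = (1 / norm v) *\<^sub>R v"
      have w: "(y, w) \<in> E" "v = norm v *\<^sub>R w" using False y by (auto simp: E_def w_def)
      have "Qf (G y) v = (norm v)\<^sup>2 * Qf (G y) w" by (subst w(2)) (rule Qf_scaleR)
      then show ?thesis
        using mult_right_mono[OF p(2)[OF w(1)] zero_le_power2[of "norm v"]]
          mult_right_mono[OF p'(2)[OF w(1)] zero_le_power2[of "norm v"]] by (simp add: mult.commute)
    qed (simp add: Qf_zero)
    then show "?q p * (norm v)\<^sup>2 \<le> Qf (G y) v" "Qf (G y) v \<le> ?q p' * (norm v)\<^sup>2" by auto
  qed
  show ?thesis
    by (rule that[of "?q p" "?q p'"]) (use pos p'(2)[OF p(1)] * in auto)
qed

text \<open>The integrating factor exp (k * t) makes \<open>w\<close> non-increasing, whatever the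
  signs of k and h.\<close>

lemma decay_bound:
  fixes h :: "real \<Rightarrow> real"
  assumes der: "\<And>t. t \<ge> 0 \<Longrightarrow> (h has_vector_derivative h' t) (at t within {0..})"
    and le: "\<And>t. t \<ge> 0 \<Longrightarrow> h' t \<le> - k * h t" and t: "t \<ge> 0"
  shows "h t \<le> exp (- k * t) * h 0"
proof -
  define w where "w = (\<lambda>t. exp (k * t) * h t)"
  have cont: "continuous_on {0..} h"
    unfolding continuous_on_eq_continuous_within
    by (intro ballI has_vector_derivative_continuous[OF der]) simp
  have "w t \<le> w 0"
  proof (rule DERIV_nonpos_imp_decreasing_open[where f = w and a = 0 and b = t])
    show "continuous_on {0..t} w"
      unfolding w_def by (intro continuous_intros continuous_on_subset[OF cont]) auto
    fix s assume s: "0 < s" "s < t"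
    have "(h has_vector_derivative h' s) (at s)"
      using der[of s] at_within_interior[of s "{0..}"] s by simp
    then have d: "(h has_real_derivative h' s) (at s)"
      by (simp add: has_real_derivative_iff_has_vector_derivative)
    have "(w has_real_derivative (exp (k * s) * h' s + exp (k * s) * k * h s)) (at s)"
      unfolding w_def by (rule derivative_eq_intros d refl | simp)+
    moreover have "exp (k * s) * h' s + exp (k * s) * k * h s \<le> 0"
      using mult_left_mono[OF le[of s] exp_ge_zero[of "k * s"]] s by (simp add: algebra_simps)
    ultimately show "\<exists>y. (w has_real_derivative y) (at s) \<and> y \<le> 0" by blast
  qed (use t in auto)
  then have "exp (k * t) * h t \<le> h 0" by (simp add: w_def)
  then show ?thesis by (simp add: exp_minus field_simps)
qed

text \<open>\<open>gt 0\<close> is known to equal \<open>g\<close> on chart ranges only. As the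
  Ricci tensor contains derivatives, it is transferred by agreement on an open set.\<close>

lemma ricci_cong:
  fixes G H :: "complex^'n \<Rightarrow> complex^'n^'n"
  assumes "open S" "x \<in> S" "\<And>y. y \<in> S \<Longrightarrow> G y = H y"
  shows "ricci G x = ricci H x"
proof -
  have 1: "dz k (\<lambda>y. G y $ i $ j) y = dz k (\<lambda>y. H y $ i $ j) y"
    "dzbar k (\<lambda>y. G y $ i $ j) y = dzbar k (\<lambda>y. H y $ i $ j) y" if "y \<in> S" for i j k y
    by (rule dz_cong[OF assms(1) that] dzbar_cong[OF assms(1) that], simp add: assms(3))+
  have 2: "dz k (dzbar l (\<lambda>y. G y $ i $ j)) x = dz k (dzbar l (\<lambda>y. H y $ i $ j)) x" for i j k l
    by (rule dz_cong[OF assms(1,2)]) (rule 1(2))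
  show ?thesis
    using assms(3)[OF assms(2)] by (simp add: ricci_def curvature_def 1[OF assms(2)] 2)
qed

lemma herm_form_pullback:
  assumes "\<And>i j. H $ i $ j = (\<Sum>k\<in>UNIV. \<Sum>l\<in>UNIV. D i k * G $ k $ l * cnj (D j l))"
  shows "herm_form H v = herm_form G (\<chi> k. \<Sum>i\<in>UNIV. v $ i * D i k)"
proof -
  have "herm_form G (\<chi> k. \<Sum>i\<in>UNIV. v $ i * D i k)
    = (\<Sum>k\<in>UNIV. \<Sum>l\<in>UNIV. \<Sum>i\<in>UNIV. \<Sum>j\<in>UNIV. D i k * G $ k $ l * cnj (D j l) * v $ i * cnj (v $ j))"
    by (simp add: herm_form_def sum_distrib_left sum_distrib_right sum_product mult_ac)
  also have "\<dots> = (\<Sum>k\<in>UNIV. \<Sum>i\<in>UNIV. \<Sum>l\<in>UNIV. \<Sum>j\<in>UNIV. D i k * G $ k $ l * cnj (D j l) * v $ i * cnj (v $ j))"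
    by (intro sum.cong refl sum.swap)
  also have "\<dots> = (\<Sum>i\<in>UNIV. \<Sum>k\<in>UNIV. \<Sum>l\<in>UNIV. \<Sum>j\<in>UNIV. D i k * G $ k $ l * cnj (D j l) * v $ i * cnj (v $ j))"
    by (rule sum.swap)
  also have "\<dots> = (\<Sum>i\<in>UNIV. \<Sum>k\<in>UNIV. \<Sum>j\<in>UNIV. \<Sum>l\<in>UNIV. D i k * G $ k $ l * cnj (D j l) * v $ i * cnj (v $ j))"
    by (intro sum.cong refl sum.swap)
  also have "\<dots> = (\<Sum>i\<in>UNIV. \<Sum>j\<in>UNIV. \<Sum>k\<in>UNIV. \<Sum>l\<in>UNIV. D i k * G $ k $ l * cnj (D j l) * v $ i * cnj (v $ j))"
    by (intro sum.cong refl sum.swap)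
  also have "\<dots> = herm_form H v"
    by (simp add: herm_form_def assms sum_distrib_right)
  finally show ?thesis by simp
qed

text \<open>By Cauchy's estimate, time derivatives of holomorphic maps commute with complex derivatives.\<close>

lemma cjac_time_derivative:
  fixes \<psi> W :: "real \<Rightarrow> complex^'n \<Rightarrow> complex^'n"
  assumes r: "r > 0" and \<psi>: "\<And>t. t \<in> {0..T} \<Longrightarrow> holomorphic_vec_on (\<psi> t) (ball x r)"
    and W: "\<And>t. t \<in> {0..T} \<Longrightarrow> holomorphic_vec_on (W t) (ball x r)"
    and der: "\<And>t z. t \<in> {0..T} \<Longrightarrow> z \<in> ball x r \<Longrightarrow> ((\<lambda>s. \<psi> s z) has_vector_derivative W t z) (at t within {0..T})"
    and unif: "\<And>s t z. s \<in> {0..T} \<Longrightarrow> t \<in> {0..T} \<Longrightarrow> z \<in> ball x r \<Longrightarrow> norm (W s z - W t z) \<le> L * \<bar>s - t\<bar>"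
    and t: "t \<in> {0..T}"
  shows "((\<lambda>s. cjac (\<psi> s) x v) has_vector_derivative cjac (W t) x v) (at t within {0..T})"
proof -
  have xb: "x \<in> ball x r" using r by simp
  have L: "L * \<bar>s - t\<bar> \<ge> 0" if "s \<in> {0..T}" for s
    using unif[OF that t xb] norm_ge_zero order_trans by blast
  \<comment> \<open>The remainder of the first-order expansion in time is O((s - t)^2) uniformly in
    z; this uniformity is what allows Cauchy's estimate to differentiate it in z.\<close>
  have key: "norm (\<psi> s z - \<psi> t z - (s - t) *\<^sub>R W t z) \<le> (L * \<bar>s - t\<bar>) * \<bar>s - t\<bar>"
    if s: "s \<in> {0..T}" and z: "z \<in> ball x r" for s z
  proof -
    \<comment> \<open>The segment treats s < t and t < s alike.\<close>
    define I where "I = closed_segment t s"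
    have I: "I \<subseteq> {0..T}" using s t by (auto simp: I_def closed_segment_eq_real_ivl)
    let ?k = "\<lambda>u. \<psi> u z - u *\<^sub>R W t z"
    have "norm (?k s - ?k t) \<le> (L * \<bar>s - t\<bar>) * norm (s - t)"
    proof (rule differentiable_bound[of I ?k "\<lambda>u h. h *\<^sub>R (W u z - W t z)"])
      show "convex I" "s \<in> I" "t \<in> I" by (auto simp: I_def)
      fix u assume u: "u \<in> I"
      then have uT: "u \<in> {0..T}" using I by blast
      have "((\<lambda>s. \<psi> s z) has_derivative (\<lambda>h. h *\<^sub>R W u z)) (at u within I)"
        using has_derivative_subset[OF der[OF uT z, unfolded has_vector_derivative_def] I] .
      from has_derivative_diff[OF this bounded_linear_imp_has_derivative[OF bounded_linear_scaleR_left]]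
      show "(?k has_derivative (\<lambda>h. h *\<^sub>R (W u z - W t z))) (at u within I)"
        by (simp add: scaleR_diff_right)
      show "onorm (\<lambda>h. h *\<^sub>R (W u z - W t z)) \<le> L * \<bar>s - t\<bar>"
      proof (rule onorm_le)
        fix h :: real
        have "\<bar>u - t\<bar> \<le> \<bar>s - t\<bar>" using u by (auto simp: I_def closed_segment_eq_real_ivl split: if_splits)
        moreover have "L \<ge> 0" if "u \<noteq> t"
          using L[OF uT] that by (simp add: zero_le_mult_iff)
        ultimately have "L * \<bar>u - t\<bar> \<le> L * \<bar>s - t\<bar>"
          using L[OF s] by (cases "u = t") (auto intro: mult_left_mono)
        then have "norm (W u z - W t z) \<le> L * \<bar>s - t\<bar>" using unif[OF uT t z] by linarith
        from mult_left_mono[OF this abs_ge_zero[of h]]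
        show "norm (h *\<^sub>R (W u z - W t z)) \<le> L * \<bar>s - t\<bar> * norm h" by (simp add: mult.commute)
      qed
    qed
    then show ?thesis by (simp add: algebra_simps)
  qed
  have comp: "((\<lambda>s. FD (\<lambda>z. \<psi> s z $ k) x v) has_vector_derivative FD (\<lambda>z. W t z $ k) x v) (at t within {0..T})" for k
    unfolding has_vector_derivative_def has_derivative_within'
  proof (intro conjI allI impI)
    show "bounded_linear (\<lambda>h. h *\<^sub>R FD (\<lambda>z. W t z $ k) x v)" by (rule bounded_linear_scaleR_left)
    fix e :: real assume e: "e > 0"
    \<comment> \<open>Cauchy's estimate on the ball of radius r / 2 costs the factor norm v * 2 / r;
      the summand 1 keeps c positive.\<close>
    define c where "c = \<bar>L\<bar> * norm v * 2 / r + 1"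
    have c: "c > 0" using r by (simp add: c_def add_nonneg_pos)
    define d where "d = e / c"
    have d: "d > 0" using e c by (simp add: d_def)
    have "norm (FD (\<lambda>z. \<psi> s z $ k) x v - FD (\<lambda>z. \<psi> t z $ k) x v - (s - t) *\<^sub>R FD (\<lambda>z. W t z $ k) x v) / norm (s - t) < e"
      if s: "s \<in> {0..T}" "0 < norm (s - t)" "norm (s - t) < d" for s
    proof -
      have h1: "holo_on (\<lambda>z. \<psi> s z $ k) (ball x r)" "holo_on (\<lambda>z. \<psi> t z $ k) (ball x r)" "holo_on (\<lambda>z. W t z $ k) (ball x r)"
        using holomorphic_vec_on_nth[OF \<psi>] holomorphic_vec_on_nth[OF W] s t by auto
      let ?m = "\<lambda>z. complex_of_real (s - t) * (W t z $ k)"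
      have h2: "holo_on ?m (ball x r)" by (intro holo_on_mult holo_on_const h1)
      let ?E = "\<lambda>z. \<psi> s z $ k - \<psi> t z $ k - ?m z"
      have h3: "holo_on ?E (ball x r)" by (intro holo_on_diff h1 h2)
      have "norm (FD ?E x v) \<le> (\<bar>L\<bar> * \<bar>s - t\<bar> * \<bar>s - t\<bar>) / (r/2) * norm v"
      proof (rule holo_on_Cauchy_bound[OF h3])
        show "cball x (r/2) \<subseteq> ball x r" "r / 2 > 0" using r by auto
        fix w assume "w \<in> cball x (r/2)"
        then have w: "w \<in> ball x r" using r by auto
        have "norm (?E w) \<le> norm (\<psi> s w - \<psi> t w - (s - t) *\<^sub>R W t w)"
        proof -
          have "?E w = (\<psi> s w - \<psi> t w - (s - t) *\<^sub>R W t w) $ k"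
            unfolding scaleR_smult vector_minus_component vector_smult_component ..
          then show ?thesis by (simp only: Finite_Cartesian_Product.norm_nth_le)
        qed
        also have "\<dots> \<le> (L * \<bar>s - t\<bar>) * \<bar>s - t\<bar>" by (rule key[OF s(1) w])
        also have "\<dots> \<le> \<bar>L\<bar> * \<bar>s - t\<bar> * \<bar>s - t\<bar>" by (intro mult_right_mono) auto
        finally show "norm (?E w) \<le> \<bar>L\<bar> * \<bar>s - t\<bar> * \<bar>s - t\<bar>" .
      qed
      moreover have "FD ?E x v = FD (\<lambda>z. \<psi> s z $ k) x v - FD (\<lambda>z. \<psi> t z $ k) x v - (s - t) *\<^sub>R FD (\<lambda>z. W t z $ k) x v"
        using holo_on_FD_diff[OF holo_on_diff[OF h1(1,2)] h2 xb, of v] holo_on_FD_diff[OF h1(1,2) xb, of v]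
          FD_cmult[OF holo_on_differentiable[OF h1(3) xb], of "complex_of_real (s - t)" v]
        by (simp add: scaleR_conv_of_real)
      moreover have "(\<bar>L\<bar> * \<bar>s - t\<bar> * \<bar>s - t\<bar>) / (r/2) * norm v = (\<bar>L\<bar> * norm v * 2 / r * \<bar>s - t\<bar>) * norm (s - t)"
        unfolding real_norm_def by (simp only: divide_inverse inverse_mult_distrib inverse_inverse_eq mult_ac)
      ultimately have "norm (FD (\<lambda>z. \<psi> s z $ k) x v - FD (\<lambda>z. \<psi> t z $ k) x v - (s - t) *\<^sub>R FD (\<lambda>z. W t z $ k) x v)
          \<le> (\<bar>L\<bar> * norm v * 2 / r * \<bar>s - t\<bar>) * norm (s - t)"
        by (simp only:)
      then have "norm (FD (\<lambda>z. \<psi> s z $ k) x v - FD (\<lambda>z. \<psi> t z $ k) x v - (s - t) *\<^sub>R FD (\<lambda>z. W t z $ k) x v) / norm (s - t)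
          \<le> \<bar>L\<bar> * norm v * 2 / r * \<bar>s - t\<bar>"
        using s(2) by (simp only: pos_divide_le_eq)
      also have "\<dots> \<le> c * \<bar>s - t\<bar>" by (intro mult_right_mono) (auto simp: c_def)
      also have "\<dots> < e" using s(3) c by (simp add: d_def pos_less_divide_eq mult.commute)
      finally show ?thesis .
    qed
    then show "\<exists>d>0. \<forall>x'\<in>{0..T}. 0 < norm (x' - t) \<and> norm (x' - t) < d \<longrightarrow>
        norm (FD (\<lambda>z. \<psi> x' z $ k) x v - FD (\<lambda>z. \<psi> t z $ k) x v - (x' - t) *\<^sub>R FD (\<lambda>z. W t z $ k) x v) / norm (x' - t) < e"
      using d by blast
  qed
  show ?thesis
    unfolding has_vector_derivative_def
  proof (rule has_derivative_vec)
    fix k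
    have e1: "cjac (\<psi> s) x v $ k = FD (\<lambda>z. \<psi> s z $ k) x v" if "s \<in> {0..T}" for s
      by (simp add: cjac_nth holo_on_FD_dz[OF holomorphic_vec_on_nth[OF \<psi>[OF that]] xb])
    have e2: "cjac (W t) x v $ k = FD (\<lambda>z. W t z $ k) x v"
      by (simp add: cjac_nth holo_on_FD_dz[OF holomorphic_vec_on_nth[OF W[OF t]] xb])
    have "((\<lambda>s. cjac (\<psi> s) x v $ k) has_vector_derivative FD (\<lambda>z. W t z $ k) x v) (at t within {0..T})"
      by (rule has_vector_derivative_transform[OF t _ comp]) (rule e1)
    then show "((\<lambda>s. cjac (\<psi> s) x v $ k) has_derivative (\<lambda>h. (h *\<^sub>R cjac (W t) x v) $ k)) (at t within {0..T})"
      by (simp add: has_vector_derivative_def e2)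
  qed
qed

section \<open>Kaehler manifolds and solitons\<close>

lemma Qf_matrix_add: "Qf (G + H) v = Qf G v + Qf H v"
  and Qf_matrix_diff: "Qf (G - H) v = Qf G v - Qf H v"
  and Qf_matrix_minus: "Qf (- G) v = - Qf G v"
  and Qf_matrix_scaleR: "Qf (r *\<^sub>R G) v = r * Qf G v"
  using linear_add[OF bounded_linear.linear[OF Qf_linear], of G H v]
    linear_diff[OF bounded_linear.linear[OF Qf_linear], of G H v]
    linear_neg[OF bounded_linear.linear[OF Qf_linear], of G v]
    linear_scale[OF bounded_linear.linear[OF Qf_linear], of r G v]
  by simp_all

locale kaehler_mfd = cmanifold X A for X :: "'a topology" and A :: "('a, 'n::finite) chart set" +
  fixes g :: "('a, 'n) herm_tensor"
  assumes kaehler: "kaehler_metric A g"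
begin

lemma pullback_form:
  assumes "is_pullback A F g h" "c \<in> A" "c' \<in> A" "p \<in> cdom c" "F p \<in> cdom c'"
  shows "herm_form (h c (coord c p)) v
    = herm_form (g c' (coord c' (F p))) (cjac (local_expr c c' F) (coord c p) v)"
  unfolding cjac_def
  by (rule herm_form_pullback) (use assms in \<open>simp add: is_pullback_def\<close>)

lemma g_pullback_id: "is_pullback A id g g"
  using kaehler by (simp add: kaehler_metric_def)

lemma g_herm_pos: "c \<in> A \<Longrightarrow> x \<in> coord_range c \<Longrightarrow> herm_pos (g c x)"
  using kaehler by (simp add: kaehler_metric_def)

lemma g_hermitian: "c \<in> A \<Longrightarrow> x \<in> coord_range c \<Longrightarrow> hermitian (g c x)"
  using g_herm_pos by (simp add: herm_pos_def)

lemma g_pos: "c \<in> A \<Longrightarrow> x \<in> coord_range c \<Longrightarrow> v \<noteq> 0 \<Longrightarrow> 0 < Qf (g c x) v"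
  using g_herm_pos[of c x] by (simp add: herm_pos_def)

lemma g_nonneg: "c \<in> A \<Longrightarrow> x \<in> coord_range c \<Longrightarrow> 0 \<le> Qf (g c x) v"
  using g_pos[of c x v] by (cases "v = 0") (auto simp: Qf_zero)

lemma g_smooth: "c \<in> A \<Longrightarrow> smooth_on (g c) (coord_range c)"
  using kaehler by (simp add: kaehler_metric_def)

lemma g_closed:
  "c \<in> A \<Longrightarrow> x \<in> coord_range c \<Longrightarrow> dz k (\<lambda>y. g c y $ i $ j) x = dz i (\<lambda>y. g c y $ k $ j) x"
  using kaehler by (simp add: kaehler_metric_def)

lemma g_nth_smooth: 
  assumes "c \<in> A" shows "smooth_on (\<lambda>x. g c x $ i $ j) (coord_range c)"
proof -
  have "bounded_linear (\<lambda>H::complex^'n^'n. H $ i $ j)"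
    using bounded_linear_compose[OF bounded_linear_vec_nth bounded_linear_vec_nth] .
  from smooth_on_linear[OF range_open[OF assms] this g_smooth[OF assms]] show ?thesis .
qed

lemma g_continuous: "c \<in> A \<Longrightarrow> continuous_on (coord_range c) (g c)"
  using smooth_on_continuous[OF g_smooth] .

lemma g_bounds_on_compact:
  assumes "c \<in> A" "compact C" "C \<subseteq> coord_range c"
  obtains m K where "m > 0" "K > 0" "\<And>y v. y \<in> C \<Longrightarrow> m * (norm v)\<^sup>2 \<le> Qf (g c y) v"
    "\<And>y v. y \<in> C \<Longrightarrow> Qf (g c y) v \<le> K * (norm v)\<^sup>2"
proof (rule Qf_bounds_on_compact[OF assms(2), of "g c"])
  show "continuous_on C (g c)" by (rule continuous_on_subset[OF g_continuous[OF assms(1)] assms(3)])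
  show "0 < Qf (g c y) v" if "y \<in> C" "v \<noteq> 0" for y v
    using g_pos[OF assms(1) _ that(2)] that(1) assms(3) by blast
qed (rule that)

text \<open>The coordinate expressions compose only where F1 lands in the part of the middle chart
  that F2 maps into the last one, so the chain rule is applied on the open set S of such
  points.\<close>

lemma cjac_local_expr_compose:
  assumes F1: "holomorphic_map X A X A F1" and F2: "holomorphic_map X A X A F2"
    and F: "\<And>q. q \<in> topspace X \<Longrightarrow> F q = F2 (F1 q)"
    and c: "c \<in> A" "c' \<in> A" "c'' \<in> A" and p: "p \<in> cdom c" "F1 p \<in> cdom c'" "F2 (F1 p) \<in> cdom c''"
  shows "cjac (local_expr c c'' F) (coord c p) v
    = cjac (local_expr c' c'' F2) (coord c' (F1 p)) (cjac (local_expr c c' F1) (coord c p) v)"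
proof -
  define T where "T = coord c' ` {q \<in> cdom c'. F2 q \<in> cdom c''}"
  define D where "D = coord c ` {q \<in> cdom c. F1 q \<in> cdom c'}"
  note D = holomorphic_map_local_expr[OF F1 c(1,2), folded D_def]
    and T = holomorphic_map_local_expr[OF F2 c(2,3), folded T_def]
  define S where "S = {x \<in> D. local_expr c c' F1 x \<in> T}"
  have S: "open S"
    using continuous_open_preimage[OF holomorphic_vec_on_continuous[OF D(2)] D(1) T(1)]
    by (simp add: S_def Int_def vimage_def)
  have x: "coord c p \<in> S"
    using p by (auto simp: S_def D_def T_def local_expr_coord[OF c(1)])
  have eq: "local_expr c c'' F y = local_expr c' c'' F2 (local_expr c c' F1 y)" if "y \<in> S" for y
  proof -
    obtain q where q: "q \<in> cdom c" "F1 q \<in> cdom c'" "y = coord c q" using \<open>y \<in> S\<close> by (auto simp: S_def D_def)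
    then have "q \<in> topspace X" using cdom_subset[OF c(1)] by blast
    then show ?thesis using q by (simp add: local_expr_coord c F)
  qed
  have "cjac (local_expr c c'' F) (coord c p) v
      = cjac (\<lambda>y. local_expr c' c'' F2 (local_expr c c' F1 y)) (coord c p) v"
    using cjac_cong[OF S x eq] by simp
  also have "\<dots> = cjac (local_expr c' c'' F2) (local_expr c c' F1 (coord c p)) (cjac (local_expr c c' F1) (coord c p) v)"
    by (rule cjac_compose[OF T(2) holomorphic_vec_on_subset[OF D(2)] _ x]) (auto simp: S_def)
  finally show ?thesis by (simp add: local_expr_coord[OF c(1) p(1)])
qed

end

section \<open>The flow and the pulled-back metrics\<close>

locale kr_soliton = kaehler_mfd X A g for X :: "'a topology" and A :: "('a, 'n::finite) chart set" and g +
  fixes \<rho> :: real and V :: "('a, 'n) vfield" and \<phi> :: "real \<Rightarrow> 'a \<Rightarrow> 'a"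
    and gt :: "real \<Rightarrow> ('a, 'n) herm_tensor"
  assumes vfield: "holomorphic_vfield A V" and flow: "is_flow X A V \<phi>"
    and biholo: "\<And>t. t \<ge> 0 \<Longrightarrow> biholomorphism X A X A (\<phi> t)"
    and pullback: "\<And>t. t \<ge> 0 \<Longrightarrow> is_pullback A (\<phi> t) g (gt t)"
    and gt_0: "\<And>c x. c \<in> A \<Longrightarrow> x \<in> coord_range c \<Longrightarrow> gt 0 c x = g c x"
    and kr: "kr_flow A \<rho> gt"
begin

lemma V_holo: "c \<in> A \<Longrightarrow> holomorphic_vec_on (V c) (coord_range c)"
  using vfield by (simp add: holomorphic_vfield_def)

lemma phi_0: "p \<in> topspace X \<Longrightarrow> \<phi> 0 p = p"
  using flow by (simp add: is_flow_def)

lemma phi_flow_line: "p \<in> topspace X \<Longrightarrow> flow_line V (\<lambda>t. \<phi> t p)"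
  using flow by (simp add: is_flow_def flow_line_def)

lemma phi_holo: "t \<ge> 0 \<Longrightarrow> holomorphic_map X A X A (\<phi> t)"
  using biholo by (simp add: biholomorphism_def)

lemma phi_continuous: "t \<ge> 0 \<Longrightarrow> continuous_map X X (\<phi> t)"
  using phi_holo by (simp add: holomorphic_map_def)

lemma phi_in: "t \<ge> 0 \<Longrightarrow> p \<in> topspace X \<Longrightarrow> \<phi> t p \<in> topspace X"
  using phi_continuous[of t] by (auto simp: continuous_map_def)

text \<open>\<open>is_flow\<close> describes single orbits. The semigroup law follows from
  uniqueness of integral curves, as both sides are orbits starting at \<phi> t p.\<close>

lemma phi_add:
  assumes "s \<ge> 0" "t \<ge> 0" "p \<in> topspace X"
  shows "\<phi> (s + t) p = \<phi> s (\<phi> t p)"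
proof (rule flow_line_unique[of V "\<lambda>s. \<phi> (s + t) p" "\<lambda>s. \<phi> s (\<phi> t p)" s])
  show "flow_line V (\<lambda>s. \<phi> (s + t) p)" by (rule flow_line_shift[OF phi_flow_line[OF assms(3)] assms(2)])
  show "flow_line V (\<lambda>s. \<phi> s (\<phi> t p))" by (rule phi_flow_line[OF phi_in[OF assms(2,3)]])
  show "\<phi> (0 + t) p = \<phi> 0 (\<phi> t p)" using phi_0[OF phi_in[OF assms(2,3)]] by simp
qed (use V_holo assms in auto)

text \<open>The transformation law carries the zero of V to every chart around p, so the constant
  curve is an integral curve and uniqueness applies.\<close>

lemma phi_fixed_of_zero:
  assumes "c \<in> A" "p \<in> cdom c" "V c (coord c p) = 0" "t \<ge> 0"
  shows "\<phi> t p = p"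
proof -
  have pM: "p \<in> topspace X" using assms cdom_subset by blast
  have "flow_line V (\<lambda>_. p)"
    unfolding flow_line_def
  proof (intro conjI allI impI ballI)
    show "continuous_map (top_of_set {0..}) X (\<lambda>_. p)" using pM by simp
    fix s c' assume c': "c' \<in> A" "p \<in> cdom c'"
    have "V c' (coord c' p) $ k = 0" for k
    proof -
      have "V c' (coord c' p) $ k =
          (\<Sum>i\<in>UNIV. dz i (\<lambda>y. local_expr c c' id y $ k) (coord c p) * V c (coord c p) $ i)"
        using vfield assms(1,2) c' by (auto simp: holomorphic_vfield_def)
      then show ?thesis by (simp add: assms(3))
    qed
    then have "V c' (coord c' p) = 0" by (simp add: vec_eq_iff)
    then show "((\<lambda>s. coord c' p) has_vector_derivative V c' (coord c' p)) (at s within {0..})" by simp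
  qed
  from flow_line_unique[OF V_holo phi_flow_line[OF pM] this phi_0[OF pM] assms(4)] show ?thesis .
qed

text \<open>The orbit is constant, and one-sided derivatives at time 0 are unique.\<close>

lemma zero_of_phi_fixed:
  assumes "c \<in> A" "p \<in> cdom c" "\<And>t. t \<ge> 0 \<Longrightarrow> \<phi> t p = p"
  shows "V c (coord c p) = 0"
proof -
  have pM: "p \<in> topspace X" using assms cdom_subset by blast
  have "((\<lambda>s. coord c (\<phi> s p)) has_vector_derivative V c (coord c (\<phi> 0 p))) (at 0 within {0..})"
  proof -
    have "\<phi> 0 p \<in> cdom c" using phi_0[OF pM] assms(2) by simp
    then show ?thesis using phi_flow_line[OF pM] assms(1) unfolding flow_line_def by blast
  qed
  then have "((\<lambda>s. coord c (\<phi> s p)) has_vector_derivative V c (coord c p)) (at 0 within {0..})"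
    by (simp only: phi_0[OF pM])
  then have "((\<lambda>s. coord c p) has_vector_derivative V c (coord c p)) (at 0 within {0..})"
    by (rule has_vector_derivative_transform[rotated 2]) (auto simp: assms(3))
  moreover have "((\<lambda>s. coord c p) has_vector_derivative 0) (at 0 within {0..})" by simp
  moreover have "at (0::real) within {0..} \<noteq> bot" by (simp add: at_within_Ici_at_right)
  ultimately show ?thesis using vector_derivative_unique_within by blast
qed

text \<open>By the semigroup law the metric at time s + t is the pull-back under \<phi> t of the one
  at time s. This moves questions about time t to time 0.\<close>

lemma gt_shift:
  assumes "s \<ge> 0" "t \<ge> 0" "c \<in> A" "c' \<in> A" "p \<in> cdom c" "\<phi> t p \<in> cdom c'"
  shows "herm_form (gt (s + t) c (coord c p)) v
    = herm_form (gt s c' (coord c' (\<phi> t p))) (cjac (local_expr c c' (\<phi> t)) (coord c p) v)"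
proof -
  have pM: "p \<in> topspace X" using assms cdom_subset by blast
  have "\<phi> (s + t) p \<in> topspace X" using phi_in[of "s + t"] assms pM by simp
  then obtain c'' where c'': "c'' \<in> A" "\<phi> (s + t) p \<in> cdom c''" using cover by blast
  have in'': "\<phi> s (\<phi> t p) \<in> cdom c''" using c''(2) phi_add[OF assms(1,2) pM] by simp
  have st: "s + t \<ge> 0" using assms by simp
  have "herm_form (gt (s + t) c (coord c p)) v
     = herm_form (g c'' (coord c'' (\<phi> (s + t) p))) (cjac (local_expr c c'' (\<phi> (s + t))) (coord c p) v)"
    by (rule pullback_form[OF pullback[OF st] assms(3) c''(1) assms(5) c''(2)])
  also have "cjac (local_expr c c'' (\<phi> (s + t))) (coord c p) v
     = cjac (local_expr c' c'' (\<phi> s)) (coord c' (\<phi> t p)) (cjac (local_expr c c' (\<phi> t)) (coord c p) v)"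
    by (rule cjac_local_expr_compose[OF phi_holo[OF assms(2)] phi_holo[OF assms(1)] phi_add[OF assms(1,2)]
          assms(3,4) c''(1) assms(5,6) in''])
  also have "herm_form (g c'' (coord c'' (\<phi> (s + t) p)))
       (cjac (local_expr c' c'' (\<phi> s)) (coord c' (\<phi> t p)) (cjac (local_expr c c' (\<phi> t)) (coord c p) v))
     = herm_form (gt s c' (coord c' (\<phi> t p))) (cjac (local_expr c c' (\<phi> t)) (coord c p) v)"
    using pullback_form[OF pullback[OF assms(1)] assms(4) c''(1) assms(6) in''] phi_add[OF assms(1,2) pM] by simp
  finally show ?thesis .
qed

text \<open>The quadratic form of Ric + 2 \<rho> g: the rate at which the flow shrinks the metric at
  time 0.\<close>

abbreviation RQ :: "('a, 'n) chart \<Rightarrow> complex^'n \<Rightarrow> complex^'n \<Rightarrow> real" where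
  "RQ c x v \<equiv> Qf (ricci (g c) x) v + 2 * \<rho> * Qf (g c x) v"

lemma ricci_gt_0: "c \<in> A \<Longrightarrow> x \<in> coord_range c \<Longrightarrow> ricci (gt 0 c) x = ricci (g c) x"
  by (rule ricci_cong[OF range_open]) (auto simp: gt_0)

lemma Qf_gt_0_derivative:
  assumes "c \<in> A" "x \<in> coord_range c"
  shows "((\<lambda>s. Qf (gt s c x) v) has_vector_derivative - RQ c x v) (at 0 within {0..})"
proof -
  have "((\<lambda>s. gt s c x) has_vector_derivative (- ricci (gt 0 c) x - (2 * \<rho>) *\<^sub>R gt 0 c x)) (at 0 within {0..})"
    using kr assms unfolding kr_flow_def by blast
  from bounded_linear.has_vector_derivative[OF Qf_linear this, of v]
  have "((\<lambda>s. Qf (gt s c x) v) has_vector_derivative Qf (- ricci (g c) x - (2 * \<rho>) *\<^sub>R g c x) v) (at 0 within {0..})"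
    by (simp add: ricci_gt_0[OF assms] gt_0[OF assms])
  moreover have "Qf (- ricci (g c) x - (2 * \<rho>) *\<^sub>R g c x) v = - RQ c x v"
    by (simp add: Qf_matrix_diff Qf_matrix_minus Qf_matrix_scaleR)
  ultimately show ?thesis by simp
qed

text \<open>The semigroup law replaces the naturality of the Ricci tensor under biholomorphisms.\<close>

lemma Qf_gt_derivative:
  assumes t: "t \<ge> 0" and c: "c \<in> A" "c' \<in> A" and p: "p \<in> cdom c" "\<phi> t p \<in> cdom c'"
  shows "((\<lambda>s. Qf (gt s c (coord c p)) v) has_vector_derivative
     - RQ c' (coord c' (\<phi> t p)) (cjac (local_expr c c' (\<phi> t)) (coord c p) v)) (at t within {0..})"
proof -
  let ?x = "coord c p" and ?y = "coord c' (\<phi> t p)"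
  let ?w = "cjac (local_expr c c' (\<phi> t)) ?x v"
  let ?h = "\<lambda>s. Qf (gt s c ?x) v"
  have x: "?x \<in> coord_range c" and y: "?y \<in> coord_range c'" using coord_in_range[of p c] coord_in_range[of "\<phi> t p" c'] p by simp_all
  obtain h' where h': "(?h has_vector_derivative h') (at t within {0..})"
    using bounded_linear.has_vector_derivative[OF Qf_linear, of "\<lambda>s. gt s c ?x"] kr t c(1) x
    unfolding kr_flow_def by blast
  have "(\<lambda>a. a + t) ` {0..} \<subseteq> {0..}" using t by auto
  from has_vector_derivative_within_subset[OF h' this]
  have "((?h \<circ> (\<lambda>s. s + t)) has_vector_derivative 1 *\<^sub>R h') (at 0 within {0..})"
    by (intro vector_diff_chain_within) (auto intro!: derivative_eq_intros)
  then have "((\<lambda>s. ?h (s + t)) has_vector_derivative h') (at 0 within {0..})" by (simp add: o_def)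
  then have "((\<lambda>s. Qf (gt s c' ?y) ?w) has_vector_derivative h') (at 0 within {0..})"
    by (rule has_vector_derivative_transform[rotated 2]) (auto simp: gt_shift[OF _ t c p])
  moreover have "((\<lambda>s. Qf (gt s c' ?y) ?w) has_vector_derivative - RQ c' ?y ?w) (at 0 within {0..})"
    by (rule Qf_gt_0_derivative[OF c(2) y])
  moreover have "at (0::real) within {0..} \<noteq> bot" by (simp add: at_within_Ici_at_right)
  ultimately have "h' = - RQ c' ?y ?w" using vector_derivative_unique_within by blast
  then show ?thesis using h' by simp
qed

lemma Qf_gt:
  assumes "t \<ge> 0" "c \<in> A" "c' \<in> A" "p \<in> cdom c" "\<phi> t p \<in> cdom c'"
  shows "Qf (gt t c (coord c p)) v = Qf (g c' (coord c' (\<phi> t p))) (cjac (local_expr c c' (\<phi> t)) (coord c p) v)"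
  using pullback_form[OF pullback[OF assms(1)] assms(2-5)] by simp

text \<open>With non-negative Ricci curvature \<open>RQ\<close> is at least 2 \<rho> times the
  metric all along the orbit, so \<open>decay_bound\<close> applies with k = 2 \<rho>.\<close>

lemma Qf_gt_decay:
  assumes ric: "\<And>c x v. c \<in> A \<Longrightarrow> x \<in> coord_range c \<Longrightarrow> 0 \<le> Qf (ricci (g c) x) v"
    and t: "t \<ge> 0" and c: "c \<in> A" and x: "x \<in> coord_range c"
  shows "Qf (gt t c x) v \<le> exp (- (2 * \<rho>) * t) * Qf (g c x) v"
proof -
  define p where "p = coord_inv c x"
  have p: "p \<in> cdom c" "coord c p = x" using coord_inv_in_cdom[OF x] coord_coord_inv[OF c x] by (auto simp: p_def)
  have pM: "p \<in> topspace X" using p c cdom_subset by blast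
  have "\<exists>h'. ((\<lambda>s. Qf (gt s c x) v) has_vector_derivative h') (at t within {0..}) \<and> h' \<le> - (2 * \<rho>) * Qf (gt t c x) v"
    if t: "t \<ge> 0" for t
  proof -
    obtain c' where c': "c' \<in> A" "\<phi> t p \<in> cdom c'" using cover phi_in[OF t pM] by blast
    let ?w = "cjac (local_expr c c' (\<phi> t)) (coord c p) v"
    have "- RQ c' (coord c' (\<phi> t p)) ?w \<le> - (2 * \<rho>) * Qf (gt t c x) v"
      using ric[OF c'(1) coord_in_range[OF c'(2)], of ?w] Qf_gt[OF t c c'(1) p(1) c'(2), of v] p(2) by simp
    then show ?thesis using Qf_gt_derivative[OF t c c'(1) p(1) c'(2), of v] p(2) by auto
  qed
  then obtain h' where "\<And>t. t \<ge> 0 \<Longrightarrow> ((\<lambda>s. Qf (gt s c x) v) has_vector_derivative h' t) (at t within {0..})"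
    "\<And>t. t \<ge> 0 \<Longrightarrow> h' t \<le> - (2 * \<rho>) * Qf (gt t c x) v" by metis
  from decay_bound[OF this t] show ?thesis by (simp add: gt_0[OF c x])
qed

lemma phi_local_expr_fixed:
  assumes "c \<in> A" "p \<in> cdom c" "\<phi> t p = p"
  shows "local_expr c c (\<phi> t) (coord c p) = coord c p"
  using assms by (simp add: local_expr_coord)

text \<open>At a fixed point the evolving form is g evaluated at L t v, and positivity of
  \<open>RQ\<close> on the compact unit sphere makes it decay exponentially. Comparing g with the
  Euclidean norm costs a factor K / m, absorbed by a large time T.\<close>

lemma fixed_point_contraction:
  assumes c: "c \<in> A" and p: "p \<in> cdom c" and fixed: "\<And>t. t \<ge> 0 \<Longrightarrow> \<phi> t p = p"
    and pos: "\<And>v. v \<noteq> 0 \<Longrightarrow> 0 < RQ c (coord c p) v"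
  shows "\<exists>T>0. \<forall>v. norm (cjac (local_expr c c (\<phi> T)) (coord c p) v) \<le> norm v / 4"
proof -
  let ?x = "coord c p"
  define L where "L = (\<lambda>t. cjac (local_expr c c (\<phi> t)) ?x)"
  have x: "?x \<in> coord_range c" using coord_in_range[OF p] .
  let ?R = "ricci (g c) ?x + (2 * \<rho>) *\<^sub>R g c ?x"
  have RQ_eq: "Qf ?R v = RQ c ?x v" for v
    by (simp add: Qf_matrix_add Qf_matrix_scaleR)
  obtain m K where m: "m > 0" "K > 0" "\<And>y v. y \<in> {?x} \<Longrightarrow> m * (norm v)\<^sup>2 \<le> Qf (g c y) v"
    "\<And>y v. y \<in> {?x} \<Longrightarrow> Qf (g c y) v \<le> K * (norm v)\<^sup>2"
    using g_bounds_on_compact[OF c, of "{?x}"] x by auto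
  obtain m' K' where m': "m' > 0" "K' > 0" "\<And>y v. y \<in> {?x} \<Longrightarrow> m' * (norm v)\<^sup>2 \<le> Qf ?R v"
    "\<And>y v. y \<in> {?x} \<Longrightarrow> Qf ?R v \<le> K' * (norm v)\<^sup>2"
    by (rule Qf_bounds_on_compact[of "{?x}" "\<lambda>_. ?R"]) (use pos RQ_eq in auto)
  \<comment> \<open>From RQ >= m' |v|^2 and g <= K |v|^2.\<close>
  define k where "k = m' / K"
  have k: "k > 0" using m m' by (simp add: k_def)
  have RQ_ge: "RQ c ?x v \<ge> k * Qf (g c ?x) v" for v
  proof -
    have "k * Qf (g c ?x) v \<le> k * (K * (norm v)\<^sup>2)" using m(4)[of ?x v] k by (intro mult_left_mono) auto
    also have "\<dots> = m' * (norm v)\<^sup>2" using m(2) by (simp add: k_def)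
    also have "\<dots> \<le> RQ c ?x v" using m'(3)[of ?x v] RQ_eq[of v] by simp
    finally show ?thesis .
  qed
  have dec: "Qf (g c ?x) (L t v) \<le> exp (- k * t) * Qf (g c ?x) v" if t: "t \<ge> 0" for t v
  proof -
    let ?h = "\<lambda>s. Qf (gt s c ?x) v"
    have "?h t \<le> exp (- k * t) * ?h 0"
    proof (rule decay_bound[OF _ _ t])
      fix s :: real assume s: "s \<ge> 0"
      show "(?h has_vector_derivative - RQ c ?x (L s v)) (at s within {0..})"
        using Qf_gt_derivative[OF s c c p, of v] p fixed[OF s] by (simp add: L_def)
      show "- RQ c ?x (L s v) \<le> - k * ?h s"
        using RQ_ge[of "L s v"] Qf_gt[OF s c c p, of v] p fixed[OF s] by (simp add: L_def)
    qed
    then show ?thesis using Qf_gt[OF t c c p, of v] p fixed[OF t] by (simp add: L_def gt_0[OF c x])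
  qed
  \<comment> \<open>16 is the square of the factor 4 in the claim, the estimate being made for
    squared norms.\<close>
  have "((\<lambda>t. exp (- k * t) * (16 * K / m)) \<longlongrightarrow> 0) at_top"
    using k by real_asymp
  then have "eventually (\<lambda>t. exp (- k * t) * (16 * K / m) < 1) at_top"
    by (rule order_tendstoD) simp
  then obtain T where T: "T > 0" "exp (- k * T) * (16 * K / m) < 1"
    using eventually_happens[OF eventually_conj[OF _ eventually_gt_at_top[of 0]]] by force
  have "norm (L T v) \<le> norm v / 4" for v
  proof -
    have "m * (norm (L T v))\<^sup>2 \<le> exp (- k * T) * Qf (g c ?x) v"
      using m(3)[of ?x "L T v"] dec[of T v] T(1) by simp
    also have "\<dots> \<le> exp (- k * T) * (K * (norm v)\<^sup>2)"
      using m(4)[of ?x v] by (intro mult_left_mono) auto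
    finally have "(norm (L T v))\<^sup>2 \<le> (exp (- k * T) * (16 * K / m)) * ((norm v)\<^sup>2 / 16)"
      using m(1) by (simp add: field_simps)
    also have "\<dots> \<le> 1 * ((norm v)\<^sup>2 / 16)" using T(2) by (intro mult_right_mono) auto
    finally have "(norm (L T v))\<^sup>2 \<le> (norm v / 4)\<^sup>2" by (simp add: power_divide)
    then show ?thesis by (rule power2_le_imp_le) simp
  qed
  then show ?thesis using T(1) by (auto simp: L_def)
qed

text \<open>A continuity argument: if staying within R up to time \<tau> implies the sharper bound b
  < R at \<tau>, then the sphere of radius R is never reached, by \<open>first_exit\<close>.\<close>

lemma phi_stay:
  assumes c: "c \<in> A" "cball x R \<subseteq> coord_range c" and p: "p \<in> cdom c" "dist x (coord c p) < R"
    and T: "T \<ge> 0" and b: "b < R"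
    and apriori: "\<And>\<tau>. \<tau> \<in> {0..T} \<Longrightarrow> (\<forall>t\<in>{0..\<tau>}. \<phi> t p \<in> cdom c \<and> dist x (coord c (\<phi> t p)) \<le> R) \<Longrightarrow>
       dist x (coord c (\<phi> \<tau> p)) \<le> b"
  shows "\<forall>t\<in>{0..T}. \<phi> t p \<in> cdom c \<and> dist x (coord c (\<phi> t p)) \<le> b"
proof -
  have pM: "p \<in> topspace X" using p c cdom_subset by blast
  have all: "\<phi> t p \<in> cdom c \<and> dist x (coord c (\<phi> t p)) < R" if t: "t \<in> {0..T}" for t
  proof (rule ccontr)
    assume neg: "\<not> ?thesis"
    have cont: "continuous_map (top_of_set {0..T}) X (\<lambda>t. \<phi> t p)"
      using phi_flow_line[OF pM] continuous_map_from_subtopology_mono[of euclidean "{0..}" X _ "{0..T}"]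
      by (simp add: flow_line_def)
    obtain \<tau> where \<tau>: "0 < \<tau>" "\<tau> \<le> T" "\<phi> \<tau> p \<in> cdom c" "dist x (coord c (\<phi> \<tau> p)) = R"
      "\<And>t. 0 \<le> t \<Longrightarrow> t < \<tau> \<Longrightarrow> \<phi> t p \<in> cdom c \<and> dist x (coord c (\<phi> t p)) < R"
      by (rule first_exit[OF c cont T]) (use p phi_0[OF pM] neg t in auto)
    have "\<forall>t\<in>{0..\<tau>}. \<phi> t p \<in> cdom c \<and> dist x (coord c (\<phi> t p)) \<le> R"
    proof
      fix s assume "s \<in> {0..\<tau>}"
      then show "\<phi> s p \<in> cdom c \<and> dist x (coord c (\<phi> s p)) \<le> R"
        using \<tau>(3,4) \<tau>(5)[of s] by (cases "s = \<tau>") auto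
    qed
    from apriori[OF _ this] show False using \<tau>(1,2,4) b by simp
  qed
  show ?thesis
  proof
    fix t assume t: "t \<in> {0..T}"
    have "\<forall>s\<in>{0..t}. \<phi> s p \<in> cdom c \<and> dist x (coord c (\<phi> s p)) \<le> R"
      using all t by (auto intro: less_imp_le)
    from apriori[OF t this] all[OF t] show "\<phi> t p \<in> cdom c \<and> dist x (coord c (\<phi> t p)) \<le> b" by blast
  qed
qed

lemma phi_coord_derivative:
  assumes "c \<in> A" "p \<in> topspace X" "t \<ge> 0" "\<phi> t p \<in> cdom c"
  shows "((\<lambda>s. coord c (\<phi> s p)) has_vector_derivative V c (coord c (\<phi> t p))) (at t within {0..})"
  using phi_flow_line[OF assms(2)] assms by (simp add: flow_line_def)

end

text \<open>If G w = 0, the form vanishes at the conjugate of w, because the second index is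
  contracted with conjugate components; positivity then forces w = 0.\<close>

lemma herm_pos_matrix_inv:
  assumes "herm_pos (G :: complex^'n^'n)"
  shows "matrix_inv G ** G = mat 1" "G ** matrix_inv G = mat 1"
proof -
  have "w = 0" if w: "G *v w = 0" for w
  proof -
    define u where "u = (\<chi> j. cnj (w $ j))"
    have "herm_form G u = (\<Sum>i\<in>UNIV. u $ i * (G *v w) $ i)"
      by (simp add: herm_form_def u_def matrix_vector_mult_def sum_distrib_left mult_ac)
    then have "Qf G u = 0" using w by simp
    then have "u = 0" using assms by (metis herm_pos_def less_irrefl)
    then show "w = 0" by (simp add: u_def vec_eq_iff)
  qed
  then have "\<exists>B. B ** G = mat 1" using matrix_left_invertible_ker by blast
  then have "invertible G" using invertible_left_inverse by blast
  then have "G ** matrix_inv G = mat 1 \<and> matrix_inv G ** G = mat 1"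
    unfolding invertible_def matrix_inv_def by (rule someI_ex)
  then show "matrix_inv G ** G = mat 1" "G ** matrix_inv G = mat 1" by simp_all
qed

lemma (in cmanifold) holomorphic_local_expr_on:
  assumes F: "holomorphic_map X A X A F" and c: "c \<in> A" "c' \<in> A" and S: "S \<subseteq> coord_range c"
    and FS: "\<And>z. z \<in> S \<Longrightarrow> F (coord_inv c z) \<in> cdom c'"
  shows "holomorphic_vec_on (local_expr c c' F) S"
proof (rule holomorphic_vec_on_subset[OF holomorphic_map_local_expr(2)[OF F c]])
  show "S \<subseteq> coord c ` {p \<in> cdom c. F p \<in> cdom c'}"
  proof
    fix z assume z: "z \<in> S"
    then have "z = coord c (coord_inv c z)" "coord_inv c z \<in> cdom c"
      using S coord_coord_inv[OF c(1), of z] coord_inv_in_cdom[of z c] by auto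
    then show "z \<in> coord c ` {p \<in> cdom c. F p \<in> cdom c'}" using FS[OF z] by blast
  qed
qed

section \<open>Gradient solitons near a fixed point of the flow\<close>

locale gradient_soliton = kr_soliton X A g \<rho> V \<phi> gt
  for X :: "'a topology" and A :: "('a, 'n::finite) chart set" and g \<rho> V \<phi> gt +
  fixes f :: "'a \<Rightarrow> real" and a :: real
  assumes f_smooth: "\<And>c. c \<in> A \<Longrightarrow> smooth_on (f \<circ> coord_inv c) (coord_range c)"
    and gradient: "\<And>c x i. c \<in> A \<Longrightarrow> x \<in> coord_range c \<Longrightarrow> V c x $ i = complex_of_real a *
       (\<Sum>j\<in>UNIV. g_up (g c x) i j * dzbar j (\<lambda>y. complex_of_real (f (coord_inv c y))) x)"
begin

definition fc :: "('a, 'n) chart \<Rightarrow> complex^'n \<Rightarrow> complex" where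
  "fc c y = complex_of_real (f (coord_inv c y))"

lemma fc_smooth: "c \<in> A \<Longrightarrow> smooth_on (fc c) (coord_range c)"
  using smooth_on_linear[OF range_open bounded_linear_of_real f_smooth] by (simp add: fc_def[abs_def] o_def)

lemma cnj_fc: "cnj (fc c y) = fc c y"
  by (simp add: fc_def)

text \<open>Multiplying by the metric removes its inverse, so this form can be differentiated with
  only the smoothness of g at hand.\<close>

lemma gradient_lowered:
  assumes "c \<in> A" "x \<in> coord_range c"
  shows "(\<Sum>i\<in>UNIV. V c x $ i * g c x $ i $ k) = complex_of_real a * dzbar k (fc c) x"
proof -
  let ?H = "matrix_inv (g c x)" and ?d = "\<lambda>j. dzbar j (fc c) x"
  have inv: "(\<Sum>i\<in>UNIV. ?H $ j $ i * g c x $ i $ k) = (if j = k then 1 else 0)" for j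
    using arg_cong[OF herm_pos_matrix_inv(1)[OF g_herm_pos[OF assms]], of "\<lambda>M. M $ j $ k"]
    by (simp add: matrix_matrix_mult_def mat_def)
  have "(\<Sum>i\<in>UNIV. V c x $ i * g c x $ i $ k)
    = (\<Sum>i\<in>UNIV. \<Sum>j\<in>UNIV. complex_of_real a * (?d j * (?H $ j $ i * g c x $ i $ k)))"
    by (simp add: gradient[OF assms] g_up_def fc_def[abs_def] sum_distrib_left sum_distrib_right mult_ac)
  also have "\<dots> = (\<Sum>j\<in>UNIV. complex_of_real a * (?d j * (\<Sum>i\<in>UNIV. ?H $ j $ i * g c x $ i $ k)))"
    by (subst sum.swap) (simp add: sum_distrib_left)
  also have "\<dots> = complex_of_real a * ?d k"
    by (simp add: inv if_distrib cong: if_cong)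
  finally show ?thesis .
qed

text \<open>The uniform Lipschitz condition in \<open>cjac_time_derivative\<close> holds with
  constant K * B: V is K-Lipschitz on the ball, and orbits move there with speed at most B.\<close>

lemma flow_jac_derivative:
  assumes c: "c \<in> A" "cball x R \<subseteq> coord_range c" and r: "0 < r" "r \<le> R"
    and stay: "\<And>z t. z \<in> ball x r \<Longrightarrow> t \<in> {0..T} \<Longrightarrow>
       \<phi> t (coord_inv c z) \<in> cdom c \<and> coord c (\<phi> t (coord_inv c z)) \<in> cball x R"
    and t: "t \<in> {0..T}"
  shows "((\<lambda>s. cjac (local_expr c c (\<phi> s)) x v) has_vector_derivative
     cjac (\<lambda>z. V c (local_expr c c (\<phi> t) z)) x v) (at t within {0..T})"
proof -
  let ?\<psi> = "\<lambda>t. local_expr c c (\<phi> t)"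
  have \<psi>: "?\<psi> t z = coord c (\<phi> t (coord_inv c z))" for t z by (simp add: local_expr_def)
  have br: "ball x r \<subseteq> coord_range c" using c(2) r by (auto simp: subset_iff)
  have hol: "holomorphic_vec_on (?\<psi> t) (ball x r)" if "t \<in> {0..T}" for t
    by (rule holomorphic_local_expr_on[OF phi_holo c(1) c(1) br]) (use stay that in auto)
  have img: "?\<psi> t ` ball x r \<subseteq> cball x R" if "t \<in> {0..T}" for t using stay[OF _ that] \<psi> by auto
  have W: "holomorphic_vec_on (\<lambda>z. V c (?\<psi> t z)) (ball x r)" if t: "t \<in> {0..T}" for t
    by (rule holomorphic_vec_on_compose[OF V_holo[OF c(1)] hol[OF t]]) (use img[OF t] c(2) in blast)
  obtain K where K: "K > 0" "\<And>y z. y \<in> cball x R \<Longrightarrow> z \<in> cball x R \<Longrightarrow> norm (V c y - V c z) \<le> K * norm (y - z)"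
    using holomorphic_vec_on_Lipschitz[OF range_open[OF c(1)] V_holo[OF c(1)] c(2)] by blast
  have "bounded (V c ` cball x R)"
    by (rule compact_imp_bounded, rule compact_continuous_image)
       (use continuous_on_subset[OF holomorphic_vec_on_continuous[OF V_holo[OF c(1)]] c(2)] in auto)
  then obtain B where B: "B > 0" "\<And>y. y \<in> cball x R \<Longrightarrow> norm (V c y) \<le> B"
    unfolding bounded_pos by blast
  have der: "((\<lambda>s. ?\<psi> s z) has_vector_derivative V c (?\<psi> t z)) (at t within {0..T})"
    if t: "t \<in> {0..T}" and z: "z \<in> ball x r" for t z
  proof -
    have "coord_inv c z \<in> topspace X" using br z coord_inv_in_cdom[of z c] cdom_subset[OF c(1)] by blast
    from phi_coord_derivative[OF c(1) this _ conjunct1[OF stay[OF z t]]] t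
    show ?thesis unfolding \<psi> by (auto intro: has_vector_derivative_within_subset)
  qed
  have lip: "norm (?\<psi> s z - ?\<psi> t z) \<le> B * \<bar>s - t\<bar>"
    if st: "s \<in> {0..T}" "t \<in> {0..T}" and z: "z \<in> ball x r" for s t z
  proof -
    have "norm (?\<psi> s z - ?\<psi> t z) \<le> B * norm (s - t)"
    proof (rule differentiable_bound[of "{0..T}" "\<lambda>s. ?\<psi> s z" "\<lambda>u h. h *\<^sub>R V c (?\<psi> u z)"])
      show "((\<lambda>s. ?\<psi> s z) has_derivative (\<lambda>h. h *\<^sub>R V c (?\<psi> u z))) (at u within {0..T})" if "u \<in> {0..T}" for u
        using der[OF that z] by (simp add: has_vector_derivative_def)
      show "onorm (\<lambda>h. h *\<^sub>R V c (?\<psi> u z)) \<le> B" if u: "u \<in> {0..T}" for u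
      proof (rule onorm_le)
        fix h :: real
        have "norm (V c (?\<psi> u z)) \<le> B" using B(2) img[OF u] z by blast
        from mult_left_mono[OF this abs_ge_zero[of h]] show "norm (h *\<^sub>R V c (?\<psi> u z)) \<le> B * norm h"
          by (simp add: mult.commute)
      qed
    qed (use st in auto)
    then show ?thesis by simp
  qed
  show ?thesis
  proof (rule cjac_time_derivative[where W = "\<lambda>t z. V c (?\<psi> t z)" and L = "K * B", OF r(1) hol W _ _ t])
    fix s t z assume st: "s \<in> {0..T}" "t \<in> {0..T}" and z: "z \<in> ball x r"
    have "norm (V c (?\<psi> s z) - V c (?\<psi> t z)) \<le> K * norm (?\<psi> s z - ?\<psi> t z)"
      by (rule K(2)) (use img st z in blast)+
    also have "\<dots> \<le> K * (B * \<bar>s - t\<bar>)" using lip[OF st z] K(1) by (intro mult_left_mono) auto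
    finally show "norm (V c (?\<psi> s z) - V c (?\<psi> t z)) \<le> K * B * \<bar>s - t\<bar>" by (simp add: mult.assoc)
  qed (use der in auto)
qed

text \<open>Near its zero x the field is bounded by K times the distance from x, so Gronwall limits
  the growth of that distance on [0, T] to a factor E, the square root of the one in
  \<open>Gronwall_sq\<close>. This holds while the orbit is in the ball, and \<open>phi_stay\<close>
  shows that it remains there.\<close>

lemma phi_stay_fixed:
  assumes c: "c \<in> A" "cball x R \<subseteq> coord_range c" "R > 0" and zero: "V c x = 0" and T: "T \<ge> 0"
  shows "\<exists>E\<ge>1. \<forall>z t. norm (z - x) * (2 * E) < R \<longrightarrow> t \<in> {0..T} \<longrightarrow>
     \<phi> t (coord_inv c z) \<in> cdom c \<and> norm (coord c (\<phi> t (coord_inv c z)) - x) \<le> E * norm (z - x)"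
proof -
  obtain K where K: "K > 0" "\<And>y z. y \<in> cball x R \<Longrightarrow> z \<in> cball x R \<Longrightarrow> norm (V c y - V c z) \<le> K * norm (y - z)"
    using holomorphic_vec_on_Lipschitz[OF range_open[OF c(1)] V_holo[OF c(1)] c(2)] by blast
  define E where "E = exp ((2 * K + 1) * T / 2)"
  have E: "E \<ge> 1" using K T by (simp add: E_def)
  have E2: "E\<^sup>2 = exp ((2 * K + 1) * T)" unfolding E_def by (simp flip: exp_double)
  have "\<phi> t (coord_inv c z) \<in> cdom c \<and> norm (coord c (\<phi> t (coord_inv c z)) - x) \<le> E * norm (z - x)"
    if z: "norm (z - x) * (2 * E) < R" and t: "t \<in> {0..T}" for z t
  proof -
    have "norm (z - x) \<le> E * norm (z - x)" using E by (simp add: mult_le_cancel_right1)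
    moreover have bR: "E * norm (z - x) < R"
    proof -
      have "0 \<le> E * norm (z - x)" using E by simp
      moreover have "2 * (E * norm (z - x)) < R" using z by (simp add: mult_ac)
      ultimately show ?thesis by linarith
    qed
    ultimately have "z \<in> cball x R" and dz: "dist x z < R"
      by (auto simp: dist_norm norm_minus_commute)
    then have zr: "z \<in> coord_range c" using c(2) by blast
    define p where "p = coord_inv c z"
    have p: "p \<in> cdom c" "coord c p = z" using coord_inv_in_cdom[OF zr] coord_coord_inv[OF c(1) zr] by (auto simp: p_def)
    have pM: "p \<in> topspace X" using p cdom_subset[OF c(1)] by blast
    have "\<forall>t\<in>{0..T}. \<phi> t p \<in> cdom c \<and> dist x (coord c (\<phi> t p)) \<le> E * norm (z - x)"
    proof (rule phi_stay[OF c(1,2) p(1) _ T bR])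
      show "dist x (coord c p) < R" using dz p(2) by simp
      fix \<tau> assume \<tau>: "\<tau> \<in> {0..T}" and st: "\<forall>t\<in>{0..\<tau>}. \<phi> t p \<in> cdom c \<and> dist x (coord c (\<phi> t p)) \<le> R"
      let ?f = "\<lambda>t. coord c (\<phi> t p) - x"
      have "(norm (?f \<tau>))\<^sup>2 \<le> exp ((2 * K + 1) * \<tau>) * ((norm (?f 0))\<^sup>2 + 0\<^sup>2 * \<tau>)"
      proof (rule Gronwall_sq[where T = \<tau> and f' = "\<lambda>t. V c (coord c (\<phi> t p))" and f = ?f])
        fix t assume t: "t \<in> {0..\<tau>}"
        have "((\<lambda>s. coord c (\<phi> s p)) has_vector_derivative V c (coord c (\<phi> t p))) (at t within {0..\<tau>})"
          by (rule has_vector_derivative_within_subset[OF phi_coord_derivative[OF c(1) pM]]) (use t st in auto)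
        from has_vector_derivative_diff[OF this has_vector_derivative_const]
        show "(?f has_vector_derivative V c (coord c (\<phi> t p))) (at t within {0..\<tau>})" by simp
        show "norm (V c (coord c (\<phi> t p))) \<le> K * norm (?f t) + 0"
          using K(2)[of "coord c (\<phi> t p)" x] st t c(3) by (simp add: zero)
      qed (use \<tau> K in auto)
      then have "(norm (?f \<tau>))\<^sup>2 \<le> exp ((2 * K + 1) * \<tau>) * (norm (z - x))\<^sup>2"
        by (simp add: phi_0[OF pM] p(2))
      also have "\<dots> \<le> exp ((2 * K + 1) * T) * (norm (z - x))\<^sup>2"
        using \<tau> K by (intro mult_right_mono) auto
      also have "\<dots> = (E * norm (z - x))\<^sup>2" by (simp add: E2 power_mult_distrib)
      finally have "norm (?f \<tau>) \<le> E * norm (z - x)" by (rule power2_le_imp_le) (use E in simp)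
      then show "dist x (coord c (\<phi> \<tau> p)) \<le> E * norm (z - x)" by (simp add: dist_norm norm_minus_commute)
    qed
    from bspec[OF this t] show ?thesis by (simp add: p_def dist_norm norm_minus_commute)
  qed
  then show ?thesis using E by blast
qed

text \<open>Collects the functions P j into one map in which V is linear up to order N, with matrix
  B. The relation between B and the Jacobian of V is the first-order part of the vanishing jets; the
  estimate is \<open>jetz_holo_bound\<close>.\<close>

lemma soliton_jets:
  assumes c: "c \<in> A" and x: "x \<in> coord_range c" and zero: "V c x = 0"
  shows "\<exists>P B C r. holomorphic_vec_on P UNIV \<and> P x = 0 \<and> linear B \<and>
     (\<forall>v j. cjac P x v $ j = (\<Sum>i\<in>UNIV. v $ i * g c x $ i $ j)) \<and>
     (\<forall>v. cjac P x (cjac (V c) x v) = B (cjac P x v)) \<and> C \<ge> 0 \<and> r > 0 \<and> cball x r \<subseteq> coord_range c \<and>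
     (\<forall>z\<in>cball x r. norm (cjac P z (V c z) - B (P z)) \<le> C * norm (z - x) ^ N)"
proof -
  let ?S = "coord_range c"
  note S = range_open[OF c] x
  note Vh = holomorphic_vec_on_nth[OF V_holo[OF c]]
  \<comment> \<open>Two orders more than N: the relation \<open>rel\<close> needs the first
    derivatives of h j to vanish at x, also when N = 0.\<close>
  have "\<exists>P :: 'n \<Rightarrow> complex^'n \<Rightarrow> complex. (\<forall>j. holo_on (P j) UNIV \<and> P j x = 0 \<and> (\<forall>i. dz i (P j) x = g c x $ i $ j) \<and>
     jetz (Suc (Suc N)) x (\<lambda>z. (\<Sum>i\<in>UNIV. V c z $ i * dz i (P j) z) - (\<Sum>k\<in>UNIV. cnj (dz j (\<lambda>y. V c y $ k) x) * P k z)))"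
    by (rule gradient_field_jets[where G = "g c" and V = "V c" and u = "fc c" and t = a,
          OF S g_nth_smooth[OF c] g_hermitian[OF c] g_closed[OF c] fc_smooth[OF c] cnj_fc V_holo[OF c] zero gradient_lowered[OF c]])
  then obtain P where P_all: "\<forall>j. holo_on (P j) UNIV \<and> P j x = 0 \<and> (\<forall>i. dz i (P j) x = g c x $ i $ j) \<and>
     jetz (Suc (Suc N)) x (\<lambda>z. (\<Sum>i\<in>UNIV. V c z $ i * dz i (P j) z) - (\<Sum>k\<in>UNIV. cnj (dz j (\<lambda>y. V c y $ k) x) * P k z))"
    by (rule exE)
  then have P: "\<And>j. holo_on (P j) UNIV" "\<And>j. P j x = 0" "\<And>i j. dz i (P j) x = g c x $ i $ j"
    and jet: "\<And>j. jetz (Suc (Suc N)) x (\<lambda>z. (\<Sum>i\<in>UNIV. V c z $ i * dz i (P j) z)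
        - (\<Sum>k\<in>UNIV. cnj (dz j (\<lambda>y. V c y $ k) x) * P k z))"
    by (simp_all del: jetz.simps)
  define b where "b = (\<lambda>j k. cnj (dz j (\<lambda>y. V c y $ k) x))"
  define h where "h = (\<lambda>j z. (\<Sum>i\<in>UNIV. V c z $ i * dz i (P j) z) - (\<Sum>k\<in>UNIV. b j k * P k z))"
  have jet: "jetz (Suc (Suc N)) x (h j)" for j using jet[of j] by (simp only: h_def b_def)
  have PS: "holo_on (P j) ?S" for j using P(1) holo_on_subset by blast
  have dPS: "holo_on (dz i (P j)) ?S" for i j by (rule holo_on_dz_holo[OF S(1) PS])
  have hh: "holo_on (h j) ?S" for j
    unfolding h_def by (intro holo_on_diff holo_on_sum holo_on_mult holo_on_const Vh PS dPS)
  \<comment> \<open>V vanishes at x, so the product rule leaves only the terms with a derivative on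
    V.\<close>
  have rel: "(\<Sum>i\<in>UNIV. dz l (\<lambda>y. V c y $ i) x * g c x $ i $ j) = (\<Sum>k\<in>UNIV. b j k * g c x $ l $ k)" for l j
  proof -
    note d = holo_on_differentiable[OF _ x]
    have d1: "(\<lambda>z. V c z $ i * dz i (P j) z) differentiable (at x)" "(\<lambda>z. b j k * P k z) differentiable (at x)" for i k
      by (rule d[OF holo_on_mult[OF Vh dPS]], rule d[OF holo_on_mult[OF holo_on_const PS]])
    have "0 = dz l (h j) x" using jet[of j] by simp
    also have "\<dots> = dz l (\<lambda>z. \<Sum>i\<in>UNIV. V c z $ i * dz i (P j) z) x - dz l (\<lambda>z. \<Sum>k\<in>UNIV. b j k * P k z) x"
      unfolding h_def
      by (rule dz_diff; rule d; intro holo_on_sum holo_on_mult holo_on_const Vh PS dPS)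
    also have "dz l (\<lambda>z. \<Sum>i\<in>UNIV. V c z $ i * dz i (P j) z) x = (\<Sum>i\<in>UNIV. dz l (\<lambda>z. V c z $ i * dz i (P j) z) x)"
      by (rule dz_sum[OF d1(1)])
    also have "dz l (\<lambda>z. \<Sum>k\<in>UNIV. b j k * P k z) x = (\<Sum>k\<in>UNIV. dz l (\<lambda>z. b j k * P k z) x)"
      by (rule dz_sum[OF d1(2)])
    finally show ?thesis
      by (simp add: dz_mult[OF d[OF Vh] d[OF dPS]] dz_cmult[OF d[OF PS]] P(3) zero)
  qed
  define PP where "PP = (\<lambda>z. \<chi> j. P j z)"
  define B where "B = (\<lambda>w::complex^'n. \<chi> j. \<Sum>k\<in>UNIV. b j k * w $ k)"
  have PPj: "(\<lambda>z. PP z $ j) = P j" for j by (simp add: PP_def)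
  have PPh: "holomorphic_vec_on PP UNIV" using P(1) by (simp add: holomorphic_vec_on_iff PPj)
  have cj: "cjac PP z v $ j = (\<Sum>i\<in>UNIV. v $ i * dz i (P j) z)" for z v j by (simp add: cjac_nth PPj)
  have Blin: "linear B"
    by (rule linearI) (simp_all add: B_def vec_eq_iff algebra_simps sum.distrib scaleR_sum_right)
  have comm: "cjac PP x (cjac (V c) x v) = B (cjac PP x v)" for v
  proof (subst vec_eq_iff, rule allI)
    fix j
    have "cjac PP x (cjac (V c) x v) $ j = (\<Sum>i\<in>UNIV. \<Sum>l\<in>UNIV. v $ l * (dz l (\<lambda>y. V c y $ i) x * g c x $ i $ j))"
      by (simp only: cj P(3)) (simp add: cjac_nth sum_distrib_right mult.assoc)
    also have "\<dots> = (\<Sum>l\<in>UNIV. v $ l * (\<Sum>i\<in>UNIV. dz l (\<lambda>y. V c y $ i) x * g c x $ i $ j))"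
      by (subst sum.swap) (simp add: sum_distrib_left)
    also have "\<dots> = (\<Sum>l\<in>UNIV. \<Sum>k\<in>UNIV. v $ l * (b j k * g c x $ l $ k))"
      by (simp add: rel sum_distrib_left)
    also have "\<dots> = (\<Sum>k\<in>UNIV. \<Sum>l\<in>UNIV. v $ l * (b j k * g c x $ l $ k))" by (rule sum.swap)
    also have "\<dots> = B (cjac PP x v) $ j"
      by (simp add: B_def cj P(3) sum_distrib_left mult_ac)
    finally show "cjac PP x (cjac (V c) x v) $ j = B (cjac PP x v) $ j" .
  qed
  have "\<exists>C r. C \<ge> 0 \<and> r > 0 \<and> cball x r \<subseteq> ?S \<and> (\<forall>w\<in>cball x r. norm (h j w) \<le> C * norm (w - x) ^ N)" for j
    by (rule jetz_holo_bound[OF S hh jetz_mono[OF jet]]) simp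
  then have "\<exists>Cr. fst Cr \<ge> 0 \<and> snd Cr > 0 \<and> cball x (snd Cr) \<subseteq> ?S \<and>
      (\<forall>w\<in>cball x (snd Cr). norm (h j w) \<le> fst Cr * norm (w - x) ^ N)" for j by simp
  then have "\<forall>j. \<exists>Cr. fst Cr \<ge> 0 \<and> snd Cr > 0 \<and> cball x (snd Cr) \<subseteq> ?S \<and>
      (\<forall>w\<in>cball x (snd Cr). norm (h j w) \<le> fst Cr * norm (w - x) ^ N)" by (rule allI)
  from choice[OF this] obtain Cr where Cr: "\<And>j. fst (Cr j) \<ge> 0" "\<And>j. snd (Cr j) > (0::real)" "\<And>j. cball x (snd (Cr j)) \<subseteq> ?S"
     "\<And>j w. w \<in> cball x (snd (Cr j)) \<Longrightarrow> norm (h j w) \<le> fst (Cr j) * norm (w - x) ^ N" by blast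
  define r where "r = Min (range (\<lambda>j. snd (Cr j)))"
  have r: "r > 0" "\<And>j. r \<le> snd (Cr j)" using Cr(2) by (auto simp: r_def)
  have rS: "cball x r \<subseteq> ?S" using Cr(3) r(2) by (meson order_trans subset_cball)
  define C where "C = (\<Sum>j\<in>UNIV. fst (Cr j))"
  have "norm (cjac PP z (V c z) - B (PP z)) \<le> C * norm (z - x) ^ N" if z: "z \<in> cball x r" for z
  proof -
    have "norm (cjac PP z (V c z) - B (PP z)) \<le> (\<Sum>j\<in>UNIV. norm ((cjac PP z (V c z) - B (PP z)) $ j))"
      unfolding norm_vec_def by (rule L2_set_le_sum) simp
    also have "\<dots> \<le> (\<Sum>j\<in>UNIV. fst (Cr j) * norm (z - x) ^ N)"
    proof (rule sum_mono)
      fix j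
      have "z \<in> cball x (snd (Cr j))" using z r(2)[of j] by auto
      moreover have "(cjac PP z (V c z) - B (PP z)) $ j = h j z"
        by (simp add: h_def cj B_def) (simp add: PP_def)
      ultimately show "norm ((cjac PP z (V c z) - B (PP z)) $ j) \<le> fst (Cr j) * norm (z - x) ^ N"
        using Cr(4) by simp
    qed
    finally show ?thesis by (simp add: C_def sum_distrib_right)
  qed
  moreover have "C \<ge> 0" using Cr(1) by (simp add: C_def sum_nonneg)
  moreover have "PP x = 0" using P(2) by (simp add: PP_def vec_eq_iff)
  ultimately show ?thesis
    using PPh Blin comm r(1) rS cj P(3)
    by - (rule exI[of _ PP], rule exI[of _ B], rule exI[of _ C], rule exI[of _ r], simp)
qed

lemma bounded_linear_cjac: "bounded_linear (cjac F x)"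
  using linear_cjac linear_conv_bounded_linear by blast

text \<open>In the coordinates P the orbit of z solves y' = B y up to an error of order norm (z -
  x)^N, and the linearized orbit of w solves it exactly. With equal initial values, P z = cjac P x
  w, Gronwall bounds their difference at time T.\<close>

lemma soliton_linear_estimate:
  assumes c: "c \<in> A" and p: "p \<in> cdom c" and fixed: "\<And>t. t \<ge> 0 \<Longrightarrow> \<phi> t p = p" and T: "T \<ge> 0"
    and x: "x = coord c p"
  shows "\<exists>P C r. holomorphic_vec_on P UNIV \<and> P x = 0 \<and>
     (\<forall>v j. cjac P x v $ j = (\<Sum>i\<in>UNIV. v $ i * g c x $ i $ j)) \<and> C \<ge> 0 \<and> r > 0 \<and> ball x r \<subseteq> coord_range c \<and>
     (\<forall>z\<in>ball x r. \<phi> T (coord_inv c z) \<in> cdom c \<and> (\<forall>w. cjac P x w = P z \<longrightarrow>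
        norm (P (local_expr c c (\<phi> T) z) - cjac P x (cjac (local_expr c c (\<phi> T)) x w)) \<le> C * norm (z - x) ^ N))"
proof -
  have xr: "x \<in> coord_range c" using coord_in_range[OF p] x by simp
  have zero: "V c x = 0" using zero_of_phi_fixed[OF c p fixed] x by simp
  obtain P B C R where P: "holomorphic_vec_on P UNIV" "P x = 0" and B: "linear B"
    and Pg: "\<forall>v j. cjac P x v $ j = (\<Sum>i\<in>UNIV. v $ i * g c x $ i $ j)"
    and PB: "\<And>v. cjac P x (cjac (V c) x v) = B (cjac P x v)" and C: "C \<ge> 0" and R: "R > 0" "cball x R \<subseteq> coord_range c"
    and est: "\<And>z. z \<in> cball x R \<Longrightarrow> norm (cjac P z (V c z) - B (P z)) \<le> C * norm (z - x) ^ N"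
    using soliton_jets[OF c xr zero, of N] by blast
  obtain E where E: "E \<ge> 1" and stay: "\<And>z t. norm (z - x) * (2 * E) < R \<Longrightarrow> t \<in> {0..T} \<Longrightarrow>
     \<phi> t (coord_inv c z) \<in> cdom c \<and> norm (coord c (\<phi> t (coord_inv c z)) - x) \<le> E * norm (z - x)"
    using phi_stay_fixed[OF c R(2,1) zero T] by blast
  define r where "r = R / (2 * E)"
  have r: "r > 0" "r \<le> R" using E R by (auto simp: r_def field_simps)
  have zr: "norm (z - x) * (2 * E) < R" if "z \<in> ball x r" for z
    using that E by (simp add: r_def dist_norm norm_minus_commute pos_less_divide_eq)
  have br: "ball x r \<subseteq> coord_range c" using R(2) r by (auto simp: subset_iff)
  let ?\<psi> = "\<lambda>t. local_expr c c (\<phi> t)"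
  have \<psi>: "?\<psi> t z = coord c (\<phi> t (coord_inv c z))" for t z by (simp add: local_expr_def)
  have st1: "\<phi> t (coord_inv c z) \<in> cdom c" "norm (?\<psi> t z - x) \<le> E * norm (z - x)" "?\<psi> t z \<in> cball x R"
    if z: "z \<in> ball x r" and t: "t \<in> {0..T}" for z t
  proof -
    show "\<phi> t (coord_inv c z) \<in> cdom c" and b: "norm (?\<psi> t z - x) \<le> E * norm (z - x)"
      using stay[OF zr[OF z] t] \<psi> by auto
    have "E * norm (z - x) \<le> R" using zr[OF z] R by (simp add: mult_ac)
    then show "?\<psi> t z \<in> cball x R" using b by (simp add: dist_norm norm_minus_commute)
  qed
  have hol: "holomorphic_vec_on (?\<psi> t) (ball x r)" if "t \<in> {0..T}" for t
    by (rule holomorphic_local_expr_on[OF phi_holo c c br]) (use st1(1) that in auto)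
  define L where "L = (\<lambda>t. cjac (?\<psi> t) x)"
  have xb: "x \<in> ball x r" using r by simp
  have \<psi>x: "?\<psi> t x = x" if "t \<ge> 0" for t
    using phi_local_expr_fixed[OF c p fixed[OF that]] x by simp
  have Lder: "((\<lambda>s. L s v) has_vector_derivative cjac (V c) x (L t v)) (at t within {0..T})" if t: "t \<in> {0..T}" for t v
  proof -
    have "((\<lambda>s. L s v) has_vector_derivative cjac (\<lambda>z. V c (?\<psi> t z)) x v) (at t within {0..T})"
      unfolding L_def
      by (rule flow_jac_derivative[OF c R(2) r _ t]) (use st1 \<psi> in auto)
    moreover have "cjac (\<lambda>z. V c (?\<psi> t z)) x v = cjac (V c) x (L t v)"
    proof -
      have "?\<psi> t ` ball x r \<subseteq> coord_range c" using st1(3)[OF _ t] R(2) by blast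
      from cjac_compose[OF V_holo[OF c] hol[OF t] this xb, of v] show ?thesis using \<psi>x[of t] t by (simp add: L_def)
    qed
    ultimately show ?thesis by simp
  qed
  have L0: "L 0 v = v" for v
  proof -
    have "?\<psi> 0 z = z" if "z \<in> ball x r" for z
    proof -
      have zc: "z \<in> coord_range c" using that br by blast
      then have "coord_inv c z \<in> topspace X" using coord_inv_in_cdom[of z c] cdom_subset[OF c] by blast
      then show ?thesis using phi_0 coord_coord_inv[OF c zc] \<psi> by simp
    qed
    then have "cjac (?\<psi> 0) x = cjac (\<lambda>z. z) x" by (intro cjac_cong[OF open_ball xb]) auto
    then show ?thesis by (simp add: L_def cjac_id)
  qed
  obtain b where b: "b > 0" "\<And>w. norm (B w) \<le> norm w * b"
    using bounded_linear.pos_bounded[OF linear_conv_bounded_linear[THEN iffD1, OF B]] by blast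
  \<comment> \<open>The root comes from the squared norms in \<open>Gronwall_sq\<close>; E ^ N
    converts distances along the orbit into the initial distance.\<close>
  define K where "K = sqrt (exp ((2 * b + 1) * T) * T) * (C * E ^ N)"
  have K: "K \<ge> 0" using T C E by (simp add: K_def)
  have bnd: "norm (P (?\<psi> T z) - cjac P x (L T w)) \<le> K * norm (z - x) ^ N"
    if z: "z \<in> ball x r" and w: "cjac P x w = P z" for z w
  proof -
    define D where "D = (\<lambda>t. P (?\<psi> t z) - cjac P x (L t w))"
    define e where "e = C * (E * norm (z - x)) ^ N"
    have zc: "z \<in> coord_range c" using z br by blast
    then have qM: "coord_inv c z \<in> topspace X" using coord_inv_in_cdom[of z c] cdom_subset[OF c] by blast
    have "(norm (D T))\<^sup>2 \<le> exp ((2 * b + 1) * T) * ((norm (D 0))\<^sup>2 + e\<^sup>2 * T)"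
    proof (rule Gronwall_sq[where T = T and f = D and
          f' = "\<lambda>t. cjac P (?\<psi> t z) (V c (?\<psi> t z)) - cjac P x (cjac (V c) x (L t w))"])
      fix t assume t: "t \<in> {0..T}"
      have "((\<lambda>s. coord c (\<phi> s (coord_inv c z))) has_vector_derivative V c (coord c (\<phi> t (coord_inv c z)))) (at t within {0..T})"
        by (rule has_vector_derivative_within_subset[OF phi_coord_derivative[OF c qM]]) (use t st1(1)[OF z t] in auto)
      then have "((\<lambda>s. ?\<psi> s z) has_derivative (\<lambda>h. h *\<^sub>R V c (?\<psi> t z))) (at t within {0..T})"
        by (simp add: \<psi> has_vector_derivative_def)
      from has_derivative_compose[OF this cjac_derivative[OF P(1) UNIV_I]]
      have "((\<lambda>s. P (?\<psi> s z)) has_vector_derivative cjac P (?\<psi> t z) (V c (?\<psi> t z))) (at t within {0..T})"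
        by (simp add: has_vector_derivative_def linear_scale[OF linear_cjac])
      from has_vector_derivative_diff[OF this bounded_linear.has_vector_derivative[OF bounded_linear_cjac Lder[OF t, of w]]]
      show "(D has_vector_derivative cjac P (?\<psi> t z) (V c (?\<psi> t z)) - cjac P x (cjac (V c) x (L t w))) (at t within {0..T})"
        unfolding D_def .
      let ?h = "cjac P (?\<psi> t z) (V c (?\<psi> t z)) - B (P (?\<psi> t z))"
      have eq: "cjac P (?\<psi> t z) (V c (?\<psi> t z)) - cjac P x (cjac (V c) x (L t w)) = B (D t) + ?h"
        by (simp add: D_def linear_diff[OF B] PB)
      have he: "norm ?h \<le> e"
      proof -
        have "norm ?h \<le> C * norm (?\<psi> t z - x) ^ N" by (rule est[OF st1(3)[OF z t]])
        also have "\<dots> \<le> e"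
          unfolding e_def by (intro mult_left_mono power_mono st1(2)[OF z t] C) simp
        finally show ?thesis .
      qed
      have "norm (B (D t) + ?h) \<le> norm (B (D t)) + norm ?h" by (rule norm_triangle_ineq)
      then show "norm (cjac P (?\<psi> t z) (V c (?\<psi> t z)) - cjac P x (cjac (V c) x (L t w))) \<le> b * norm (D t) + e"
        unfolding eq using he b(2)[of "D t"] by (simp add: mult.commute)
    qed (use T b in auto)
    moreover have "D 0 = 0"
      using phi_0[OF qM] coord_coord_inv[OF c zc] by (simp add: D_def \<psi> L0 w)
    ultimately have "(norm (D T))\<^sup>2 \<le> (exp ((2 * b + 1) * T) * T) * e\<^sup>2" by (simp add: mult_ac)
    also have "\<dots> = (K * norm (z - x) ^ N)\<^sup>2"
      using T by (simp add: K_def e_def power_mult_distrib mult_ac)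
    finally have "norm (D T) \<le> K * norm (z - x) ^ N" by (rule power2_le_imp_le) (use K in simp)
    then show ?thesis by (simp add: D_def)
  qed
  have "T \<in> {0..T}" using T by simp
  then show ?thesis
    using P Pg K r(1) br st1(1) bnd unfolding L_def
    by - (rule exI[of _ P], rule exI[of _ K], rule exI[of _ r], blast)
qed

lemma cjac_local_expr_id:
  assumes c: "c \<in> A" and x: "x \<in> coord_range c"
  shows "cjac (local_expr c c id) x v = v"
proof -
  have "cjac (local_expr c c id) x = cjac (\<lambda>y. y) x"
    by (rule cjac_cong[OF range_open[OF c] x]) (simp add: local_expr_def coord_coord_inv[OF c])
  then show ?thesis by (simp add: cjac_id)
qed

text \<open>The chain rule for the holomorphic inverse of \<phi> t.\<close>

lemma inj_cjac_phi:
  assumes c: "c \<in> A" "c' \<in> A" and p: "p \<in> cdom c" "\<phi> t p \<in> cdom c'" and t: "t \<ge> 0"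
  shows "inj (cjac (local_expr c c' (\<phi> t)) (coord c p))"
proof -
  obtain G where G: "holomorphic_map X A X A G" "\<forall>p\<in>topspace X. G (\<phi> t p) = p"
    using biholo[OF t] by (auto simp: biholomorphism_def)
  have pM: "p \<in> topspace X" using p cdom_subset[OF c(1)] by blast
  have "cjac (local_expr c c id) (coord c p) v
    = cjac (local_expr c' c G) (coord c' (\<phi> t p)) (cjac (local_expr c c' (\<phi> t)) (coord c p) v)" for v
    by (rule cjac_local_expr_compose[OF phi_holo[OF t] G(1) _ c(1) c(2) c(1) p]) (use G(2) p(1) pM in auto)
  then have "cjac (local_expr c' c G) (coord c' (\<phi> t p)) (cjac (local_expr c c' (\<phi> t)) (coord c p) v) = v" for v
    using cjac_local_expr_id[OF c(1) coord_in_range[OF p(1)]] by simp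
  then show ?thesis by (metis injI)
qed

text \<open>The order of choices matters: T makes the linear part a contraction, this determines the
  bound \<kappa> of N, then n is taken with 2 \<kappa> < 2^n, and only then P is chosen, of order
  n.\<close>

lemma fixed_point_linearization:
  assumes c: "c \<in> A" and p: "p \<in> cdom c" and fixed: "\<And>t. t \<ge> 0 \<Longrightarrow> \<phi> t p = p"
    and pos: "\<And>v. v \<noteq> 0 \<Longrightarrow> 0 < RQ c (coord c p) v" and x: "x = coord c p"
  shows "\<exists>T r (F :: complex^'n \<Rightarrow> complex^'n) M N. T > 0 \<and> r > 0 \<and> ball x r \<subseteq> coord_range c \<and>
    (\<forall>z\<in>ball x r. \<phi> T (coord_inv c z) \<in> cdom c \<and> norm (coord c (\<phi> T (coord_inv c z)) - x) \<le> norm (z - x) / 2) \<and>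
    holomorphic_vec_on F (ball x r) \<and> F x = 0 \<and> inj (cjac F x) \<and>
    (\<forall>z\<in>ball x r. F (coord c (\<phi> T (coord_inv c z))) = M (F z)) \<and>
    linear M \<and> (\<forall>k v. M (k *s v) = k *s M v) \<and> linear N \<and> (\<forall>k v. N (k *s v) = k *s N v) \<and>
    (\<forall>v. N (M v) = v) \<and> (\<forall>v. M (N v) = v) \<and> (\<forall>w. (\<lambda>m. (M ^^ m) w) \<longlonglongrightarrow> 0)"
proof -
  have xr: "x \<in> coord_range c" using coord_in_range[OF p] x by simp
  obtain T where T: "T > 0" and contr: "\<And>v. norm (cjac (local_expr c c (\<phi> T)) x v) \<le> norm v / 4"
    using fixed_point_contraction[OF c p fixed pos] x by blast
  have T0: "T \<ge> 0" using T by simp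
  define \<psi> where "\<psi> = local_expr c c (\<phi> T)"
  define L where "L = cjac \<psi> x"
  have \<psi>z: "\<psi> z = coord c (\<phi> T (coord_inv c z))" for z by (simp add: \<psi>_def local_expr_def)
  have Llin: "linear L" "\<And>k v. L (k *s v) = k *s L v"
    by (simp_all add: L_def linear_cjac cjac_smult)
  have "\<phi> T p \<in> cdom c" using fixed[OF T0] p by simp
  then have "inj L" using inj_cjac_phi[OF c c p _ T0] by (simp add: L_def \<psi>_def x)
  then obtain Li where Li: "linear Li" "\<And>v. Li (L v) = v" "\<And>v. L (Li v) = v"
    using linear_inj_inv[OF Llin(1)] by blast
  \<comment> \<open>The derivative of P at x: it lowers an index with the metric at x and is
    injective by positivity. Conjugating L and its inverse by it gives M and N, which act on the
    target of P.\<close>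
  define Ga where "Ga = (\<lambda>v::complex^'n. \<chi> j. \<Sum>i\<in>UNIV. v $ i * g c x $ i $ j)"
  have Galin: "linear Ga" "\<And>k v. Ga (k *s v) = k *s Ga v"
    by (rule linearI, simp_all add: Ga_def vec_eq_iff algebra_simps sum.distrib scaleR_sum_right sum_distrib_left)
  have Ga0: "v = 0" if "Ga v = 0" for v
  proof -
    have "herm_form (g c x) v = (\<Sum>j\<in>UNIV. (\<Sum>i\<in>UNIV. v $ i * g c x $ i $ j) * cnj (v $ j))"
      unfolding herm_form_def by (subst sum.swap) (simp add: sum_distrib_left sum_distrib_right mult_ac)
    also have "\<dots> = (\<Sum>j\<in>UNIV. Ga v $ j * cnj (v $ j))" by (simp add: Ga_def)
    finally have "Qf (g c x) v = 0" using that by simp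
    then show "v = 0" using g_pos[OF c xr, of v] by fastforce
  qed
  then have "inj Ga" using linear_injective_0[OF Galin(1)] by blast
  then obtain Gi where Gi: "linear Gi" "\<And>v. Gi (Ga v) = v" "\<And>v. Ga (Gi v) = v"
    using linear_inj_inv[OF Galin(1)] by blast
  have Gisc: "Gi (k *s v) = k *s Gi v" for k v by (metis Galin(2) Gi(2,3))
  have Lisc: "Li (k *s v) = k *s Li v" for k v by (metis Llin(2) Li(2,3))
  define M where "M = (\<lambda>w. Ga (L (Gi w)))"
  define N where "N = (\<lambda>w. Ga (Li (Gi w)))"
  have Mlin: "linear M" "\<And>k v. M (k *s v) = k *s M v" and Nlin: "linear N" "\<And>k v. N (k *s v) = k *s N v"
    using linear_compose[OF linear_compose[OF Gi(1) Llin(1)] Galin(1)] linear_compose[OF linear_compose[OF Gi(1) Li(1)] Galin(1)]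
    by (simp_all add: M_def N_def o_def Gisc Lisc Llin(2) Galin(2))
  have NM: "N (M v) = v" "M (N v) = v" for v by (simp_all add: N_def M_def Gi Li)
  obtain \<kappa> where \<kappa>: "\<kappa> > 0" "\<And>v. norm (N v) \<le> norm v * \<kappa>"
    using bounded_linear.pos_bounded[OF linear_conv_bounded_linear[THEN iffD1, OF Nlin(1)]] by blast
  obtain n :: nat where n: "2 * \<kappa> < 2 ^ n" using real_arch_pow[of 2 "2 * \<kappa>"] by auto
  obtain P C r0 where P: "holomorphic_vec_on P UNIV" "P x = 0"
    and Pg: "\<And>v j. cjac P x v $ j = (\<Sum>i\<in>UNIV. v $ i * g c x $ i $ j)" and C: "C \<ge> 0" and r0: "r0 > 0" "ball x r0 \<subseteq> coord_range c"
    and est: "\<And>z. z \<in> ball x r0 \<Longrightarrow> \<phi> T (coord_inv c z) \<in> cdom c \<and> (\<forall>w. cjac P x w = P z \<longrightarrow>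
        norm (P (\<psi> z) - cjac P x (cjac \<psi> x w)) \<le> C * norm (z - x) ^ n)"
    using soliton_linear_estimate[OF c p fixed T0 x, of n] unfolding \<psi>_def by blast
  have PGa: "cjac P x = Ga" by (rule ext) (simp add: vec_eq_iff Pg Ga_def)
  have hol0: "holomorphic_vec_on \<psi> (ball x r0)"
    unfolding \<psi>_def by (rule holomorphic_local_expr_on[OF phi_holo[OF T0] c c r0(2)]) (use est in auto)
  have \<psi>x: "\<psi> x = x" using phi_local_expr_fixed[OF c p fixed[OF T0]] by (simp add: \<psi>_def x)
  have xb: "x \<in> ball x r0" using r0 by simp
  have "(\<psi> has_derivative L) (at x)" unfolding L_def by (rule cjac_derivative[OF hol0 xb])
  \<comment> \<open>A remainder of at most 1/4 and the factor 1/4 of the linear part add up to the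
    contraction factor 1/2.\<close>
  then obtain d where d: "d > 0" "\<And>z. norm (z - x) < d \<Longrightarrow> norm (\<psi> z - \<psi> x - L (z - x)) \<le> 1/4 * norm (z - x)"
    unfolding has_derivative_at_alt by (meson zero_less_divide_1_iff zero_less_numeral)
  define r where "r = min r0 d"
  have r: "r > 0" "ball x r \<subseteq> ball x r0" using r0 d by (auto simp: r_def)
  have half: "norm (\<psi> z - x) \<le> norm (z - x) / 2" if z: "z \<in> ball x r" for z
  proof -
    have "norm (\<psi> z - x - L (z - x)) \<le> norm (z - x) / 4"
      using d(2)[of z] z \<psi>x by (simp add: r_def dist_norm norm_minus_commute)
    moreover have "norm (L (z - x)) \<le> norm (z - x) / 4" using contr by (simp add: L_def \<psi>_def)
    moreover have "norm (\<psi> z - x) \<le> norm (\<psi> z - x - L (z - x)) + norm (L (z - x))"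
      using norm_triangle_ineq[of "\<psi> z - x - L (z - x)" "L (z - x)"] by simp
    ultimately show ?thesis by simp
  qed
  have "\<exists>F. holomorphic_vec_on F (ball x r) \<and> F x = 0 \<and> inj (cjac F x) \<and> (\<forall>z\<in>ball x r. F (\<psi> z) = M (F z))"
  proof (rule linearize_attracting[where N = N and \<kappa> = \<kappa> and n = n and C = C and P = P, OF r(1) holomorphic_vec_on_subset[OF hol0 r(2)] \<psi>x half
        holomorphic_vec_on_subset[OF P(1) subset_UNIV] P(2)])
    show "inj (cjac P x)" using \<open>inj Ga\<close> PGa by simp
    show "norm (N v) \<le> \<kappa> * norm v" for v using \<kappa>(2)[of v] by (simp add: mult.commute)
    show "\<kappa> \<le> 2 ^ n / 2" using n by simp
    show "norm (P (\<psi> z) - M (P z)) \<le> C * norm (z - x) ^ n" if z: "z \<in> ball x r" for z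
    proof -
      have "cjac P x (Gi (P z)) = P z" by (simp add: PGa Gi)
      then show ?thesis using est[of z] z r(2) by (auto simp: M_def PGa L_def)
    qed
    show "M (cjac P x v) = cjac P x (cjac \<psi> x v)" for v by (simp add: PGa M_def Gi L_def)
  qed (use \<kappa>(1) C Mlin Nlin NM in auto)
  then obtain F where F: "holomorphic_vec_on F (ball x r)" "F x = 0" "inj (cjac F x)" "\<And>z. z \<in> ball x r \<Longrightarrow> F (\<psi> z) = M (F z)"
    by blast
  have Mpow: "(M ^^ m) w = Ga ((L ^^ m) (Gi w))" for m w
    by (induction m) (simp_all add: M_def Gi)
  have Lpow: "norm ((L ^^ m) w) \<le> norm w * (1/4) ^ m" for m w
  proof (induction m)
    case (Suc m)
    have "norm ((L ^^ Suc m) w) \<le> norm ((L ^^ m) w) / 4" using contr[of "(L ^^ m) w"] by (simp add: L_def \<psi>_def)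
    then show ?case using Suc by simp
  qed simp
  have Mlim: "(\<lambda>m. (M ^^ m) w) \<longlonglongrightarrow> 0" for w
  proof -
    have "(\<lambda>m. norm (Gi w) * (1/4) ^ m) \<longlonglongrightarrow> 0"
      by (rule tendsto_mult_right_zero, rule LIMSEQ_power_zero) simp
    then have "(\<lambda>m. (L ^^ m) (Gi w)) \<longlonglongrightarrow> 0"
      by (rule Lim_null_comparison[rotated]) (simp add: Lpow)
    from bounded_linear.tendsto[OF linear_conv_bounded_linear[THEN iffD1, OF Galin(1)] this]
    show ?thesis by (simp add: Mpow linear_0[OF Galin(1)])
  qed
  have br: "ball x r \<subseteq> coord_range c" using r(2) r0(2) by (rule order_trans)
  have dom: "\<phi> T (coord_inv c z) \<in> cdom c" if "z \<in> ball x r" for z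
    using est[OF subsetD[OF r(2) that]] by simp
  show ?thesis
  proof (rule exI[of _ T], rule exI[of _ r], rule exI[of _ F], rule exI[of _ M], rule exI[of _ N], intro conjI ballI allI)
    show "(\<lambda>m. (M ^^ m) w) \<longlonglongrightarrow> 0" for w by (rule Mlim)
  qed (use T r(1) br dom F(1-3) F(4)[unfolded \<psi>z] half[unfolded \<psi>z] Mlin Nlin NM in auto)
qed

end

section \<open>The Riemannian distance\<close>

lemma C1_compose_holomorphic:
  fixes f :: "real \<Rightarrow> complex^'n" and H :: "complex^'n \<Rightarrow> complex^'m"
  assumes f: "f C1_differentiable_on J" and fJ: "f ` J \<subseteq> D" and D: "open D" "holomorphic_vec_on H D"
  shows "(\<lambda>t. H (f t)) C1_differentiable_on J"
    and "\<And>t. t \<in> J \<Longrightarrow> vector_derivative (\<lambda>t. H (f t)) (at t) = cjac H (f t) (vector_derivative f (at t))"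
proof -
  let ?d = "\<lambda>t. vector_derivative f (at t)"
  have fd: "(f has_vector_derivative ?d t) (at t)" if "t \<in> J" for t
    using f that by (simp add: C1_differentiable_on_eq vector_derivative_works)
  have cf: "continuous_on J f"
    using fd has_vector_derivative_continuous continuous_at_imp_continuous_on by blast
  have cd: "continuous_on J ?d" using f by (simp add: C1_differentiable_on_eq)
  have der: "((\<lambda>t. H (f t)) has_vector_derivative cjac H (f t) (?d t)) (at t)" if t: "t \<in> J" for t
  proof -
    have "f t \<in> D" using t fJ by blast
    from has_derivative_compose[OF fd[OF t, unfolded has_vector_derivative_def] cjac_derivative[OF D(2) this]]
    show ?thesis by (simp add: has_vector_derivative_def linear_scale[OF linear_cjac])
  qed
  show vd: "vector_derivative (\<lambda>t. H (f t)) (at t) = cjac H (f t) (?d t)" if "t \<in> J" for t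
    using vector_derivative_at[OF der[OF that]] .
  have "continuous_on J (\<lambda>t. cjac H (f t) (?d t))"
    unfolding cjac_def
    by (intro continuous_on_vec_lambda continuous_intros continuous_on_component cd
        continuous_on_compose2[OF continuous_on_dz[OF D] cf] fJ)
  then have "continuous_on J (\<lambda>t. vector_derivative (\<lambda>t. H (f t)) (at t))"
    using continuous_on_cong[OF refl vd, of J] by simp
  then show "(\<lambda>t. H (f t)) C1_differentiable_on J"
    unfolding C1_differentiable_on_eq using der differentiableI_vector by blast
qed

lemma C1_differentiable_on_open_local:
  fixes f :: "real \<Rightarrow> 'b::real_normed_vector"
  assumes "\<And>t. t \<in> T \<Longrightarrow> \<exists>e>0. f C1_differentiable_on ball t e"
  shows "f C1_differentiable_on T"
  unfolding C1_differentiable_on_eq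
proof (intro conjI ballI continuous_at_imp_continuous_on)
  fix t assume "t \<in> T"
  then obtain e where e: "e > 0" "f C1_differentiable_on ball t e" using assms by blast
  have tb: "t \<in> ball t e" using e by simp
  then show "f differentiable at t" using e(2) by (simp add: C1_differentiable_on_eq)
  have "continuous_on (ball t e) (\<lambda>t. vector_derivative f (at t))"
    using e(2) by (simp add: C1_differentiable_on_eq)
  then show "isCont (\<lambda>t. vector_derivative f (at t)) t"
    using continuous_on_eq_continuous_at[OF open_ball] tb by blast
qed

lemma vector_derivative_cong_ball:
  fixes f h :: "real \<Rightarrow> 'b::real_normed_vector"
  assumes "e > 0" "\<And>\<tau>. \<tau> \<in> ball t e \<Longrightarrow> f \<tau> = h \<tau>" "s \<in> ball t e"
  shows "(f has_vector_derivative D) (at s) \<longleftrightarrow> (h has_vector_derivative D) (at s)"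
    and "vector_derivative f (at s) = vector_derivative h (at s)"
proof -
  show *: "(f has_vector_derivative D) (at s) \<longleftrightarrow> (h has_vector_derivative D) (at s)" for D
    using has_vector_derivative_transform_within_open[of f D s "ball t e" h]
      has_vector_derivative_transform_within_open[of h D s "ball t e" f] assms by (metis open_ball)
  then show "vector_derivative f (at s) = vector_derivative h (at s)"
    unfolding vector_derivative_def by simp
qed

lemma C1_cong_ball:
  fixes f h :: "real \<Rightarrow> 'b::real_normed_vector"
  assumes "e > 0" "\<And>\<tau>. \<tau> \<in> ball t e \<Longrightarrow> f \<tau> = h \<tau>" "f C1_differentiable_on ball t e"
  shows "h C1_differentiable_on ball t e"
proof -
  obtain D where D: "\<And>s. s \<in> ball t e \<Longrightarrow> (f has_vector_derivative D s) (at s)" "continuous_on (ball t e) D"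
    using assms(3) unfolding C1_differentiable_on_def by blast
  have "(h has_vector_derivative D s) (at s)" if "s \<in> ball t e" for s
    using vector_derivative_cong_ball(1)[OF assms(1,2) that] D(1)[OF that] by simp
  then show ?thesis using D(2) unfolding C1_differentiable_on_def by blast
qed

lemma C1_affine:
  fixes f :: "real \<Rightarrow> 'b::real_normed_vector"
  assumes m: "m \<noteq> 0" and e: "e > 0" and f: "f C1_differentiable_on ball (m * t + b) e"
  shows "(\<lambda>s. f (m * s + b)) C1_differentiable_on ball t (e / \<bar>m\<bar>)"
    and "vector_derivative (\<lambda>s. f (m * s + b)) (at t) = m *\<^sub>R vector_derivative f (at (m * t + b))"
proof -
  obtain D where D: "\<And>s. s \<in> ball (m * t + b) e \<Longrightarrow> (f has_vector_derivative D s) (at s)"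
    "continuous_on (ball (m * t + b) e) D"
    using f unfolding C1_differentiable_on_def by blast
  have in_b: "m * s + b \<in> ball (m * t + b) e" if "s \<in> ball t (e / \<bar>m\<bar>)" for s
  proof -
    have "\<bar>m\<bar> * \<bar>t - s\<bar> < e" using that m by (simp add: dist_real_def field_simps)
    moreover have "m * t + b - (m * s + b) = m * (t - s)" by (simp add: algebra_simps)
    ultimately show ?thesis by (simp add: dist_real_def abs_mult)
  qed
  have der: "((\<lambda>s. f (m * s + b)) has_vector_derivative m *\<^sub>R D (m * s + b)) (at s)" if "s \<in> ball t (e / \<bar>m\<bar>)" for s
  proof -
    have "((\<lambda>s. m * s + b) has_vector_derivative m) (at s)" by (auto intro!: derivative_eq_intros)
    from vector_diff_chain_at[OF this D(1)[OF in_b[OF that]]] show ?thesis by (simp add: o_def)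
  qed
  have "continuous_on (ball t (e / \<bar>m\<bar>)) (\<lambda>s. m *\<^sub>R D (m * s + b))"
    by (intro continuous_intros continuous_on_compose2[OF D(2)]) (use in_b in auto)
  then show "(\<lambda>s. f (m * s + b)) C1_differentiable_on ball t (e / \<bar>m\<bar>)"
    unfolding C1_differentiable_on_def
    by (intro exI[of _ "\<lambda>s. m *\<^sub>R D (m * s + b)"] conjI ballI der)
  have "t \<in> ball t (e / \<bar>m\<bar>)" "m * t + b \<in> ball (m * t + b) e" using e m by auto
  then show "vector_derivative (\<lambda>s. f (m * s + b)) (at t) = m *\<^sub>R vector_derivative f (at (m * t + b))"
    using vector_derivative_at[OF der] vector_derivative_at[OF D(1)] by simp
qed

section \<open>Speed and length of curves\<close>

context kaehler_mfd
begin

text \<open>Continuous differentiability on a neighbourhood of t, not just at t: this notion is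
  independent of the chart and makes the speed continuous at t.\<close>

definition regC :: "('a, 'n) chart \<Rightarrow> (real \<Rightarrow> 'a) \<Rightarrow> real \<Rightarrow> bool" where
  "regC c \<eta> t \<longleftrightarrow> (\<exists>e>0. (\<forall>\<tau>\<in>ball t e. \<eta> \<tau> \<in> cdom c) \<and> (\<lambda>\<tau>. coord c (\<eta> \<tau>)) C1_differentiable_on ball t e)"

abbreviation vel :: "('a, 'n) chart \<Rightarrow> (real \<Rightarrow> 'a) \<Rightarrow> real \<Rightarrow> complex^'n" where
  "vel c \<eta> t \<equiv> vector_derivative (\<lambda>\<tau>. coord c (\<eta> \<tau>)) (at t)"

text \<open>One chart is chosen per point, so that the speed is a single real function to integrate;
  by \<open>spd_eq\<close> every chart gives the same value at regular times.\<close>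

definition spd :: "(real \<Rightarrow> 'a) \<Rightarrow> real \<Rightarrow> real" where
  "spd \<eta> t = (if \<eta> t \<in> topspace X then
     (let c = SOME c. c \<in> A \<and> \<eta> t \<in> cdom c in sqrt (Qf (g c (coord c (\<eta> t))) (vel c \<eta> t))) else 0)"

lemma regC_in: "regC c \<eta> t \<Longrightarrow> \<eta> t \<in> cdom c"
  by (auto simp: regC_def)

lemma spd_some:
  assumes "\<eta> t \<in> topspace X"
  obtains c where "c \<in> A" "\<eta> t \<in> cdom c" "spd \<eta> t = sqrt (Qf (g c (coord c (\<eta> t))) (vel c \<eta> t))"
proof -
  define c where "c = (SOME c. c \<in> A \<and> \<eta> t \<in> cdom c)"
  have "c \<in> A \<and> \<eta> t \<in> cdom c"
    unfolding c_def by (rule someI_ex) (use cover[OF assms] in blast)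
  then show ?thesis using that[of c] assms by (simp add: spd_def c_def Let_def)
qed

lemma spd_nonneg: "0 \<le> spd \<eta> t"
proof (cases "\<eta> t \<in> topspace X")
  case True
  obtain c where "c \<in> A" "\<eta> t \<in> cdom c" "spd \<eta> t = sqrt (Qf (g c (coord c (\<eta> t))) (vel c \<eta> t))"
    by (rule spd_some[of \<eta> t, OF True])
  then show ?thesis using g_nonneg[of c "coord c (\<eta> t)"] coord_in_range[of "\<eta> t" c] by simp
qed (simp add: spd_def)

text \<open>The parameter interval is shrunk until the curve stays in the open set where F has a
  coordinate expression. The identity map gives invariance under chart changes.\<close>

lemma regC_image:
  assumes F: "holomorphic_map X A X A F" and c: "c \<in> A" "c' \<in> A" and reg: "regC c \<eta> t" and in': "F (\<eta> t) \<in> cdom c'"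
  shows "regC c' (\<lambda>\<tau>. F (\<eta> \<tau>)) t"
    and "vel c' (\<lambda>\<tau>. F (\<eta> \<tau>)) t = cjac (local_expr c c' F) (coord c (\<eta> t)) (vel c \<eta> t)"
proof -
  obtain e where e: "e > 0" "\<And>\<tau>. \<tau> \<in> ball t e \<Longrightarrow> \<eta> \<tau> \<in> cdom c" "(\<lambda>\<tau>. coord c (\<eta> \<tau>)) C1_differentiable_on ball t e"
    using reg unfolding regC_def by blast
  define D where "D = coord c ` {q \<in> cdom c. F q \<in> cdom c'}"
  note D = holomorphic_map_local_expr[OF F c, folded D_def]
  have cont: "continuous_on (ball t e) (\<lambda>\<tau>. coord c (\<eta> \<tau>))"
    using e(3) differentiable_imp_continuous_within by (auto simp: C1_differentiable_on_eq intro!: continuous_at_imp_continuous_on)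
  have tD: "coord c (\<eta> t) \<in> D" using in' regC_in[OF reg] by (auto simp: D_def)
  have "open (ball t e \<inter> (\<lambda>\<tau>. coord c (\<eta> \<tau>)) -` D)"
    by (rule continuous_open_preimage[OF cont open_ball D(1)])
  moreover have "t \<in> ball t e \<inter> (\<lambda>\<tau>. coord c (\<eta> \<tau>)) -` D" using tD e(1) by simp
  ultimately obtain d where d: "d > 0" "ball t d \<subseteq> ball t e \<inter> (\<lambda>\<tau>. coord c (\<eta> \<tau>)) -` D"
    using open_contains_ball by blast
  have in2: "F (\<eta> \<tau>) \<in> cdom c'" "\<eta> \<tau> \<in> cdom c" if "\<tau> \<in> ball t d" for \<tau>
  proof -
    show \<eta>c: "\<eta> \<tau> \<in> cdom c" using e(2) d(2) that by blast
    have "coord c (\<eta> \<tau>) \<in> D" using d(2) that by blast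
    then obtain q where q: "q \<in> cdom c" "F q \<in> cdom c'" "coord c (\<eta> \<tau>) = coord c q" by (auto simp: D_def)
    have "\<eta> \<tau> = q" using arg_cong[OF q(3), of "coord_inv c"] coord_inv_coord[OF c(1)] \<eta>c q(1) by simp
    then show "F (\<eta> \<tau>) \<in> cdom c'" using q by simp
  qed
  have eq: "local_expr c c' F (coord c (\<eta> \<tau>)) = coord c' (F (\<eta> \<tau>))" if "\<tau> \<in> ball t d" for \<tau>
    by (rule local_expr_coord[OF c(1) in2(2)[OF that]])
  have C1d: "(\<lambda>\<tau>. coord c (\<eta> \<tau>)) C1_differentiable_on ball t d"
    by (rule C1_differentiable_on_subset[OF e(3)]) (use d(2) in blast)
  have imD: "(\<lambda>\<tau>. coord c (\<eta> \<tau>)) ` ball t d \<subseteq> D" using d(2) by blast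
  note comp = C1_compose_holomorphic[OF C1d imD D]
  have "(\<lambda>\<tau>. coord c' (F (\<eta> \<tau>))) C1_differentiable_on ball t d"
    by (rule C1_cong_ball[OF d(1) _ comp(1)]) (rule eq)
  then show "regC c' (\<lambda>\<tau>. F (\<eta> \<tau>)) t" unfolding regC_def using d(1) in2(1) by blast
  have tb: "t \<in> ball t d" using d(1) by simp
  have "vel c' (\<lambda>\<tau>. F (\<eta> \<tau>)) t = vector_derivative (\<lambda>\<tau>. local_expr c c' F (coord c (\<eta> \<tau>))) (at t)"
    by (rule vector_derivative_cong_ball(2)[OF d(1) _ tb, symmetric]) (rule eq)
  also have "\<dots> = cjac (local_expr c c' F) (coord c (\<eta> t)) (vel c \<eta> t)" by (rule comp(2)[OF tb])
  finally show "vel c' (\<lambda>\<tau>. F (\<eta> \<tau>)) t = cjac (local_expr c c' F) (coord c (\<eta> t)) (vel c \<eta> t)" .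
qed

lemma regC_change:
  assumes "c \<in> A" "c' \<in> A" "regC c \<eta> t" "\<eta> t \<in> cdom c'"
  shows "regC c' \<eta> t" "Qf (g c' (coord c' (\<eta> t))) (vel c' \<eta> t) = Qf (g c (coord c (\<eta> t))) (vel c \<eta> t)"
proof -
  have i: "id (\<eta> t) \<in> cdom c'" using assms(4) by simp
  note r = regC_image[OF holomorphic_map_id assms(1-3) i]
  show "regC c' \<eta> t" using r(1) by simp
  show "Qf (g c' (coord c' (\<eta> t))) (vel c' \<eta> t) = Qf (g c (coord c (\<eta> t))) (vel c \<eta> t)"
    using r(2) pullback_form[OF g_pullback_id assms(1,2) regC_in[OF assms(3)] i] by simp
qed

lemma spd_eq:
  assumes "c \<in> A" "regC c \<eta> t"
  shows "spd \<eta> t = sqrt (Qf (g c (coord c (\<eta> t))) (vel c \<eta> t))"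
proof -
  have "\<eta> t \<in> topspace X" using regC_in[OF assms(2)] cdom_subset[OF assms(1)] by blast
  then obtain c' where c': "c' \<in> A" "\<eta> t \<in> cdom c'" "spd \<eta> t = sqrt (Qf (g c' (coord c' (\<eta> t))) (vel c' \<eta> t))"
    by (rule spd_some[of \<eta> t])
  show ?thesis using regC_change(2)[OF assms(1) c'(1) assms(2) c'(2)] c'(3) by simp
qed

definition regular_off :: "real set \<Rightarrow> (real \<Rightarrow> 'a) \<Rightarrow> bool" where
  "regular_off S \<eta> \<longleftrightarrow> finite S \<and> (\<forall>t\<in>{0<..<1} - S. \<exists>c\<in>A. regC c \<eta> t)"

text \<open>The integrand s of \<open>has_length\<close> and the speed differ at most at finitely
  many times of [0, 1]. In this form charts enter only pointwise.\<close>

lemma has_length_iff: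
  "has_length X A g \<gamma> L \<longleftrightarrow> pathin X \<gamma> \<and> (\<exists>S. regular_off S \<gamma>) \<and> (spd \<gamma> has_integral L) {0..1}"
proof
  assume "has_length X A g \<gamma> L"
  then obtain S s where path: "pathin X \<gamma>" and S: "finite S" and int: "(s has_integral L) {0..1}"
    and C: "\<And>c. c \<in> A \<Longrightarrow> (coord c \<circ> \<gamma>) C1_differentiable_on ({t\<in>{0<..<1}. \<gamma> t \<in> cdom c} - S)"
    and s: "\<And>c t. c \<in> A \<Longrightarrow> t \<in> {t\<in>{0<..<1}. \<gamma> t \<in> cdom c} - S \<Longrightarrow>
       s t = sqrt (Re (herm_form (g c (coord c (\<gamma> t))) (vector_derivative (coord c \<circ> \<gamma>) (at t))))"
    unfolding has_length_def Let_def by blast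
  have cm: "continuous_map (top_of_set {0..1}) X \<gamma>" using path by (simp add: pathin_def)
  have reg: "\<exists>c\<in>A. regC c \<gamma> t \<and> s t = spd \<gamma> t" if t: "t \<in> {0<..<1} - S" for t
  proof -
    have "\<gamma> t \<in> topspace X" using cm t by (auto simp: continuous_map_def)
    then obtain c where c: "c \<in> A" "\<gamma> t \<in> cdom c" using cover by blast
    let ?T = "{t\<in>{0<..<1}. \<gamma> t \<in> cdom c} - S"
    have "continuous_map (top_of_set {0<..<1}) X \<gamma>"
      by (rule continuous_map_from_subtopology_mono[OF cm]) auto
    from curve_preimage_open[OF this cdom_open[OF c(1)]] 
    have "open {t\<in>{0<..<1}. \<gamma> t \<in> cdom c}" using openin_open_trans open_greaterThanLessThan by blast
    then have "open ?T" using finite_imp_closed[OF S] by (rule open_Diff)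
    moreover have tT: "t \<in> ?T" using t c(2) by auto
    ultimately obtain e where e: "e > 0" "ball t e \<subseteq> ?T" using open_contains_ball by blast
    have "(\<lambda>\<tau>. coord c (\<gamma> \<tau>)) C1_differentiable_on ball t e"
      using C1_differentiable_on_subset[OF C[OF c(1)] e(2)] by (simp add: o_def)
    then have r: "regC c \<gamma> t" unfolding regC_def using e by blast
    show ?thesis using s[OF c(1) tT] spd_eq[OF c(1) r] c(1) r by (auto simp: o_def)
  qed
  have "(spd \<gamma> has_integral L) {0..1}"
  proof (rule has_integral_spike_finite[OF _ _ int])
    show "finite (S \<union> {0,1})" using S by simp
    show "spd \<gamma> t = s t" if "t \<in> {0..1} - (S \<union> {0,1})" for t using reg[of t] that by force
  qed
  moreover have "regular_off S \<gamma>" unfolding regular_off_def using S reg by blast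
  ultimately show "pathin X \<gamma> \<and> (\<exists>S. regular_off S \<gamma>) \<and> (spd \<gamma> has_integral L) {0..1}"
    using path by blast
next
  assume "pathin X \<gamma> \<and> (\<exists>S. regular_off S \<gamma>) \<and> (spd \<gamma> has_integral L) {0..1}"
  then obtain S where path: "pathin X \<gamma>" and S: "finite S" and reg: "\<And>t. t \<in> {0<..<1} - S \<Longrightarrow> \<exists>c\<in>A. regC c \<gamma> t"
    and int: "(spd \<gamma> has_integral L) {0..1}"
    unfolding regular_off_def by blast
  have r: "regC c \<gamma> t" if c: "c \<in> A" and t: "t \<in> {t\<in>{0<..<1}. \<gamma> t \<in> cdom c} - S" for c t
  proof -
    obtain c' where "c' \<in> A" "regC c' \<gamma> t" using reg[of t] t by auto
    then show ?thesis using regC_change(1) c t by blast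
  qed
  show "has_length X A g \<gamma> L"
    unfolding has_length_def Let_def
  proof (intro conjI path exI[of _ S] exI[of _ "spd \<gamma>"] S int ballI)
    fix c assume c: "c \<in> A"
    show "(coord c \<circ> \<gamma>) C1_differentiable_on ({t\<in>{0<..<1}. \<gamma> t \<in> cdom c} - S)"
      by (rule C1_differentiable_on_open_local) (use r[OF c] in \<open>auto simp: regC_def o_def\<close>)
    show "spd \<gamma> t = sqrt (Re (herm_form (g c (coord c (\<gamma> t))) (vector_derivative (coord c \<circ> \<gamma>) (at t))))"
      if "t \<in> {t\<in>{0<..<1}. \<gamma> t \<in> cdom c} - S" for t
      using spd_eq[OF c r[OF c that]] by (simp add: o_def)
  qed
qed

lemma regC_cong:
  assumes "e > 0" "\<And>\<tau>. \<tau> \<in> ball t e \<Longrightarrow> \<eta> \<tau> = \<eta>' \<tau>" "c \<in> A" "regC c \<eta> t"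
  shows "regC c \<eta>' t" "spd \<eta>' t = spd \<eta> t"
proof -
  obtain d where d: "d > 0" "\<And>\<tau>. \<tau> \<in> ball t d \<Longrightarrow> \<eta> \<tau> \<in> cdom c" "(\<lambda>\<tau>. coord c (\<eta> \<tau>)) C1_differentiable_on ball t d"
    using assms(4) unfolding regC_def by blast
  define r where "r = min d e"
  have r: "r > 0" "ball t r \<subseteq> ball t d" "ball t r \<subseteq> ball t e" using d assms(1) by (auto simp: r_def)
  have eq: "coord c (\<eta> \<tau>) = coord c (\<eta>' \<tau>)" if "\<tau> \<in> ball t r" for \<tau> using assms(2) r(3) that by (metis subsetD)
  have "(\<lambda>\<tau>. coord c (\<eta>' \<tau>)) C1_differentiable_on ball t r"
    by (rule C1_cong_ball[OF r(1) eq C1_differentiable_on_subset[OF d(3) r(2)]])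
  moreover have "\<eta>' \<tau> \<in> cdom c" if "\<tau> \<in> ball t r" for \<tau>
    using d(2)[OF subsetD[OF r(2) that]] assms(2)[OF subsetD[OF r(3) that]] by simp
  ultimately show reg: "regC c \<eta>' t" unfolding regC_def using r(1) by blast
  have tr: "t \<in> ball t r" using r(1) by simp
  show "spd \<eta>' t = spd \<eta> t"
    using spd_eq[OF assms(3) reg] spd_eq[OF assms(3,4)] eq[OF tr] vector_derivative_cong_ball(2)[OF r(1) eq tr] by simp
qed

lemma regC_affine:
  assumes "m \<noteq> 0" "c \<in> A" "regC c \<eta> (m * t + b)"
  shows "regC c (\<lambda>s. \<eta> (m * s + b)) t" "spd (\<lambda>s. \<eta> (m * s + b)) t = \<bar>m\<bar> * spd \<eta> (m * t + b)"
proof -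
  obtain e where e: "e > 0" "\<And>\<tau>. \<tau> \<in> ball (m * t + b) e \<Longrightarrow> \<eta> \<tau> \<in> cdom c"
    "(\<lambda>\<tau>. coord c (\<eta> \<tau>)) C1_differentiable_on ball (m * t + b) e"
    using assms(3) unfolding regC_def by blast
  have "m * s + b \<in> ball (m * t + b) e" if "s \<in> ball t (e / \<bar>m\<bar>)" for s
  proof -
    have "\<bar>m\<bar> * \<bar>t - s\<bar> < e" using that assms(1) by (simp add: dist_real_def field_simps)
    moreover have "m * t + b - (m * s + b) = m * (t - s)" by (simp add: algebra_simps)
    ultimately show ?thesis by (simp add: dist_real_def abs_mult)
  qed
  then have "\<eta> (m * s + b) \<in> cdom c" if "s \<in> ball t (e / \<bar>m\<bar>)" for s using e(2) that by blast
  then show reg: "regC c (\<lambda>s. \<eta> (m * s + b)) t"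
    unfolding regC_def using C1_affine(1)[OF assms(1) e(1,3)] e(1) assms(1) by (intro exI[of _ "e / \<bar>m\<bar>"]) auto
  show "spd (\<lambda>s. \<eta> (m * s + b)) t = \<bar>m\<bar> * spd \<eta> (m * t + b)"
    using spd_eq[OF assms(2) reg] spd_eq[OF assms(2,3)] C1_affine(2)[OF assms(1) e(1,3)]
    by (simp add: Qf_scaleR real_sqrt_mult)
qed

lemma spd_continuous:
  assumes "\<And>t. t \<in> J \<Longrightarrow> \<exists>c\<in>A. regC c \<eta> t"
  shows "continuous_on J (spd \<eta>)"
proof (rule continuous_at_imp_continuous_on, rule ballI)
  fix t assume "t \<in> J"
  then obtain c where c: "c \<in> A" "regC c \<eta> t" using assms by blast
  then obtain e where e: "e > 0" "\<And>\<tau>. \<tau> \<in> ball t e \<Longrightarrow> \<eta> \<tau> \<in> cdom c" "(\<lambda>\<tau>. coord c (\<eta> \<tau>)) C1_differentiable_on ball t e"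
    unfolding regC_def by blast
  have r: "regC c \<eta> \<tau>" if \<tau>: "\<tau> \<in> ball t e" for \<tau>
  proof -
    obtain d where d: "d > 0" "ball \<tau> d \<subseteq> ball t e" using \<tau> open_contains_ball open_ball by blast
    then show ?thesis unfolding regC_def using e(2) C1_differentiable_on_subset[OF e(3) d(2)] by blast
  qed
  have cont: "continuous_on (ball t e) (\<lambda>\<tau>. coord c (\<eta> \<tau>))"
    using e(3) differentiable_imp_continuous_within by (auto simp: C1_differentiable_on_eq intro!: continuous_at_imp_continuous_on)
  have "(\<lambda>\<tau>. coord c (\<eta> \<tau>)) ` ball t e \<subseteq> coord_range c"
  proof (rule image_subsetI)
    fix \<tau> assume "\<tau> \<in> ball t e"
    then show "coord c (\<eta> \<tau>) \<in> coord_range c" using e(2) coord_in_range[of "\<eta> \<tau>" c] by blast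
  qed
  then have "continuous_on (ball t e) (\<lambda>\<tau>. sqrt (Qf (g c (coord c (\<eta> \<tau>))) (vel c \<eta> \<tau>)))"
    using e(3) by (intro continuous_on_real_sqrt continuous_on_Qf continuous_on_compose2[OF g_continuous[OF c(1)] cont])
      (auto simp: C1_differentiable_on_eq)
  then have "continuous_on (ball t e) (spd \<eta>)"
    by (rule continuous_on_eq) (simp add: spd_eq[OF c(1) r])
  then show "isCont (spd \<eta>) t" using continuous_on_eq_continuous_at[OF open_ball] e(1) by (metis centre_in_ball)
qed

lemma spd_line:
  assumes c: "c \<in> A" and J: "open J" "t \<in> J" "\<And>s. s \<in> J \<Longrightarrow> x + s *\<^sub>R v \<in> coord_range c"
  shows "regC c (\<lambda>s. coord_inv c (x + s *\<^sub>R v)) t"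
    and "spd (\<lambda>s. coord_inv c (x + s *\<^sub>R v)) t = sqrt (Qf (g c (x + t *\<^sub>R v)) v)"
proof -
  let ?\<eta> = "\<lambda>s. coord_inv c (x + s *\<^sub>R v)"
  obtain e where e: "e > 0" "ball t e \<subseteq> J" using J(1,2) open_contains_ball by blast
  have eq: "x + s *\<^sub>R v = coord c (?\<eta> s)" if "s \<in> ball t e" for s
    using coord_coord_inv[OF c J(3)] that e(2) by (simp add: subset_iff)
  have vd: "((\<lambda>s. x + s *\<^sub>R v) has_vector_derivative v) (at s)" for s
    by (auto intro!: derivative_eq_intros simp: has_vector_derivative_def)
  have "(\<lambda>s. x + s *\<^sub>R v) C1_differentiable_on ball t e"
    unfolding C1_differentiable_on_def using vd by (intro exI[of _ "\<lambda>_. v"]) auto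
  then have "(\<lambda>s. coord c (?\<eta> s)) C1_differentiable_on ball t e"
    using C1_cong_ball[where f = "\<lambda>s. x + s *\<^sub>R v" and h = "\<lambda>s. coord c (?\<eta> s)", OF e(1)] eq by blast
  moreover have "?\<eta> s \<in> cdom c" if "s \<in> ball t e" for s
    using coord_inv_in_cdom[OF J(3)] that e(2) by blast
  ultimately show reg: "regC c ?\<eta> t" unfolding regC_def using e(1) by blast
  have tb: "t \<in> ball t e" using e by simp
  have "vector_derivative (\<lambda>s. x + s *\<^sub>R v) (at t) = vel c ?\<eta> t"
    by (rule vector_derivative_cong_ball(2)[where f = "\<lambda>s. x + s *\<^sub>R v" and h = "\<lambda>s. coord c (?\<eta> s)", OF e(1) _ tb]) (rule eq)
  then have "vel c ?\<eta> t = v" using vector_derivative_at[OF vd] by simp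
  then show "spd ?\<eta> t = sqrt (Qf (g c (x + t *\<^sub>R v)) v)"
    using spd_eq[OF c reg] eq[OF tb] by simp
qed

lemma length_nonneg: "has_length X A g \<gamma> L \<Longrightarrow> 0 \<le> L"
  unfolding has_length_iff using has_integral_nonneg spd_nonneg by blast

lemma pathin_reverse:
  assumes "pathin X \<gamma>" shows "pathin X (\<lambda>t. \<gamma> (1 - t))"
proof -
  have "continuous_map (top_of_set {0..1::real}) (top_of_set {0..1}) (\<lambda>t. 1 - t)"
    by (auto simp: continuous_map_in_subtopology intro!: continuous_intros)
  from continuous_map_compose[OF this, of X \<gamma>] show ?thesis using assms by (simp add: pathin_def o_def)
qed

lemma length_reverse:
  assumes "has_length X A g \<gamma> L"
  shows "has_length X A g (\<lambda>t. \<gamma> (1 - t)) L"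
proof -
  obtain S where path: "pathin X \<gamma>" and S: "finite S" and reg: "\<And>t. t \<in> {0<..<1} - S \<Longrightarrow> \<exists>c\<in>A. regC c \<gamma> t"
    and int: "(spd \<gamma> has_integral L) {0..1}"
    using assms unfolding has_length_iff regular_off_def by blast
  let ?S = "(\<lambda>t. 1 - t) ` S"
  have r: "\<exists>c\<in>A. regC c (\<lambda>t. \<gamma> (1 - t)) t" "spd (\<lambda>t. \<gamma> (1 - t)) t = spd \<gamma> (1 - t)" if t: "t \<in> {0<..<1} - ?S" for t
  proof -
    have "1 - t \<in> {0<..<1} - S" using t by (force simp: image_iff)
    then obtain c where c: "c \<in> A" "regC c \<gamma> (1 - t)" using reg by blast
    have e: "(-1) * s + 1 = 1 - s" for s :: real by simp
    have c': "regC c \<gamma> ((-1) * t + 1)" using c(2) by simp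
    show "\<exists>c\<in>A. regC c (\<lambda>t. \<gamma> (1 - t)) t" "spd (\<lambda>t. \<gamma> (1 - t)) t = spd \<gamma> (1 - t)"
      using regC_affine[OF _ c(1) c'] c(1) unfolding e by auto
  qed
  have i1: "((\<lambda>t. spd \<gamma> (1 - t)) has_integral L) {0..1}"
    using has_integral_affinity01[OF int, of "-1" 1] by (simp add: image_comp o_def)
  have "(spd (\<lambda>t. \<gamma> (1 - t)) has_integral L) {0..1}"
  proof (rule has_integral_spike_finite[OF _ _ i1])
    show "finite (?S \<union> {0,1})" using S by simp
    show "spd (\<lambda>t. \<gamma> (1 - t)) t = spd \<gamma> (1 - t)" if "t \<in> {0..1} - (?S \<union> {0,1})" for t
      by (rule r(2)) (use that in auto)
  qed
  moreover have "regular_off ?S (\<lambda>t. \<gamma> (1 - t))" unfolding regular_off_def using S r(1) by simp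
  ultimately show ?thesis unfolding has_length_iff using pathin_reverse[OF path] by blast
qed

text \<open>The summands 0 and -1 keep the affine shape \<open>m * t + b\<close> of
  \<open>regC_affine\<close>.\<close>

definition pjoin :: "(real \<Rightarrow> 'a) \<Rightarrow> (real \<Rightarrow> 'a) \<Rightarrow> real \<Rightarrow> 'a" where
  "pjoin \<gamma> \<eta> t = (if t \<le> 1/2 then \<gamma> (2 * t + 0) else \<eta> (2 * t + (-1)))"

lemma pathin_pjoin:
  assumes "pathin X \<gamma>" "pathin X \<eta>" "\<gamma> 1 = \<eta> 0"
  shows "pathin X (pjoin \<gamma> \<eta>)"
  unfolding pathin_def pjoin_def
proof (rule continuous_map_cases_le)
  show "continuous_map (top_of_set {0..1}) euclideanreal (\<lambda>t. t)" "continuous_map (top_of_set {0..1}) euclideanreal (\<lambda>t. 1/2)"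
    by (auto intro!: continuous_intros)
  have 1: "continuous_map (top_of_set {t \<in> {0..1}. t \<le> 1/2}) (top_of_set {0..1::real}) (\<lambda>t. 2 * t + 0)"
    "continuous_map (top_of_set {t \<in> {0..1}. 1/2 \<le> t}) (top_of_set {0..1::real}) (\<lambda>t. 2 * t + (-1))"
    by (auto simp: continuous_map_in_subtopology intro!: continuous_intros)
  show "continuous_map (subtopology (top_of_set {0..1}) {x \<in> topspace (top_of_set {0..1}). x \<le> 1/2}) X (\<lambda>t. \<gamma> (2 * t + 0))"
  proof -
    have "{0..1} \<inter> {x \<in> topspace (top_of_set {0..1}). x \<le> 1/2} = {t \<in> {0..1::real}. t \<le> 1/2}" by auto
    then show ?thesis
      using continuous_map_compose[OF 1(1), of X \<gamma>] assms(1)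
      unfolding subtopology_subtopology by (simp only: pathin_def o_def)
  qed
  show "continuous_map (subtopology (top_of_set {0..1}) {x \<in> topspace (top_of_set {0..1}). 1/2 \<le> x}) X (\<lambda>t. \<eta> (2 * t + (-1)))"
  proof -
    have "{0..1} \<inter> {x \<in> topspace (top_of_set {0..1}). 1/2 \<le> x} = {t \<in> {0..1::real}. 1/2 \<le> t}" by auto
    then show ?thesis
      using continuous_map_compose[OF 1(2), of X \<eta>] assms(2)
      unfolding subtopology_subtopology by (simp only: pathin_def o_def)
  qed
next
  fix t :: real assume "t = 1/2"
  then have "2 * t + 0 = 1" "2 * t + (-1) = 0" by simp_all
  then show "\<gamma> (2 * t + 0) = \<eta> (2 * t + (-1))" using assms(3) by (simp only:)
qed

lemma length_join:
  assumes "has_length X A g \<gamma> L" "has_length X A g \<eta> K" "\<gamma> 1 = \<eta> 0"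
  shows "has_length X A g (pjoin \<gamma> \<eta>) (L + K)"
proof -
  obtain S where path: "pathin X \<gamma>" and S: "finite S" and reg: "\<And>t. t \<in> {0<..<1} - S \<Longrightarrow> \<exists>c\<in>A. regC c \<gamma> t"
    and int: "(spd \<gamma> has_integral L) {0..1}"
    using assms(1) unfolding has_length_iff regular_off_def by blast
  obtain R where path': "pathin X \<eta>" and R: "finite R" and reg': "\<And>t. t \<in> {0<..<1} - R \<Longrightarrow> \<exists>c\<in>A. regC c \<eta> t"
    and int': "(spd \<eta> has_integral K) {0..1}"
    using assms(2) unfolding has_length_iff regular_off_def by blast
  let ?j = "pjoin \<gamma> \<eta>"
  define S' where "S' = (\<lambda>t. t / 2) ` S" 
  define R' where "R' = (\<lambda>t. (t + 1) / 2) ` R"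
  have r1: "\<exists>c\<in>A. regC c ?j t" "spd ?j t = 2 * spd \<gamma> (2 * t + 0)" if t: "0 < t" "t < 1/2" "t \<notin> S'" for t
  proof -
    have "2 * t \<notin> S"
    proof
      assume "2 * t \<in> S"
      then have "2 * t / 2 \<in> S'" unfolding S'_def by (rule imageI)
      then show False using t(3) by simp
    qed
    then obtain c where c: "c \<in> A" "regC c \<gamma> (2 * t + 0)" using reg[of "2 * t"] t by auto
    have e: "(1/2 - t) > 0" using t by simp
    have eq: "\<gamma> (2 * \<tau> + 0) = ?j \<tau>" if "\<tau> \<in> ball t (1/2 - t)" for \<tau>
      using that by (auto simp: pjoin_def dist_real_def)
    have n: "(2::real) \<noteq> 0" by simp
    note a = regC_affine[OF n c]
    show "\<exists>c\<in>A. regC c ?j t" "spd ?j t = 2 * spd \<gamma> (2 * t + 0)"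
      using regC_cong[where \<eta> = "\<lambda>s. \<gamma> (2 * s + 0)" and \<eta>' = ?j, OF e eq c(1) a(1)] a(2) c(1) by auto
  qed
  have r2: "\<exists>c\<in>A. regC c ?j t" "spd ?j t = 2 * spd \<eta> (2 * t + (-1))" if t: "1/2 < t" "t < 1" "t \<notin> R'" for t
  proof -
    have "2 * t + (-1) \<notin> R"
    proof
      assume "2 * t + (-1) \<in> R"
      then have "(2 * t + (-1) + 1) / 2 \<in> R'" unfolding R'_def by (rule imageI)
      then show False using t(3) by simp
    qed
    then obtain c where c: "c \<in> A" "regC c \<eta> (2 * t + (-1))" using reg'[of "2 * t + (-1)"] t by auto
    have e: "(t - 1/2) > 0" using t by simp
    have eq: "\<eta> (2 * \<tau> + (-1)) = ?j \<tau>" if "\<tau> \<in> ball t (t - 1/2)" for \<tau>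
      using that by (auto simp: pjoin_def dist_real_def)
    have n: "(2::real) \<noteq> 0" by simp
    note a = regC_affine[OF n c]
    show "\<exists>c\<in>A. regC c ?j t" "spd ?j t = 2 * spd \<eta> (2 * t + (-1))"
      using regC_cong[where \<eta> = "\<lambda>s. \<eta> (2 * s + (-1))" and \<eta>' = ?j, OF e eq c(1) a(1)] a(2) c(1) by auto
  qed
  have i1: "((\<lambda>t. 2 * spd \<gamma> (2 * t + 0)) has_integral L) {0..1/2}"
    and i2: "((\<lambda>t. 2 * spd \<eta> (2 * t + (-1))) has_integral K) {1/2..1}"
    using has_integral_affinity01[OF int, where m = 2 and c = 0, THEN has_integral_cmul[where c = 2]]
      has_integral_affinity01[OF int', where m = 2 and c = "-1", THEN has_integral_cmul[where c = 2]]
    by (simp_all only: image_affinity_atLeastAtMost_div_diff, simp_all add: mult_ac)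
  have j1: "(spd ?j has_integral L) {0..1/2}"
  proof (rule has_integral_spike_finite[OF _ _ i1])
    show "finite (S' \<union> {0, 1/2})" using S by (simp add: S'_def)
    show "spd ?j t = 2 * spd \<gamma> (2 * t + 0)" if "t \<in> {0..1/2} - (S' \<union> {0, 1/2})" for t
      by (rule r1(2)) (use that in auto)
  qed
  have j2: "(spd ?j has_integral K) {1/2..1}"
  proof (rule has_integral_spike_finite[OF _ _ i2])
    show "finite (R' \<union> {1, 1/2})" using R by (simp add: R'_def)
    show "spd ?j t = 2 * spd \<eta> (2 * t + (-1))" if "t \<in> {1/2..1} - (R' \<union> {1, 1/2})" for t
      by (rule r2(2)) (use that in auto)
  qed
  have "(spd ?j has_integral (L + K)) {0..1}"
    by (rule has_integral_combine[OF _ _ j1 j2]) auto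
  \<comment> \<open>The curve may have a corner at the junction 1/2.\<close>
  moreover have "regular_off (S' \<union> R' \<union> {1/2}) ?j"
    unfolding regular_off_def
  proof (intro conjI ballI)
    show "finite (S' \<union> R' \<union> {1/2})" using S R by (simp add: S'_def R'_def)
    fix t :: real assume t: "t \<in> {0<..<1} - (S' \<union> R' \<union> {1/2})"
    then show "\<exists>c\<in>A. regC c ?j t" using r1(1)[of t] r2(1)[of t] by (cases "t < 1/2") auto
  qed
  ultimately show ?thesis unfolding has_length_iff using pathin_pjoin[OF path path' assms(3)] by blast
qed

lemma pjoin_ends: "pjoin \<gamma> \<eta> 0 = \<gamma> 0" "pjoin \<gamma> \<eta> 1 = \<eta> 1"
  by (simp_all add: pjoin_def)

text \<open>Off a finite set the speed of the image is at most k times the original speed.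
  Continuity is available there but not on all of [0, 1], so integrability comes from measurability
  and domination.\<close>

lemma length_image:
  assumes len: "has_length X A g \<gamma> L" and F: "holomorphic_map X A X A F" and pb: "is_pullback A F g h"
    and k: "k \<ge> 0" "\<And>c x v. c \<in> A \<Longrightarrow> x \<in> coord_range c \<Longrightarrow> Qf (h c x) v \<le> k\<^sup>2 * Qf (g c x) v"
  shows "\<exists>L'\<le>k * L. has_length X A g (\<lambda>t. F (\<gamma> t)) L'"
proof -
  obtain S where path: "pathin X \<gamma>" and S: "finite S" and reg: "\<And>t. t \<in> {0<..<1} - S \<Longrightarrow> \<exists>c\<in>A. regC c \<gamma> t"
    and int: "(spd \<gamma> has_integral L) {0..1}"
    using len unfolding has_length_iff regular_off_def by blast
  let ?\<eta> = "\<lambda>t. F (\<gamma> t)"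
  have cF: "continuous_map X X F" using F by (simp add: holomorphic_map_def)
  have path': "pathin X ?\<eta>"
    using continuous_map_compose[OF _ cF, of "top_of_set {0..1}" \<gamma>] path by (simp add: pathin_def o_def)
  have r: "\<exists>c\<in>A. regC c ?\<eta> t" "spd ?\<eta> t \<le> k * spd \<gamma> t" if t: "t \<in> {0<..<1} - S" for t
  proof -
    obtain c where c: "c \<in> A" "regC c \<gamma> t" using reg[OF t] by blast
    have "\<gamma> t \<in> topspace X" using regC_in[OF c(2)] cdom_subset[OF c(1)] by blast
    then have "F (\<gamma> t) \<in> topspace X" using cF by (auto simp: continuous_map_def)
    then obtain c' where c': "c' \<in> A" "F (\<gamma> t) \<in> cdom c'" using cover by blast
    note im = regC_image[OF F c(1) c'(1) c(2) c'(2)]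
    show "\<exists>c\<in>A. regC c ?\<eta> t" using im(1) c'(1) by blast
    have "(spd ?\<eta> t)\<^sup>2 = Qf (h c (coord c (\<gamma> t))) (vel c \<gamma> t)"
      using spd_eq[OF c'(1) im(1)] pullback_form[OF pb c(1) c'(1) regC_in[OF c(2)] c'(2)] im(2)
        g_nonneg[OF c'(1) coord_in_range[OF c'(2)]] by simp
    also have "\<dots> \<le> k\<^sup>2 * Qf (g c (coord c (\<gamma> t))) (vel c \<gamma> t)"
      by (rule k(2)[OF c(1) coord_in_range[OF regC_in[OF c(2)]]])
    also have "\<dots> = (k * spd \<gamma> t)\<^sup>2"
      using spd_eq[OF c] g_nonneg[OF c(1) coord_in_range[OF regC_in[OF c(2)]]] by (simp add: power_mult_distrib)
    finally show "spd ?\<eta> t \<le> k * spd \<gamma> t"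
      by (rule power2_le_imp_le) (use k(1) spd_nonneg in simp)
  qed
  let ?J = "{0<..<1} - S"
  have cont: "continuous_on ?J (spd ?\<eta>)" by (rule spd_continuous) (rule r(1))
  have oJ: "open ?J" using finite_imp_closed[OF S] by (intro open_Diff) auto
  have neg: "negligible (({0..1} - ?J) \<union> (?J - {0..1}))"
    by (rule negligible_finite) (rule finite_subset[of _ "S \<union> {0,1}"], use S in auto)
  have spike: "(u has_integral y) {0..1} \<longleftrightarrow> (u has_integral y) ?J" for u :: "real \<Rightarrow> real" and y
    by (rule has_integral_spike_set_eq; rule negligible_subset[OF neg]) auto
  have intJ: "(spd \<gamma> has_integral L) ?J"
    using int spike by simp
  have mJ: "?J \<in> sets lebesgue"
    by (rule sets_completionI_sets) (simp only: sets_lborel borel_open[OF oJ])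
  have "spd ?\<eta> integrable_on ?J"
  proof (rule measurable_bounded_by_integrable_imp_integrable[OF _ _ _ mJ])
    show "spd ?\<eta> \<in> borel_measurable (lebesgue_on ?J)"
      by (rule continuous_imp_measurable_on_sets_lebesgue[OF cont mJ])
    show "(\<lambda>t. k * spd \<gamma> t) integrable_on ?J" using has_integral_mult_right[OF intJ, of k] by (rule has_integral_integrable)
    show "norm (spd ?\<eta> t) \<le> k * spd \<gamma> t" if "t \<in> ?J" for t using r(2)[OF that] spd_nonneg by simp
  qed
  then obtain L' where L': "(spd ?\<eta> has_integral L') ?J" by blast
  have "L' \<le> k * L" by (rule has_integral_le[OF L' has_integral_mult_right[OF intJ, of k]]) (rule r(2))
  moreover have "(spd ?\<eta> has_integral L') {0..1}"
    using L' spike by simp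
  moreover have "regular_off S ?\<eta>" unfolding regular_off_def using S r(1) by blast
  ultimately show ?thesis unfolding has_length_iff using path' by blast
qed

text \<open>The straight segment in coordinates has speed at most sqrt K * norm (y - x).\<close>

lemma length_line:
  assumes c: "c \<in> A" "cball z r \<subseteq> coord_range c" and K: "\<And>y v. y \<in> cball z r \<Longrightarrow> Qf (g c y) v \<le> K * (norm v)\<^sup>2"
    and x: "x \<in> cball z r" "y \<in> cball z r"
  shows "\<exists>\<gamma> L. has_length X A g \<gamma> L \<and> \<gamma> 0 = coord_inv c x \<and> \<gamma> 1 = coord_inv c y \<and> L \<le> sqrt K * norm (y - x)"
proof -
  define v where "v = y - x"
  let ?\<gamma> = "\<lambda>s. coord_inv c (x + s *\<^sub>R v)"
  define J where "J = (\<lambda>s. x + s *\<^sub>R v) -` coord_range c"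
  have J: "open J" unfolding J_def
    by (intro open_vimage range_open[OF c(1)] continuous_intros)
  have seg: "x + s *\<^sub>R v \<in> cball z r" if "s \<in> {0..1}" for s
  proof -
    have "x + s *\<^sub>R v = (1 - s) *\<^sub>R x + s *\<^sub>R y" by (simp add: v_def algebra_simps)
    then show ?thesis using convexD_alt[OF convex_cball x, of s] that by simp
  qed
  have segr: "x + s *\<^sub>R v \<in> coord_range c" if "s \<in> {0..1}" for s using seg[OF that] c(2) by blast
  have sJ: "{0..1} \<subseteq> J" using segr by (auto simp: J_def)
  have JJ: "x + s *\<^sub>R v \<in> coord_range c" if "s \<in> J" for s using that by (simp add: J_def)
  note l = spd_line[OF c(1) J _ JJ]
  have reg: "\<exists>c\<in>A. regC c ?\<gamma> t" if "t \<in> {0..1}" for t using l(1) that sJ c(1) by blast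
  have "continuous_map (top_of_set {0..1}) (top_of_set (coord_range c)) (\<lambda>s. x + s *\<^sub>R v)"
    using segr by (auto simp: continuous_map_in_subtopology intro!: continuous_intros)
  from continuous_map_compose[OF this coord_inv_continuous[OF c(1)]]
  have path: "pathin X ?\<gamma>" by (simp add: pathin_def o_def)
  have "spd ?\<gamma> integrable_on {0..1}"
    by (rule integrable_continuous_interval, rule spd_continuous) (rule reg)
  then obtain L where L: "(spd ?\<gamma> has_integral L) {0..1}" by blast
  have "L \<le> sqrt K * norm v"
  proof (rule has_integral_le[OF L])
    show "((\<lambda>_. sqrt K * norm v) has_integral sqrt K * norm v) {0..1::real}"
      using has_integral_const_real[of "sqrt K * norm v" 0 1] by simp
    fix t :: real assume t: "t \<in> {0..1}"
    have "spd ?\<gamma> t = sqrt (Qf (g c (x + t *\<^sub>R v)) v)" using l(2) t sJ by blast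
    also have "\<dots> \<le> sqrt (K * (norm v)\<^sup>2)" using K[OF seg[OF t]] by simp
    finally show "spd ?\<gamma> t \<le> sqrt K * norm v" by (simp add: real_sqrt_mult)
  qed
  moreover have "regular_off {} ?\<gamma>" unfolding regular_off_def using reg by auto
  ultimately show ?thesis
    unfolding has_length_iff using path L
    by (intro exI[of _ ?\<gamma>]) (rule exI[of _ L], auto simp: v_def)
qed

text \<open>Up to the first exit from the ball the speed is at least sqrt m times the coordinate
  speed. So the length is at least sqrt m times the coordinate displacement, which has norm R at the
  exit.\<close>

lemma length_lower:
  assumes c: "c \<in> A" "cball z R \<subseteq> coord_range c" and m: "m > 0" "\<And>y v. y \<in> cball z R \<Longrightarrow> m * (norm v)\<^sup>2 \<le> Qf (g c y) v"
    and R: "R > 0" and len: "has_length X A g \<gamma> L" and start: "\<gamma> 0 \<in> cdom c" "coord c (\<gamma> 0) = z"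
    and stop: "\<not> (\<gamma> 1 \<in> cdom c \<and> dist z (coord c (\<gamma> 1)) < R)"
  shows "sqrt m * R \<le> L"
proof -
  obtain S where path: "pathin X \<gamma>" and S: "finite S" and reg: "\<And>t. t \<in> {0<..<1} - S \<Longrightarrow> \<exists>c\<in>A. regC c \<gamma> t"
    and int: "(spd \<gamma> has_integral L) {0..1}"
    using len unfolding has_length_iff regular_off_def by blast
  have cm: "continuous_map (top_of_set {0..1}) X \<gamma>" using path by (simp add: pathin_def)
  obtain \<tau> where \<tau>: "0 < \<tau>" "\<tau> \<le> 1" "\<gamma> \<tau> \<in> cdom c" "dist z (coord c (\<gamma> \<tau>)) = R"
    "\<And>t. 0 \<le> t \<Longrightarrow> t < \<tau> \<Longrightarrow> \<gamma> t \<in> cdom c \<and> dist z (coord c (\<gamma> t)) < R"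
  proof (rule first_exit[OF c cm])
    show "\<exists>t\<in>{0..1}. \<not> (\<gamma> t \<in> cdom c \<and> dist z (coord c (\<gamma> t)) < R)" using stop by (intro bexI[of _ 1]) auto
  qed (use start R in auto)
  let ?w = "\<lambda>t. coord c (\<gamma> t)"
  have r: "regC c \<gamma> t" if t: "t \<in> {0<..<\<tau>} - S" for t
  proof -
    obtain c' where c': "c' \<in> A" "regC c' \<gamma> t" using reg[of t] t \<tau>(2) by auto
    then show ?thesis using regC_change(1)[OF c'(1) c(1) c'(2)] \<tau>(5)[of t] t by simp
  qed
  have contw: "continuous_on {0..\<tau>} ?w"
  proof (rule continuous_on_subset[OF curve_coord_continuous[OF cm c(1)]])
    show "{0..\<tau>} \<subseteq> {t \<in> {0..1}. \<gamma> t \<in> cdom c}"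
    proof
      fix t assume "t \<in> {0..\<tau>}"
      then show "t \<in> {t \<in> {0..1}. \<gamma> t \<in> cdom c}" using \<tau>(2,3) \<tau>(5)[of t] by (cases "t = \<tau>") auto
    qed
  qed
  \<comment> \<open>Set to 0 at the exceptional times, so that the bound by the speed holds on the
    whole interval.\<close>
  define f' where "f' = (\<lambda>t. if t \<in> {0<..<\<tau>} - S then vel c \<gamma> t else 0)"
  have "(f' has_integral (?w \<tau> - ?w 0)) {0..\<tau>}"
  proof (rule fundamental_theorem_of_calculus_interior_strong[OF S _ _ contw])
    fix t assume t: "t \<in> {0<..<\<tau>} - S"
    obtain e where e: "e > 0" "(\<lambda>\<tau>. coord c (\<gamma> \<tau>)) C1_differentiable_on ball t e"
      using r[OF t] unfolding regC_def by blast
    then have "?w differentiable at t" by (simp add: C1_differentiable_on_eq)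
    then show "(?w has_vector_derivative f' t) (at t)" using t by (simp add: f'_def vector_derivative_works)
  qed (use \<tau> in auto)
  moreover have "spd \<gamma> integrable_on {0..\<tau>}"
    by (rule integrable_subinterval_real[OF has_integral_integrable[OF int]]) (use \<tau> in auto)
  then have i2: "(\<lambda>t. spd \<gamma> t / sqrt m) integrable_on {0..\<tau>}" by (rule integrable_on_divide)
  ultimately have "norm (?w \<tau> - ?w 0) \<le> integral {0..\<tau>} (\<lambda>t. spd \<gamma> t / sqrt m)"
  proof -
    assume fi: "(f' has_integral (?w \<tau> - ?w 0)) {0..\<tau>}"
    have "norm (integral {0..\<tau>} f') \<le> integral {0..\<tau>} (\<lambda>t. spd \<gamma> t / sqrt m)"
    proof (rule Henstock_Kurzweil_Integration.integral_norm_bound_integral[OF has_integral_integrable[OF fi] i2])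
      fix t assume "t \<in> {0..\<tau>}"
      show "norm (f' t) \<le> spd \<gamma> t / sqrt m"
      proof (cases "t \<in> {0<..<\<tau>} - S")
        case True
        have "?w t \<in> cball z R" using \<tau>(5)[of t] True by (simp add: less_imp_le)
        from m(2)[OF this, of "vel c \<gamma> t"] have "sqrt (m * (norm (vel c \<gamma> t))\<^sup>2) \<le> spd \<gamma> t"
          unfolding spd_eq[OF c(1) r[OF True]] by (rule real_sqrt_le_mono)
        then show ?thesis using True m(1) by (simp add: f'_def real_sqrt_mult field_simps)
      next
        case False
        have "f' t = 0" unfolding f'_def using False by (rule if_not_P)
        then show ?thesis using spd_nonneg[of \<gamma> t] m(1) by simp
      qed
    qed
    then show ?thesis using integral_unique[OF fi] by simp
  qed
  also have "\<dots> \<le> integral {0..1} (\<lambda>t. spd \<gamma> t / sqrt m)"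
    by (rule integral_subset_le[OF _ i2 integrable_on_divide[OF has_integral_integrable[OF int]]])
       (use \<tau> spd_nonneg m(1) in auto)
  also have "\<dots> = L / sqrt m" using integral_unique[OF has_integral_divide[OF int, of "sqrt m"]] .
  finally have "R \<le> L / sqrt m" using \<tau>(4) start(2) by (simp add: dist_norm norm_minus_commute)
  then show ?thesis using m(1) by (simp add: pos_le_divide_eq mult.commute)
qed

end

section \<open>The Riemannian distance is a metric\<close>

context kaehler_mfd
begin

definition lengths :: "'a \<Rightarrow> 'a \<Rightarrow> real set" where
  "lengths p q = {L. \<exists>\<gamma>. has_length X A g \<gamma> L \<and> \<gamma> 0 = p \<and> \<gamma> 1 = q}"

lemma lengths_nonneg: "L \<in> lengths p q \<Longrightarrow> 0 \<le> L"
  by (auto simp: lengths_def length_nonneg)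

lemma lengths_sym: "L \<in> lengths p q \<Longrightarrow> L \<in> lengths q p"
  unfolding lengths_def using length_reverse by force

lemma lengths_trans: 
  assumes "L \<in> lengths p q" "K \<in> lengths q r" shows "L + K \<in> lengths p r"
proof -
  obtain \<gamma> \<eta> where "has_length X A g \<gamma> L" "\<gamma> 0 = p" "\<gamma> 1 = q" "has_length X A g \<eta> K" "\<eta> 0 = q" "\<eta> 1 = r"
    using assms unfolding lengths_def by blast
  then show ?thesis
    unfolding lengths_def using length_join[of \<gamma> L \<eta> K] pjoin_ends[of \<gamma> \<eta>] by auto
qed

lemma lengths_local:
  assumes c: "c \<in> A" "cball z r \<subseteq> coord_range c"
  shows "\<exists>K>0. \<forall>x\<in>cball z r. \<forall>y\<in>cball z r. \<exists>L\<in>lengths (coord_inv c x) (coord_inv c y). L \<le> K * norm (y - x)"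
proof -
  obtain m K where K: "m > 0" "K > 0" "\<And>y v. y \<in> cball z r \<Longrightarrow> m * (norm v)\<^sup>2 \<le> Qf (g c y) v"
    "\<And>y v. y \<in> cball z r \<Longrightarrow> Qf (g c y) v \<le> K * (norm v)\<^sup>2"
    using g_bounds_on_compact[OF c(1) compact_cball c(2)] by blast
  have "\<exists>L\<in>lengths (coord_inv c x) (coord_inv c y). L \<le> sqrt K * norm (y - x)"
    if "x \<in> cball z r" "y \<in> cball z r" for x y
    using length_line[OF c K(4) that] unfolding lengths_def by blast
  then show ?thesis using K(2) by (intro exI[of _ "sqrt K"]) auto
qed

lemma chart_ball:
  assumes "p \<in> topspace X"
  obtains c r where "c \<in> A" "p \<in> cdom c" "r > 0" "cball (coord c p) r \<subseteq> coord_range c"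
proof -
  obtain c where c: "c \<in> A" "p \<in> cdom c" using cover[OF assms] by blast
  obtain r where "r > 0" "cball (coord c p) r \<subseteq> coord_range c"
    using range_open[OF c(1)] coord_in_range[OF c(2)] open_contains_cball by blast
  then show ?thesis using that c by blast
qed

lemma lengths_near:
  assumes "p \<in> topspace X"
  shows "\<exists>N. openin X N \<and> p \<in> N \<and> (\<forall>q\<in>N. lengths p q \<noteq> {})"
proof -
  obtain c r where c: "c \<in> A" "p \<in> cdom c" and r: "r > 0" "cball (coord c p) r \<subseteq> coord_range c"
    by (rule chart_ball[OF assms])
  obtain K where K: "K > 0" "\<forall>x\<in>cball (coord c p) r. \<forall>y\<in>cball (coord c p) r. \<exists>L\<in>lengths (coord_inv c x) (coord_inv c y). L \<le> K * norm (y - x)"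
    using lengths_local[OF c(1) r(2)] by blast
  let ?N = "{q \<in> cdom c. coord c q \<in> ball (coord c p) r}"
  have "lengths p q \<noteq> {}" if q: "q \<in> ?N" for q
  proof -
    have "coord c p \<in> cball (coord c p) r" "coord c q \<in> cball (coord c p) r" using q r(1) by auto
    from K(2)[rule_format, OF this] show ?thesis
      using coord_inv_coord[OF c(1)] c(2) q by auto
  qed
  moreover have "p \<in> ?N" using c(2) r(1) by simp
  ultimately show ?thesis using coord_preimage_open[OF c(1) open_ball] by blast
qed

text \<open>The points joined to p by a curve that has a length form an open and closed set, and X
  is connected. This keeps the infimum in \<open>riem_dist\<close> from ranging over the empty
  set.\<close>

lemma lengths_nonempty:
  assumes "p \<in> topspace X" "q \<in> topspace X"
  shows "lengths p q \<noteq> {}"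
proof -
  define R where "R = {u \<in> topspace X. lengths p u \<noteq> {}}"
  have "openin X R"
  proof (subst openin_subopen, rule ballI)
    fix u assume u: "u \<in> R"
    then obtain N where N: "openin X N" "u \<in> N" "\<forall>q\<in>N. lengths u q \<noteq> {}"
      using lengths_near[of u] by (auto simp: R_def)
    have "N \<subseteq> R"
    proof
      fix w assume w: "w \<in> N"
      have "lengths p u \<noteq> {}" "lengths u w \<noteq> {}" using u N(3) w by (auto simp: R_def)
      then obtain L K where "L \<in> lengths p u" "K \<in> lengths u w" by blast
      then have "lengths p w \<noteq> {}" using lengths_trans by blast
      then show "w \<in> R" using openin_subset[OF N(1)] w by (auto simp: R_def)
    qed
    then show "\<exists>T. openin X T \<and> u \<in> T \<and> T \<subseteq> R" using N by blast
  qed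
  moreover have "openin X (topspace X - R)"
  proof (subst openin_subopen, rule ballI)
    fix u assume u: "u \<in> topspace X - R"
    then obtain N where N: "openin X N" "u \<in> N" "\<forall>q\<in>N. lengths u q \<noteq> {}"
      using lengths_near[of u] by auto
    have "N \<subseteq> topspace X - R"
    proof
      fix w assume w: "w \<in> N"
      have "lengths p w = {}"
      proof (rule ccontr)
        assume "lengths p w \<noteq> {}"
        then obtain L K where "L \<in> lengths p w" "K \<in> lengths u w" using N(3) w by blast
        then have "lengths p u \<noteq> {}" using lengths_trans lengths_sym by blast
        then show False using u by (auto simp: R_def)
      qed
      then show "w \<in> topspace X - R" using openin_subset[OF N(1)] w by (auto simp: R_def)
    qed
    then show "\<exists>T. openin X T \<and> u \<in> T \<and> T \<subseteq> topspace X - R" using N by blast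
  qed
  moreover have "R \<subseteq> topspace X" by (auto simp: R_def)
  ultimately have "openin X R \<and> closedin X R" by (simp add: closedin_def)
  moreover have "connected_space X" using mfd by (simp add: complex_manifold_def)
  ultimately have "R = {} \<or> R = topspace X" by (simp add: connected_space_clopen_in)
  moreover have "p \<in> R"
    using lengths_near[OF assms(1)] assms(1) by (auto simp: R_def)
  ultimately show ?thesis using assms(2) by (auto simp: R_def)
qed

abbreviation rd :: "'a \<Rightarrow> 'a \<Rightarrow> real" where
  "rd \<equiv> riem_dist X A g"

lemma rd_eq: "p \<in> topspace X \<Longrightarrow> q \<in> topspace X \<Longrightarrow> rd p q = Inf (lengths p q)"
  by (simp add: riem_dist_def lengths_def)

lemma lengths_bdd: "bdd_below (lengths p q)"
  using lengths_nonneg by (auto intro!: bdd_belowI[of _ 0])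

lemma rd_le:
  assumes "L \<in> lengths p q" "p \<in> topspace X" "q \<in> topspace X" shows "rd p q \<le> L"
  using cInf_lower[OF assms(1) lengths_bdd] assms by (simp add: rd_eq)

lemma rd_less:
  assumes "p \<in> topspace X" "q \<in> topspace X" "rd p q < e"
  shows "\<exists>L\<in>lengths p q. L < e"
  using assms cInf_less_iff[OF lengths_nonempty[OF assms(1,2)] lengths_bdd] by (simp add: rd_eq)

lemma rd_nonneg: "0 \<le> rd p q"
proof (cases "p \<in> topspace X \<and> q \<in> topspace X")
  case True
  then show ?thesis using cInf_greatest[OF lengths_nonempty, of p q 0] lengths_nonneg by (simp add: rd_eq)
next
  case False
  then have "rd p q = 0" unfolding riem_dist_def by (rule if_not_P)
  then show ?thesis by simp
qed

lemma rd_commute: "rd p q = rd q p"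
proof -
  have "lengths p q = lengths q p" using lengths_sym by blast
  then show ?thesis by (auto simp: riem_dist_def lengths_def)
qed

lemma rd_triangle:
  assumes "p \<in> topspace X" "q \<in> topspace X" "r \<in> topspace X"
  shows "rd p r \<le> rd p q + rd q r"
proof (rule field_le_epsilon)
  fix e :: real assume e: "e > 0"
  obtain L where L: "L \<in> lengths p q" "L < rd p q + e / 2" using rd_less[OF assms(1,2), of "rd p q + e / 2"] e by auto
  obtain K where K: "K \<in> lengths q r" "K < rd q r + e / 2" using rd_less[OF assms(2,3), of "rd q r + e / 2"] e by auto
  have "rd p r \<le> L + K" by (rule rd_le[OF lengths_trans[OF L(1) K(1)] assms(1,3)])
  then show "rd p r \<le> rd p q + rd q r + e" using L(2) K(2) by simp
qed

lemma rd_upper: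
  assumes c: "c \<in> A" "cball z r \<subseteq> coord_range c"
  shows "\<exists>K>0. \<forall>x\<in>cball z r. \<forall>y\<in>cball z r. rd (coord_inv c x) (coord_inv c y) \<le> K * norm (y - x)"
proof -
  obtain K where K: "K > 0" "\<forall>x\<in>cball z r. \<forall>y\<in>cball z r. \<exists>L\<in>lengths (coord_inv c x) (coord_inv c y). L \<le> K * norm (y - x)"
    using lengths_local[OF c] by blast
  have M: "coord_inv c x \<in> topspace X" if "x \<in> cball z r" for x
    using coord_inv_in_cdom[of x c] cdom_subset[OF c(1)] c(2) that by blast
  have "rd (coord_inv c x) (coord_inv c y) \<le> K * norm (y - x)" if xy: "x \<in> cball z r" "y \<in> cball z r" for x y
  proof -
    obtain L where L: "L \<in> lengths (coord_inv c x) (coord_inv c y)" "L \<le> K * norm (y - x)"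
      using K(2)[rule_format, OF xy] by blast
    then show ?thesis using rd_le[OF L(1) M[OF xy(1)] M[OF xy(2)]] by simp
  qed
  then show ?thesis using K(1) by blast
qed

text \<open>By \<open>length_lower\<close> a curve shorter than sqrt m * R cannot leave the
  coordinate ball. Together with \<open>rd_upper\<close> this compares distance and coordinates near
  p.\<close>

lemma rd_lower:
  assumes c: "c \<in> A" "p \<in> cdom c" "R > 0" "cball (coord c p) R \<subseteq> coord_range c"
  shows "\<exists>e>0. \<forall>q\<in>topspace X. rd p q < e \<longrightarrow> q \<in> cdom c \<and> dist (coord c p) (coord c q) < R"
proof -
  obtain m K where m: "m > 0" "K > 0" "\<And>y v. y \<in> cball (coord c p) R \<Longrightarrow> m * (norm v)\<^sup>2 \<le> Qf (g c y) v"
    "\<And>y v. y \<in> cball (coord c p) R \<Longrightarrow> Qf (g c y) v \<le> K * (norm v)\<^sup>2"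
    using g_bounds_on_compact[OF c(1) compact_cball c(4)] by blast
  have pM: "p \<in> topspace X" using c(1,2) cdom_subset by blast
  have "q \<in> cdom c \<and> dist (coord c p) (coord c q) < R" if q: "q \<in> topspace X" "rd p q < sqrt m * R" for q
  proof (rule ccontr)
    assume neg: "\<not> ?thesis"
    obtain L where "L \<in> lengths p q" and L: "L < sqrt m * R" using rd_less[OF pM q] by blast
    then obtain \<gamma> where \<gamma>: "has_length X A g \<gamma> L" "\<gamma> 0 = p" "\<gamma> 1 = q" unfolding lengths_def by blast
    have "sqrt m * R \<le> L"
      by (rule length_lower[OF c(1,4) m(1,3) c(3) \<gamma>(1)]) (use \<gamma> c(2) neg in auto)
    then show False using L by simp
  qed
  then show ?thesis using m(1) c(3) by (intro exI[of _ "sqrt m * R"]) auto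
qed

lemma rd_zero:
  assumes "p \<in> topspace X" "q \<in> topspace X"
  shows "rd p q = 0 \<longleftrightarrow> p = q"
proof
  assume 0: "rd p q = 0"
  obtain c r where c: "c \<in> A" "p \<in> cdom c" and r: "r > 0" "cball (coord c p) r \<subseteq> coord_range c"
    by (rule chart_ball[OF assms(1)])
  have near: "q \<in> cdom c \<and> dist (coord c p) (coord c q) < R" if R: "R > 0" "R \<le> r" for R
  proof -
    have "cball (coord c p) R \<subseteq> coord_range c" using r(2) R by (meson order_trans subset_cball)
    from rd_lower[OF c R(1) this] show ?thesis using assms(2) 0 by auto
  qed
  have qc: "q \<in> cdom c" using near[OF r(1)] by simp
  have "dist (coord c p) (coord c q) \<le> 0"
  proof (rule ccontr)
    assume "\<not> dist (coord c p) (coord c q) \<le> 0"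
    then show False using near[of "min r (dist (coord c p) (coord c q))"] r(1) by simp
  qed
  then have "coord c p = coord c q" by simp
  from arg_cong[OF this, of "coord_inv c"] show "p = q"
    using coord_inv_coord[OF c(1)] c(2) qc by simp
next
  assume eq: "p = q"
  obtain c r where c: "c \<in> A" "p \<in> cdom c" and r: "r > 0" "cball (coord c p) r \<subseteq> coord_range c"
    by (rule chart_ball[OF assms(1)])
  obtain K where K: "K > 0" "\<forall>x\<in>cball (coord c p) r. \<forall>y\<in>cball (coord c p) r. rd (coord_inv c x) (coord_inv c y) \<le> K * norm (y - x)"
    using rd_upper[OF c(1) r(2)] by blast
  have "coord c p \<in> cball (coord c p) r" using r(1) by simp
  from K(2)[rule_format, OF this this] have "rd p p \<le> 0" using coord_inv_coord[OF c] by simp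
  then show "rd p q = 0" using rd_nonneg[of p q] eq by simp
qed

lemma rd_metric: "Metric_space (topspace X) rd"
  by unfold_locales (auto simp: rd_nonneg rd_zero rd_triangle intro: rd_commute)

lemma rd_image:
  assumes F: "holomorphic_map X A X A F" and pb: "is_pullback A F g h"
    and k: "k \<ge> 0" "\<And>c x v. c \<in> A \<Longrightarrow> x \<in> coord_range c \<Longrightarrow> Qf (h c x) v \<le> k\<^sup>2 * Qf (g c x) v"
    and pq: "p \<in> topspace X" "q \<in> topspace X"
  shows "rd (F p) (F q) \<le> k * rd p q"
proof (rule field_le_epsilon)
  fix e :: real assume e: "e > 0"
  have FM: "F u \<in> topspace X" if "u \<in> topspace X" for u
    using F that by (auto simp: holomorphic_map_def continuous_map_def)
  \<comment> \<open>The slack is multiplied by k later; dividing by k + 1 keeps the product below e,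
    also for k = 0.\<close>
  have "e / (k + 1) > 0" using e k(1) by simp
  then obtain L where "L \<in> lengths p q" and L: "L < rd p q + e / (k + 1)"
    using rd_less[OF pq, of "rd p q + e / (k + 1)"] by auto
  then obtain \<gamma> where \<gamma>: "has_length X A g \<gamma> L" "\<gamma> 0 = p" "\<gamma> 1 = q" unfolding lengths_def by blast
  obtain L' where L': "L' \<le> k * L" "has_length X A g (\<lambda>t. F (\<gamma> t)) L'"
    using length_image[OF \<gamma>(1) F pb k] by blast
  have "L' \<in> lengths (F p) (F q)" unfolding lengths_def using L'(2) \<gamma>(2,3) by blast
  then have "rd (F p) (F q) \<le> L'" by (rule rd_le) (use FM pq in auto)
  also have "\<dots> \<le> k * (rd p q + e / (k + 1))" using L'(1) mult_left_mono[OF less_imp_le[OF L] k(1)] by linarith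
  also have "\<dots> = k * rd p q + (k / (k + 1)) * e" by (simp add: distrib_left)
  also have "\<dots> \<le> k * rd p q + 1 * e"
    using k(1) e by (intro add_left_mono mult_right_mono) auto
  finally show "rd (F p) (F q) \<le> k * rd p q + e" by simp
qed

text \<open>Holomorphy gives continuity in each chart, and the chart domains are an open cover, so
  continuity on X follows.\<close>

lemma holomorphic_to_std:
  assumes "\<And>c. c \<in> A \<Longrightarrow> holomorphic_vec_on (\<lambda>y. F (coord_inv c y) :: complex^'n) (coord_range c)"
  shows "holomorphic_map X A euclidean std_atlas F"
  unfolding holomorphic_map_def
proof (intro conjI ballI)
  show "continuous_map X euclidean F"
    unfolding continuous_map_def
  proof (intro conjI allI impI)
    fix U :: "(complex^'n) set" assume "openin euclidean U"
    then have U: "open U" by simp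
    have "{p \<in> topspace X. F p \<in> U} = (\<Union>c\<in>A. {p \<in> cdom c. coord c p \<in> coord_range c \<inter> (\<lambda>y. F (coord_inv c y)) -` U})"
    proof (intro equalityI subsetI)
      fix p assume p: "p \<in> {p \<in> topspace X. F p \<in> U}"
      then obtain c where c: "c \<in> A" "p \<in> cdom c" using cover[of p] by auto
      then have "p \<in> {p \<in> cdom c. coord c p \<in> coord_range c \<inter> (\<lambda>y. F (coord_inv c y)) -` U}"
        using p coord_inv_coord[OF c] coord_in_range[OF c(2)] by auto
      then show "p \<in> (\<Union>c\<in>A. {p \<in> cdom c. coord c p \<in> coord_range c \<inter> (\<lambda>y. F (coord_inv c y)) -` U})"
        using c(1) by blast
    next
      fix p assume "p \<in> (\<Union>c\<in>A. {p \<in> cdom c. coord c p \<in> coord_range c \<inter> (\<lambda>y. F (coord_inv c y)) -` U})"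
      then obtain c where c: "c \<in> A" "p \<in> cdom c" "F (coord_inv c (coord c p)) \<in> U" by auto
      then show "p \<in> {p \<in> topspace X. F p \<in> U}"
        using coord_inv_coord[OF c(1,2)] cdom_subset[OF c(1)] by auto
    qed
    moreover have "openin X {p \<in> cdom c. coord c p \<in> coord_range c \<inter> (\<lambda>y. F (coord_inv c y)) -` U}" if c: "c \<in> A" for c
      by (intro coord_preimage_open[OF c] continuous_open_preimage[OF holomorphic_vec_on_continuous[OF assms[OF c]] range_open[OF c] U])
    ultimately show "openin X {p \<in> topspace X. F p \<in> U}" by (auto intro: openin_Union)
  qed simp
  fix c c' assume c: "c \<in> A" and c': "c' \<in> (std_atlas :: (complex^'n, 'n) chart set)"
  have "c' = (UNIV, id)" using c' by (simp add: std_atlas_def)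
  then show "holomorphic_vec_on (local_expr c c' F) (coord c ` {p \<in> cdom c. F p \<in> cdom c'})"
    using assms[OF c] by (simp add: local_expr_def o_def coord_range_def)
qed

end

section \<open>Contraction of the distance\<close>

context kr_soliton
begin

text \<open>The metric shrinks at least by the factor exp (- 2 \<rho> t), hence lengths and
  distances at least by its square root.\<close>

lemma phi_rd:
  assumes ric: "\<And>c x v. c \<in> A \<Longrightarrow> x \<in> coord_range c \<Longrightarrow> 0 \<le> Qf (ricci (g c) x) v"
    and t: "t \<ge> 0" and pq: "p \<in> topspace X" "q \<in> topspace X"
  shows "rd (\<phi> t p) (\<phi> t q) \<le> exp (- \<rho> * t) * rd p q"
proof (rule rd_image[OF phi_holo[OF t] pullback[OF t] _ _ pq])
  fix c x v assume "c \<in> A" "x \<in> coord_range c"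
  from Qf_gt_decay[OF ric t this, of v]
  show "Qf (gt t c x) v \<le> (exp (- \<rho> * t))\<^sup>2 * Qf (g c x) v"
    by (simp add: power2_eq_square mult.assoc flip: exp_add)
qed simp

text \<open>Banach's theorem for \<phi> 1. As \<phi> t commutes with \<phi> 1, it maps the fixed
  point to a fixed point of \<phi> 1, and the contraction allows only one.\<close>

lemma fixed_point_expanding:
  assumes ric: "\<And>c x v. c \<in> A \<Longrightarrow> x \<in> coord_range c \<Longrightarrow> 0 \<le> Qf (ricci (g c) x) v"
    and \<rho>: "\<rho> > 0" and compl: "complete_metric X A g" and ne: "topspace X \<noteq> {}"
  shows "\<exists>p\<in>topspace X. \<forall>t\<ge>0. \<phi> t p = p"
proof -
  interpret MS: Metric_space "topspace X" rd by (rule rd_metric)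
  have contr: "rd (\<phi> 1 p) (\<phi> 1 q) \<le> exp (- \<rho>) * rd p q" if "p \<in> topspace X" "q \<in> topspace X" for p q
    using phi_rd[OF ric _ that, of 1] by simp
  have k1: "exp (- \<rho>) < 1" using \<rho> by simp
  obtain p where p: "p \<in> topspace X" "\<phi> 1 p = p"
  proof (rule MS.Banach_fixedpoint_thm[of "\<phi> 1" "exp (- \<rho>)"])
    show "MS.mcomplete" using compl by (simp add: complete_metric_def)
    show "\<phi> 1 \<in> topspace X \<rightarrow> topspace X" using phi_in[of 1] by auto
  qed (use ne k1 contr in auto)
  have "\<phi> t p = p" if t: "t \<ge> 0" for t
  proof -
    have tp: "\<phi> t p \<in> topspace X" by (rule phi_in[OF t p(1)])
    have "\<phi> 1 (\<phi> t p) = \<phi> t (\<phi> 1 p)"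
      using phi_add[of 1 t p] phi_add[of t 1 p] t p(1) by (simp add: add.commute)
    then have "rd (\<phi> t p) p \<le> exp (- \<rho>) * rd (\<phi> t p) p"
      using contr[OF tp p(1)] p(2) by simp
    then have "(1 - exp (- \<rho>)) * rd (\<phi> t p) p \<le> 0" by (simp add: algebra_simps)
    then have "rd (\<phi> t p) p \<le> 0" using k1 by (simp add: mult_le_0_iff)
    then show ?thesis using rd_nonneg[of "\<phi> t p" p] rd_zero[OF tp p(1)] by simp
  qed
  then show ?thesis using p(1) by blast
qed

end

section \<open>The basin of attraction and the global coordinates\<close>

context gradient_soliton
begin

text \<open>The local conjugacy F is extended by \<Phi> q = N^m F(\<phi>_(mT) q) for any m that
  brings q near p. This is injective because F and the flow maps are, and onto because M^m w tends
  to 0 and so enters the open image of F.\<close>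

lemma biholomorphic_of_fixed_point:
  assumes ric: "\<And>c x v. c \<in> A \<Longrightarrow> x \<in> coord_range c \<Longrightarrow> 0 \<le> Qf (ricci (g c) x) v" and \<rho>: "\<rho> \<ge> 0"
    and c: "c \<in> A" and p: "p \<in> cdom c" and fixed: "\<And>t. t \<ge> 0 \<Longrightarrow> \<phi> t p = p"
    and pos: "\<And>v. v \<noteq> 0 \<Longrightarrow> 0 < RQ c (coord c p) v"
  shows "\<exists>F. biholomorphism X A (euclidean :: (complex^'n) topology) std_atlas F"
proof -
  define x where "x = coord c p"
  have pM: "p \<in> topspace X" using p cdom_subset[OF c] by blast
  have lin: "\<exists>T r (F :: complex^'n \<Rightarrow> complex^'n) M N. T > 0 \<and> r > 0 \<and> ball x r \<subseteq> coord_range c \<and>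
    (\<forall>z\<in>ball x r. \<phi> T (coord_inv c z) \<in> cdom c \<and> norm (coord c (\<phi> T (coord_inv c z)) - x) \<le> norm (z - x) / 2) \<and>
    holomorphic_vec_on F (ball x r) \<and> F x = 0 \<and> inj (cjac F x) \<and>
    (\<forall>z\<in>ball x r. F (coord c (\<phi> T (coord_inv c z))) = M (F z)) \<and>
    linear M \<and> (\<forall>k v. M (k *s v) = k *s M v) \<and> linear N \<and> (\<forall>k v. N (k *s v) = k *s N v) \<and>
    (\<forall>v. N (M v) = v) \<and> (\<forall>v. M (N v) = v) \<and> (\<forall>w. (\<lambda>m. (M ^^ m) w) \<longlonglongrightarrow> 0)"
    by (rule fixed_point_linearization[OF c p _ _ x_def]) (use fixed pos in auto)
  obtain T r M N and F :: "complex^'n \<Rightarrow> complex^'n" where T: "T > 0" and r: "r > 0" "ball x r \<subseteq> coord_range c"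
    and loc': "\<forall>z\<in>ball x r. \<phi> T (coord_inv c z) \<in> cdom c \<and> norm (coord c (\<phi> T (coord_inv c z)) - x) \<le> norm (z - x) / 2"
    and F: "holomorphic_vec_on F (ball x r)" "F x = 0" "inj (cjac F x)"
    and FM': "\<forall>z\<in>ball x r. F (coord c (\<phi> T (coord_inv c z))) = M (F z)"
    and M': "linear M" "\<forall>k v. M (k *s v) = k *s M v" and N': "linear N" "\<forall>k v. N (k *s v) = k *s N v"
    and NM': "\<forall>v. N (M v) = v" "\<forall>v. M (N v) = v" and Mlim': "\<forall>w. (\<lambda>m. (M ^^ m) w) \<longlonglongrightarrow> 0"
    using lin by (elim exE conjE) (rule that)
  note loc = loc'[rule_format] and FM = FM'[rule_format] and M = M'[rule_format] and N = N'[rule_format]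
    and NM = NM'[rule_format] and Mlim = Mlim'[rule_format]
  have xb: "x \<in> ball x r" using r by simp
  obtain U G where U: "open U" "x \<in> U" "U \<subseteq> ball x r" "open (F ` U)" "inj_on F U" "holomorphic_vec_on G (F ` U)"
    "\<And>z. z \<in> U \<Longrightarrow> G (F z) = z"
    by (rule holomorphic_local_inverse[OF open_ball xb F(1,3)], rule that)
  obtain r1 where r1: "r1 > 0" "ball x r1 \<subseteq> U" using U(1,2) open_contains_ball by blast
  \<comment> \<open>The image of \<open>ball x r1\<close> under F, written through the local inverse
    so that its openness is a statement about a preimage.\<close>
  define B where "B = {w \<in> F ` U. G w \<in> ball x r1}"
  have B: "open B"
    using continuous_open_preimage[OF holomorphic_vec_on_continuous[OF U(6)] U(4) open_ball]
    by (simp add: B_def Int_def vimage_def)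
  have FB: "F z \<in> B" if "z \<in> ball x r1" for z
    using that r1(2) U(7) by (auto simp: B_def)
  have GB: "G w \<in> ball x r1" "F (G w) = w" if "w \<in> B" for w
    using that U(7) by (auto simp: B_def)
  have r1r: "ball x r1 \<subseteq> ball x r" using r1(2) U(3) by blast
  \<comment> \<open>Only the time T map has been linearized, so the basin is explored at the times m
    T.\<close>
  define Th where "Th = (\<lambda>m. \<phi> (real m * T))"
  have mT: "real m * T \<ge> 0" for m using T by simp
  have Th_in: "Th m q \<in> topspace X" if "q \<in> topspace X" for m q unfolding Th_def by (rule phi_in[OF mT that])
  have Th_holo: "holomorphic_map X A X A (Th m)" for m unfolding Th_def by (rule phi_holo[OF mT])
  have Th_add: "Th (m + k) q = Th m (Th k q)" if "q \<in> topspace X" for m k q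
    unfolding Th_def using phi_add[OF mT mT that, of m k] by (simp add: distrib_right)
  have Th1: "Th (Suc 0) q = \<phi> T q" for q by (simp add: Th_def)
  have Th0: "Th 0 q = q" if "q \<in> topspace X" for q using phi_0[OF that] by (simp add: Th_def)
  define W where "W = {q \<in> cdom c. coord c q \<in> ball x r1}"
  have W: "openin X W" unfolding W_def by (rule coord_preimage_open[OF c open_ball])
  have WM: "W \<subseteq> topspace X" by (rule openin_subset[OF W])
  have step: "\<phi> T q \<in> W" "norm (coord c (\<phi> T q) - x) \<le> norm (coord c q - x) / 2" "F (coord c (\<phi> T q)) = M (F (coord c q))"
    if q: "q \<in> W" for q
  proof -
    have qc: "q \<in> cdom c" "coord c q \<in> ball x r1" "coord c q \<in> ball x r" using q r1r by (auto simp: W_def)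
    note l = loc[OF qc(3)] FM[OF qc(3)]
    note i = coord_inv_coord[OF c qc(1)]
    show h: "norm (coord c (\<phi> T q) - x) \<le> norm (coord c q - x) / 2" and "F (coord c (\<phi> T q)) = M (F (coord c q))"
      using l i by auto
    have "norm (coord c q - x) < r1" using qc(2) by (simp add: dist_norm norm_minus_commute)
    then have "norm (coord c (\<phi> T q) - x) < r1" using h norm_ge_zero[of "coord c q - x"] by linarith
    then show "\<phi> T q \<in> W" using l i by (auto simp: W_def dist_norm norm_minus_commute)
  qed
  have iter: "Th k q \<in> W \<and> norm (coord c (Th k q) - x) \<le> norm (coord c q - x) / 2 ^ k \<and> F (coord c (Th k q)) = (M ^^ k) (F (coord c q))"
    if q: "q \<in> W" for q k
  proof (induction k)
    case 0
    have "q \<in> topspace X" using q WM by blast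
    then show ?case using q Th0 by simp
  next
    case (Suc k)
    have qM: "q \<in> topspace X" using q WM by blast
    have e: "Th (Suc k) q = \<phi> T (Th k q)" using Th_add[OF qM, of "Suc 0" k] Th1 by simp
    from step[of "Th k q"] Suc show ?case unfolding e by auto
  qed
  have pW: "p \<in> W" using p r1(1) by (simp add: W_def x_def)
  obtain R0 where R0: "R0 > 0" "cball x R0 \<subseteq> coord_range c"
    using range_open[OF c] coord_in_range[OF p] open_contains_cball unfolding x_def by blast
  \<comment> \<open>R is below r1, so that points within e0 of p lie in W, and the closed R-ball
    lies in the chart range.\<close>
  define R where "R = min R0 (r1 / 2)"
  have R: "R > 0" "R < r1" "cball x R \<subseteq> coord_range c"
    using R0 r1(1) by (auto simp: R_def)
  obtain e0 where e0: "e0 > 0" "\<And>q. q \<in> topspace X \<Longrightarrow> rd p q < e0 \<Longrightarrow> q \<in> cdom c \<and> dist x (coord c q) < R"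
    using rd_lower[OF c p R(1)] R(3) unfolding x_def by blast
  have e0W: "q \<in> W" if "q \<in> topspace X" "rd p q < e0" for q
    using e0(2)[OF that] R(2) by (auto simp: W_def)
  obtain K where K: "K > 0" "\<forall>y\<in>cball x R. \<forall>z\<in>cball x R. rd (coord_inv c y) (coord_inv c z) \<le> K * norm (z - y)"
    using rd_upper[OF c R(3)] by blast
  \<comment> \<open>Here the curvature away from p enters: no flow map increases distances.\<close>
  have nonexp: "rd (Th m q) (Th m q') \<le> rd q q'" if "q \<in> topspace X" "q' \<in> topspace X" for m q q'
  proof -
    have "rd (Th m q) (Th m q') \<le> exp (- \<rho> * (real m * T)) * rd q q'"
      unfolding Th_def by (rule phi_rd[OF ric mT that])
    also have "\<dots> \<le> 1 * rd q q'" using \<rho> mT[of m] by (intro mult_right_mono rd_nonneg) simp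
    finally show ?thesis by simp
  qed
  \<comment> \<open>In coordinates the distance to x at least halves with every iteration;
    \<open>rd_upper\<close> turns this into smallness of the Riemannian distance to p, whose e0-ball
    lies in W.\<close>
  have close: "\<exists>k. rd p (Th k q) < e0 / 2" if q: "q \<in> W" for q
  proof -
    have "(\<lambda>k. norm (coord c q - x) * (1/2) ^ k) \<longlonglongrightarrow> 0"
      by (rule tendsto_mult_right_zero, rule LIMSEQ_power_zero) simp
    moreover have "min R (e0 / (2 * K)) > 0" using R e0 K by simp
    ultimately have "\<forall>\<^sub>F k in sequentially. norm (coord c q - x) * (1/2) ^ k < min R (e0 / (2 * K))"
      by (rule order_tendstoD)
    then obtain k where k: "norm (coord c q - x) * (1/2) ^ k < min R (e0 / (2 * K))"
      unfolding eventually_sequentially by blast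
    have n: "norm (coord c (Th k q) - x) < min R (e0 / (2 * K))"
      using iter[OF q, of k] k by (simp add: power_divide)
    have Wk: "Th k q \<in> cdom c" using iter[OF q, of k] by (simp add: W_def)
    have xR: "x \<in> cball x R" and tR: "coord c (Th k q) \<in> cball x R"
      using R(1) n by (auto simp: dist_norm norm_minus_commute)
    have "rd p (Th k q) \<le> K * norm (coord c (Th k q) - x)"
      using K(2)[rule_format, OF xR tR] coord_inv_coord[OF c Wk] coord_inv_coord[OF c p] by (simp add: x_def)
    also have "\<dots> < K * (e0 / (2 * K))" using n K(1) by (intro mult_strict_left_mono) auto
    also have "\<dots> = e0 / 2" using K(1) by simp
    finally show ?thesis by blast
  qed
  define Om where "Om = {q \<in> topspace X. \<exists>m. Th m q \<in> W}"
  have O_open: "openin X {q \<in> topspace X. Th m q \<in> W}" for m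
    using Th_holo[of m] W by (auto simp: holomorphic_map_def continuous_map_def)
  have "Om = (\<Union>m. {q \<in> topspace X. Th m q \<in> W})" by (auto simp: Om_def)
  then have "openin X Om" using O_open by (auto intro: openin_Union)
  \<comment> \<open>If a point u within e0 / 2 of q had an iterate in W, some later iterate of u
    would be within e0 / 2 of p. The same iterate of q would then be within e0 of p, hence in W. So
    points near q stay outside the basin together with q.\<close>
  moreover have "openin X (topspace X - Om)"
  proof (subst openin_subopen, rule ballI)
    fix q assume q: "q \<in> topspace X - Om"
    then obtain c' r' where c': "c' \<in> A" "q \<in> cdom c'" and r': "r' > 0" "cball (coord c' q) r' \<subseteq> coord_range c'"
      using chart_ball[of q] by auto
    obtain K' where K': "K' > 0" "\<forall>y\<in>cball (coord c' q) r'. \<forall>z\<in>cball (coord c' q) r'. rd (coord_inv c' y) (coord_inv c' z) \<le> K' * norm (z - y)"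
      using rd_upper[OF c'(1) r'(2)] by blast
    \<comment> \<open>By the bound K' on distances, this radius gives rd q u < e0 / 2.\<close>
    define s where "s = min r' (e0 / (2 * K'))"
    have s: "s > 0" "s \<le> r'" "K' * s \<le> e0 / 2"
    proof -
      show "s > 0" "s \<le> r'" using r'(1) e0(1) K'(1) by (auto simp: s_def)
      have "K' * s \<le> K' * (e0 / (2 * K'))" using K'(1) by (intro mult_left_mono) (auto simp: s_def)
      then show "K' * s \<le> e0 / 2" using K'(1) by simp
    qed
    let ?N = "{u \<in> cdom c'. coord c' u \<in> ball (coord c' q) s}"
    have "?N \<subseteq> topspace X - Om"
    proof
      fix u assume u: "u \<in> ?N"
      have uM: "u \<in> topspace X" using u cdom_subset[OF c'(1)] by blast
      have cb: "coord c' q \<in> cball (coord c' q) r'" "coord c' u \<in> cball (coord c' q) r'"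
        using u s(2) r'(1) by auto
      have "rd q u \<le> K' * norm (coord c' u - coord c' q)"
        using K'(2)[rule_format, OF cb] coord_inv_coord[OF c'(1)] c'(2) u by auto
      also have "\<dots> < K' * s" using u K'(1) by (intro mult_strict_left_mono) (auto simp: dist_norm norm_minus_commute)
      finally have qu: "rd q u < e0 / 2" using s(3) by simp
      have "u \<notin> Om"
      proof
        assume "u \<in> Om"
        then obtain m where m: "Th m u \<in> W" by (auto simp: Om_def)
        obtain k where k: "rd p (Th k (Th m u)) < e0 / 2" using close[OF m] by blast
        have qM: "q \<in> topspace X" using q by simp
        have "rd p (Th (k + m) q) \<le> rd p (Th (k + m) u) + rd (Th (k + m) u) (Th (k + m) q)"
          by (intro rd_triangle pM Th_in uM qM)
        also have "\<dots> < e0 / 2 + e0 / 2"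
        proof (rule add_strict_mono)
          show "rd p (Th (k + m) u) < e0 / 2" using k Th_add[OF uM, of k m] by simp
          have "rd (Th (k + m) u) (Th (k + m) q) \<le> rd u q" by (rule nonexp[OF uM qM])
          then show "rd (Th (k + m) u) (Th (k + m) q) < e0 / 2" using qu rd_commute[of u q] by simp
        qed
        finally have "Th (k + m) q \<in> W" by (intro e0W Th_in qM) simp
        then show False using q by (auto simp: Om_def)
      qed
      then show "u \<in> topspace X - Om" using uM by blast
    qed
    moreover have "q \<in> ?N" using c'(2) s(1) by simp
    ultimately show "\<exists>T. openin X T \<and> q \<in> T \<and> T \<subseteq> topspace X - Om"
      using coord_preimage_open[OF c'(1) open_ball] by blast
  qed
  moreover have "Om \<subseteq> topspace X" by (auto simp: Om_def)
  ultimately have clopen: "openin X Om \<and> closedin X Om" by (simp add: closedin_def)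
  have "connected_space X" using mfd by (simp add: complex_manifold_def)
  then have "Om = {} \<or> Om = topspace X" using clopen by (simp add: connected_space_clopen_in)
  moreover have "p \<in> Om" using pM pW Th0[OF pM] unfolding Om_def by (intro CollectI conjI exI[of _ 0]) simp_all
  ultimately have basin: "\<exists>m. Th m q \<in> W" if "q \<in> topspace X" for q using that by (auto simp: Om_def)
  have Nlin: "linear (N ^^ m)" "(N ^^ m) (k *s v) = k *s (N ^^ m) v" for m k v
    using linear_funpow[OF N(1)] by (auto, induction m) (simp_all add: N(2))
  have Mlin: "linear (M ^^ m)" for m using linear_funpow[OF M(1)] .
  have Msm: "(M ^^ m) (k *s v) = k *s (M ^^ m) v" for m k v by (induction m) (simp_all add: M(2))
  have NMm: "(N ^^ m) ((M ^^ m) v) = v" for m v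
  proof (induction m arbitrary: v)
    case (Suc m)
    have "(N ^^ Suc m) ((M ^^ Suc m) v) = (N ^^ m) (N (M ((M ^^ m) v)))" by (simp add: funpow_swap1)
    then show ?case using Suc NM(1) by simp
  qed simp
  have MNm: "(M ^^ m) ((N ^^ m) v) = v" for m v
  proof (induction m arbitrary: v)
    case (Suc m)
    have "(M ^^ Suc m) ((N ^^ Suc m) v) = (M ^^ m) (M (N ((N ^^ m) v)))" by (simp add: funpow_swap1)
    then show ?case using Suc NM(2) by simp
  qed simp
  \<comment> \<open>The least m only fixes a value. By \<open>\<Phi>_eq\<close> every m with Th m q
    in W gives the same one, since k further iterations multiply F by M^k, which N^k
    cancels.\<close>
  define \<Phi> where "\<Phi> = (\<lambda>q. let m = (LEAST m. Th m q \<in> W) in (N ^^ m) (F (coord c (Th m q))))"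
  have \<Phi>_eq: "\<Phi> q = (N ^^ m) (F (coord c (Th m q)))" if q: "q \<in> topspace X" and m: "Th m q \<in> W" for q m
  proof -
    define l where "l = (LEAST m. Th m q \<in> W)"
    have l: "Th l q \<in> W" "l \<le> m" unfolding l_def using m by (auto intro: LeastI Least_le)
    obtain k where k: "m = k + l" using l(2) by (metis le_iff_add add.commute)
    have "F (coord c (Th m q)) = (M ^^ k) (F (coord c (Th l q)))"
      using iter[OF l(1), of k] Th_add[OF q, of k l] k by simp
    then have "(N ^^ m) (F (coord c (Th m q))) = (N ^^ (l + k)) ((M ^^ k) (F (coord c (Th l q))))"
      using k by (simp add: add.commute)
    also have "\<dots> = (N ^^ l) (F (coord c (Th l q)))" by (simp add: funpow_add NMm)
    finally show ?thesis by (simp add: \<Phi>_def l_def Let_def)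
  qed
  have Finj: "z = z'" if "z \<in> ball x r1" "z' \<in> ball x r1" "F z = F z'" for z z'
    using inj_onD[OF U(5) that(3)] that r1(2) by blast
  have "\<exists>Inv. holomorphic_map X A X A Inv \<and> (\<forall>q\<in>topspace X. Inv (Th m q) = q) \<and> (\<forall>q\<in>topspace X. Th m (Inv q) = q)" for m
    using biholo[OF mT[of m]] unfolding biholomorphism_def Th_def by blast
  then have "\<forall>m. \<exists>Inv. holomorphic_map X A X A Inv \<and> (\<forall>q\<in>topspace X. Inv (Th m q) = q) \<and> (\<forall>q\<in>topspace X. Th m (Inv q) = q)"
    by (rule allI)
  from choice[OF this] obtain Inv where Inv: "\<And>m. holomorphic_map X A X A (Inv m)"
    "\<And>m q. q \<in> topspace X \<Longrightarrow> Inv m (Th m q) = q" "\<And>m q. q \<in> topspace X \<Longrightarrow> Th m (Inv m q) = q" by blast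
  have Inv_in: "Inv m q \<in> topspace X" if "q \<in> topspace X" for m q
    using Inv(1)[of m] that by (auto simp: holomorphic_map_def continuous_map_def)
  have \<Phi>_inj: "q = q'" if q: "q \<in> topspace X" "q' \<in> topspace X" "\<Phi> q = \<Phi> q'" for q q'
  proof -
    obtain m1 m2 where m: "Th m1 q \<in> W" "Th m2 q' \<in> W" using basin q(1,2) by blast
    \<comment> \<open>W is mapped into itself, so at the sum of the two times both points are in
      W.\<close>
    define m where "m = m1 + m2"
    have mW: "Th m q \<in> W" "Th m q' \<in> W"
      using iter[OF m(1), of m2] iter[OF m(2), of m1] Th_add[OF q(1), of m2 m1] Th_add[OF q(2), of m1 m2]
      by (simp_all add: m_def add.commute)
    have "(N ^^ m) (F (coord c (Th m q))) = (N ^^ m) (F (coord c (Th m q')))"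
      using \<Phi>_eq[OF q(1) mW(1)] \<Phi>_eq[OF q(2) mW(2)] q(3) by simp
    from arg_cong[OF this, of "M ^^ m"] have "F (coord c (Th m q)) = F (coord c (Th m q'))" by (simp add: MNm)
    then have ceq: "coord c (Th m q) = coord c (Th m q')" by (rule Finj[rotated 2]) (use mW in \<open>auto simp: W_def\<close>)
    have in_c: "Th m q \<in> cdom c" "Th m q' \<in> cdom c" using mW by (auto simp: W_def)
    from arg_cong[OF ceq, of "coord_inv c"] have "Th m q = Th m q'"
      by (simp only: coord_inv_coord[OF c in_c(1)] coord_inv_coord[OF c in_c(2)])
    from arg_cong[OF this, of "Inv m"] show ?thesis by (simp only: Inv(2)[OF q(1)] Inv(2)[OF q(2)])
  qed
  \<comment> \<open>The inverse of \<Phi> on the open set where M^m w lies in B: move into B, invert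
    F there, and go back with the inverse of Th m. By \<open>exB\<close> these open sets cover the
    space.\<close>
  define Ps where "Ps = (\<lambda>m w. Inv m (coord_inv c (G ((M ^^ m) w))))"
  have GW: "coord_inv c (G w) \<in> W" "coord c (coord_inv c (G w)) = G w" if "w \<in> B" for w
  proof -
    have "G w \<in> coord_range c" using GB(1)[OF that] r1r r(2) by blast
    then show "coord_inv c (G w) \<in> W" "coord c (coord_inv c (G w)) = G w"
      using coord_inv_in_cdom[of "G w" c] coord_coord_inv[OF c, of "G w"] GB(1)[OF that] by (auto simp: W_def)
  qed
  have Ps: "Ps m w \<in> topspace X" "\<Phi> (Ps m w) = w" if w: "(M ^^ m) w \<in> B" for m w
  proof -
    have uM: "coord_inv c (G ((M ^^ m) w)) \<in> topspace X" using GW(1)[OF w] WM by blast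
    show PM: "Ps m w \<in> topspace X" unfolding Ps_def by (rule Inv_in[OF uM])
    have Thm: "Th m (Ps m w) = coord_inv c (G ((M ^^ m) w))" unfolding Ps_def by (rule Inv(3)[OF uM])
    have "\<Phi> (Ps m w) = (N ^^ m) (F (coord c (Th m (Ps m w))))" by (rule \<Phi>_eq[OF PM]) (simp add: Thm GW(1)[OF w])
    then show "\<Phi> (Ps m w) = w" by (simp add: Thm GW(2)[OF w] GB(2)[OF w] NMm)
  qed
  have F0: "0 \<in> B" using FB[of x] r1(1) F(2) by simp
  have exB: "\<exists>m. (M ^^ m) w \<in> B" for w
  proof -
    have "\<forall>\<^sub>F m in sequentially. (M ^^ m) w \<in> B" by (rule topological_tendstoD[OF Mlim B F0])
    then show ?thesis unfolding eventually_sequentially by blast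
  qed
  \<comment> \<open>The inverse is defined globally from injectivity and coincides locally with the
    holomorphic maps \<open>Ps m\<close>.\<close>
  define \<Psi> where "\<Psi> = inv_into (topspace X) \<Phi>"
  have \<Psi>_eq: "\<Psi> w = Ps m w" if "(M ^^ m) w \<in> B" for m w
    unfolding \<Psi>_def by (rule inv_into_f_eq) (use Ps[OF that] \<Phi>_inj in \<open>auto intro: inj_onI\<close>)
  have \<Phi>\<Psi>: "\<Phi> (\<Psi> w) = w" "\<Psi> w \<in> topspace X" for w
    using exB[of w] \<Psi>_eq Ps by auto
  have \<Psi>\<Phi>: "\<Psi> (\<Phi> q) = q" if "q \<in> topspace X" for q
    by (rule \<Phi>_inj) (use \<Phi>\<Psi> that in auto)
  have \<Phi>_holo: "holomorphic_map X A euclidean std_atlas \<Phi>"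
  proof (rule holomorphic_to_std, rule holomorphic_vec_on_local)
    fix c' y assume c': "c' \<in> A" and y: "y \<in> coord_range c'"
    define q where "q = coord_inv c' y"
    have q: "q \<in> cdom c'" "coord c' q = y" using coord_inv_in_cdom[OF y] coord_coord_inv[OF c' y] by (auto simp: q_def)
    have qM: "q \<in> topspace X" using q(1) cdom_subset[OF c'] by blast
    obtain m where m: "Th m q \<in> W" using basin[OF qM] by blast
    define S where "S = coord c' ` (cdom c' \<inter> {q \<in> topspace X. Th m q \<in> W})"
    have S: "open S" unfolding S_def by (rule coord_image_open[OF c' O_open])
    have Sq: "coord_inv c' z \<in> topspace X" "Th m (coord_inv c' z) \<in> W" "z \<in> coord_range c'" if "z \<in> S" for z
    proof -
      obtain u where u: "u \<in> cdom c'" "u \<in> topspace X" "Th m u \<in> W" "z = coord c' u"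
        using \<open>z \<in> S\<close> by (auto simp: S_def)
      show "coord_inv c' z \<in> topspace X" "Th m (coord_inv c' z) \<in> W" "z \<in> coord_range c'"
        using u coord_inv_coord[OF c' u(1)] coord_in_range[OF u(1)] by auto
    qed
    have le: "local_expr c' c (Th m) z = coord c (Th m (coord_inv c' z))" for z by (simp add: local_expr_def)
    have h1: "holomorphic_vec_on (local_expr c' c (Th m)) S"
      by (rule holomorphic_local_expr_on[OF Th_holo c' c]) (use Sq in \<open>auto simp: W_def\<close>)
    have h2: "holomorphic_vec_on (\<lambda>z. F (local_expr c' c (Th m) z)) S"
      by (rule holomorphic_vec_on_compose[OF holomorphic_vec_on_subset[OF F(1) r1r] h1]) (use Sq(2) le in \<open>auto simp: W_def\<close>)
    have h3: "holomorphic_vec_on (\<lambda>z. (N ^^ m) (F (local_expr c' c (Th m) z))) S"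
      by (rule holomorphic_vec_on_compose[OF holomorphic_vec_on_linear[OF Nlin] h2 subset_UNIV])
    have "holomorphic_vec_on (\<lambda>y. \<Phi> (coord_inv c' y)) S"
      by (rule holomorphic_vec_on_cong[OF S _ h3]) (simp add: le \<Phi>_eq[OF Sq(1,2)])
    moreover have "y \<in> S" unfolding S_def using q m qM by blast
    ultimately show "\<exists>T. y \<in> T \<and> holomorphic_vec_on (\<lambda>y. \<Phi> (coord_inv c' y)) T" by blast
  qed
  have OB: "open {w. (M ^^ m) w \<in> B}" for m
    using open_vimage[OF B, of "M ^^ m"] linear_continuous_on[OF linear_conv_bounded_linear[THEN iffD1, OF Mlin[of m]], of UNIV]
    by (simp add: vimage_def)
  have hG: "holomorphic_vec_on (\<lambda>w. G ((M ^^ m) w)) {w. (M ^^ m) w \<in> B}" for m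
    by (rule holomorphic_vec_on_compose[OF holomorphic_vec_on_subset[OF U(6)] holomorphic_vec_on_linear[OF Mlin Msm]])
       (auto simp: B_def)
  have Ps_cont: "continuous_map (top_of_set {w. (M ^^ m) w \<in> B}) X (Ps m)" for m
  proof -
    let ?O = "{w. (M ^^ m) w \<in> B}"
    have "G ((M ^^ m) w) \<in> coord_range c" if "(M ^^ m) w \<in> B" for w
      using GB(1)[OF that] r1r r(2) by blast
    then have "continuous_map (top_of_set ?O) (top_of_set (coord_range c)) (\<lambda>w. G ((M ^^ m) w))"
      using holomorphic_vec_on_continuous[OF hG, of m] by (auto simp: continuous_map_in_subtopology)
    from continuous_map_compose[OF continuous_map_compose[OF this coord_inv_continuous[OF c]], of X "Inv m"]
    show ?thesis using Inv(1)[of m] by (simp add: holomorphic_map_def Ps_def[abs_def] o_def)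
  qed
  have \<Psi>_cont: "continuous_map euclidean X \<Psi>"
    unfolding continuous_map_def
  proof (intro conjI allI impI)
    show "\<Psi> \<in> topspace euclidean \<rightarrow> topspace X" using \<Phi>\<Psi>(2) by auto
    fix V assume V: "openin X V"
    have "{w \<in> topspace euclidean. \<Psi> w \<in> V} = (\<Union>m. {w \<in> {w. (M ^^ m) w \<in> B}. Ps m w \<in> V})"
    proof (intro equalityI subsetI)
      fix w assume "w \<in> {w \<in> topspace euclidean. \<Psi> w \<in> V}"
      then have w: "\<Psi> w \<in> V" by simp
      obtain m where m: "(M ^^ m) w \<in> B" using exB by blast
      show "w \<in> (\<Union>m. {w \<in> {w. (M ^^ m) w \<in> B}. Ps m w \<in> V})"
        by (rule UN_I[of m]) (use m w \<Psi>_eq[OF m] in simp_all)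
    next
      fix w assume "w \<in> (\<Union>m. {w \<in> {w. (M ^^ m) w \<in> B}. Ps m w \<in> V})"
      then obtain m where m: "(M ^^ m) w \<in> B" "Ps m w \<in> V" by (elim UN_E CollectE conjE) blast
      then show "w \<in> {w \<in> topspace euclidean. \<Psi> w \<in> V}" using \<Psi>_eq[OF m(1)] by simp
    qed
    moreover have "open {w \<in> {w. (M ^^ m) w \<in> B}. Ps m w \<in> V}" for m
      using openin_open_trans[OF _ OB[of m]] curve_preimage_open[OF Ps_cont[of m] V] by blast
    ultimately show "openin euclidean {w \<in> topspace euclidean. \<Psi> w \<in> V}" by (simp add: open_UN)
  qed
  have \<Psi>_holo: "holomorphic_map euclidean std_atlas X A \<Psi>"
    unfolding holomorphic_map_def
  proof (intro conjI ballI \<Psi>_cont)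
    fix c0 c' assume c0: "c0 \<in> (std_atlas :: (complex^'n, 'n) chart set)" and c': "c' \<in> A"
    have c0: "c0 = (UNIV, id)" using c0 by (simp add: std_atlas_def)
    have ci: "coord_inv c0 w = w" for w by (simp add: c0 coord_inv_def)
    have "holomorphic_vec_on (\<lambda>w. coord c' (\<Psi> w)) {w. \<Psi> w \<in> cdom c'}"
    proof (rule holomorphic_vec_on_local)
      fix w assume w: "w \<in> {w. \<Psi> w \<in> cdom c'}"
      obtain m where m: "(M ^^ m) w \<in> B" using exB by blast
      define D where "D = coord c ` {q \<in> cdom c. Inv m q \<in> cdom c'}"
      note D = holomorphic_map_local_expr[OF Inv(1) c c', of m, folded D_def]
      define S where "S = {w \<in> {w. (M ^^ m) w \<in> B}. G ((M ^^ m) w) \<in> D}"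
      have S: "open S"
        using continuous_open_preimage[OF holomorphic_vec_on_continuous[OF hG] OB D(1), of m]
        by (simp add: S_def Int_def vimage_def)
      have h: "holomorphic_vec_on (\<lambda>w. local_expr c c' (Inv m) (G ((M ^^ m) w))) S"
        by (rule holomorphic_vec_on_compose[OF D(2) holomorphic_vec_on_subset[OF hG, of _ m]]) (auto simp: S_def)
      have "holomorphic_vec_on (\<lambda>w. coord c' (\<Psi> w)) S"
      proof (rule holomorphic_vec_on_cong[OF S _ h])
        fix y assume "y \<in> S"
        then have "\<Psi> y = Ps m y" by (intro \<Psi>_eq) (simp add: S_def)
        then show "local_expr c c' (Inv m) (G ((M ^^ m) y)) = coord c' (\<Psi> y)" by (simp add: Ps_def local_expr_def)
      qed
      moreover have "w \<in> S"
      proof -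
        have "coord_inv c (G ((M ^^ m) w)) \<in> cdom c" using GW(1)[OF m] by (simp add: W_def)
        moreover have "Inv m (coord_inv c (G ((M ^^ m) w))) \<in> cdom c'" using w \<Psi>_eq[OF m] by (simp add: Ps_def)
        ultimately have "coord c (coord_inv c (G ((M ^^ m) w))) \<in> D" unfolding D_def by blast
        then show ?thesis using m GW(2)[OF m] by (simp add: S_def)
      qed
      ultimately show "\<exists>T. w \<in> T \<and> holomorphic_vec_on (\<lambda>w. coord c' (\<Psi> w)) T" by blast
    qed
    then show "holomorphic_vec_on (local_expr c0 c' \<Psi>) (coord c0 ` {p \<in> cdom c0. \<Psi> p \<in> cdom c'})"
      by (simp add: local_expr_def o_def ci) (simp add: c0)
  qed
  have "biholomorphism X A (euclidean :: (complex^'n) topology) std_atlas \<Phi>"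
    unfolding biholomorphism_def using \<Phi>_holo \<Psi>_holo \<Psi>\<Phi> \<Phi>\<Psi>(1) by blast
  then show ?thesis by blast
qed

end

section \<open>Ricci curvature and the steady case\<close>

text \<open>Where u vanishes, the product rule needs only continuity of b. This suits the inverse
  matrix, whose continuity is obtained before its derivative.\<close>

lemma has_derivative_mult_vanishing:
  fixes b u :: "'a::real_normed_vector \<Rightarrow> complex"
  assumes b: "isCont b x" and u: "(u has_derivative u') (at x)" "u x = 0"
  shows "((\<lambda>y. b y * u y) has_derivative (\<lambda>v. b x * u' v)) (at x)"
  unfolding has_derivative_at_alt
proof (intro conjI allI impI)
  have bl: "bounded_linear u'" using u(1) by (rule has_derivative_bounded_linear)
  show "bounded_linear (\<lambda>v. b x * u' v)" by (rule bounded_linear_compose[OF bounded_linear_mult_right bl])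
  obtain C where C: "C > 0" "\<And>v. norm (u' v) \<le> norm v * C" using bounded_linear.pos_bounded[OF bl] by blast
  fix e :: real assume e: "e > 0"
  \<comment> \<open>A bound for b near x, where b y stays within 1 of b x.\<close>
  define k where "k = norm (b x) + 1"
  have k: "k > 0" by (simp add: k_def add_nonneg_pos)
  have ek: "e / (2 * k) > 0" "min 1 (e / (2 * C)) > 0" using e k C by auto
  obtain d1 where d1: "d1 > 0" "\<And>y. norm (y - x) < d1 \<Longrightarrow> norm (u y - u x - u' (y - x)) \<le> e / (2 * k) * norm (y - x)"
    using u(1)[unfolded has_derivative_at_alt, THEN conjunct2, rule_format, OF ek(1)] by blast
  obtain d2 where d2: "d2 > 0" "\<And>y. dist y x < d2 \<Longrightarrow> dist (b y) (b x) < min 1 (e / (2 * C))"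
    using b[unfolded continuous_at_eps_delta, rule_format, OF ek(2)] by blast
  have "norm (b y * u y - b x * u x - b x * u' (y - x)) \<le> e * norm (y - x)" if y: "norm (y - x) < min d1 d2" for y
  proof -
    have bb: "norm (b y - b x) < min 1 (e / (2 * C))" using d2(2)[of y] y by (simp add: dist_norm)
    have "norm (b y) \<le> k" using bb norm_triangle_ineq[of "b y - b x" "b x"] by (simp add: k_def)
    then have "norm (b y * (u y - u' (y - x))) \<le> k * (e / (2 * k) * norm (y - x))"
      using d1(2)[of y] y u(2) k by (simp only: norm_mult) (intro mult_mono, auto)
    also have "\<dots> = e / 2 * norm (y - x)" using k by simp
    finally have 1: "norm (b y * (u y - u' (y - x))) \<le> e / 2 * norm (y - x)" .
    have "norm ((b y - b x) * u' (y - x)) \<le> e / (2 * C) * (norm (y - x) * C)"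
      using bb C e unfolding norm_mult by (intro mult_mono) auto
    also have "\<dots> = e / 2 * norm (y - x)" using C by simp
    finally have 2: "norm ((b y - b x) * u' (y - x)) \<le> e / 2 * norm (y - x)" .
    have "b y * u y - b x * u x - b x * u' (y - x) = b y * (u y - u' (y - x)) + (b y - b x) * u' (y - x)"
      by (simp add: u(2) algebra_simps)
    then have "norm (b y * u y - b x * u x - b x * u' (y - x)) \<le> norm (b y * (u y - u' (y - x))) + norm ((b y - b x) * u' (y - x))"
      using norm_triangle_ineq by metis
    then show ?thesis using 1 2 by simp
  qed
  then show "\<exists>d>0. \<forall>y. norm (y - x) < d \<longrightarrow> norm (b y * u y - b x * u x - b x * u' (y - x)) \<le> e * norm (y - x)"
    using d1(1) d2(1) by (intro exI[of _ "min d1 d2"]) auto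
qed

lemma matrix_inv_sums:
  assumes "herm_pos (G :: complex^'n^'n)"
  shows "(\<Sum>j\<in>UNIV. matrix_inv G $ i $ j * G $ j $ k) = (if i = k then 1 else 0)"
    and "(\<Sum>j\<in>UNIV. G $ i $ j * matrix_inv G $ j $ k) = (if i = k then 1 else 0)"
  using arg_cong[OF herm_pos_matrix_inv(1)[OF assms], of "\<lambda>M. M $ i $ k"]
    arg_cong[OF herm_pos_matrix_inv(2)[OF assms], of "\<lambda>M. M $ i $ k"]
  by (simp_all add: matrix_matrix_mult_def mat_def)

text \<open>The resolvent identity: expand the product and cancel by H^-1 H = 1 and G G^-1 =
  1.\<close>

lemma matrix_inv_difference:
  assumes G: "herm_pos (G :: complex^'n^'n)" and H: "herm_pos H"
  shows "matrix_inv H $ k $ l - matrix_inv G $ k $ l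
    = - (\<Sum>p\<in>UNIV. \<Sum>q\<in>UNIV. matrix_inv H $ k $ p * (H $ p $ q - G $ p $ q) * matrix_inv G $ q $ l)"
proof -
  let ?A = "matrix_inv G" and ?B = "matrix_inv H"
  have "(\<Sum>p\<in>UNIV. \<Sum>q\<in>UNIV. ?B $ k $ p * G $ p $ q * ?A $ q $ l)
      = (\<Sum>p\<in>UNIV. ?B $ k $ p * (\<Sum>q\<in>UNIV. G $ p $ q * ?A $ q $ l))"
    by (simp add: sum_distrib_left mult.assoc)
  also have "\<dots> = ?B $ k $ l" by (simp add: matrix_inv_sums(2)[OF G] if_distrib cong: if_cong)
  finally have 1: "(\<Sum>p\<in>UNIV. \<Sum>q\<in>UNIV. ?B $ k $ p * G $ p $ q * ?A $ q $ l) = ?B $ k $ l" .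
  have "(\<Sum>p\<in>UNIV. \<Sum>q\<in>UNIV. ?B $ k $ p * H $ p $ q * ?A $ q $ l)
      = (\<Sum>q\<in>UNIV. (\<Sum>p\<in>UNIV. ?B $ k $ p * H $ p $ q) * ?A $ q $ l)"
    by (subst sum.swap) (simp add: sum_distrib_right)
  also have "\<dots> = (\<Sum>q\<in>UNIV. if k = q then ?A $ q $ l else 0)"
    by (rule sum.cong[OF refl]) (simp add: matrix_inv_sums(1)[OF H])
  also have "\<dots> = ?A $ k $ l" by simp
  finally have 2: "(\<Sum>p\<in>UNIV. \<Sum>q\<in>UNIV. ?B $ k $ p * H $ p $ q * ?A $ q $ l) = ?A $ k $ l" .
  show ?thesis using 1 2 by (simp add: right_diff_distrib left_diff_distrib sum_subtractf)
qed

text \<open>The conjugate transpose of the inverse is a right inverse of the Hermitian matrix G,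
  hence equal to the inverse.\<close>

lemma matrix_inv_hermitian:
  assumes "herm_pos (G :: complex^'n^'n)"
  shows "cnj (matrix_inv G $ k $ l) = matrix_inv G $ l $ k"
proof -
  let ?H = "matrix_inv G"
  define H' where "H' = (\<chi> k l. cnj (?H $ l $ k))"
  have herm: "G $ j $ i = cnj (G $ i $ j)" for i j using assms unfolding herm_pos_def hermitian_def by blast
  have "G ** H' = mat 1"
  proof (subst vec_eq_iff, rule allI, subst vec_eq_iff, rule allI)
    fix i l
    have "(G ** H') $ i $ l = cnj (\<Sum>j\<in>UNIV. ?H $ l $ j * cnj (G $ i $ j))"
      by (simp add: matrix_matrix_mult_def H'_def mult.commute)
    also have "\<dots> = cnj (\<Sum>j\<in>UNIV. ?H $ l $ j * G $ j $ i)"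
      by (simp only: herm[of _ i, symmetric])
    also have "\<dots> = (mat 1 :: complex^'n^'n) $ i $ l"
      by (simp add: matrix_inv_sums(1)[OF assms] mat_def)
    finally show "(G ** H') $ i $ l = (mat 1 :: complex^'n^'n) $ i $ l" .
  qed
  then have "?H ** (G ** H') = ?H" by simp
  then have "H' = ?H" using herm_pos_matrix_inv(1)[OF assms] by (simp add: matrix_mul_assoc)
  then have "H' $ l $ k = ?H $ l $ k" by simp
  then show ?thesis by (simp add: H'_def)
qed

text \<open>Test the lower bound on the conjugate w of the l-th column of the inverse. There the
  form equals w $ l, so m |w|^2 <= |w|.\<close>

lemma matrix_inv_entry_bound:
  assumes G: "herm_pos (G :: complex^'n^'n)" and m: "m > 0" "\<And>v. m * (norm v)\<^sup>2 \<le> Qf G v"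
  shows "norm (matrix_inv G $ k $ l) \<le> 1 / m"
proof -
  let ?H = "matrix_inv G"
  define w where "w = (\<chi> j. cnj (?H $ j $ l))"
  have "herm_form G w = (\<Sum>i\<in>UNIV. w $ i * (\<Sum>j\<in>UNIV. G $ i $ j * ?H $ j $ l))"
    by (simp add: herm_form_def w_def sum_distrib_left mult_ac)
  also have "\<dots> = w $ l" by (simp add: matrix_inv_sums(2)[OF G] if_distrib cong: if_cong)
  finally have "m * (norm w)\<^sup>2 \<le> Re (w $ l)" using m(2)[of w] by simp
  also have "\<dots> \<le> norm w" using complex_Re_le_cmod[of "w $ l"] Finite_Cartesian_Product.norm_nth_le[of w l] by linarith
  finally have le: "m * (norm w)\<^sup>2 \<le> norm w" .
  have "norm w \<le> 1 / m"
  proof (cases "norm w = 0")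
    case False
    then have "m * norm w * norm w \<le> 1 * norm w" using le by (simp add: power2_eq_square mult.assoc)
    then have "m * norm w \<le> 1" using False by (simp add: mult_le_cancel_right)
    then show ?thesis using m(1) by (simp add: field_simps)
  qed (use m(1) in simp)
  moreover have "norm (?H $ k $ l) = norm (w $ k)" by (simp add: w_def)
  ultimately show ?thesis using Finite_Cartesian_Product.norm_nth_le[of w k] by linarith
qed

text \<open>No determinants: the entry bound makes the inverse bounded near x, the resolvent
  identity then makes it continuous at x, and the same identity with
  \<open>has_derivative_mult_vanishing\<close> makes it differentiable.\<close>

lemma matrix_inv_derivative:
  fixes G :: "complex^'n \<Rightarrow> complex^'n^'n"
  assumes S: "open S" "x \<in> S" and G: "continuous_on S G" "\<And>p q. (\<lambda>y. G y $ p $ q) differentiable (at x)"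
    and pos: "\<And>y. y \<in> S \<Longrightarrow> herm_pos (G y)"
  shows "((\<lambda>y. matrix_inv (G y) $ k $ l) has_derivative
      (\<lambda>v. - (\<Sum>p\<in>UNIV. \<Sum>q\<in>UNIV. matrix_inv (G x) $ k $ p * (FD (\<lambda>y. G y $ p $ q) x v * matrix_inv (G x) $ q $ l)))) (at x)"
proof -
  let ?H = "\<lambda>y. matrix_inv (G y)"
  obtain r where r: "r > 0" "cball x r \<subseteq> S" using S open_contains_cball by blast
  obtain m K where m: "m > 0" "K > 0" "\<And>y v. y \<in> cball x r \<Longrightarrow> m * (norm v)\<^sup>2 \<le> Qf (G y) v"
    "\<And>y v. y \<in> cball x r \<Longrightarrow> Qf (G y) v \<le> K * (norm v)\<^sup>2"
  proof (rule Qf_bounds_on_compact[OF compact_cball continuous_on_subset[OF G(1) r(2)]])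
    show "0 < Qf (G y) v" if "y \<in> cball x r" "v \<noteq> 0" for y v
      using pos[of y] that r(2) by (auto simp: herm_pos_def)
  qed (rule that)
  have bound: "norm (?H y $ p $ q) \<le> 1 / m" if "y \<in> cball x r" for y p q
    by (rule matrix_inv_entry_bound[OF pos m(1) m(3)[OF that]]) (use that r(2) in blast)
  have diff: "?H y $ p $ q = ?H x $ p $ q - (\<Sum>i\<in>UNIV. \<Sum>j\<in>UNIV. ?H y $ p $ i * ((G y $ i $ j - G x $ i $ j) * ?H x $ j $ q))"
    if "y \<in> S" for y p q
    using matrix_inv_difference[OF pos[OF S(2)] pos[OF that], of p q] by (simp add: mult.assoc algebra_simps)
  have cont: "isCont (\<lambda>y. ?H y $ p $ q) x" for p q
  proof -
    have z: "((\<lambda>y. ?H y $ p $ i * ((G y $ i $ j - G x $ i $ j) * ?H x $ j $ q)) \<longlongrightarrow> 0) (at x)" for i j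
    proof (rule Lim_null_comparison)
      have "isCont (\<lambda>y. G y $ i $ j) x" by (rule differentiable_imp_continuous_within[OF G(2)])
      then have "((\<lambda>y. G y $ i $ j) \<longlongrightarrow> G x $ i $ j) (at x)" by (simp only: isCont_def)
      from tendsto_mult[OF tendsto_diff[OF this tendsto_const[of "G x $ i $ j"]] tendsto_const[of "?H x $ j $ q"]]
      have "((\<lambda>y. (G y $ i $ j - G x $ i $ j) * ?H x $ j $ q) \<longlongrightarrow> (G x $ i $ j - G x $ i $ j) * ?H x $ j $ q) (at x)" .
      from tendsto_mult_left[OF tendsto_norm[OF this], of "1 / m"]
      show "((\<lambda>y. 1 / m * norm ((G y $ i $ j - G x $ i $ j) * ?H x $ j $ q)) \<longlongrightarrow> 0) (at x)" by simp
      have "\<forall>\<^sub>F y in at x. y \<in> ball x r" using eventually_at_ball'[OF r(1), of x UNIV] by (auto elim: eventually_mono)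
      then show "\<forall>\<^sub>F y in at x. norm (?H y $ p $ i * ((G y $ i $ j - G x $ i $ j) * ?H x $ j $ q))
          \<le> 1 / m * norm ((G y $ i $ j - G x $ i $ j) * ?H x $ j $ q)"
      proof eventually_elim
        case (elim y)
        have "norm (?H y $ p $ i) \<le> 1 / m" using bound[of y p i] elim by simp
        then show ?case unfolding norm_mult[of "?H y $ p $ i"] by (rule mult_right_mono) simp
      qed
    qed
    have "((\<lambda>y. ?H x $ p $ q - (\<Sum>i\<in>UNIV. \<Sum>j\<in>UNIV. ?H y $ p $ i * ((G y $ i $ j - G x $ i $ j) * ?H x $ j $ q))) \<longlongrightarrow> ?H x $ p $ q - (\<Sum>i\<in>(UNIV::'n set). \<Sum>j\<in>(UNIV::'n set). 0)) (at x)"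
      by (intro tendsto_diff tendsto_const tendsto_sum z)
    then have "((\<lambda>y. ?H y $ p $ q) \<longlongrightarrow> ?H x $ p $ q) (at x)"
      using Lim_transform_within_open[OF _ S, of _ "?H x $ p $ q" UNIV "\<lambda>y. ?H y $ p $ q"] diff by simp
    then show ?thesis by (simp add: isCont_def)
  qed
  have d1: "((\<lambda>y. (G y $ i $ j - G x $ i $ j) * ?H x $ j $ l) has_derivative (\<lambda>v. FD (\<lambda>y. G y $ i $ j) x v * ?H x $ j $ l)) (at x)" for i j
    using has_derivative_mult_left[OF has_derivative_diff[OF FD_works[OF G(2)[of i j]] has_derivative_const[of "G x $ i $ j"]], of "?H x $ j $ l"]
    by simp
  have "((\<lambda>y. ?H x $ k $ l - (\<Sum>i\<in>UNIV. \<Sum>j\<in>UNIV. ?H y $ k $ i * ((G y $ i $ j - G x $ i $ j) * ?H x $ j $ l))) has_derivative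
      (\<lambda>v. 0 - (\<Sum>i\<in>UNIV. \<Sum>j\<in>UNIV. ?H x $ k $ i * (FD (\<lambda>y. G y $ i $ j) x v * ?H x $ j $ l)))) (at x)"
    by (intro has_derivative_diff has_derivative_const has_derivative_sum has_derivative_mult_vanishing cont d1) simp
  then have "((\<lambda>y. ?H y $ k $ l) has_derivative
      (\<lambda>v. 0 - (\<Sum>i\<in>UNIV. \<Sum>j\<in>UNIV. ?H x $ k $ i * (FD (\<lambda>y. G y $ i $ j) x v * ?H x $ j $ l)))) (at x)"
    by (rule has_derivative_transform_within_open[OF _ S]) (simp add: diff[symmetric])
  then show ?thesis by simp
qed

section \<open>The Ricci form as a derivative of log det g\<close>

context kaehler_mfd
begin

lemma g_up_derivative:
  assumes c: "c \<in> A" and x: "x \<in> coord_range c"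
  shows "(\<lambda>y. g_up (g c y) l k) differentiable (at x)"
    and "dzbar j (\<lambda>y. g_up (g c y) l k) x
      = - (\<Sum>p\<in>UNIV. \<Sum>q\<in>UNIV. g_up (g c x) p k * (dzbar j (\<lambda>y. g c y $ p $ q) x * g_up (g c x) l q))"
proof -
  note d = matrix_inv_derivative[OF range_open[OF c] x g_continuous[OF c] smooth_on_differentiable[OF g_nth_smooth[OF c] x] g_herm_pos[OF c],
      of k l]
  show "(\<lambda>y. g_up (g c y) l k) differentiable (at x)"
    unfolding g_up_def using differentiableI[OF d] .
  show "dzbar j (\<lambda>y. g_up (g c y) l k) x
      = - (\<Sum>p\<in>UNIV. \<Sum>q\<in>UNIV. g_up (g c x) p k * (dzbar j (\<lambda>y. g c y $ p $ q) x * g_up (g c x) l q))"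
  proof -
    let ?a = "\<lambda>p. matrix_inv (g c x) $ k $ p" and ?b = "\<lambda>q. matrix_inv (g c x) $ q $ l"
      and ?D = "\<lambda>p q v. FD (\<lambda>y. g c y $ p $ q) x v"
    have e: "FD (\<lambda>y. matrix_inv (g c y) $ k $ l) x v = - (\<Sum>p\<in>UNIV. \<Sum>q\<in>UNIV. ?a p * (?D p q v * ?b q))" for v
      by (rule fun_cong[OF FD_eqI[OF d]])
    have "(- (\<Sum>p\<in>UNIV. \<Sum>q\<in>UNIV. P p q) + \<i> * - (\<Sum>p\<in>UNIV. \<Sum>q\<in>UNIV. Q p q)) / 2
        = - (\<Sum>p\<in>UNIV. \<Sum>q\<in>UNIV. (P p q + \<i> * Q p q) / 2)" for P Q :: "'n \<Rightarrow> 'n \<Rightarrow> complex"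
      by (simp add: sum_divide_distrib[symmetric] sum.distrib sum_distrib_left[symmetric] add_divide_distrib)
    note s = this[of "\<lambda>p q. ?a p * (?D p q (axis j 1) * ?b q)" "\<lambda>p q. ?a p * (?D p q (axis j \<i>) * ?b q)"]
    show ?thesis
      unfolding g_up_def dzbar_def e s by (intro arg_cong[of _ _ uminus] sum.cong refl) (simp add: algebra_simps)
  qed
qed

lemma g_closed_bar:
  assumes c: "c \<in> A" and x: "x \<in> coord_range c"
  shows "dzbar m (\<lambda>y. g c y $ i $ j) x = dzbar j (\<lambda>y. g c y $ i $ m) x"
proof -
  have herm: "g c y $ i $ j = cnj (g c y $ j $ i)" if "y \<in> coord_range c" for i j y
    using g_hermitian[OF c that] unfolding hermitian_def by blast
  have e: "dzbar m (\<lambda>y. g c y $ i $ j) x = cnj (dz m (\<lambda>y. g c y $ j $ i) x)" for m i j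
  proof -
    have "dzbar m (\<lambda>y. g c y $ i $ j) x = dzbar m (\<lambda>y. cnj (g c y $ j $ i)) x"
      by (rule dzbar_cong[OF range_open[OF c] x]) (rule herm)
    also have "\<dots> = cnj (dz m (\<lambda>y. g c y $ j $ i) x)"
      by (rule dzbar_cnj[OF smooth_on_differentiable[OF g_nth_smooth[OF c] x]])
    finally show ?thesis .
  qed
  show ?thesis unfolding e by (simp only: g_closed[OF c x, of m j i])
qed

definition dlog_det :: "('a, 'n) chart \<Rightarrow> 'n \<Rightarrow> complex^'n \<Rightarrow> complex" where
  "dlog_det c i y = (\<Sum>l\<in>UNIV. \<Sum>k\<in>UNIV. g_up (g c y) l k * dz i (\<lambda>y. g c y $ l $ k) y)"

lemma dlog_det_differentiable:
  assumes c: "c \<in> A" and x: "x \<in> coord_range c"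
  shows "dlog_det c i differentiable (at x)"
  unfolding dlog_det_def[abs_def]
  by (intro differentiable_sum finite ballI differentiable_mult g_up_derivative(1)[OF c x]
      smooth_on_differentiable[OF smooth_on_dz[OF range_open[OF c] g_nth_smooth[OF c]] x])

text \<open>The identity \<open>Ric = - \<partial>\<partial>-bar log det g\<close>, with \<open>dlog_det c i = \<partial>\<^sub>i log det g\<close> written without determinants.\<close>

lemma dzbar_dlog_det:
  assumes c: "c \<in> A" and x: "x \<in> coord_range c"
  shows "dzbar j (dlog_det c i) x = - ricci (g c) x $ i $ j"
proof -
  let ?u = "g_up (g c x)" and ?G = "\<lambda>p q y. g c y $ p $ q"
  note S = range_open[OF c]
  note gs = g_nth_smooth[OF c]
  have ud: "(\<lambda>y. g_up (g c y) l k) differentiable (at x)" for l k by (rule g_up_derivative(1)[OF c x])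
  have gd: "dz i (?G l k) differentiable (at x)" for l k
    by (rule smooth_on_differentiable[OF smooth_on_dz[OF S gs] x])
  have "dzbar j (dlog_det c i) x = (\<Sum>l\<in>UNIV. \<Sum>k\<in>UNIV. dzbar j (\<lambda>y. g_up (g c y) l k * dz i (?G l k) y) x)"
  proof -
    have "dzbar j (dlog_det c i) x = (\<Sum>l\<in>UNIV. dzbar j (\<lambda>y. \<Sum>k\<in>UNIV. g_up (g c y) l k * dz i (?G l k) y) x)"
      unfolding dlog_det_def[abs_def] by (rule dzbar_sum) (intro differentiable_sum finite ballI differentiable_mult ud gd)
    then show ?thesis by (simp only: dzbar_sum[OF differentiable_mult[OF ud gd]])
  qed
  also have "\<dots> = (\<Sum>l\<in>UNIV. \<Sum>k\<in>UNIV. ?u l k * dzbar j (dz i (?G l k)) x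
      - (\<Sum>p\<in>UNIV. \<Sum>q\<in>UNIV. ?u p k * (dzbar j (?G p q) x * ?u l q)) * dz i (?G l k) x)"
    by (simp add: dzbar_mult[OF ud gd] g_up_derivative(2)[OF c x])
  also have "\<dots> = (\<Sum>l\<in>UNIV. \<Sum>k\<in>UNIV. ?u l k * dzbar j (dz i (?G l k)) x)
      - (\<Sum>l\<in>UNIV. \<Sum>k\<in>UNIV. \<Sum>p\<in>UNIV. \<Sum>q\<in>UNIV. ?u l q * (?u p k * dz i (?G l k) x * dzbar j (?G p q) x))"
  proof -
    have "?u p k * (dzbar j (?G p q) x * ?u l q) * dz i (?G l k) x = ?u l q * (?u p k * dz i (?G l k) x * dzbar j (?G p q) x)"
      for p q k l by (simp only: mult_ac)
    then show ?thesis by (simp only: sum_subtractf sum_distrib_right)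
  qed
  also have "(\<Sum>l\<in>UNIV. \<Sum>k\<in>UNIV. \<Sum>p\<in>UNIV. \<Sum>q\<in>UNIV. ?u l q * (?u p k * dz i (?G l k) x * dzbar j (?G p q) x))
     = (\<Sum>l\<in>UNIV. \<Sum>q\<in>UNIV. ?u l q * (\<Sum>p\<in>UNIV. \<Sum>k\<in>UNIV. ?u p k * dz i (?G l k) x * dzbar j (?G p q) x))"
  proof (rule sum.cong[OF refl])
    fix l
    have "(\<Sum>k\<in>UNIV. \<Sum>p\<in>UNIV. \<Sum>q\<in>UNIV. ?u l q * (?u p k * dz i (?G l k) x * dzbar j (?G p q) x))
       = (\<Sum>p\<in>UNIV. \<Sum>k\<in>UNIV. \<Sum>q\<in>UNIV. ?u l q * (?u p k * dz i (?G l k) x * dzbar j (?G p q) x))"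
      by (rule sum.swap)
    also have "\<dots> = (\<Sum>p\<in>UNIV. \<Sum>q\<in>UNIV. \<Sum>k\<in>UNIV. ?u l q * (?u p k * dz i (?G l k) x * dzbar j (?G p q) x))"
      by (intro sum.cong refl sum.swap)
    also have "\<dots> = (\<Sum>q\<in>UNIV. \<Sum>p\<in>UNIV. \<Sum>k\<in>UNIV. ?u l q * (?u p k * dz i (?G l k) x * dzbar j (?G p q) x))"
      by (rule sum.swap)
    finally show "(\<Sum>k\<in>UNIV. \<Sum>p\<in>UNIV. \<Sum>q\<in>UNIV. ?u l q * (?u p k * dz i (?G l k) x * dzbar j (?G p q) x))
       = (\<Sum>q\<in>UNIV. ?u l q * (\<Sum>p\<in>UNIV. \<Sum>k\<in>UNIV. ?u p k * dz i (?G l k) x * dzbar j (?G p q) x))"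
      by (simp add: sum_distrib_left)
  qed
  also have "(\<Sum>l\<in>UNIV. \<Sum>k\<in>UNIV. ?u l k * dzbar j (dz i (?G l k)) x)
      - (\<Sum>l\<in>UNIV. \<Sum>q\<in>UNIV. ?u l q * (\<Sum>p\<in>UNIV. \<Sum>k\<in>UNIV. ?u p k * dz i (?G l k) x * dzbar j (?G p q) x))
     = - (\<Sum>k\<in>UNIV. \<Sum>l\<in>UNIV. ?u k l * (- dzbar j (dz i (?G k l)) x
         + (\<Sum>p\<in>UNIV. \<Sum>q\<in>UNIV. ?u p q * dz i (?G k q) x * dzbar j (?G p l) x)))"
    by (simp add: distrib_left right_diff_distrib sum.distrib sum_negf sum_subtractf)
  also have "\<dots> = - ricci (g c) x $ i $ j"
  proof -
    \<comment> \<open>The Kaehler condition and its conjugate exchange a derivative index with an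
      index of the metric; this identifies the contracted expression with the curvature.\<close>
    have "- dzbar j (dz i (?G k l)) x + (\<Sum>p\<in>UNIV. \<Sum>q\<in>UNIV. ?u p q * dz i (?G k q) x * dzbar j (?G p l) x)
        = curvature (g c) x i j k l" for k l
    proof -
      have "dz k (dzbar l (?G i j)) x = dz k (dzbar j (?G i l)) x"
        by (rule dz_cong[OF S x]) (rule g_closed_bar[OF c])
      also have "\<dots> = dzbar j (dz k (?G i l)) x" by (rule dz_dzbar_commute[OF S gs x])
      also have "\<dots> = dzbar j (dz i (?G k l)) x"
        by (rule dzbar_cong[OF S x]) (rule g_closed[OF c])
      finally have 1: "dz k (dzbar l (?G i j)) x = dzbar j (dz i (?G k l)) x" .
      have 2: "dz k (?G i q) x = dz i (?G k q) x" "dzbar l (?G p j) x = dzbar j (?G p l) x" for p q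
        by (rule g_closed[OF c x], rule g_closed_bar[OF c x])
      show ?thesis unfolding curvature_def 1 2 ..
    qed
    then show ?thesis by (simp add: ricci_def)
  qed
  finally show ?thesis .
qed

end

section \<open>The soliton equation and zeros of the field\<close>

context gradient_soliton
begin

lemma V_nth_differentiable: "c \<in> A \<Longrightarrow> x \<in> coord_range c \<Longrightarrow> (\<lambda>y. V c y $ k) differentiable (at x)"
  by (rule smooth_on_differentiable[OF smooth_on_holo[OF range_open holomorphic_vec_on_nth[OF V_holo]]])

text \<open>One half of the Lie derivative of g along V plus its conjugate; the other half is
  \<open>gradient_lowered_cnj_dzbar\<close>. Both equal the same multiple of the mixed Hessian of f,
  whence the factor 2 in \<open>soliton_equation\<close>.\<close>

lemma gradient_lowered_dz:
  assumes c: "c \<in> A" and x: "x \<in> coord_range c"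
  shows "(\<Sum>k\<in>UNIV. V c x $ k * dz i (\<lambda>y. g c y $ k $ j) x + dz i (\<lambda>y. V c y $ k) x * g c x $ k $ j)
    = complex_of_real a * dz i (dzbar j (fc c)) x"
proof -
  note S = range_open[OF c]
  have gd: "(\<lambda>y. g c y $ k $ j) differentiable (at x)" for k by (rule smooth_on_differentiable[OF g_nth_smooth[OF c] x])
  note vd = V_nth_differentiable[OF c x]
  have "complex_of_real a * dz i (dzbar j (fc c)) x = dz i (\<lambda>y. complex_of_real a * dzbar j (fc c) y) x"
    by (rule dz_cmult[symmetric]) (rule smooth_on_differentiable[OF smooth_on_dzbar[OF S fc_smooth[OF c]] x])
  also have "\<dots> = dz i (\<lambda>y. \<Sum>k\<in>UNIV. V c y $ k * g c y $ k $ j) x"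
    by (rule dz_cong[OF S x]) (simp add: gradient_lowered[OF c])
  also have "\<dots> = (\<Sum>k\<in>UNIV. dz i (\<lambda>y. V c y $ k * g c y $ k $ j) x)"
    by (rule dz_sum) (rule differentiable_mult[OF vd gd])
  finally show ?thesis by (simp only: dz_mult[OF vd gd])
qed

lemma gradient_lowered_cnj_dzbar:
  assumes c: "c \<in> A" and x: "x \<in> coord_range c"
  shows "(\<Sum>k\<in>UNIV. cnj (V c x $ k) * dzbar j (\<lambda>y. g c y $ i $ k) x + cnj (dz j (\<lambda>y. V c y $ k) x) * g c x $ i $ k)
    = complex_of_real a * dz i (dzbar j (fc c)) x"
proof -
  note S = range_open[OF c]
  note fs = fc_smooth[OF c]
  have gd: "(\<lambda>y. g c y $ i $ k) differentiable (at x)" for k by (rule smooth_on_differentiable[OF g_nth_smooth[OF c] x])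
  note vd = V_nth_differentiable[OF c x]
  have vcd: "(\<lambda>y. cnj (V c y $ k)) differentiable (at x)" for k
    by (rule differentiableI[OF bounded_linear.has_derivative[OF bounded_linear_cnj FD_works[OF vd]]])
  have eq: "complex_of_real a * dz i (fc c) y = (\<Sum>k\<in>UNIV. cnj (V c y $ k) * g c y $ i $ k)" if y: "y \<in> coord_range c" for y
  proof -
    have herm: "cnj (g c y $ k $ i) = g c y $ i $ k" for k
      using g_hermitian[OF c y] unfolding hermitian_def by (metis complex_cnj_cnj)
    have "cnj (dzbar i (fc c) y) = dz i (\<lambda>y. cnj (fc c y)) y"
      by (rule dz_cnj[OF smooth_on_differentiable[OF fs y], symmetric])
    then have "cnj (dzbar i (fc c) y) = dz i (fc c) y" by (simp only: cnj_fc)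
    then have "complex_of_real a * dz i (fc c) y = cnj (complex_of_real a * dzbar i (fc c) y)" by simp
    also have "\<dots> = cnj (\<Sum>k\<in>UNIV. V c y $ k * g c y $ k $ i)" by (simp only: gradient_lowered[OF c y])
    finally show ?thesis by (simp add: herm)
  qed
  have "complex_of_real a * dz i (dzbar j (fc c)) x = complex_of_real a * dzbar j (dz i (fc c)) x"
    by (simp only: dz_dzbar_commute[OF S fs x])
  also have "\<dots> = dzbar j (\<lambda>y. complex_of_real a * dz i (fc c) y) x"
    by (rule dzbar_cmult[symmetric]) (rule smooth_on_differentiable[OF smooth_on_dz[OF S fs] x])
  also have "\<dots> = dzbar j (\<lambda>y. \<Sum>k\<in>UNIV. cnj (V c y $ k) * g c y $ i $ k) x"
    by (rule dzbar_cong[OF S x eq])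
  also have "\<dots> = (\<Sum>k\<in>UNIV. dzbar j (\<lambda>y. cnj (V c y $ k) * g c y $ i $ k) x)"
    by (rule dzbar_sum) (rule differentiable_mult[OF vcd gd])
  finally show ?thesis by (simp only: dzbar_mult[OF vcd gd] dzbar_cnj[OF vd])
qed

text \<open>While in \<open>cball x R\<close>, orbits have speed at most K, so within time R / (4 K)
  they move at most R / 4. An orbit starting within R / 2 thus stays within 3 R / 4.\<close>

lemma phi_stay_uniformly:
  assumes c: "c \<in> A" and R: "R > 0" "cball x R \<subseteq> coord_range c"
  shows "\<exists>T>0. \<forall>z\<in>ball x (R / 2). \<forall>t\<in>{0..T}.
    \<phi> t (coord_inv c z) \<in> cdom c \<and> coord c (\<phi> t (coord_inv c z)) \<in> cball x R"
proof -
  have "compact (V c ` cball x R)"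
    by (rule compact_continuous_image[OF continuous_on_subset[OF holomorphic_vec_on_continuous[OF V_holo[OF c]] R(2)] compact_cball])
  then obtain K where K: "K > 0" "\<And>y. y \<in> cball x R \<Longrightarrow> norm (V c y) \<le> K"
    using compact_imp_bounded bounded_pos[of "V c ` cball x R"] by (metis image_eqI)
  define T where "T = R / (4 * K)"
  have T: "T > 0" using R K by (simp add: T_def)
  have "\<phi> t (coord_inv c z) \<in> cdom c \<and> coord c (\<phi> t (coord_inv c z)) \<in> cball x R"
    if z: "z \<in> ball x (R / 2)" and t: "t \<in> {0..T}" for z t
  proof -
    define p where "p = coord_inv c z"
    have zc: "z \<in> coord_range c" using z R by (auto simp: subset_iff)
    have p: "p \<in> cdom c" "coord c p = z" using coord_inv_in_cdom[OF zc] coord_coord_inv[OF c zc] by (simp_all add: p_def)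
    have pM: "p \<in> topspace X" using p(1) cdom_subset[OF c] by blast
    have "\<forall>t\<in>{0..T}. \<phi> t p \<in> cdom c \<and> dist x (coord c (\<phi> t p)) \<le> 3 * R / 4"
    proof (rule phi_stay[OF c R(2) p(1)])
      show "dist x (coord c p) < R" "T \<ge> 0" "3 * R / 4 < R" using z p(2) R T by auto
      fix \<tau> assume \<tau>: "\<tau> \<in> {0..T}" and st: "\<forall>t\<in>{0..\<tau>}. \<phi> t p \<in> cdom c \<and> dist x (coord c (\<phi> t p)) \<le> R"
      let ?h = "\<lambda>t. coord c (\<phi> t p)"
      have "norm (?h \<tau> - ?h 0 - \<tau> *\<^sub>R 0) \<le> K * \<tau>"
      proof (rule linear_approx_bound[where h' = "\<lambda>t. V c (?h t)"])
        fix s assume s: "s \<in> {0..\<tau>}"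
        show "(?h has_vector_derivative V c (?h s)) (at s within {0..\<tau>})"
          by (rule has_vector_derivative_within_subset[OF phi_coord_derivative[OF c pM]]) (use s st in auto)
        show "norm (V c (?h s) - 0) \<le> K" using K(2)[of "?h s"] s st by simp
      qed (use \<tau> in simp)
      also have "\<dots> \<le> K * T" using \<tau> K(1) by simp
      also have "\<dots> = R / 4" using K(1) by (simp add: T_def)
      finally have "dist z (?h \<tau>) \<le> R / 4" using phi_0[OF pM] p(2) by (simp add: dist_norm norm_minus_commute)
      then show "dist x (?h \<tau>) \<le> 3 * R / 4" using z dist_triangle[of x "?h \<tau>" z] by simp
    qed
    then show ?thesis using t R(1) unfolding p_def by force
  qed
  then show ?thesis using T by (intro exI[of _ T]) simp
qed

text \<open>The derivative at time 0 of the pulled-back metric is computed twice: from the pull-back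
  formula it is the Lie derivative of g, from the flow equation it is - Ric - 2 \<rho> g.\<close>

lemma soliton_equation:
  assumes c: "c \<in> A" and x: "x \<in> coord_range c"
  shows "2 * (complex_of_real a * dz i (dzbar j (fc c)) x)
    = - (ricci (g c) x $ i $ j + 2 * complex_of_real \<rho> * g c x $ i $ j)"
proof -
  obtain R where R: "R > 0" "cball x R \<subseteq> coord_range c" using range_open[OF c] x open_contains_cball by blast
  obtain T where T: "T > 0" and stay: "\<And>z t. z \<in> ball x (R / 2) \<Longrightarrow> t \<in> {0..T} \<Longrightarrow>
      \<phi> t (coord_inv c z) \<in> cdom c \<and> coord c (\<phi> t (coord_inv c z)) \<in> cball x R"
    using phi_stay_uniformly[OF c R] by blast
  have xb: "x \<in> ball x (R / 2)" and zT: "0 \<in> {0..T}" using R T by simp_all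
  let ?\<psi> = "\<lambda>s. local_expr c c (\<phi> s)"
  have \<psi>: "?\<psi> s z = coord c (\<phi> s (coord_inv c z))" for s z by (simp add: local_expr_def)
  have \<psi>0: "?\<psi> 0 z = z" if "z \<in> ball x (R / 2)" for z
  proof -
    have zc: "z \<in> coord_range c" using that R by (auto simp: subset_iff)
    then have "coord_inv c z \<in> topspace X" using coord_inv_in_cdom[of z c] cdom_subset[OF c] by blast
    then show ?thesis using phi_0 coord_coord_inv[OF c zc] \<psi> by simp
  qed
  have px: "coord_inv c x \<in> cdom c" "coord c (coord_inv c x) = x"
    using coord_inv_in_cdom[OF x] coord_coord_inv[OF c x] by simp_all
  have pM: "coord_inv c x \<in> topspace X" using px(1) cdom_subset[OF c] by blast
  have nth: "cjac F x (axis i 1) $ k = dz i (\<lambda>y. F y $ k) x" for F :: "complex^'n \<Rightarrow> complex^'n" and i k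
    by (simp add: cjac_nth axis_def if_distrib[of "\<lambda>u. u * _"] cong: if_cong)
  \<comment> \<open>Entries of the Jacobian of the flow, and with \<open>G\<close> below those of
    the metric along the orbit: the pull-back is a sum of products of D, G and a conjugate of D, to
    be differentiated at s = 0.\<close>
  define D where "D = (\<lambda>i k s. dz i (\<lambda>y. ?\<psi> s y $ k) x)"
  define V' where "V' = (\<lambda>i k. dz i (\<lambda>y. V c y $ k) x)"
  have D: "(D i k has_vector_derivative V' i k) (at 0 within {0..T})" for i k
  proof -
    have "((\<lambda>s. cjac (?\<psi> s) x (axis i 1)) has_vector_derivative cjac (\<lambda>z. V c (?\<psi> 0 z)) x (axis i 1)) (at 0 within {0..T})"
      by (rule flow_jac_derivative[where r = "R / 2", OF c R(2) _ _ stay zT]) (use R in auto)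
    moreover have "cjac (\<lambda>z. V c (?\<psi> 0 z)) x = cjac (V c) x"
      by (rule cjac_cong[OF open_ball xb]) (simp add: \<psi>0)
    ultimately have "((\<lambda>s. cjac (?\<psi> s) x (axis i 1)) has_vector_derivative cjac (V c) x (axis i 1)) (at 0 within {0..T})" by simp
    from bounded_linear.has_vector_derivative[OF bounded_linear_vec_nth this, of k]
    show ?thesis unfolding nth D_def V'_def .
  qed
  have D0: "D i k 0 = (if i = k then 1 else 0)" for i k
  proof -
    have "D i k 0 = dz i (\<lambda>y. y $ k) x" unfolding D_def by (rule dz_cong[OF open_ball xb]) (simp add: \<psi>0)
    then show ?thesis by (simp add: dz_nth)
  qed
  define G where "G = (\<lambda>k l s. g c (?\<psi> s x) $ k $ l)"
  define G' where "G' = (\<lambda>k l. FD (\<lambda>y. g c y $ k $ l) x (V c x))"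
  have gd: "(\<lambda>y. g c y $ k $ l) differentiable (at x)" for k l by (rule smooth_on_differentiable[OF g_nth_smooth[OF c] x])
  have G: "(G k l has_vector_derivative G' k l) (at 0 within {0..T})" for k l
  proof -
    have "((\<lambda>s. coord c (\<phi> s (coord_inv c x))) has_vector_derivative V c (coord c (\<phi> 0 (coord_inv c x)))) (at 0 within {0..T})"
      by (rule has_vector_derivative_within_subset[OF phi_coord_derivative[OF c pM]]) (use px phi_0[OF pM] in auto)
    then have 1: "((\<lambda>s. ?\<psi> s x) has_derivative (\<lambda>h. h *\<^sub>R V c x)) (at 0 within {0..T})"
      using phi_0[OF pM] px(2) by (simp add: \<psi> has_vector_derivative_def)
    have 2: "((\<lambda>y. g c y $ k $ l) has_derivative FD (\<lambda>y. g c y $ k $ l) x) (at (?\<psi> 0 x))"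
      unfolding \<psi>0[OF xb] by (rule FD_works[OF gd])
    from has_derivative_compose[OF 1 2] show ?thesis
      by (simp add: G_def G'_def has_vector_derivative_def
          linear_scale[OF bounded_linear.linear[OF has_derivative_bounded_linear[OF FD_works[OF gd]]]])
  qed
  have G0: "G k l 0 = g c x $ k $ l" for k l by (simp add: G_def \<psi>0[OF xb])
  have "((\<lambda>s. \<Sum>k\<in>UNIV. \<Sum>l\<in>UNIV. D i k s * G k l s * cnj (D j l s)) has_vector_derivative
     (\<Sum>k\<in>UNIV. \<Sum>l\<in>UNIV. (D i k 0 * G k l 0) * cnj (V' j l) + (D i k 0 * G' k l + V' i k * G k l 0) * cnj (D j l 0)))
     (at 0 within {0..T})"
    by (intro has_vector_derivative_sum has_vector_derivative_mult D G bounded_linear.has_vector_derivative[OF bounded_linear_cnj])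
  also have "(\<Sum>k\<in>UNIV. \<Sum>l\<in>UNIV. (D i k 0 * G k l 0) * cnj (V' j l) + (D i k 0 * G' k l + V' i k * G k l 0) * cnj (D j l 0))
     = (\<Sum>k\<in>UNIV. \<Sum>l\<in>UNIV. (if i = k then g c x $ k $ l * cnj (V' j l) else 0)
         + (if j = l then (if i = k then G' k l else 0) + V' i k * g c x $ k $ l else 0))"
    unfolding D0 G0 by (intro sum.cong refl) simp
  also have "\<dots> = (\<Sum>k\<in>UNIV. \<Sum>l\<in>UNIV. if i = k then g c x $ k $ l * cnj (V' j l) else 0)
      + (\<Sum>k\<in>UNIV. \<Sum>l\<in>UNIV. if j = l then (if i = k then G' k l else 0) + V' i k * g c x $ k $ l else 0)"
    by (simp only: sum.distrib)
  also have "(\<Sum>k\<in>UNIV. \<Sum>l\<in>UNIV. if i = k then g c x $ k $ l * cnj (V' j l) else 0) = (\<Sum>l\<in>UNIV. g c x $ i $ l * cnj (V' j l))"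
    by (subst sum.swap) simp
  also have "(\<Sum>k\<in>UNIV. \<Sum>l\<in>UNIV. if j = l then (if i = k then G' k l else 0) + V' i k * g c x $ k $ l else 0)
      = G' i j + (\<Sum>k\<in>UNIV. V' i k * g c x $ k $ j)"
    by (simp add: sum.distrib)
  finally have der1: "((\<lambda>s. \<Sum>k\<in>UNIV. \<Sum>l\<in>UNIV. D i k s * G k l s * cnj (D j l s)) has_vector_derivative
     (\<Sum>l\<in>UNIV. g c x $ i $ l * cnj (V' j l)) + (G' i j + (\<Sum>k\<in>UNIV. V' i k * g c x $ k $ j))) (at 0 within {0..T})" .
  have pb: "(\<Sum>k\<in>UNIV. \<Sum>l\<in>UNIV. D i k s * G k l s * cnj (D j l s)) = gt s c x $ i $ j" if s: "s \<in> {0..T}" for s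
  proof -
    have "\<phi> s (coord_inv c x) \<in> cdom c" "s \<ge> 0" using stay[OF xb s] s by auto
    then have "gt s c (coord c (coord_inv c x)) $ i $ j = (\<Sum>k\<in>UNIV. \<Sum>l\<in>UNIV.
        dz i (\<lambda>y. ?\<psi> s y $ k) (coord c (coord_inv c x)) * g c (coord c (\<phi> s (coord_inv c x))) $ k $ l *
        cnj (dz j (\<lambda>y. ?\<psi> s y $ l) (coord c (coord_inv c x))))"
      using pullback[of s] c px(1) unfolding is_pullback_def by blast
    then show ?thesis by (simp add: D_def G_def px(2) \<psi>)
  qed
  have "((\<lambda>s. gt s c x) has_vector_derivative (- ricci (gt 0 c) x - (2 * \<rho>) *\<^sub>R gt 0 c x)) (at 0 within {0..})"
    using kr c x unfolding kr_flow_def by blast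
  then have "((\<lambda>s. gt s c x) has_vector_derivative (- ricci (g c) x - (2 * \<rho>) *\<^sub>R g c x)) (at 0 within {0..T})"
    unfolding ricci_gt_0[OF c x] gt_0[OF c x] by (rule has_vector_derivative_within_subset) simp
  from bounded_linear.has_vector_derivative[OF bounded_linear_compose[OF bounded_linear_vec_nth bounded_linear_vec_nth] this, of i j]
  have "((\<lambda>s. gt s c x $ i $ j) has_vector_derivative (- ricci (g c) x - (2 * \<rho>) *\<^sub>R g c x) $ i $ j) (at 0 within {0..T})" .
  then have der2: "((\<lambda>s. \<Sum>k\<in>UNIV. \<Sum>l\<in>UNIV. D i k s * G k l s * cnj (D j l s)) has_vector_derivative
      (- ricci (g c) x - (2 * \<rho>) *\<^sub>R g c x) $ i $ j) (at 0 within {0..T})"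
    by (rule has_vector_derivative_transform[where f = "\<lambda>s. gt s c x $ i $ j", OF zT, rotated]) (rule pb)
  have eq: "(\<Sum>l\<in>UNIV. g c x $ i $ l * cnj (V' j l)) + (G' i j + (\<Sum>k\<in>UNIV. V' i k * g c x $ k $ j))
      = (- ricci (g c) x - (2 * \<rho>) *\<^sub>R g c x) $ i $ j"
    by (rule vector_derivative_unique_within_closed_interval[OF T _ der1[folded cbox_interval] der2[folded cbox_interval]])
       (use T in simp)
  have Geq: "G' i j = (\<Sum>k\<in>UNIV. V c x $ k * dz i (\<lambda>y. g c y $ k $ j) x) + (\<Sum>k\<in>UNIV. cnj (V c x $ k) * dzbar j (\<lambda>y. g c y $ i $ k) x)"
    unfolding G'_def FD_dz[OF gd] sum.distrib g_closed[OF c x, of _ i j] g_closed_bar[OF c x, of _ i j] ..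
  let ?W = "complex_of_real a * dz i (dzbar j (fc c)) x"
  have L1: "(\<Sum>k\<in>UNIV. V c x $ k * dz i (\<lambda>y. g c y $ k $ j) x) + (\<Sum>k\<in>UNIV. V' i k * g c x $ k $ j) = ?W"
    using gradient_lowered_dz[OF c x, of i j] by (simp only: sum.distrib V'_def)
  have L2: "(\<Sum>k\<in>UNIV. cnj (V c x $ k) * dzbar j (\<lambda>y. g c y $ i $ k) x) + (\<Sum>l\<in>UNIV. g c x $ i $ l * cnj (V' j l)) = ?W"
    using gradient_lowered_cnj_dzbar[OF c x, of j i] by (simp add: sum.distrib V'_def mult.commute)
  have "p + (q + r + t) = w + w" if "q + t = w" "r + p = w" for p q r t w :: complex
    using arg_cong2[OF that, of "(+)"] by (simp add: algebra_simps)
  from this[OF L1 L2] have "?W + ?W = (- ricci (g c) x - (2 * \<rho>) *\<^sub>R g c x) $ i $ j"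
    using eq unfolding Geq by simp
  also have "\<dots> = - ricci (g c) x $ i $ j - (2 * \<rho>) *\<^sub>R (g c x $ i $ j)" by simp
  also have "(2 * \<rho>) *\<^sub>R (g c x $ i $ j) = 2 * complex_of_real \<rho> * g c x $ i $ j"
    by (simp only: scaleR_conv_of_real of_real_mult of_real_numeral)
  finally show ?thesis by simp
qed

text \<open>Tracing the soliton equation gives \<open>- 2 div V = R + 2 \<rho> n\<close>, while holomorphy of \<open>V\<close> gives
  \<open>\<partial>\<^sub>j-bar div V = - R\<^sub>i\<^sub>j V\<^sup>i\<close>: critical points of the scalar curvature \<open>R\<close> are zeros of \<open>V\<close> when
  \<open>Ric > 0\<close>.\<close>

definition divergence :: "('a, 'n) chart \<Rightarrow> complex^'n \<Rightarrow> complex" where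
  "divergence c y = (\<Sum>l\<in>UNIV. dz l (\<lambda>y. V c y $ l) y) + (\<Sum>i\<in>UNIV. V c y $ i * dlog_det c i y)"

text \<open>Contract the soliton equation with the inverse metric. The Kaehler condition turns the
  derivative of g into one in the direction of V, so the terms with V become the two sums in
  \<open>divergence\<close>, and g itself contributes the dimension.\<close>

lemma ricci_trace:
  assumes c: "c \<in> A" and x: "x \<in> coord_range c"
  shows "(\<Sum>i\<in>UNIV. \<Sum>j\<in>UNIV. g_up (g c x) i j * ricci (g c) x $ i $ j) = - 2 * divergence c x - 2 * complex_of_real \<rho> * of_nat CARD('n)"
proof -
  let ?u = "g_up (g c x)" and ?d = "\<lambda>k i j. dz k (\<lambda>y. g c y $ i $ j) x" and ?V' = "\<lambda>i k. dz i (\<lambda>y. V c y $ k) x"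
  have inv: "(\<Sum>j\<in>UNIV. g c x $ k $ j * ?u i j) = (if k = i then 1 else 0)" for k i
    using matrix_inv_sums(2)[OF g_herm_pos[OF c x], of k i] by (simp only: g_up_def)
  have ric: "ricci (g c) x $ i $ j = - 2 * (\<Sum>k\<in>UNIV. ?V' i k * g c x $ k $ j) - 2 * (\<Sum>k\<in>UNIV. V c x $ k * ?d k i j) - 2 * complex_of_real \<rho> * g c x $ i $ j" for i j
  proof -
    have "(\<Sum>k\<in>UNIV. V c x $ k * ?d k i j) = (\<Sum>k\<in>UNIV. V c x $ k * ?d i k j)"
      by (rule sum.cong[OF refl]) (simp only: g_closed[OF c x, of _ i j])
    then have grad: "complex_of_real a * dz i (dzbar j (fc c)) x
        = (\<Sum>k\<in>UNIV. V c x $ k * ?d k i j) + (\<Sum>k\<in>UNIV. ?V' i k * g c x $ k $ j)"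
      using gradient_lowered_dz[OF c x, of i j] by (simp add: sum.distrib)
    have r: "r = - 2 * q - 2 * p - t" if "2 * (p + q) = - (r + t)" for p q r t :: complex
    proof -
      have "r = - (2 * (p + q)) - t" using that by simp
      also have "\<dots> = - 2 * q - 2 * p - t" by (simp add: algebra_simps)
      finally show ?thesis .
    qed
    show ?thesis by (rule r) (rule soliton_equation[OF c x, of i j, unfolded grad])
  qed
  have lin: "(\<Sum>i\<in>UNIV. \<Sum>j\<in>UNIV. ?u i j * (- 2 * P i j - 2 * Q i j - r * H i j))
      = - 2 * (\<Sum>i\<in>UNIV. \<Sum>j\<in>UNIV. ?u i j * P i j) - 2 * (\<Sum>i\<in>UNIV. \<Sum>j\<in>UNIV. ?u i j * Q i j)
        - r * (\<Sum>i\<in>UNIV. \<Sum>j\<in>UNIV. H i j * ?u i j)" for P Q H :: "'n \<Rightarrow> 'n \<Rightarrow> complex" and r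
    unfolding sum_distrib_left sum_subtractf[symmetric] by (intro sum.cong refl) (simp add: algebra_simps)
  have "(\<Sum>i\<in>UNIV. \<Sum>j\<in>UNIV. ?u i j * ricci (g c) x $ i $ j)
      = - 2 * (\<Sum>i\<in>UNIV. \<Sum>j\<in>UNIV. ?u i j * (\<Sum>k\<in>UNIV. ?V' i k * g c x $ k $ j))
        - 2 * (\<Sum>i\<in>UNIV. \<Sum>j\<in>UNIV. ?u i j * (\<Sum>k\<in>UNIV. V c x $ k * ?d k i j))
        - 2 * complex_of_real \<rho> * (\<Sum>i\<in>UNIV. \<Sum>j\<in>UNIV. g c x $ i $ j * ?u i j)"
    unfolding ric by (rule lin)
  also have "(\<Sum>i\<in>UNIV. \<Sum>j\<in>UNIV. g c x $ i $ j * ?u i j) = of_nat CARD('n)" by (simp add: inv)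
  also have "(\<Sum>i\<in>UNIV. \<Sum>j\<in>UNIV. ?u i j * (\<Sum>k\<in>UNIV. ?V' i k * g c x $ k $ j)) = (\<Sum>i\<in>UNIV. ?V' i i)"
  proof (rule sum.cong[OF refl])
    fix i
    have "(\<Sum>j\<in>UNIV. ?u i j * (\<Sum>k\<in>UNIV. ?V' i k * g c x $ k $ j)) = (\<Sum>k\<in>UNIV. ?V' i k * (\<Sum>j\<in>UNIV. g c x $ k $ j * ?u i j))"
      unfolding sum_distrib_left by (subst sum.swap) (simp add: mult_ac)
    then show "(\<Sum>j\<in>UNIV. ?u i j * (\<Sum>k\<in>UNIV. ?V' i k * g c x $ k $ j)) = ?V' i i"
      by (simp add: inv if_distrib cong: if_cong)
  qed
  also have "(\<Sum>i\<in>UNIV. \<Sum>j\<in>UNIV. ?u i j * (\<Sum>k\<in>UNIV. V c x $ k * ?d k i j)) = (\<Sum>k\<in>UNIV. V c x $ k * dlog_det c k x)"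
  proof -
    have "(\<Sum>i\<in>UNIV. \<Sum>j\<in>UNIV. ?u i j * (\<Sum>k\<in>UNIV. V c x $ k * ?d k i j))
        = (\<Sum>i\<in>UNIV. \<Sum>k\<in>UNIV. \<Sum>j\<in>UNIV. V c x $ k * (?u i j * ?d k i j))"
      unfolding sum_distrib_left by (rule sum.cong[OF refl], subst sum.swap) (simp add: mult_ac)
    also have "\<dots> = (\<Sum>k\<in>UNIV. \<Sum>i\<in>UNIV. \<Sum>j\<in>UNIV. V c x $ k * (?u i j * ?d k i j))" by (rule sum.swap)
    finally show ?thesis by (simp only: dlog_det_def sum_distrib_left)
  qed
  finally show ?thesis by (simp add: divergence_def algebra_simps)
qed

lemma vfield_zero_at_scalar_curv_max:
  assumes c: "c \<in> A" and x: "x \<in> coord_range c"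
    and ric: "\<And>y. y \<in> coord_range c \<Longrightarrow> herm_pos (ricci (g c) y)"
    and max: "\<And>y. y \<in> coord_range c \<Longrightarrow> scalar_curv (g c) y \<le> scalar_curv (g c) x"
  shows "V c x = 0"
proof -
  note S = range_open[OF c]
  have vh: "holo_on (\<lambda>y. V c y $ k) (coord_range c)" for k by (rule holomorphic_vec_on_nth[OF V_holo[OF c]])
  have dvh: "holo_on (dz l (\<lambda>y. V c y $ l)) (coord_range c)" for l by (rule holo_on_dz_holo[OF S vh])
  note vd = V_nth_differentiable[OF c x] and Gd = dlog_det_differentiable[OF c x]
  have dvd: "dz l (\<lambda>y. V c y $ l) differentiable (at x)" for l
    by (rule smooth_on_differentiable[OF smooth_on_holo[OF S dvh] x])
  have Ed1: "(\<lambda>y. \<Sum>l\<in>UNIV. dz l (\<lambda>y. V c y $ l) y) differentiable (at x)"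
    by (intro differentiable_sum finite ballI dvd)
  have Ed2: "(\<lambda>y. \<Sum>i\<in>UNIV. V c y $ i * dlog_det c i y) differentiable (at x)"
    by (intro differentiable_sum finite ballI differentiable_mult vd Gd)
  have Ed: "divergence c differentiable (at x)"
    unfolding divergence_def[abs_def] by (rule differentiable_add[OF Ed1 Ed2])
  \<comment> \<open>The trace of a Hermitian tensor is real, hence so is the divergence. At a
    critical point of its real part the whole derivative therefore vanishes, and
    \<open>dzbar\<close> with it.\<close>
  have real: "divergence c y = complex_of_real (Re (divergence c y))" and sc: "scalar_curv (g c) y = - 2 * Re (divergence c y) - 2 * \<rho> * CARD('n)"
    if y: "y \<in> coord_range c" for y
  proof -
    let ?s = "\<Sum>i\<in>UNIV. \<Sum>j\<in>UNIV. g_up (g c y) i j * ricci (g c) y $ i $ j"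
    have "cnj ?s = (\<Sum>i\<in>UNIV. \<Sum>j\<in>UNIV. g_up (g c y) j i * ricci (g c) y $ j $ i)"
    proof -
      have "cnj (ricci (g c) y $ i $ j) = ricci (g c) y $ j $ i" for i j
        using ric[OF y, unfolded herm_pos_def hermitian_def, THEN conjunct1, rule_format, of j i, symmetric] .
      then show ?thesis by (simp add: g_up_def matrix_inv_hermitian[OF g_herm_pos[OF c y]])
    qed
    also have "\<dots> = ?s" by (rule sum.swap)
    finally have "cnj ?s = ?s" .
    moreover have "Im z = 0" if "cnj z = z" for z using that by (simp add: complex_eq_iff)
    ultimately have "Im ?s = 0" by blast
    then have im: "Im (divergence c y) = 0" unfolding ricci_trace[OF c y] by simp
    then show "divergence c y = complex_of_real (Re (divergence c y))" by (simp add: complex_eq_iff)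
    show "scalar_curv (g c) y = - 2 * Re (divergence c y) - 2 * \<rho> * CARD('n)"
      unfolding scalar_curv_def ricci_trace[OF c y] by simp
  qed
  have "((\<lambda>y. Re (divergence c y)) has_derivative (\<lambda>v. Re (FD (divergence c) x v))) (at x)"
    by (rule bounded_linear.has_derivative[OF bounded_linear_Re FD_works[OF Ed]])
  \<comment> \<open>The factor -2 turns a maximum of the scalar curvature into a minimum of the
    divergence.\<close>
  moreover have "\<forall>y\<in>coord_range c. Re (divergence c x) \<le> Re (divergence c y)"
    using max sc x by fastforce
  ultimately have "(\<lambda>v. Re (FD (divergence c) x v)) = (\<lambda>v. 0)"
    using differential_zero_maxmin[OF x S] by blast
  then have re: "Re (FD (divergence c) x v) = 0" for v by meson
  have "((\<lambda>y. complex_of_real (Re (divergence c y))) has_derivative (\<lambda>v. complex_of_real (Re (FD (divergence c) x v)))) (at x)"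
    by (rule bounded_linear.has_derivative[OF bounded_linear_of_real bounded_linear.has_derivative[OF bounded_linear_Re FD_works[OF Ed]]])
  then have "(divergence c has_derivative (\<lambda>v. complex_of_real (Re (FD (divergence c) x v)))) (at x)"
    by (rule has_derivative_transform_within_open[OF _ S x]) (rule real[symmetric])
  then have "FD (divergence c) x v = 0" for v using FD_eqI re by (metis of_real_0)
  then have E0: "dzbar j (divergence c) x = 0" for j by (simp add: dzbar_def)
  have Vric: "(\<Sum>i\<in>UNIV. V c x $ i * ricci (g c) x $ i $ j) = 0" for j
  proof -
    have "dzbar j (divergence c) x = dzbar j (\<lambda>y. \<Sum>l\<in>UNIV. dz l (\<lambda>y. V c y $ l) y) x + dzbar j (\<lambda>y. \<Sum>i\<in>UNIV. V c y $ i * dlog_det c i y) x"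
      unfolding divergence_def[abs_def] by (rule dzbar_add[OF Ed1 Ed2])
    also have "dzbar j (\<lambda>y. \<Sum>l\<in>UNIV. dz l (\<lambda>y. V c y $ l) y) x = (\<Sum>l\<in>UNIV. dzbar j (dz l (\<lambda>y. V c y $ l)) x)"
      by (rule dzbar_sum) (rule dvd)
    \<comment> \<open>The first sum in the divergence is holomorphic, so only the logarithmic
      derivative of det g contributes, and that yields the Ricci tensor.\<close>
    also have "\<dots> = 0" by (simp add: holo_on_dzbar[OF dvh x])
    also have "dzbar j (\<lambda>y. \<Sum>i\<in>UNIV. V c y $ i * dlog_det c i y) x = (\<Sum>i\<in>UNIV. dzbar j (\<lambda>y. V c y $ i * dlog_det c i y) x)"
      by (rule dzbar_sum) (rule differentiable_mult[OF vd Gd])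
    also have "\<dots> = - (\<Sum>i\<in>UNIV. V c x $ i * ricci (g c) x $ i $ j)"
      by (simp add: dzbar_mult[OF vd Gd] holo_on_dzbar[OF vh x] dzbar_dlog_det[OF c x] sum_negf)
    finally show ?thesis using E0[of j] by simp
  qed
  have "herm_form (ricci (g c) x) (V c x) = (\<Sum>j\<in>UNIV. (\<Sum>i\<in>UNIV. V c x $ i * ricci (g c) x $ i $ j) * cnj (V c x $ j))"
    unfolding herm_form_def sum_distrib_right by (subst sum.swap) (simp only: mult_ac)
  then have "herm_form (ricci (g c) x) (V c x) = 0" by (simp add: Vric)
  then show ?thesis using ric[OF x] unfolding herm_pos_def by force
qed

end

theorem theorem1:
  fixes X :: "'a topology"
    and A :: "('a, 'n::finite) chart set"
    and g :: "('a, 'n) herm_tensor"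
    and \<rho> :: real
  assumes "complex_manifold X A"
    and "\<not> compact_space X"
    and "kaehler_metric A g"
    and "complete_metric X A g"
    and "gradient_kr_soliton X A g \<rho>"
    and "(\<rho> = 0 \<and> positive_ricci A g \<and> scalar_curv_attains_max A g) \<or>
         (\<rho> > 0 \<and> nonneg_ricci A g)"
  shows "\<exists>F. biholomorphism X A (euclidean :: (complex^'n) topology) std_atlas F"
proof -
  obtain V f where V: "kr_soliton_field X A g \<rho> V" and f: "is_gradient_of A g V f"
    using assms(5) unfolding gradient_kr_soliton_def by blast
  obtain \<phi> gt where hol: "holomorphic_vfield A V" and fl: "is_flow X A V \<phi>"
    and t: "\<forall>t\<ge>0. biholomorphism X A X A (\<phi> t) \<and> is_pullback A (\<phi> t) g (gt t)"
    and gt0: "\<forall>c\<in>A. \<forall>x\<in>coord_range c. gt 0 c x = g c x" and kr: "kr_flow A \<rho> gt"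
    using V unfolding kr_soliton_field_def by blast
  have f1: "\<forall>c\<in>A. smooth_on (f \<circ> coord_inv c) (coord_range c)" using f unfolding is_gradient_of_def by blast
  obtain a where a: "\<forall>c\<in>A. \<forall>x\<in>coord_range c. \<forall>i. V c x $ i = complex_of_real a *
      (\<Sum>j\<in>UNIV. g_up (g c x) i j * dzbar j (\<lambda>y. complex_of_real (f (coord_inv c y))) x)"
    using f unfolding is_gradient_of_def by (elim exE conjE)
  interpret gradient_soliton X A g \<rho> V \<phi> gt f a
  proof
    show "complex_manifold X A" "kaehler_metric A g" by fact+
    show "holomorphic_vfield A V" "is_flow X A V \<phi>" "kr_flow A \<rho> gt" by fact+
    show "biholomorphism X A X A (\<phi> t)" "is_pullback A (\<phi> t) g (gt t)" if "t \<ge> 0" for t using t that by simp_all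
    show "gt 0 c x = g c x" if "c \<in> A" "x \<in> coord_range c" for c x using gt0 that by simp
    show "smooth_on (f \<circ> coord_inv c) (coord_range c)" if "c \<in> A" for c using f1 that by simp
    show "V c x $ i = complex_of_real a * (\<Sum>j\<in>UNIV. g_up (g c x) i j * dzbar j (\<lambda>y. complex_of_real (f (coord_inv c y))) x)"
      if "c \<in> A" "x \<in> coord_range c" for c x i using a that by blast
  qed
  from assms(6) show ?thesis
  proof (elim disjE conjE)
    assume \<rho>: "\<rho> = 0" and pos: "positive_ricci A g" and "scalar_curv_attains_max A g"
    then obtain c x where c: "c \<in> A" and x: "x \<in> coord_range c"
      and max: "\<forall>c'\<in>A. \<forall>y\<in>coord_range c'. scalar_curv (g c') y \<le> scalar_curv (g c) x"
      unfolding scalar_curv_attains_max_def by blast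
    have ric: "herm_pos (ricci (g c) x)" if "c \<in> A" "x \<in> coord_range c" for c x
      using pos that unfolding positive_ricci_def by blast
    have "V c x = 0" by (rule vfield_zero_at_scalar_curv_max[OF c x ric[OF c]]) (use max c in auto)
    then have zero: "V c (coord c (coord_inv c x)) = 0" by (simp only: coord_coord_inv[OF c x])
    show ?thesis
    proof (rule biholomorphic_of_fixed_point[OF _ _ c coord_inv_in_cdom[OF x]])
      show "0 \<le> Qf (ricci (g c) x) v" if "c \<in> A" "x \<in> coord_range c" for c x v
        using ric[OF that] by (cases "v = 0") (auto simp: herm_pos_def herm_form_def intro: less_imp_le)
      show "\<phi> t (coord_inv c x) = coord_inv c x" if "t \<ge> 0" for t
        by (rule phi_fixed_of_zero[OF c coord_inv_in_cdom[OF x] zero that])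
      show "0 < RQ c (coord c (coord_inv c x)) v" if "v \<noteq> 0" for v
        using ric[OF c x] that by (simp add: \<rho> coord_coord_inv[OF c x] herm_pos_def)
    qed (simp add: \<rho>)
  next
    assume \<rho>: "\<rho> > 0" and "nonneg_ricci A g"
    then have ric: "0 \<le> Qf (ricci (g c) x) v" if "c \<in> A" "x \<in> coord_range c" for c x v
      using that unfolding nonneg_ricci_def herm_nonneg_def by blast
    \<comment> \<open>An empty space would be compact, so non-compactness supplies the starting
      point for Banach's theorem.\<close>
    have ne: "topspace X \<noteq> {}" 
    proof
      assume "topspace X = {}"
      then have "compact_space X" by (simp add: compact_space_def)
      then show False using assms(2) by blast
    qed
    have "\<exists>p\<in>topspace X. \<forall>t\<ge>0. \<phi> t p = p" by (rule fixed_point_expanding[OF ric \<rho> assms(4) ne])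
    then obtain p where p: "p \<in> topspace X" "\<forall>t\<ge>0. \<phi> t p = p" by (elim bexE) (rule that)
    obtain c where c: "c \<in> A" "p \<in> cdom c" using p(1) assms(1) unfolding complex_manifold_def by blast
    note pr = coord_in_range[of p c, OF c(2)]
    show ?thesis
    proof (rule biholomorphic_of_fixed_point[OF ric _ c])
      show "\<phi> t p = p" if "t \<ge> 0" for t using p(2) that by simp
      \<comment> \<open>\<rho> > 0 makes Ric + 2 \<rho> g positive even where Ric
        degenerates.\<close>
      show "0 < RQ c (coord c p) v" if "v \<noteq> 0" for v
        using ric[OF c(1) pr, of v] g_pos[OF c(1) pr that] \<rho> by (intro add_nonneg_pos mult_pos_pos) simp_all
    qed (use \<rho> in auto)
  qed
qed

end
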